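(* Let $\mathcal S$ be the law of a street system, let $\kappa$ be any waypoint kernel, and let $r,\rho\ge 0$. Then: (1) For all $\lambda\ge 0$ and all velocity distributions $\mu$ we have $T_{\mathrm c}(\lambda,\mu,\rho,r)>2\rho$. (2) For all $T\ge 0$ and all velocity distributions $\mu$ we have $\lambda_{\mathrm c}(T,\mu,\rho,r)>0$. (3) For all $T,\lambda\ge 0$ (and every velocity distribution $\mu$, whose rescalings $\mu^a$ enter the definition of $v_{\mathrm c}$) we have $v_{\mathrm c}(T,\lambda,\rho,r)>0$.
   Context: Street system. $S\subset\mathbb R^2$ is a stationary random planar segment process, i.e. a simple point process of line segments with lengths in $(0,\infty)$, with law $\mathcal S$; $S$ also denotes the union of the segments, $S\cap B$ its restriction to $B\subset\mathbb R^2$, and $|S\cap B|$ the total length in $B$. Put $Q_n(x)=x+[-n/2,n/2]^2$, $Q_n=Q_n(o)$. $S$ is normalized: $\mathbb E|S\cap Q_1|=1$. $S$ is assumed stabilizing: there is a random field $R=\{R_x\}_{x\in\mathbb R^2}$ (stabilization radii), measurable with respect to $S$, such that (i) $(S,R)$ is jointly stationary; (ii) $\lim_{n\uparrow\infty}\mathbb P(\sup_{y\in Q_n\cap\mathbb Q^2}R_y<n)=1$; (iii) for all $n\ge1$, all non-negative bounded measurable $f$ and all finite $\varphi\subset\mathbb R^2$ with $\mathrm{dist}(x,\varphi\setminus\{x\})>3n$ for all $x\in\varphi$, the random variables $f(S\cap Q_n(x))\mathbf 1\{\sup_{y\in Q_n(x)\cap\mathbb Q^2}R_y<n\}$, $x\in\varphi$,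 are independent. $S$ is also assumed asymptotically essentially connected: for all sufficiently large $n$, whenever $\sup_{y\in Q_{2n}\cap\mathbb Q^2}R_y<n/2$, then $|S\cap Q_n|>0$ and $S\cap Q_n$ is contained in one connected component of $S\cap Q_{2n}$. A crossing is an intersection point of two distinct segments of $S$ or an endpoint of a segment. Two distinct crossings are neighbors if they lie on the same segment and are not separated by another crossing; the part of a segment between two neighboring crossings is a street. Devices. Given $S$, the initial device positions $X^\lambda=\{X_i\}$ form a Poisson point process with intensity measure $A\mapsto\lambda|S\cap A|$, $\lambda\ge0$ (a Cox process). A waypoint kernel $\kappa^S(x,\mathrm dy)$ is a probability kernel from points $x\in S$ to $S$, translation covariant: $\kappa^S(x,\mathrm dy)=\kappa^{S+z}(x+z,\mathrm dy+z)$ for all $z\in\mathbb R^2$. Each device $X_i$ independently picks a target $Y_i\sim\kappa^S(X_i,\cdot)$ and independently a velocity $V_i\sim\mu$. A velocity distribution $\mu$ is a probability measure on $[0,\infty)$ with $0<v_{\min}\le v_{\max}<\infty$, where $v_{\min}=\sup\{v:\mu([v,\infty))=1\}$, $v_{\max}=\inf\{v:\mu([0,v])=1\}$. Device $X_i$ moves with speed $V_i$ along the shortest path on $S$ to $Y_i$, immediately returns along the same path to $X_i$ with the same speed, and repeats this commute until the time horizon $T$; its position at time $t$ is $\mathcal T_{i,t}$. Connections. $Z(X_i,X_j)$ is the set of times $t\ge0$ at which $\mathcal T_{i,t}$ and $\mathcal T_{j,t}$ are on the same street and $|\mathcal T_{i,t}-\mathcal T_{j,t}|<r$ (for $r=0$: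 $\mathcal T_{i,t}=\mathcal T_{j,t}$). The graph $g_{T,\mu,\rho,r}(X^\lambda)$ has vertex set $X^\lambda$ and an edge between $X_i$ and $X_j$ iff $[t,t+\rho]\subset Z(X_i,X_j)$ for some $t\in[0,T-\rho]$ (no edges if $T<\rho$). It percolates if it contains an unbounded connected component. Critical parameters, with $\inf\emptyset=+\infty$ and $\mu^a(\mathrm dv)=\mu(\mathrm dv/a)$ (the law of $aV$ for $V\sim\mu$), $a>0$: $T_{\mathrm c}(\lambda,\mu,\rho,r)=\inf\{T>0:\mathbb P(g_{T,\mu,\rho,r}(X^\lambda)\text{ percolates})>0\}$; $\lambda_{\mathrm c}(T,\mu,\rho,r)=\inf\{\lambda\ge0:\mathbb P(g_{T,\mu,\rho,r}(X^\lambda)\text{ percolates})>0\}$; $v_{\mathrm c}(T,\lambda,\rho,r)=\inf\{av_{\max}: a>0,\ \mathbb P(g_{T,\mu^a,\rho,r}(X^\lambda)\text{ percolates})>0\}$. *)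

theory Defs
  imports "HOL-Probability.Probability"
begin

type_synonym point = "real \<times> real"

(* A realisation of the segment process is the set of its segments, each segment being a set of
   points; the union of the segments is \<Union>\<phi>. *)
type_synonym streets = "point set set"


section \<open>Geometry\<close>

definition Q :: "real \<Rightarrow> point \<Rightarrow> point set" where
  "Q n x = cbox (x - (n/2, n/2)) (x + (n/2, n/2))"

definition translate :: "point \<Rightarrow> streets \<Rightarrow> streets" where
  "translate z \<phi> = (\<lambda>s. (\<lambda>p. p + z) ` s) ` \<phi>"

(* One-dimensional Hausdorff (outer) measure; the total length |S \<inter> B| is
   len (\<Union>\<phi> \<inter> B), so overlapping parts of segments count once. *)
definition len :: "point set \<Rightarrow> ennreal" where
  "len A = (SUP \<delta>\<in>{0<..}. INF U\<in>{U :: nat \<Rightarrow> point set. A \<subseteq> (\<Union>i. U i) \<and>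
       (\<forall>i. bounded (U i) \<and> diameter (U i) \<le> \<delta>)}. (\<Sum>i. ennreal (diameter (U i))))"

definition curve_length :: "(real \<Rightarrow> point) \<Rightarrow> real \<Rightarrow> real \<Rightarrow> ennreal" where
  "curve_length g a b = (SUP ts\<in>{ts. sorted ts \<and> set ts \<subseteq> {a..b}}.
       \<Sum>i<length ts - 1. ennreal (dist (g (ts ! i)) (g (ts ! Suc i))))"


section \<open>Spaces of configurations\<close>

(* Segment configurations are locally finite in the sense of particle processes: every bounded
   set is hit by finitely many segments.  The sigma-algebra is generated by the numbers of
   segments with endpoints in a bounded Borel set E of pairs; as closed_segment a b =
   closed_segment b a, the existential quantifier accounts for unordered endpoints. *)
definition street_configs :: "streets set" where
  "street_configs = {\<phi>. (\<forall>s\<in>\<phi>. \<exists>a b. a \<noteq> b \<and> s = closed_segment a b) \<and>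
       (\<forall>B. bounded B \<longrightarrow> finite {s\<in>\<phi>. s \<inter> B \<noteq> {}})}"

definition street_space :: "streets measure" where
  "street_space = sigma street_configs
     {{\<phi>\<in>street_configs. card {s\<in>\<phi>. \<exists>(a, b)\<in>E. s = closed_segment a b} = k} | E k.
        E \<in> sets borel \<and> bounded E}"

(* closed subsets of the plane with the Fell (hit-or-miss) sigma-algebra *)
definition closed_space :: "point set measure" where
  "closed_space = sigma {F. closed F} {{F. closed F \<and> F \<inter> K \<noteq> {}} | K. compact K}"

definition point_configs :: "point set set" where
  "point_configs = {\<xi>. \<forall>B. bounded B \<longrightarrow> finite (\<xi> \<inter> B)}"

definition point_space :: "point set measure" where
  "point_space = sigma point_configs
     {{\<xi>\<in>point_configs. card (\<xi> \<inter> B) = k} | B k. B \<in> sets borel \<and> bounded B}"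


section \<open>Street systems\<close>

definition small_radii :: "(streets \<Rightarrow> point \<Rightarrow> real) \<Rightarrow> streets \<Rightarrow> real \<Rightarrow> point \<Rightarrow> real \<Rightarrow> bool" where
  "small_radii R \<phi> n x c \<longleftrightarrow> (SUP y\<in>Q n x \<inter> (\<rat> \<times> \<rat>). ereal (R \<phi> y)) < ereal c"

(* M is the law of S; since R is measurable with respect to S it is a function of the
   configuration.  Condition (iii) involves the union of the segments only. *)
definition stabilizing :: "streets measure \<Rightarrow> (streets \<Rightarrow> point \<Rightarrow> real) \<Rightarrow> bool" where
  "stabilizing M R \<longleftrightarrow>
     (\<forall>x. (\<lambda>\<phi>. R \<phi> x) \<in> borel_measurable M) \<and>
     (\<forall>z. distr M (street_space \<Otimes>\<^sub>M PiM UNIV (\<lambda>_. borel)) (\<lambda>\<phi>. (translate z \<phi>, \<lambda>x. R \<phi> (x - z)))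
        = distr M (street_space \<Otimes>\<^sub>M PiM UNIV (\<lambda>_. borel)) (\<lambda>\<phi>. (\<phi>, R \<phi>))) \<and>
     (\<lambda>n::nat. measure M {\<phi>\<in>space M. small_radii R \<phi> n 0 n}) \<longlonglongrightarrow> 1 \<and>
     (\<forall>(n::nat) (f :: point set \<Rightarrow> real) F.
        n \<ge> 1 \<and> f \<in> borel_measurable closed_space \<and> (\<forall>A. 0 \<le> f A) \<and> (\<exists>c. \<forall>A. f A \<le> c) \<and>
        finite F \<and> (\<forall>x\<in>F. \<forall>y\<in>F - {x}. dist x y > 3 * n) \<longrightarrow>
        prob_space.indep_vars M (\<lambda>_. borel)
          (\<lambda>x \<phi>. f (\<Union>\<phi> \<inter> Q n x) * (if small_radii R \<phi> n x n then 1 else 0)) F)"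

definition asymp_ess_connected :: "streets measure \<Rightarrow> (streets \<Rightarrow> point \<Rightarrow> real) \<Rightarrow> bool" where
  "asymp_ess_connected M R \<longleftrightarrow>
     (\<forall>\<^sub>F n::nat in sequentially. AE \<phi> in M. small_radii R \<phi> (2 * n) 0 (n / 2) \<longrightarrow>
        len (\<Union>\<phi> \<inter> Q n 0) > 0 \<and>
        (\<exists>C\<in>components (\<Union>\<phi> \<inter> Q (2 * n) 0). \<Union>\<phi> \<inter> Q n 0 \<subseteq> C))"

definition street_system :: "streets measure \<Rightarrow> bool" where
  "street_system M \<longleftrightarrow> prob_space M \<and> sets M = sets street_space \<and>
     (\<forall>z. distr M street_space (translate z) = M) \<and>
     (\<integral>\<^sup>+\<phi>. len (\<Union>\<phi> \<inter> Q 1 0) \<partial>M) = 1 \<and>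
     (\<exists>R. stabilizing M R \<and> asymp_ess_connected M R)"

definition crossings :: "streets \<Rightarrow> point set" where
  "crossings \<phi> = {p. \<exists>s\<in>\<phi>. \<exists>t\<in>\<phi>. s \<noteq> t \<and> p \<in> s \<inter> t} \<union>
     {p. \<exists>a b. closed_segment a b \<in> \<phi> \<and> p \<in> {a, b}}"

definition neighbors :: "streets \<Rightarrow> point \<Rightarrow> point \<Rightarrow> bool" where
  "neighbors \<phi> p q \<longleftrightarrow> p \<in> crossings \<phi> \<and> q \<in> crossings \<phi> \<and> p \<noteq> q \<and>
     (\<exists>s\<in>\<phi>. p \<in> s \<and> q \<in> s) \<and> open_segment p q \<inter> crossings \<phi> = {}"

definition is_street :: "streets \<Rightarrow> point set \<Rightarrow> bool" where
  "is_street \<phi> e \<longleftrightarrow> (\<exists>p q. neighbors \<phi> p q \<and> e = closed_segment p q)"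


section \<open>Devices and their movement\<close>

(* P is the law of a Poisson point process with intensity measure m *)
definition poisson_process :: "(point set \<Rightarrow> ennreal) \<Rightarrow> point set measure \<Rightarrow> bool" where
  "poisson_process m P \<longleftrightarrow> prob_space P \<and> sets P = sets point_space \<and>
     (\<forall>B k. B \<in> sets borel \<and> bounded B \<longrightarrow> m B < \<infinity> \<and>
        measure P {\<xi>\<in>space P. card (\<xi> \<inter> B) = k}
          = enn2real (m B) ^ k / fact k * exp (- enn2real (m B))) \<and>
     (\<forall>\<B>. finite \<B> \<and> disjoint \<B> \<and> (\<forall>B\<in>\<B>. B \<in> sets borel \<and> bounded B) \<longrightarrow>
        prob_space.indep_vars P (\<lambda>_. count_space UNIV) (\<lambda>B \<xi>. card (\<xi> \<inter> B)) \<B>)"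

(* D l \<phi> is the conditional law of the initial device positions with parameter \<lambda> = l given
   S = \<phi>.  It is determined by this condition for almost every \<phi>. *)
definition cox_process :: "streets measure \<Rightarrow> (real \<Rightarrow> streets \<Rightarrow> point set measure) \<Rightarrow> bool" where
  "cox_process M D \<longleftrightarrow> (\<forall>l\<ge>0. AE \<phi> in M.
     poisson_process (\<lambda>A. ennreal l * len (\<Union>\<phi> \<inter> A)) (D l \<phi>))"

definition waypoint_kernel :: "(streets \<Rightarrow> point \<Rightarrow> point measure) \<Rightarrow> bool" where
  "waypoint_kernel \<kappa> \<longleftrightarrow> (\<forall>\<phi>\<in>street_configs.
     \<kappa> \<phi> \<in> restrict_space borel (\<Union>\<phi>) \<rightarrow>\<^sub>M prob_algebra borel \<and>
     (\<forall>x\<in>\<Union>\<phi>. (AE y in \<kappa> \<phi> x. y \<in> \<Union>\<phi>) \<and>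
        (\<forall>z. \<kappa> (translate z \<phi>) (x + z) = distr (\<kappa> \<phi> x) borel (\<lambda>y. y + z))))"

definition v_min :: "real measure \<Rightarrow> ereal" where
  "v_min \<mu> = Sup (ereal ` {v. emeasure \<mu> {v..} = 1})"

definition v_max :: "real measure \<Rightarrow> ereal" where
  "v_max \<mu> = Inf (ereal ` {v. emeasure \<mu> {0..v} = 1})"

definition velocity_distribution :: "real measure \<Rightarrow> bool" where
  "velocity_distribution \<mu> \<longleftrightarrow> prob_space \<mu> \<and> sets \<mu> = sets borel \<and> emeasure \<mu> {0..} = 1 \<and>
     0 < v_min \<mu> \<and> v_min \<mu> \<le> v_max \<mu> \<and> v_max \<mu> < \<infinity>"

definition scale_velocity :: "real \<Rightarrow> real measure \<Rightarrow> real measure" where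
  "scale_velocity a \<mu> = distr \<mu> borel (\<lambda>v. a * v)"

(* g, parametrised by arc length on [0, L], is a shortest path on S from x to y *)
definition shortest_path :: "streets \<Rightarrow> point \<Rightarrow> point \<Rightarrow> (real \<Rightarrow> point) \<times> real \<Rightarrow> bool" where
  "shortest_path \<phi> x y = (\<lambda>(g, L). 0 \<le> L \<and> continuous_on {0..L} g \<and> g ` {0..L} \<subseteq> \<Union>\<phi> \<and>
     g 0 = x \<and> g L = y \<and>
     (\<forall>s t. 0 \<le> s \<and> s \<le> t \<and> t \<le> L \<longrightarrow> curve_length g s t = ennreal (t - s)) \<and>
     (\<forall>h. path h \<and> path_image h \<subseteq> \<Union>\<phi> \<and> pathstart h = x \<and> pathfinish h = y \<longrightarrow>
        ennreal L \<le> curve_length h 0 1))"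

(* Shortest paths need not be unique: \<gamma> selects one of them for each pair of points. *)
definition selects_shortest_paths ::
    "(streets \<Rightarrow> point \<Rightarrow> point \<Rightarrow> (real \<Rightarrow> point) \<times> real) \<Rightarrow> bool" where
  "selects_shortest_paths \<gamma> \<longleftrightarrow> (\<forall>\<phi>\<in>street_configs. \<forall>x\<in>\<Union>\<phi>. \<forall>y\<in>\<Union>\<phi>.
     (\<exists>p. shortest_path \<phi> x y p) \<longrightarrow> shortest_path \<phi> x y (\<gamma> \<phi> x y))"

(* Commuting along p = (g, L) with speed v: after travelling the distance v * t the device has
   covered u = (v * t) mod (2 * L) of its current round trip.  If L = 0 it stays at g 0. *)
definition commute :: "(real \<Rightarrow> point) \<times> real \<Rightarrow> real \<Rightarrow> real \<Rightarrow> point" where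
  "commute p v t = (case p of (g, L) \<Rightarrow>
     let u = 2 * L * frac (v * t / (2 * L)) in g (min u (2 * L - u)))"


section \<open>The connectivity graph\<close>

(* Devices are identified with their initial positions; w x = (y, v) are the target and the
   velocity of the device starting in x. *)
definition device_pos :: "(streets \<Rightarrow> point \<Rightarrow> point \<Rightarrow> (real \<Rightarrow> point) \<times> real) \<Rightarrow> streets \<Rightarrow>
    (point \<Rightarrow> point \<times> real) \<Rightarrow> point \<Rightarrow> real \<Rightarrow> point" where
  "device_pos \<gamma> \<phi> w x t = commute (\<gamma> \<phi> x (fst (w x))) (snd (w x)) t"

definition contact_times :: "(streets \<Rightarrow> point \<Rightarrow> point \<Rightarrow> (real \<Rightarrow> point) \<times> real) \<Rightarrow> streets \<Rightarrow>
    (point \<Rightarrow> point \<times> real) \<Rightarrow> real \<Rightarrow> point \<Rightarrow> point \<Rightarrow> real set" where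
  "contact_times \<gamma> \<phi> w r x x' = {t. 0 \<le> t \<and>
     (\<exists>e. is_street \<phi> e \<and> device_pos \<gamma> \<phi> w x t \<in> e \<and> device_pos \<gamma> \<phi> w x' t \<in> e) \<and>
     (if r = 0 then device_pos \<gamma> \<phi> w x t = device_pos \<gamma> \<phi> w x' t
      else dist (device_pos \<gamma> \<phi> w x t) (device_pos \<gamma> \<phi> w x' t) < r)}"

definition edges :: "(streets \<Rightarrow> point \<Rightarrow> point \<Rightarrow> (real \<Rightarrow> point) \<times> real) \<Rightarrow> streets \<Rightarrow> point set \<Rightarrow>
    (point \<Rightarrow> point \<times> real) \<Rightarrow> real \<Rightarrow> real \<Rightarrow> real \<Rightarrow> (point \<times> point) set" where
  "edges \<gamma> \<phi> \<xi> w T \<rho> r = {(x, x'). x \<in> \<xi> \<and> x' \<in> \<xi> \<and> x \<noteq> x' \<and>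
     (\<exists>t\<in>{0..T - \<rho>}. {t..t + \<rho>} \<subseteq> contact_times \<gamma> \<phi> w r x x')}"

definition percolates :: "point set \<Rightarrow> (point \<times> point) set \<Rightarrow> bool" where
  "percolates V E \<longleftrightarrow> (\<exists>x\<in>V. \<not> bounded {y. (x, y) \<in> E\<^sup>*})"

(* The percolation probability is the iterated integral over the streets (law M), the initial
   positions given the streets (law D l \<phi>), and the independent targets and velocities given
   both.  It is positive iff it is not the case that percolation fails almost surely at each
   level.  In terms of AE this is meaningful without proving the event measurable: an event
   contained in no null set counts as having positive probability. *)
definition percolates_pos_prob :: "streets measure \<Rightarrow> (streets \<Rightarrow> point \<Rightarrow> point measure) \<Rightarrow>
    (streets \<Rightarrow> point \<Rightarrow> point \<Rightarrow> (real \<Rightarrow> point) \<times> real) \<Rightarrow> (real \<Rightarrow> streets \<Rightarrow> point set measure) \<Rightarrow>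
    real \<Rightarrow> real \<Rightarrow> real measure \<Rightarrow> real \<Rightarrow> real \<Rightarrow> bool" where
  "percolates_pos_prob M \<kappa> \<gamma> D T l \<mu> \<rho> r \<longleftrightarrow>
     \<not> (AE \<phi> in M. AE \<xi> in D l \<phi>. AE w in PiM \<xi> (\<lambda>x. \<kappa> \<phi> x \<Otimes>\<^sub>M \<mu>).
          \<not> percolates \<xi> (edges \<gamma> \<phi> \<xi> w T \<rho> r))"


section \<open>Critical parameters\<close>

definition T_crit where
  "T_crit M \<kappa> \<gamma> D l \<mu> \<rho> r = Inf (ereal ` {T. T > 0 \<and> percolates_pos_prob M \<kappa> \<gamma> D T l \<mu> \<rho> r})"

definition lambda_crit where
  "lambda_crit M \<kappa> \<gamma> D T \<mu> \<rho> r = Inf (ereal ` {l. l \<ge> 0 \<and> percolates_pos_prob M \<kappa> \<gamma> D T l \<mu> \<rho> r})"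

definition v_crit where
  "v_crit M \<kappa> \<gamma> D T l \<mu> \<rho> r =
     Inf {ereal a * v_max \<mu> | a. a > 0 \<and> percolates_pos_prob M \<kappa> \<gamma> D T l (scale_velocity a \<mu>) \<rho> r}"

end

theory Submission
  imports Defs "HOL-Complex_Analysis.Great_Picard"
begin

text \<open>
  Call a point of the street set regular if the set is convex near it, and irregular otherwise. Irregular points are
  locally finite, and a shortest path is straight between two of them. Write the time horizon as $2\rho + \varepsilon$;
  then a contact of two devices begins at some time $t \le \rho + \varepsilon$. If $t > \varepsilon$, both are on one street just
  after time $\rho + \varepsilon$. If $t \le \varepsilon$, suppose that neither device with speed $v$ has an irregular point
  at a distance $d$ with $d \le v \varepsilon$ or $v \rho \le d \le v (\rho + \varepsilon)$. Then they start on one straight piece of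
  regular points, and a device that leaves this piece before time $\rho + \varepsilon$ does so during the contact; the other one would have
  to reach an irregular point at the same instant, an event of probability zero. In both cases the
  positions just after time $\rho + \varepsilon$ are joined by a segment of regular points. Hence an unbounded cluster without exceptional
  devices follows a long segment of regular points, which asymptotic essential connectedness forbids. Exceptional devices
  are rare when $\varepsilon$ is small, and stabilization makes distant boxes independent, so a Peierls argument over
  boxes excludes percolation.

  The bound for $v_c$ is the case in which $\rho$ is replaced by zero, which only adds edges; for $\lambda_c$ it
  suffices to call every device of a box exceptional.
\<close>

section \<open>Lipschitz paths and shortest paths\<close>

text \<open>The number 2\<rho> has the following origin. For T = 2\<rho> every contact interval
  [t, t + \<rho>] with t \<le> \<rho> contains the time \<rho>, and at one fixed time a device is on
  one street unless it sits at a crossing. All edges are then witnessed at once, and no cluster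
  turns a corner. The slack \<epsilon> destroys this only for devices that may pass an irregular
  point in one of two short time windows; this is where the two forbidden ranges of distances come
  from. Two obstacles shape the rest. Measurability is established neither for percolation nor for
  the irregular points, so null sets are obtained from measurable supersets of small measure, and
  properties of the streets are replaced by countable tests on closed sets. Moreover, exceptional
  devices must be rare uniformly over all good boxes before \<epsilon> is chosen. The constants are
  therefore fixed in the order: \<eta> from the number of chains, then the scale k of the boxes,
  then the finest scale of the certificates, and \<epsilon> last.\<close>

definition lip_reach :: "'a::euclidean_space set \<Rightarrow> real \<Rightarrow> 'a \<Rightarrow> 'a \<Rightarrow> bool" where
  "lip_reach S L x y \<longleftrightarrow>
     0 \<le> L \<and> (\<exists>g. 1-lipschitz_on {0..L} g \<and> g ` {0..L} \<subseteq> S \<and> g 0 = x \<and> g L = y)"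

lemma lip_reach_const: "x \<in> S \<Longrightarrow> 0 \<le> L \<Longrightarrow> lip_reach S L x x"
  unfolding lip_reach_def by (intro conjI exI[of _ "\<lambda>_. x"]) (auto simp: lipschitz_on_def)

lemma lip_reach_mono: "lip_reach S L x y \<Longrightarrow> S \<subseteq> S' \<Longrightarrow> lip_reach S' L x y"
  unfolding lip_reach_def by blast

lemma lip_reach_trans:
  assumes "lip_reach S L x y" "lip_reach S L' y z"
  shows "lip_reach S (L + L') x z"
proof -
  obtain g where g: "0 \<le> L" "1-lipschitz_on {0..L} g" "g ` {0..L} \<subseteq> S" "g 0 = x" "g L = y"
    using assms(1) unfolding lip_reach_def by blast
  obtain h where h: "0 \<le> L'" "1-lipschitz_on {0..L'} h" "h ` {0..L'} \<subseteq> S" "h 0 = y" "h L' = z"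
    using assms(2) unfolding lip_reach_def by blast
  have "1-lipschitz_on {L..L + L'} (\<lambda>t. h (t - L))"
  proof (rule lipschitz_onI)
    fix s t assume "s \<in> {L..L + L'}" "t \<in> {L..L + L'}"
    then show "dist (h (s - L)) (h (t - L)) \<le> 1 * dist s t"
      using lipschitz_onD[OF h(2), of "s - L" "t - L"] by (auto simp: dist_real_def)
  qed simp
  then have "1-lipschitz_on {0..L + L'} (\<lambda>t. if t \<le> L then g t else h (t - L))"
    by (intro lipschitz_on_concat g) (auto simp: g h)
  moreover have "(\<lambda>t. if t \<le> L then g t else h (t - L)) ` {0..L + L'} \<subseteq> S"
    using g(3) h(3) by (auto simp: image_subset_iff)
  moreover have "(if L + L' \<le> L then g (L + L') else h (L + L' - L)) = z"
    using g h by (auto intro: antisym)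
  ultimately show ?thesis
    unfolding lip_reach_def using g(1,4) h(1)
    by (intro conjI exI[of _ "\<lambda>t. if t \<le> L then g t else h (t - L)"]) auto
qed

lemma lip_reach_in: "lip_reach S L x y \<Longrightarrow> x \<in> S \<and> y \<in> S"
  unfolding lip_reach_def by fastforce

lemma lip_reach_le: "lip_reach S L x y \<Longrightarrow> L \<le> L' \<Longrightarrow> lip_reach S L' x y"
  using lip_reach_trans[of S L x y "L' - L" y] lip_reach_const[of y S "L' - L"] lip_reach_in
  by force

lemma lip_reach_subpath:
  assumes "1-lipschitz_on {a..b} g" "g ` {a..b} \<subseteq> S" "a \<le> b"
  shows "lip_reach S (b - a) (g a) (g b)"
proof -
  have "1-lipschitz_on {0..b - a} (\<lambda>t. g (a + t))"
  proof (rule lipschitz_onI)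
    fix s t assume "s \<in> {0..b - a}" "t \<in> {0..b - a}"
    then show "dist (g (a + s)) (g (a + t)) \<le> 1 * dist s t"
      using lipschitz_onD[OF assms(1), of "a + s" "a + t"] by (auto simp: dist_real_def)
  qed simp
  then show ?thesis
    unfolding lip_reach_def using assms(2,3)
    by (intro conjI exI[of _ "\<lambda>t. g (a + t)"]) (auto simp: image_subset_iff)
qed

lemma lip_reach_sym:
  assumes "lip_reach S L x y"
  shows "lip_reach S L y x"
proof -
  obtain g where g: "0 \<le> L" "1-lipschitz_on {0..L} g" "g ` {0..L} \<subseteq> S" "g 0 = x" "g L = y"
    using assms(1) unfolding lip_reach_def by blast
  have "1-lipschitz_on {0..L} (\<lambda>t. g (L - t))"
  proof (rule lipschitz_onI)
    fix s t assume "s \<in> {0..L}" "t \<in> {0..L}"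
    then show "dist (g (L - s)) (g (L - t)) \<le> 1 * dist s t"
      using lipschitz_onD[OF g(2), of "L - s" "L - t"] by (auto simp: dist_real_def)
  qed simp
  then show ?thesis
    unfolding lip_reach_def using g
    by (intro conjI exI[of _ "\<lambda>t. g (L - t)"]) (auto simp: image_subset_iff)
qed

lemma lip_reach_segment:
  assumes "closed_segment x y \<subseteq> S"
  shows "lip_reach S (dist x y) x y"
proof (cases "x = y")
  case True
  then show ?thesis using assms by (auto intro: lip_reach_const)
next
  case False
  define g where "g t = x + (t / dist x y) *\<^sub>R (y - x)" for t
  have "1-lipschitz_on {0..dist x y} g"
  proof (rule lipschitz_onI)
    fix s t
    have "g s - g t = ((s - t) / dist x y) *\<^sub>R (y - x)"
      by (simp add: g_def algebra_simps diff_divide_distrib)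
    then have "dist (g s) (g t) = \<bar>s - t\<bar> / dist x y * dist x y"
      by (simp add: dist_norm norm_minus_commute)
    then show "dist (g s) (g t) \<le> 1 * dist s t"
      using False by (simp add: dist_real_def)
  qed simp
  moreover have "g ` {0..dist x y} \<subseteq> S"
  proof safe
    fix t assume "t \<in> {0..dist x y}"
    then have "0 \<le> t / dist x y" "t / dist x y \<le> 1" using False by auto
    then have "g t \<in> closed_segment x y"
      unfolding in_segment g_def
      by (intro exI[of _ "t / dist x y"]) (auto simp: algebra_simps)
    then show "g t \<in> S" using assms by blast
  qed
  moreover have "g 0 = x" "g (dist x y) = y" using False by (auto simp: g_def)
  ultimately show ?thesis unfolding lip_reach_def by (intro conjI exI[of _ g]) auto
qed

text \<open>Arzela-Ascoli: 1-Lipschitz curves with a common starting point are relatively compact,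
  and a limit of curves in shrinking neighbourhoods of a closed set runs in the set. This is the
  benefit of bounding lengths by Lipschitz parametrisations: \<open>lip_reach\<close> passes to
  limits without any reparametrisation.\<close>

lemma lip_reach_closed:
  fixes S :: "'a::euclidean_space set"
  assumes S: "closed S" "S \<noteq> {}" and L: "0 \<le> L"
    and ap: "\<And>e. e > 0 \<Longrightarrow> lip_reach {z. infdist z S \<le> e} (L + e) x y"
  shows "lip_reach S L x y"
proof -
  define e where "e k = 1 / real (Suc k)" for k
  have e: "e k > 0" for k by (simp add: e_def)
  have e0: "e \<longlonglongrightarrow> 0"
    unfolding e_def using LIMSEQ_inverse_real_of_nat by (simp add: inverse_eq_divide)
  have "\<forall>k. \<exists>g. 1-lipschitz_on {0..L + e k} g \<and> g ` {0..L + e k} \<subseteq> {z. infdist z S \<le> e k} \<and>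
     g 0 = x \<and> g (L + e k) = y"
    using ap[OF e] unfolding lip_reach_def by blast
  then obtain F where F: "\<And>k. 1-lipschitz_on {0..L + e k} (F k)"
      "\<And>k. F k ` {0..L + e k} \<subseteq> {z. infdist z S \<le> e k}"
      "\<And>k. F k 0 = x" "\<And>k. F k (L + e k) = y"
    by metis
  have lip: "dist (F k s) (F k t) \<le> \<bar>s - t\<bar>" if "s \<in> {0..L + e k}" "t \<in> {0..L + e k}" for k s t
    using lipschitz_onD[OF F(1) that] by (simp add: dist_real_def)
  have sub: "t \<in> {0..L + e k}" if "t \<in> {0..L}" for k t
    using that e[of k] by auto
  obtain g k where g: "strict_mono (k :: nat \<Rightarrow> nat)"
      "\<And>e. 0 < e \<Longrightarrow> \<exists>N. \<forall>n t. n \<ge> N \<and> t \<in> {0..L} \<longrightarrow> norm (F (k n) t - g t) < e"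
  proof (rule Arzela_Ascoli[of "{0..L}" F "norm x + L"])
    fix n t assume t: "t \<in> {0..L}"
    have "norm (F n t) \<le> norm (F n 0) + dist (F n t) (F n 0)"
      using norm_triangle_sub[of "F n t" "F n 0"] by (simp add: dist_norm)
    also have "dist (F n t) (F n 0) \<le> \<bar>t - 0\<bar>"
      using t L e[of n] by (intro lip sub) auto
    finally show "norm (F n t) \<le> norm x + L" using t by (simp add: F)
  next
    fix t \<epsilon> assume t: "t \<in> {0..L}" "0 < (\<epsilon>::real)"
    have "norm (F n t - F n u) < \<epsilon>" if "u \<in> {0..L}" "norm (t - u) < \<epsilon>" for n u
      using lip[OF sub[OF t(1)] sub[OF that(1)], of n] that by (simp add: dist_norm)
    with t(2) show "\<exists>d>0. \<forall>n u. u \<in> {0..L} \<and> norm (t - u) < d \<longrightarrow> norm (F n t - F n u) < \<epsilon>"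
      by blast
  qed auto
  have lim: "(\<lambda>n. F (k n) t) \<longlonglongrightarrow> g t" if "t \<in> {0..L}" for t
    unfolding LIMSEQ_def dist_norm using g(2) that by blast
  have ek: "(\<lambda>n. e (k n)) \<longlonglongrightarrow> 0"
    using LIMSEQ_subseq_LIMSEQ[OF e0 g(1)] by (simp add: o_def)
  have "1-lipschitz_on {0..L} g"
  proof (rule lipschitz_onI)
    fix s t assume st: "s \<in> {0..L}" "t \<in> {0..L}"
    have "(\<lambda>n. dist (F (k n) s) (F (k n) t)) \<longlonglongrightarrow> dist (g s) (g t)"
      by (intro tendsto_dist lim st)
    moreover have "\<forall>n\<ge>0. dist (F (k n) s) (F (k n) t) \<le> 1 * dist s t"
      using lip[OF sub[OF st(1)] sub[OF st(2)]] by (simp add: dist_real_def)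
    ultimately show "dist (g s) (g t) \<le> 1 * dist s t"
      using LIMSEQ_le_const2 by blast
  qed simp
  moreover have "g t \<in> S" if t: "t \<in> {0..L}" for t
  proof -
    have "(\<lambda>n. infdist (F (k n) t) S) \<longlonglongrightarrow> infdist (g t) S"
      by (intro tendsto_infdist lim t)
    moreover have "infdist (F (k n) t) S \<le> e (k n)" for n
      using F(2)[of "k n"] sub[OF t] by blast
    ultimately have "infdist (g t) S \<le> 0"
      using ek by (intro LIMSEQ_le[of _ _ _ 0]) auto
    then show ?thesis
      using in_closed_iff_infdist_zero[OF S] infdist_nonneg[of "g t" S] by simp
  qed
  moreover have "g 0 = x"
    using LIMSEQ_unique[OF lim[of 0]] L F(3) by simp
  moreover have "g L = y"
  proof -
    \<comment> \<open>The approximating curve reaches y only at time L + e, so at time L it is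
      within e of y.\<close>
    have "dist (F (k n) L) y \<le> e (k n)" for n
      using lip[of L "k n" "L + e (k n)"] L e[of "k n"] by (simp add: F(4))
    then have "(\<lambda>n. dist (F (k n) L) y) \<longlonglongrightarrow> 0"
      by (intro tendsto_sandwich[OF _ _ tendsto_const ek]) auto
    then have "(\<lambda>n. F (k n) L) \<longlonglongrightarrow> y" by (rule tendsto_dist_iff[THEN iffD2])
    with lim[of L] L show ?thesis by (auto intro: LIMSEQ_unique)
  qed
  ultimately show ?thesis
    unfolding lip_reach_def using L by blast
qed

section \<open>Lipschitz curves and the length of curves\<close>

lemma curve_length_mono_reparam:
  assumes "mono_on {a..b} f" "f ` {a..b} \<subseteq> {c..d}" "\<And>t. t \<in> {a..b} \<Longrightarrow> h t = g (f t)"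
  shows "curve_length h a b \<le> curve_length g c d"
  unfolding curve_length_def
proof (rule SUP_mono)
  fix ts assume "ts \<in> {ts. sorted ts \<and> set ts \<subseteq> {a..b}}"
  then have ts: "sorted ts" "set ts \<subseteq> {a..b}" by auto
  have "sorted (map f ts)"
    unfolding sorted_wrt_map sorted_iff_nth_mono sorted_wrt_iff_nth_less
    using ts assms(1) by (force simp: sorted_iff_nth_mono mono_on_def subset_iff)
  moreover have "set (map f ts) \<subseteq> {c..d}" using ts assms(2) by auto
  moreover have "(\<Sum>i<length ts - 1. ennreal (dist (h (ts ! i)) (h (ts ! Suc i)))) \<le>
      (\<Sum>i<length (map f ts) - 1. ennreal (dist (g (map f ts ! i)) (g (map f ts ! Suc i))))"
  proof (rule eq_refl, rule sum.cong, simp)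
    fix i assume "i \<in> {..<length (map f ts) - 1}"
    then have i: "i < length ts" "Suc i < length ts" by auto
    then have "ts ! i \<in> {a..b}" "ts ! Suc i \<in> {a..b}" using ts(2) nth_mem by blast+
    then show "ennreal (dist (h (ts ! i)) (h (ts ! Suc i))) =
      ennreal (dist (g (map f ts ! i)) (g (map f ts ! Suc i)))"
      using i assms(3) by simp
  qed
  ultimately show "\<exists>us\<in>{ts. sorted ts \<and> set ts \<subseteq> {c..d}}.
     (\<Sum>i<length ts - 1. ennreal (dist (h (ts ! i)) (h (ts ! Suc i))))
       \<le> (\<Sum>i<length us - 1. ennreal (dist (g (us ! i)) (g (us ! Suc i))))"
    by (intro bexI[of _ "map f ts"]) auto
qed

lemma curve_length_lipschitz:
  assumes "1-lipschitz_on {a..b} g" "a \<le> b"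
  shows "curve_length g a b \<le> ennreal (b - a)"
  unfolding curve_length_def
proof (rule SUP_least)
  fix ts assume "ts \<in> {ts. sorted ts \<and> set ts \<subseteq> {a..b}}"
  then have ts: "sorted ts" "set ts \<subseteq> {a..b}" by auto
  have "(\<Sum>i<length ts - 1. ennreal (dist (g (ts ! i)) (g (ts ! Suc i)))) \<le>
     (\<Sum>i<length ts - 1. ennreal (ts ! Suc i - ts ! i))"
  proof (rule sum_mono)
    fix i assume "i \<in> {..<length ts - 1}"
    then have i: "i < length ts" "Suc i < length ts" by auto
    then have "ts ! i \<in> {a..b}" "ts ! Suc i \<in> {a..b}" using ts(2) nth_mem by blast+
    then show "ennreal (dist (g (ts ! i)) (g (ts ! Suc i))) \<le> ennreal (ts ! Suc i - ts ! i)"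
      using lipschitz_onD[OF assms(1), of "ts ! i" "ts ! Suc i"] ts(1) i
      by (intro ennreal_leI) (auto simp: dist_real_def sorted_iff_nth_Suc)
  qed
  also have "\<dots> = ennreal (\<Sum>i<length ts - 1. ts ! Suc i - ts ! i)"
    using ts(1) by (intro sum_ennreal) (auto simp: sorted_iff_nth_Suc)
  also have "(\<Sum>i<length ts - 1. ts ! Suc i - ts ! i) = ts ! (length ts - 1) - ts ! 0"
    by (simp add: sum_lessThan_telescope)
  also have "ennreal \<dots> \<le> ennreal (b - a)"
  proof (cases "ts = []")
    case False
    then have "ts ! (length ts - 1) \<in> {a..b}" "ts ! 0 \<in> {a..b}"
      using ts(2) by (auto intro: nth_mem simp: subset_iff)
    then show ?thesis by (intro ennreal_leI) auto
  qed (use assms(2) in auto)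
  finally show "(\<Sum>i<length ts - 1. ennreal (dist (g (ts ! i)) (g (ts ! Suc i)))) \<le> ennreal (b - a)" .
qed

lemma dist_le_curve_length:
  assumes "a \<le> s" "s \<le> t" "t \<le> b"
  shows "ennreal (dist (g s) (g t)) \<le> curve_length g a b"
  unfolding curve_length_def
  by (rule SUP_upper2[of "[s, t]"]) (use assms in auto)

text \<open>Instead of reparametrising h by arc length, inscribe fine polygons: their length is at
  most that of h, their chords stay within e of S, and \<open>lip_reach_closed\<close> removes the
  e.\<close>

lemma curve_length_imp_lip_reach:
  assumes h: "continuous_on {a..b} h" "h ` {a..b} \<subseteq> S" "a \<le> b" and S: "closed S"
    and len: "curve_length h a b \<le> ennreal l" "0 \<le> l"
  shows "lip_reach S l (h a) (h b)"
proof (rule lip_reach_closed[OF S _ len(2)])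
  show "S \<noteq> {}" using h by force
  fix e :: real assume e: "e > 0"
  have "uniformly_continuous_on {a..b} h"
    using h(1) by (intro compact_uniformly_continuous) auto
  then obtain d where d: "d > 0" "\<And>s t. s \<in> {a..b} \<Longrightarrow> t \<in> {a..b} \<Longrightarrow> dist s t < d \<Longrightarrow> dist (h s) (h t) < e"
    using e unfolding uniformly_continuous_on_def by metis
  obtain N :: nat where N: "(b - a) / d < N" using reals_Archimedean2 by blast
  then have N0: "N > 0" using d(1) h(3)
    by (metis divide_nonneg_pos diff_ge_0_iff_ge gr0I less_le_not_le of_nat_0)
  define t where "t i = a + (b - a) * (real i / real N)" for i
  have tin: "t i \<in> {a..b}" if "i \<le> N" for i
  proof -
    have "0 \<le> real i / real N" "real i / real N \<le> 1" using that N0 by auto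
    then have "0 \<le> (b - a) * (real i / real N)" "(b - a) * (real i / real N) \<le> (b - a) * 1"
      using h(3) by (intro mult_nonneg_nonneg mult_left_mono; simp)+
    then show ?thesis by (simp add: t_def)
  qed
  have tmono: "t i \<le> t j" if "i \<le> j" for i j
    unfolding t_def using that h(3) by (intro add_left_mono mult_left_mono divide_right_mono) auto
  have tstep: "dist (t i) (t (Suc i)) < d" for i
  proof -
    have "t (Suc i) - t i = (b - a) / N" using N0 by (simp add: t_def field_simps)
    then have "dist (t i) (t (Suc i)) = (b - a) / N"
      using tmono[of i "Suc i"] by (simp add: dist_real_def)
    also have "\<dots> < d" using N N0 d(1) by (simp add: field_simps)
    finally show ?thesis .
  qed
  have "lip_reach {z. infdist z S \<le> e} (\<Sum>i<j. dist (h (t i)) (h (t (Suc i)))) (h a) (h (t j))"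
    if "j \<le> N" for j
    using that
  proof (induction j)
    case 0
    have "h a \<in> S" using h by auto
    then show ?case using e by (auto intro!: lip_reach_const simp: t_def)
  next
    case (Suc j)
    have "closed_segment (h (t j)) (h (t (Suc j))) \<subseteq> {z. infdist z S \<le> e}"
    proof safe
      fix z assume z: "z \<in> closed_segment (h (t j)) (h (t (Suc j)))"
      have "h (t j) \<in> S" using tin[of j] Suc(2) h by auto
      then have "infdist z S \<le> dist z (h (t j))" by (rule infdist_le)
      also have "\<dots> \<le> dist (h (t j)) (h (t (Suc j)))"
        using z dist_in_closed_segment(1) by (metis dist_commute)
      also have "\<dots> < e" using tin[of j] tin[of "Suc j"] Suc(2) tstep by (intro d) auto
      finally show "infdist z S \<le> e" by simp
    qed
    then show ?case using Suc by (auto intro: lip_reach_trans lip_reach_segment)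
  qed
  from this[of N] have "lip_reach {z. infdist z S \<le> e} (\<Sum>i<N. dist (h (t i)) (h (t (Suc i)))) (h a) (h b)"
    using N0 by (simp add: t_def)
  moreover have "(\<Sum>i<N. dist (h (t i)) (h (t (Suc i)))) \<le> l"
  proof -
    define ts where "ts = map t [0..<Suc N]"
    have "ennreal (\<Sum>i<N. dist (h (t i)) (h (t (Suc i)))) = (\<Sum>i<N. ennreal (dist (h (t i)) (h (t (Suc i)))))"
      by simp
    also have "\<dots> = (\<Sum>i<length ts - 1. ennreal (dist (h (ts ! i)) (h (ts ! Suc i))))"
      by (intro sum.cong) (auto simp: ts_def nth_append simp del: upt_Suc)
    also have "\<dots> \<le> curve_length h a b"
      unfolding curve_length_def
    proof (rule SUP_upper)
      have "sorted ts" unfolding ts_def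
        by (auto simp: sorted_iff_nth_Suc tmono simp del: upt_Suc)
      moreover have "set ts \<subseteq> {a..b}" using tin by (auto simp: ts_def simp del: upt_Suc)
      ultimately show "ts \<in> {ts. sorted ts \<and> set ts \<subseteq> {a..b}}" by simp
    qed
    also note len(1)
    finally show ?thesis using len(2) by (simp add: sum_nonneg)
  qed
  ultimately show "lip_reach {z. infdist z S \<le> e} (l + e) (h a) (h b)"
    by (rule lip_reach_le[OF _ order_trans]) (use e in auto)
qed

lemma lip_reach_imp_path:
  assumes "lip_reach S L x y"
  obtains h where "path h" "path_image h \<subseteq> S" "pathstart h = x" "pathfinish h = y"
    "curve_length h 0 1 \<le> ennreal L"
proof -
  obtain g where g: "0 \<le> L" "1-lipschitz_on {0..L} g" "g ` {0..L} \<subseteq> S" "g 0 = x" "g L = y"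
    using assms(1) unfolding lip_reach_def by blast
  define f where "f t = L * t" for t :: real
  have f: "f ` {0..1} \<subseteq> {0..L}" using g(1) by (auto simp: f_def mult_left_le)
  have "continuous_on {0..1} (g \<circ> f)"
    by (intro continuous_on_compose continuous_on_subset[OF lipschitz_on_continuous_on[OF g(2)] f])
      (auto simp: f_def intro!: continuous_intros)
  then have "path (g \<circ> f)" by (simp add: path_def)
  moreover have "path_image (g \<circ> f) \<subseteq> S"
    using f g(3) by (auto simp: path_image_def)
  moreover have "pathstart (g \<circ> f) = x" "pathfinish (g \<circ> f) = y"
    by (auto simp: pathstart_def pathfinish_def f_def g)
  moreover have "curve_length (g \<circ> f) 0 1 \<le> ennreal L"
  proof -
    have "curve_length (g \<circ> f) 0 1 \<le> curve_length g 0 L"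
      using f by (intro curve_length_mono_reparam[where f = f])
        (auto simp: mono_on_def f_def g(1) mult_left_mono)
    also have "\<dots> \<le> ennreal (L - 0)" by (intro curve_length_lipschitz g)
    finally show ?thesis by simp
  qed
  ultimately show ?thesis by (rule that)
qed

text \<open>The Lipschitz bound holds because a chord is no longer than its arc. Minimality among
  all paths becomes minimality with respect to \<open>lip_reach\<close>, the form in which it is
  used later.\<close>

lemma shortest_pathD:
  assumes "shortest_path \<phi> x y (g, L)"
  shows "0 \<le> L" "1-lipschitz_on {0..L} g" "g ` {0..L} \<subseteq> \<Union>\<phi>" "g 0 = x" "g L = y"
    "lip_reach (\<Union>\<phi>) L' x y \<Longrightarrow> L \<le> L'"
proof -
  show L: "0 \<le> L" and im: "g ` {0..L} \<subseteq> \<Union>\<phi>" and "g 0 = x" "g L = y"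
    using assms by (auto simp: shortest_path_def)
  have *: "dist (g s) (g t) \<le> t - s" if "0 \<le> s" "s \<le> t" "t \<le> L" for s t
  proof -
    have "ennreal (dist (g s) (g t)) \<le> curve_length g s t"
      using that by (intro dist_le_curve_length) auto
    also have "\<dots> = ennreal (t - s)" using assms that by (auto simp: shortest_path_def)
    finally show ?thesis using that by simp
  qed
  show "1-lipschitz_on {0..L} g"
  proof (rule lipschitz_onI)
    fix s t assume "s \<in> {0..L}" "t \<in> {0..L}"
    then show "dist (g s) (g t) \<le> 1 * dist s t"
      using *[of s t] *[of t s] by (cases "s \<le> t") (auto simp: dist_real_def dist_commute)
  qed simp
  show "L \<le> L'" if r: "lip_reach (\<Union>\<phi>) L' x y"
  proof -
    obtain h where h: "path h" "path_image h \<subseteq> \<Union>\<phi>" "pathstart h = x" "pathfinish h = y"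
      "curve_length h 0 1 \<le> ennreal L'"
      using lip_reach_imp_path[OF r] .
    have "ennreal L \<le> curve_length h 0 1"
      using assms h(1-4) unfolding shortest_path_def prod.case by blast
    with h(5) have "ennreal L \<le> ennreal L'" by (rule order_trans[rotated])
    moreover have "0 \<le> L'" using r by (simp add: lip_reach_def)
    ultimately show ?thesis by simp
  qed
qed

text \<open>\<open>selects_shortest_paths\<close> promises something only where a shortest path
  exists. The infimum of the admissible lengths is attained by \<open>lip_reach_closed\<close>, and
  the minimiser has unit speed automatically.\<close>

lemma shortest_path_exists:
  assumes cl: "closed (\<Union>\<phi>)" and r: "lip_reach (\<Union>\<phi>) L0 x y"
  shows "\<exists>p. shortest_path \<phi> x y p"
proof -
  define A where "A = {L. lip_reach (\<Union>\<phi>) L x y}"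
  define L where "L = Inf A"
  have A: "A \<noteq> {}" "bdd_below A" "0 \<le> L"
    using r unfolding A_def L_def
    by (auto simp: lip_reach_def intro!: bdd_belowI[of _ 0] cInf_greatest)
  have min: "L \<le> L'" if "lip_reach (\<Union>\<phi>) L' x y" for L'
    unfolding L_def using that by (intro cInf_lower A(2)) (simp add: A_def)
  have "lip_reach (\<Union>\<phi>) L x y"
  proof (rule lip_reach_closed[OF cl _ A(3)])
    show "\<Union>\<phi> \<noteq> {}" using lip_reach_in[OF r] by blast
    fix e :: real assume e: "e > 0"
    then have "Inf A < L + e" by (simp add: L_def)
    then obtain L' where "L' \<in> A" "L' < L + e" using A cInf_lessD by blast
    then have "lip_reach (\<Union>\<phi>) (L + e) x y"
      unfolding A_def by (auto intro: lip_reach_le)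
    moreover have "\<Union>\<phi> \<subseteq> {z. infdist z (\<Union>\<phi>) \<le> e}"
      using e by (metis (mono_tags, lifting) infdist_zero less_imp_le mem_Collect_eq subsetI)
    ultimately show "lip_reach {z. infdist z (\<Union>\<phi>) \<le> e} (L + e) x y"
      by (rule lip_reach_mono)
  qed
  then obtain g where g: "1-lipschitz_on {0..L} g" "g ` {0..L} \<subseteq> \<Union>\<phi>" "g 0 = x" "g L = y"
    unfolding lip_reach_def by blast
  have cont: "continuous_on {0..L} g" using lipschitz_on_continuous_on[OF g(1)] .
  have "curve_length g s t = ennreal (t - s)" if st: "0 \<le> s" "s \<le> t" "t \<le> L" for s t
  proof (rule antisym)
    have sub: "1-lipschitz_on {u..v} g" "g ` {u..v} \<subseteq> \<Union>\<phi>" if "0 \<le> u" "v \<le> L" for u v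
      using lipschitz_on_subset[OF g(1), of "{u..v}"] g(2) that by auto
    show "curve_length g s t \<le> ennreal (t - s)"
      using st by (intro curve_length_lipschitz sub) auto
    then obtain c where c: "curve_length g s t = ennreal c" "0 \<le> c"
      by (metis ennreal_cases ennreal_less_top infinity_ennreal_def leD)
    \<comment> \<open>Replacing the arc from s to t by a curve of its true length c gives a curve of
      length s + c + (L - t), which cannot be less than L.\<close>
    have "lip_reach (\<Union>\<phi>) c (g s) (g t)"
      using st sub c cl by (intro curve_length_imp_lip_reach continuous_on_subset[OF cont]) auto
    then have "lip_reach (\<Union>\<phi>) ((s - 0) + c + (L - t)) (g 0) (g L)"
      using st by (intro lip_reach_trans[of _ _ _ "g t"] lip_reach_trans[of _ _ _ "g s"]
          lip_reach_subpath sub) auto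
    then have "L \<le> s + c + (L - t)" using g by (intro min) auto
    then show "ennreal (t - s) \<le> curve_length g s t"
      unfolding c by (intro ennreal_leI) auto
  qed
  moreover have "ennreal L \<le> curve_length h 0 1"
    if h: "path h" "path_image h \<subseteq> \<Union>\<phi>" "pathstart h = x" "pathfinish h = y" for h
  proof (cases "curve_length h 0 1")
    case (real c)
    then have "lip_reach (\<Union>\<phi>) c (h 0) (h 1)"
      using h cl by (intro curve_length_imp_lip_reach) (auto simp: path_def path_image_def)
    then have "L \<le> c" using h by (intro min) (auto simp: pathstart_def pathfinish_def)
    then show ?thesis unfolding real by (intro ennreal_leI) auto
  qed auto
  ultimately have "shortest_path \<phi> x y (g, L)"
    unfolding shortest_path_def using A(3) cont g by auto
  then show ?thesis by blast
qed

text \<open>A chord inside the streets is an admissible shortcut, so the arc is no longer than the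
  chord.\<close>

lemma shortest_path_straight:
  assumes sp: "shortest_path \<phi> x y (g, L)" and st: "0 \<le> s" "s \<le> t" "t \<le> L"
    and seg: "closed_segment (g s) (g t) \<subseteq> \<Union>\<phi>"
  shows "dist (g s) (g t) = t - s"
proof (rule antisym)
  note g = shortest_pathD[OF sp]
  show "dist (g s) (g t) \<le> t - s"
    using lipschitz_onD[OF g(2), of s t] st by (simp add: dist_real_def)
  have sub: "1-lipschitz_on {u..v} g" "g ` {u..v} \<subseteq> \<Union>\<phi>" if "0 \<le> u" "v \<le> L" for u v
    using lipschitz_on_subset[OF g(2), of "{u..v}"] g(3) that by auto
  have "lip_reach (\<Union>\<phi>) ((s - 0) + dist (g s) (g t) + (L - t)) (g 0) (g L)"
    using st by (intro lip_reach_trans[of _ _ _ "g t"] lip_reach_trans[of _ _ _ "g s"]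
        lip_reach_subpath sub lip_reach_segment seg) auto
  then have "L \<le> s + dist (g s) (g t) + (L - t)" using g(4,5) by (intro g(6)) auto
  then show "t - s \<le> dist (g s) (g t)" by simp
qed

text \<open>Coinciding points are joined by a degenerate chord, so straightness leaves no time
  between them.\<close>

lemma shortest_path_inj:
  assumes sp: "shortest_path \<phi> x y (g, L)"
  shows "inj_on g {0..L}"
proof -
  have "s = t" if "s \<le> t" "s \<in> {0..L}" "t \<in> {0..L}" "g s = g t" for s t
  proof -
    have "g s \<in> \<Union>\<phi>" using shortest_pathD(3)[OF sp] that(2) by blast
    then have "closed_segment (g s) (g t) \<subseteq> \<Union>\<phi>" using that(4) by (simp add: closed_segment_idem)
    then have "dist (g s) (g t) = t - s"
      using that by (intro shortest_path_straight[OF sp]) auto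
    then show ?thesis using that by simp
  qed
  then show ?thesis unfolding inj_on_def by (metis linear)
qed

section \<open>Regular points of a street configuration\<close>

text \<open>The notion depends on the union alone and not on how it is cut into segments.
  \<open>crossings\<close> would not do: two overlapping collinear segments produce a continuum of
  crossings, whereas irregular points are locally finite.\<close>

definition irregular :: "'a::real_normed_vector set \<Rightarrow> 'a set" where
  "irregular A = {p\<in>A. \<forall>e>0. \<not> convex (A \<inter> ball p e)}"

definition regular :: "streets \<Rightarrow> point set" where
  "regular \<phi> = \<Union>\<phi> - irregular (\<Union>\<phi>)"

lemma street_configs_segment:
  assumes "\<phi> \<in> street_configs" "s \<in> \<phi>"
  obtains a b where "a \<noteq> b" "s = closed_segment a b"
  using assms unfolding street_configs_def by blast

lemma street_configs_finite: "\<phi> \<in> street_configs \<Longrightarrow> bounded B \<Longrightarrow> finite {s\<in>\<phi>. s \<inter> B \<noteq> {}}"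
  unfolding street_configs_def by blast

text \<open>Only finitely many segments come near x; those that avoid x are closed, so a smaller
  ball misses them all. Near x the union is thus a star with centre x.\<close>

lemma street_configs_ball:
  assumes "\<phi> \<in> street_configs"
  obtains e where "e > 0" "\<And>s. s \<in> \<phi> \<Longrightarrow> s \<inter> ball x e \<noteq> {} \<Longrightarrow> x \<in> s"
proof -
  define F where "F = {s\<in>\<phi>. s \<inter> ball x 1 \<noteq> {}}"
  have F: "finite F" unfolding F_def by (rule street_configs_finite[OF assms]) auto
  have "closed (\<Union>{s\<in>F. x \<notin> s})"
  proof (rule closed_Union)
    show "finite {s \<in> F. x \<notin> s}" using F by auto
    show "\<forall>s\<in>{s \<in> F. x \<notin> s}. closed s"
      using street_configs_segment[OF assms] by (force simp: F_def)
  qed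
  then have "open (- \<Union>{s\<in>F. x \<notin> s})" by auto
  moreover have "x \<in> - \<Union>{s\<in>F. x \<notin> s}" by auto
  ultimately obtain d where d: "d > 0" "ball x d \<subseteq> - \<Union>{s\<in>F. x \<notin> s}"
    by (meson openE)
  show ?thesis
  proof (rule that[of "min d 1"])
    fix s assume s: "s \<in> \<phi>" "s \<inter> ball x (min d 1) \<noteq> {}"
    then obtain z where z: "z \<in> s" "z \<in> ball x d" "z \<in> ball x 1" by auto
    then have "s \<in> F" using s by (auto simp: F_def)
    then show "x \<in> s" using d(2) z by blast
  qed (use d in auto)
qed

lemma closed_streets:
  assumes "\<phi> \<in> street_configs"
  shows "closed (\<Union>\<phi>)"
proof -
  have "open (- \<Union>\<phi>)"
    unfolding open_contains_ball
  proof
    fix x assume x: "x \<in> - \<Union>\<phi>"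
    obtain e where e: "e > 0" "\<And>s. s \<in> \<phi> \<Longrightarrow> s \<inter> ball x e \<noteq> {} \<Longrightarrow> x \<in> s"
      using street_configs_ball[OF assms] by blast
    then have "ball x e \<subseteq> - \<Union>\<phi>" using x by blast
    with e(1) show "\<exists>e>0. ball x e \<subseteq> - \<Union>\<phi>" by blast
  qed
  then show ?thesis by (simp add: closed_def)
qed

lemma streets_starlike:
  assumes "\<phi> \<in> street_configs"
  obtains e where "e > 0" "\<And>z. z \<in> \<Union>\<phi> \<inter> ball x e \<Longrightarrow> closed_segment x z \<subseteq> \<Union>\<phi>"
proof -
  obtain e where e: "e > 0" "\<And>s. s \<in> \<phi> \<Longrightarrow> s \<inter> ball x e \<noteq> {} \<Longrightarrow> x \<in> s"
    using street_configs_ball[OF assms] by blast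
  show ?thesis
  proof (rule that[OF e(1)])
    fix z assume "z \<in> \<Union>\<phi> \<inter> ball x e"
    then obtain s where s: "s \<in> \<phi>" "z \<in> s" "z \<in> ball x e" by blast
    then have "x \<in> s" using e(2)[of s] by blast
    moreover have "convex s" using street_configs_segment[OF assms s(1)] by auto
    ultimately have "closed_segment x z \<subseteq> s" using s by (intro closed_segment_subset)
    then show "closed_segment x z \<subseteq> \<Union>\<phi>" using s by blast
  qed
qed

text \<open>The streets are locally starlike, so reachability by a curve of finite length is an
  equivalence relation with open classes, and a connected set has only one class.\<close>

lemma connected_lip_reach:
  assumes "\<phi> \<in> street_configs" "connected (\<Union>\<phi>)" "x \<in> \<Union>\<phi>" "y \<in> \<Union>\<phi>"
  shows "\<exists>L. lip_reach (\<Union>\<phi>) L x y"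
proof (rule connected_equivalence_relation[OF assms(2-4)])
  fix a assume "a \<in> \<Union>\<phi>"
  obtain e where e: "e > 0" "\<And>z. z \<in> \<Union>\<phi> \<inter> ball a e \<Longrightarrow> closed_segment a z \<subseteq> \<Union>\<phi>"
    using streets_starlike[OF assms(1), of a] by blast
  have "openin (top_of_set (\<Union>\<phi>)) (\<Union>\<phi> \<inter> ball a e)" by (simp add: openin_open_Int)
  moreover have "\<forall>z\<in>\<Union>\<phi> \<inter> ball a e. \<exists>L. lip_reach (\<Union>\<phi>) L a z"
    using e(2) lip_reach_segment by blast
  ultimately show "\<exists>T. openin (top_of_set (\<Union>\<phi>)) T \<and> a \<in> T \<and> (\<forall>z\<in>T. \<exists>L. lip_reach (\<Union>\<phi>) L a z)"
    using e(1) \<open>a \<in> \<Union>\<phi>\<close> by (intro exI[of _ "\<Union>\<phi> \<inter> ball a e"]) auto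
qed (blast intro: lip_reach_sym lip_reach_trans)+

section \<open>Straightness near regular points\<close>

lemma interior_finite_segments:
  fixes F :: "'a::euclidean_space set set"
  assumes "2 \<le> DIM('a)" "finite F" "\<And>s. s \<in> F \<Longrightarrow> \<exists>a b. s = closed_segment a b"
  shows "interior (\<Union>F) = {}"
  using assms(2,3)
proof (induction F rule: finite_induct)
  case (insert s F)
  obtain a b where s: "s = closed_segment a b" using insert(4) by blast
  have "interior (s \<union> \<Union>F) = interior s"
    using insert s by (intro interior_closed_Un_empty_interior) auto
  then show ?case using s assms(1) by (simp add: interior_closed_segment_ge2)
qed auto

lemma streets_ball_interior:
  assumes "\<phi> \<in> street_configs"
  shows "interior (\<Union>\<phi> \<inter> ball x e) = {}"
proof -
  have "interior (\<Union>{s\<in>\<phi>. s \<inter> ball x e \<noteq> {}}) = {}"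
  proof (rule interior_finite_segments)
    show "finite {s\<in>\<phi>. s \<inter> ball x e \<noteq> {}}" by (rule street_configs_finite[OF assms]) auto
    show "\<exists>a b. s = closed_segment a b" if "s \<in> {s\<in>\<phi>. s \<inter> ball x e \<noteq> {}}" for s
      using street_configs_segment[OF assms, of s] that by blast
  qed simp
  moreover have "\<Union>\<phi> \<inter> ball x e \<subseteq> \<Union>{s\<in>\<phi>. s \<inter> ball x e \<noteq> {}}" by blast
  ultimately show ?thesis using interior_mono by blast
qed

text \<open>A convex planar set of full affine dimension has interior points.\<close>

lemma convex_empty_interior_collinear:
  fixes C :: "(real \<times> real) set"
  assumes "convex C" "interior C = {}"
  shows "collinear C"
proof (rule ccontr)
  assume "\<not> collinear C"
  then have "aff_dim C > 1" by (simp add: collinear_aff_dim)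
  moreover have "aff_dim C \<le> 2" using aff_dim_le_DIM[of C] by simp
  ultimately have "aff_dim C = int (DIM(real \<times> real))" by simp
  then have "rel_interior C = interior C" by (rule interior_rel_interior)
  then have "C = {}" using assms rel_interior_eq_empty by blast
  then show False using \<open>\<not> collinear C\<close> by simp
qed

text \<open>Finitely many segments have no interior, so a convex piece of the union is contained in
  a line. Nearby points inherit regularity because the intersection with a smaller ball is again
  convex.\<close>

lemma regular_ball:
  assumes \<phi>: "\<phi> \<in> street_configs" and y: "y \<in> regular \<phi>"
  obtains e where "e > 0" "convex (\<Union>\<phi> \<inter> ball y e)" "collinear (\<Union>\<phi> \<inter> ball y e)"
    "\<Union>\<phi> \<inter> ball y e \<subseteq> regular \<phi>"
proof -
  obtain e where e: "e > 0" "convex (\<Union>\<phi> \<inter> ball y e)"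
    using y unfolding regular_def irregular_def by blast
  have "z \<in> regular \<phi>" if z: "z \<in> \<Union>\<phi> \<inter> ball y e" for z
  proof -
    obtain d where d: "d > 0" "ball z d \<subseteq> ball y e"
      using z by (meson IntD2 open_ball openE)
    have "convex ((\<Union>\<phi> \<inter> ball y e) \<inter> ball z d)" by (intro convex_Int e convex_ball)
    moreover have "(\<Union>\<phi> \<inter> ball y e) \<inter> ball z d = \<Union>\<phi> \<inter> ball z d" using d by blast
    ultimately show ?thesis using z d(1) unfolding regular_def irregular_def by auto
  qed
  with e show ?thesis
    using convex_empty_interior_collinear[OF e(2) streets_ball_interior[OF \<phi>]] by (intro that[of e]) (use \<open>\<And>z. z \<in> \<Union>\<phi> \<inter> ball y e \<Longrightarrow> z \<in> regular \<phi>\<close> in blast)+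
qed

lemma point_near_on_segment:
  fixes x y :: "'a::real_normed_vector"
  assumes "e > 0"
  obtains t where "0 < t" "t \<le> 1" "y + t *\<^sub>R (x - y) \<in> closed_segment y x" "dist y (y + t *\<^sub>R (x - y)) < e"
proof
  define t where "t = min 1 (e / (2 * (norm (x - y) + 1)))"
  have n: "norm (x - y) + 1 > 0" by (simp add: add_nonneg_pos)
  show t: "0 < t" "t \<le> 1" using assms n by (auto simp: t_def)
  show "y + t *\<^sub>R (x - y) \<in> closed_segment y x"
    unfolding in_segment using t by (intro exI[of _ t]) (auto simp: algebra_simps)
  have "t * (norm (x - y) + 1) \<le> e / (2 * (norm (x - y) + 1)) * (norm (x - y) + 1)"
    using n by (intro mult_right_mono) (auto simp: t_def)
  also have "\<dots> = e / 2" using n by (auto simp: divide_simps)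
  finally have "t * norm (x - y) < e" using t assms by (simp add: algebra_simps)
  then show "dist y (y + t *\<^sub>R (x - y)) < e" using t by (simp add: dist_norm)
qed

text \<open>Near the common point y the streets lie on one line, and both segments start along it.
  So x, y, z are collinear, and the third segment is covered by the other two.\<close>

lemma regular_segment_trans:
  assumes \<phi>: "\<phi> \<in> street_configs"
    and xy: "closed_segment x y \<subseteq> regular \<phi>" and yz: "closed_segment y z \<subseteq> regular \<phi>"
  shows "closed_segment x z \<subseteq> regular \<phi>"
proof -
  have y: "y \<in> regular \<phi>" using xy by auto
  obtain e where e: "e > 0" and "convex (\<Union>\<phi> \<inter> ball y e)" "collinear (\<Union>\<phi> \<inter> ball y e)"
      "\<Union>\<phi> \<inter> ball y e \<subseteq> regular \<phi>"
    by (rule regular_ball[OF \<phi> y])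
  then have e: "e > 0" "collinear (\<Union>\<phi> \<inter> ball y e)" by simp_all
  obtain s where s: "0 < s" "y + s *\<^sub>R (x - y) \<in> closed_segment y x" "dist y (y + s *\<^sub>R (x - y)) < e"
    using point_near_on_segment[OF e(1), of y x] by blast
  obtain t where t: "0 < t" "y + t *\<^sub>R (z - y) \<in> closed_segment y z" "dist y (y + t *\<^sub>R (z - y)) < e"
    using point_near_on_segment[OF e(1), of y z] by blast
  have "{y + s *\<^sub>R (x - y), y, y + t *\<^sub>R (z - y)} \<subseteq> \<Union>\<phi> \<inter> ball y e"
  proof -
    have "\<Union>\<phi> \<supseteq> regular \<phi>" by (auto simp: regular_def)
    moreover have "y + s *\<^sub>R (x - y) \<in> regular \<phi>"
      using s(2) xy by (metis closed_segment_commute subsetD)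
    moreover have "y + t *\<^sub>R (z - y) \<in> regular \<phi>" using t(2) yz by blast
    ultimately have "{y + s *\<^sub>R (x - y), y, y + t *\<^sub>R (z - y)} \<subseteq> \<Union>\<phi>" using y by blast
    moreover have "{y + s *\<^sub>R (x - y), y, y + t *\<^sub>R (z - y)} \<subseteq> ball y e"
      using s(3) t(3) e(1) by simp
    ultimately show ?thesis by blast
  qed
  then have "collinear {y + s *\<^sub>R (x - y), y, y + t *\<^sub>R (z - y)}"
    using e(2) collinear_subset by blast
  then have "collinear {0, s *\<^sub>R (x - y), t *\<^sub>R (z - y)}" by (subst (asm) collinear_3) auto
  \<comment> \<open>Collinearity of y with nearby points of the two segments passes to their end
    points by rescaling.\<close>
  then have "collinear {0, x - y, z - y}"
  proof (cases "x = y \<or> z = y")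
    case False
    then obtain c where "t *\<^sub>R (z - y) = c *\<^sub>R (s *\<^sub>R (x - y))"
      using \<open>collinear {0, s *\<^sub>R (x - y), t *\<^sub>R (z - y)}\<close> s(1) t(1) unfolding collinear_lemma by auto
    then have "(1 / t) *\<^sub>R (t *\<^sub>R (z - y)) = (1 / t) *\<^sub>R (c *\<^sub>R (s *\<^sub>R (x - y)))" by simp
    then have "z - y = (c * s / t) *\<^sub>R (x - y)" using t(1) by (simp add: field_simps)
    then show ?thesis unfolding collinear_lemma by blast
  qed (auto simp: collinear_lemma)
  then have "collinear {x, y, z}" by (subst collinear_3) auto
  then have "closed_segment x z \<subseteq> closed_segment x y \<union> closed_segment y z"
    unfolding collinear_between_cases between_mem_segment
  proof (elim disjE)
    assume "x \<in> closed_segment y z"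
    then have "closed_segment x z \<subseteq> closed_segment y z" by (simp add: subset_closed_segment)
    then show ?thesis by blast
  next
    assume "y \<in> closed_segment z x"
    then have "closed_segment x y \<union> closed_segment y z = closed_segment x z"
      by (simp add: Un_closed_segment closed_segment_commute)
    then show ?thesis by simp
  next
    assume "z \<in> closed_segment x y"
    then have "closed_segment x z \<subseteq> closed_segment x y" by (simp add: subset_closed_segment)
    then show ?thesis by blast
  qed
  then show ?thesis using xy yz by blast
qed

text \<open>Being joined by a segment of regular points is an equivalence relation with relatively
  open classes, so connectedness leaves one class. In particular a path through regular points never
  has to turn a corner.\<close>

lemma connected_regular_segment:
  assumes \<phi>: "\<phi> \<in> street_configs" and S: "connected S" "S \<subseteq> regular \<phi>" "a \<in> S" "b \<in> S"
  shows "closed_segment a b \<subseteq> regular \<phi>"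
proof (rule connected_equivalence_relation[OF S(1,3,4), where R = "\<lambda>a b. closed_segment a b \<subseteq> regular \<phi>"])
  fix a assume a: "a \<in> S"
  then have "a \<in> regular \<phi>" using S(2) by blast
  then obtain e where e: "e > 0" "convex (\<Union>\<phi> \<inter> ball a e)" and "collinear (\<Union>\<phi> \<inter> ball a e)"
      and sub: "\<Union>\<phi> \<inter> ball a e \<subseteq> regular \<phi>"
    by (rule regular_ball[OF \<phi>])
  have "closed_segment a z \<subseteq> regular \<phi>" if "z \<in> S \<inter> ball a e" for z
  proof -
    have "closed_segment a z \<subseteq> \<Union>\<phi> \<inter> ball a e"
      using that S(2) a e(1) by (intro closed_segment_subset e) (auto simp: regular_def)
    then show ?thesis using sub by blast
  qed
  then show "\<exists>T. openin (top_of_set S) T \<and> a \<in> T \<and> (\<forall>x\<in>T. closed_segment a x \<subseteq> regular \<phi>)"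
    using a e(1) by (intro exI[of _ "S \<inter> ball a e"]) (auto simp: openin_open_Int)
qed (auto simp: closed_segment_commute intro: regular_segment_trans[OF \<phi>, THEN subsetD])

lemma path_regular_segment:
  assumes \<phi>: "\<phi> \<in> street_configs" and h: "continuous_on {a..b::real} h" "h ` {a..b} \<subseteq> regular \<phi>" "a \<le> b"
  shows "closed_segment (h a) (h b) \<subseteq> regular \<phi>"
  using h by (intro connected_regular_segment[OF \<phi>, of "h ` {a..b}"] connected_continuous_image) auto

text \<open>A point strictly between two neighbouring crossings lies on exactly one segment, and
  near it the union is that segment.\<close>

lemma street_regular:
  assumes \<phi>: "\<phi> \<in> street_configs" and n: "neighbors \<phi> p q"
  shows "open_segment p q \<subseteq> regular \<phi>"
proof
  fix z assume z: "z \<in> open_segment p q"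
  obtain s where s: "s \<in> \<phi>" "p \<in> s" "q \<in> s" using n by (auto simp: neighbors_def)
  have "convex s" using street_configs_segment[OF \<phi> s(1)] by auto
  then have zs: "z \<in> s" using s z by (meson closed_segment_subset segment_open_subset_closed subsetD)
  have nc: "z \<notin> crossings \<phi>" using n z by (auto simp: neighbors_def)
  have only: "t = s" if "t \<in> \<phi>" "z \<in> t" for t
    using nc that zs s(1) unfolding crossings_def by blast
  obtain e where e: "e > 0" "\<And>s. s \<in> \<phi> \<Longrightarrow> s \<inter> ball z e \<noteq> {} \<Longrightarrow> z \<in> s"
    using street_configs_ball[OF \<phi>] by blast
  have "\<Union>\<phi> \<inter> ball z e = s \<inter> ball z e" using e(2) only s(1) by blast
  then have "convex (\<Union>\<phi> \<inter> ball z e)" using \<open>convex s\<close> by (simp add: convex_Int)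
  then show "z \<in> regular \<phi>" using e(1) s(1) zs unfolding regular_def irregular_def by blast
qed

text \<open>The ends of a street may be irregular, hence the assumption on a and b; everything
  strictly between them is interior to the street.\<close>

lemma is_street_regular_segment:
  assumes \<phi>: "\<phi> \<in> street_configs" and st: "is_street \<phi> st" and ab: "a \<in> st" "b \<in> st"
    "a \<in> regular \<phi>" "b \<in> regular \<phi>"
  shows "closed_segment a b \<subseteq> regular \<phi>"
proof -
  obtain p q where pq: "neighbors \<phi> p q" "st = closed_segment p q" using st by (auto simp: is_street_def)
  have "open_segment a b \<subseteq> open_segment p q" using ab pq by (simp add: subset_open_segment)
  then have "open_segment a b \<subseteq> regular \<phi>" using street_regular[OF \<phi> pq(1)] by blast
  then show ?thesis using ab by (auto simp: closed_segment_eq_open)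
qed

section \<open>Local finiteness of the irregular points\<close>

lemma line_in_segment:
  fixes a b :: "'a::real_normed_vector"
  assumes "p \<in> open_segment a b"
  obtains e where "e > 0" "\<And>t. norm (t *\<^sub>R (b - a)) < e \<Longrightarrow> p + t *\<^sub>R (b - a) \<in> closed_segment a b"
proof -
  obtain u where u: "a \<noteq> b" "0 < u" "u < 1" "p = (1 - u) *\<^sub>R a + u *\<^sub>R b"
    using assms unfolding in_segment by blast
  define e where "e = min u (1 - u) * norm (b - a)"
  show ?thesis
  proof (rule that[of e])
    show "e > 0" using u by (simp add: e_def)
    fix t assume "norm (t *\<^sub>R (b - a)) < e"
    then have "\<bar>t\<bar> < min u (1 - u)" using u by (simp add: e_def)
    then have "0 \<le> u + t" "u + t \<le> 1" by auto
    moreover have "p + t *\<^sub>R (b - a) = (1 - (u + t)) *\<^sub>R a + (u + t) *\<^sub>R b"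
      unfolding u by (simp add: algebra_simps)
    ultimately show "p + t *\<^sub>R (b - a) \<in> closed_segment a b"
      unfolding in_segment by blast
  qed
qed

lemma segment_direction:
  fixes a b :: "'a::real_vector"
  assumes "p \<in> closed_segment a b" "q \<in> closed_segment a b"
  obtains t where "q - p = t *\<^sub>R (b - a)"
proof -
  obtain u v where uv: "p = (1 - u) *\<^sub>R a + u *\<^sub>R b" "q = (1 - v) *\<^sub>R a + v *\<^sub>R b"
    using assms unfolding in_segment by blast
  have "q - p = (v - u) *\<^sub>R (b - a)" unfolding uv by (simp add: algebra_simps)
  then show ?thesis by (rule that)
qed

text \<open>Segments that share p and a second point span the same line. One of them already covers
  this line near p, because p is not an end point of it; so the union is locally a line.\<close>

lemma regular_if_parallel:
  assumes \<phi>: "\<phi> \<in> street_configs" and p: "p \<in> \<Union>\<phi>"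
    and op: "\<And>a b. closed_segment a b \<in> \<phi> \<Longrightarrow> p \<in> closed_segment a b \<Longrightarrow> p \<in> open_segment a b"
    and pa: "\<And>s t. s \<in> \<phi> \<Longrightarrow> t \<in> \<phi> \<Longrightarrow> p \<in> s \<Longrightarrow> p \<in> t \<Longrightarrow> s \<inter> t \<noteq> {p}"
  shows "p \<in> regular \<phi>"
proof -
  obtain d where d: "d > 0" "\<And>s. s \<in> \<phi> \<Longrightarrow> s \<inter> ball p d \<noteq> {} \<Longrightarrow> p \<in> s"
    using street_configs_ball[OF \<phi>] by blast
  obtain s0 where s0: "s0 \<in> \<phi>" "p \<in> s0" using p by blast
  obtain a0 b0 where ab0: "a0 \<noteq> b0" "s0 = closed_segment a0 b0"
    using street_configs_segment[OF \<phi> s0(1)] .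
  define l where "l t = p + t *\<^sub>R (b0 - a0)" for t :: real
  obtain e where e: "e > 0" "\<And>t. norm (t *\<^sub>R (b0 - a0)) < e \<Longrightarrow> l t \<in> s0"
    using line_in_segment[OF op[OF s0(1)[unfolded ab0(2)] s0(2)[unfolded ab0(2)]]]
    unfolding l_def ab0(2) by metis
  have on_line: "z \<in> range l" if z: "z \<in> \<Union>\<phi> \<inter> ball p d" for z
  proof -
    obtain s where s: "s \<in> \<phi>" "z \<in> s" using z by blast
    then have ps: "p \<in> s" using d(2) z by blast
    obtain a b where ab: "a \<noteq> b" "s = closed_segment a b" using street_configs_segment[OF \<phi> s(1)] .
    obtain q where q: "q \<in> s" "q \<in> s0" "q \<noteq> p" using pa[OF s(1) s0(1) ps s0(2)] ps s0(2) by blast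
    obtain t1 where t1: "q - p = t1 *\<^sub>R (b - a)" using segment_direction ps q(1) ab(2) by metis
    obtain t2 where t2: "q - p = t2 *\<^sub>R (b0 - a0)" using segment_direction s0(2) q(2) ab0(2) by metis
    obtain t3 where t3: "z - p = t3 *\<^sub>R (b - a)" using segment_direction ps s(2) ab(2) by metis
    have "t1 \<noteq> 0" using t1 q(3) by auto
    then have "b - a = (t2 / t1) *\<^sub>R (b0 - a0)"
      using t1 t2 by (metis (no_types, opaque_lifting) divide_inverse_commute scaleR_left.minus
          scaleR_scaleR scale_one left_inverse)
    then have "z - p = (t3 * (t2 / t1)) *\<^sub>R (b0 - a0)" using t3 by simp
    then have "z = l (t3 * (t2 / t1))" unfolding l_def by (simp add: algebra_simps)
    then show ?thesis by blast
  qed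
  have "\<Union>\<phi> \<inter> ball p (min d e) = range l \<inter> ball p (min d e)"
  proof (intro equalityI subsetI)
    fix z assume "z \<in> \<Union>\<phi> \<inter> ball p (min d e)"
    then show "z \<in> range l \<inter> ball p (min d e)" using on_line[of z] by auto
  next
    fix z assume z: "z \<in> range l \<inter> ball p (min d e)"
    then obtain t where t: "z = l t" by blast
    then have "norm (t *\<^sub>R (b0 - a0)) < e" using z by (auto simp: l_def dist_norm)
    then have "z \<in> s0" using e(2) t by blast
    then show "z \<in> \<Union>\<phi> \<inter> ball p (min d e)" using s0(1) z by blast
  qed
  moreover have "convex (range l)"
  proof -
    have "range l = (+) p ` ((\<lambda>t. t *\<^sub>R (b0 - a0)) ` UNIV)" by (auto simp: l_def)
    moreover have "convex ((\<lambda>t. t *\<^sub>R (b0 - a0)) ` (UNIV :: real set))"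
      by (intro convex_linear_image) (auto intro: linear_scaleR_left)
    ultimately show ?thesis by (simp add: convex_translation)
  qed
  ultimately have "convex (\<Union>\<phi> \<inter> ball p (min d e))" by (simp add: convex_Int)
  then show ?thesis using p d(1) e(1) unfolding regular_def irregular_def
    by (metis (mono_tags, lifting) DiffI mem_Collect_eq min_less_iff_conj)
qed

text \<open>An irregular point violates a hypothesis of \<open>regular_if_parallel\<close>: it is an
  end point of a segment or the only common point of two segments. Finitely many segments have
  finitely many such points.\<close>

lemma finite_irregular:
  assumes \<phi>: "\<phi> \<in> street_configs" and B: "bounded B"
  shows "finite (irregular (\<Union>\<phi>) \<inter> B)"
proof -
  define F where "F = {s\<in>\<phi>. s \<inter> B \<noteq> {}}"
  have F: "finite F" unfolding F_def by (rule street_configs_finite[OF \<phi> B])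
  \<comment> \<open>A segment determines its end points only up to order; \<open>ends\<close> fixes
    an order.\<close>
  define ends where "ends s = (SOME ab. s = closed_segment (fst ab) (snd ab))" for s :: "point set"
  define N where "N = (\<lambda>s. fst (ends s)) ` F \<union> (\<lambda>s. snd (ends s)) ` F \<union>
     (\<lambda>(s, t). SOME p. s \<inter> t = {p}) ` (F \<times> F)"
  have "irregular (\<Union>\<phi>) \<inter> B \<subseteq> N"
  proof
    fix p assume p: "p \<in> irregular (\<Union>\<phi>) \<inter> B"
    then have pU: "p \<in> \<Union>\<phi>" by (auto simp: irregular_def)
    show "p \<in> N"
    proof (rule ccontr)
      assume pN: "p \<notin> N"
      have "p \<in> regular \<phi>"
      proof (rule regular_if_parallel[OF \<phi> pU])
        fix a b assume ab: "closed_segment a b \<in> \<phi>" "p \<in> closed_segment a b"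
        then have sF: "closed_segment a b \<in> F" using p by (auto simp: F_def)
        have "closed_segment a b = closed_segment (fst (ends (closed_segment a b))) (snd (ends (closed_segment a b)))"
          unfolding ends_def by (rule someI[of _ "(a, b)"]) simp
        then have "{a, b} = {fst (ends (closed_segment a b)), snd (ends (closed_segment a b))}"
          by (simp add: closed_segment_eq)
        moreover have "p \<noteq> fst (ends (closed_segment a b))" "p \<noteq> snd (ends (closed_segment a b))"
          using pN sF unfolding N_def by blast+
        ultimately show "p \<in> open_segment a b"
          using ab(2) by (auto simp: open_segment_def doubleton_eq_iff)
      next
        fix s t assume st: "s \<in> \<phi>" "t \<in> \<phi>" "p \<in> s" "p \<in> t"
        then have "(s, t) \<in> F \<times> F" using p by (auto simp: F_def)
        moreover have "(SOME p. s \<inter> t = {p}) = p" if "s \<inter> t = {p}" using that by auto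
        ultimately show "s \<inter> t \<noteq> {p}" using pN unfolding N_def by (metis (mono_tags, lifting) UnI2 case_prod_conv image_eqI)
      qed
      then show False using p by (auto simp: regular_def)
    qed
  qed
  moreover have "finite N" using F by (simp add: N_def)
  ultimately show ?thesis by (rule finite_subset)
qed

text \<open>Near u the streets lie on one line, and a piece of this line around u belongs to the
  segment. So a regular segment is relatively open in the streets except at its ends, and the other
  streets can be separated from it.\<close>

lemma regular_segment_open:
  assumes \<phi>: "\<phi> \<in> street_configs" and ab: "closed_segment a b \<subseteq> regular \<phi>" and u: "u \<in> open_segment a b"
  obtains e where "e > 0" "\<Union>\<phi> \<inter> ball u e \<subseteq> closed_segment a b"
proof -
  have uc: "u \<in> closed_segment a b" and "a \<noteq> b" using u by (auto simp: open_segment_def)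
  have "u \<in> regular \<phi>" using ab uc by blast
  then obtain e where e: "e > 0" and "convex (\<Union>\<phi> \<inter> ball u e)" "collinear (\<Union>\<phi> \<inter> ball u e)"
      "\<Union>\<phi> \<inter> ball u e \<subseteq> regular \<phi>"
    by (rule regular_ball[OF \<phi>])
  then have e: "e > 0" "collinear (\<Union>\<phi> \<inter> ball u e)" by simp_all
  obtain d where d: "d > 0" "\<And>t. norm (t *\<^sub>R (b - a)) < d \<Longrightarrow> u + t *\<^sub>R (b - a) \<in> closed_segment a b"
    using line_in_segment[OF u] by blast
  show ?thesis
  proof (rule that[of "min d e"])
    show "min d e > 0" using d e by simp
    show "\<Union>\<phi> \<inter> ball u (min d e) \<subseteq> closed_segment a b"
    proof
      fix z assume z: "z \<in> \<Union>\<phi> \<inter> ball u (min d e)"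
      \<comment> \<open>A second point of the segment close to u identifies the line.\<close>
      obtain t where t: "0 < t" "u + t *\<^sub>R (b - u) \<in> closed_segment u b" "dist u (u + t *\<^sub>R (b - u)) < e"
        using point_near_on_segment[OF e(1), of u b] by blast
      have sub: "closed_segment u b \<subseteq> closed_segment a b"
        using uc by (simp add: subset_closed_segment)
      have ub: "u \<noteq> b" using u by (simp add: open_segment_def)
      have "\<Union>\<phi> \<supseteq> regular \<phi>" by (auto simp: regular_def)
      then have "{u + t *\<^sub>R (b - u), u, z} \<subseteq> \<Union>\<phi>" using t(2) sub ab z uc by blast
      moreover have "{u + t *\<^sub>R (b - u), u, z} \<subseteq> ball u e" using t(3) z e(1) by simp
      ultimately have "{u + t *\<^sub>R (b - u), u, z} \<subseteq> \<Union>\<phi> \<inter> ball u e" by blast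
      then have "collinear {u + t *\<^sub>R (b - u), u, z}" using e(2) collinear_subset by blast
      then have "collinear {0, t *\<^sub>R (b - u), z - u}" by (subst (asm) collinear_3) auto
      then obtain c where c: "z - u = c *\<^sub>R (t *\<^sub>R (b - u))"
        using ub t(1) unfolding collinear_lemma by (metis scaleR_zero_left scaleR_eq_0_iff eq_iff_diff_eq_0 less_irrefl)
      obtain v where v: "b - u = v *\<^sub>R (b - a)" using segment_direction uc ends_in_segment(2) by metis
      have zz: "z = u + (c * t * v) *\<^sub>R (b - a)" using c unfolding v by (simp add: algebra_simps)
      moreover have "norm ((c * t * v) *\<^sub>R (b - a)) < d" using z zz by (simp add: dist_norm)
      ultimately show "z \<in> closed_segment a b" using d(2) by blast
    qed
  qed
qed

section \<open>The motion of a device\<close>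

text \<open>The function of arc length that underlies \<^const>\<open>commute\<close>: a triangle wave of period $2L$, equal to
  $0$ if $L = 0$ because of $s / 0 = 0$.\<close>

definition tent :: "real \<Rightarrow> real \<Rightarrow> real" where
  "tent L s = (let u = 2 * L * frac (s / (2 * L)) in min u (2 * L - u))"

lemma tent_zero_length [simp]: "tent 0 s = 0"
  by (simp add: tent_def)

text \<open>Together with \<open>tent_attained\<close> this says, for L > 0, that
  \<open>tent L s\<close> is the distance of s from the lattice 2LZ of complete round trips. The
  Lipschitz bound and the location of the level sets follow from it.\<close>

lemma tent_le:
  assumes "0 \<le> L"
  shows "tent L s \<le> \<bar>s - 2 * L * of_int k\<bar>"
proof (cases "L = 0")
  case False
  define f where "f = \<lfloor>s / (2 * L)\<rfloor>"
  define u where "u = 2 * L * frac (s / (2 * L))"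
  have u: "u = s - 2 * L * of_int f" using False by (simp add: u_def f_def frac_def field_simps)
  show ?thesis
  proof (cases "k \<le> f")
    case True
    then have "2 * L * of_int k \<le> 2 * L * of_int f" using assms by (intro mult_left_mono) auto
    then have "u \<le> \<bar>s - 2 * L * of_int k\<bar>" using u by linarith
    then show ?thesis by (simp add: tent_def Let_def flip: u_def)
  next
    case False
    then have "of_int (f + 1) \<le> (of_int k :: real)" by (intro of_int_le_iff[THEN iffD2]) simp
    then have "2 * L * of_int (f + 1) \<le> 2 * L * of_int k" using assms by (intro mult_left_mono) auto
    then have "2 * L * of_int f + 2 * L \<le> 2 * L * of_int k" by (simp add: algebra_simps)
    then have "2 * L - u \<le> \<bar>s - 2 * L * of_int k\<bar>" using u by linarith
    then show ?thesis by (simp add: tent_def Let_def flip: u_def)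
  qed
qed simp

lemma tent_attained:
  assumes "0 \<le> L"
  obtains k :: int where "tent L s = \<bar>s - 2 * L * of_int k\<bar> \<or> L = 0"
proof (cases "L = 0")
  case True
  then show ?thesis using that[of 0] by simp
next
  case False
  define f where "f = \<lfloor>s / (2 * L)\<rfloor>"
  define u where "u = 2 * L * frac (s / (2 * L))"
  have u: "u = s - 2 * L * of_int f" using False by (simp add: u_def f_def frac_def field_simps)
  have "0 \<le> u" using assms by (simp add: u_def)
  moreover have "u \<le> 2 * L * 1"
    unfolding u_def using assms by (intro mult_left_mono) (auto simp: frac_lt_1 less_imp_le)
  moreover have "tent L s = min u (2 * L - u)" by (simp add: tent_def Let_def flip: u_def)
  ultimately have "tent L s = \<bar>s - 2 * L * of_int f\<bar> \<or> tent L s = \<bar>s - 2 * L * of_int (f + 1)\<bar>"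
    using u by (auto simp: min_def algebra_simps)
  then show ?thesis using that by blast
qed

lemma tent_bounds:
  assumes "0 \<le> L"
  shows "0 \<le> tent L s" "tent L s \<le> L"
proof -
  define u where "u = 2 * L * frac (s / (2 * L))"
  have "0 \<le> u" using assms by (simp add: u_def)
  moreover have "u \<le> 2 * L * 1"
    unfolding u_def using assms by (intro mult_left_mono) (auto simp: frac_lt_1 less_imp_le)
  moreover have "tent L s = min u (2 * L - u)" by (simp add: tent_def Let_def flip: u_def)
  ultimately show "0 \<le> tent L s" "tent L s \<le> L" by auto
qed

lemma tent_lipschitz:
  assumes "0 \<le> L"
  shows "\<bar>tent L s - tent L t\<bar> \<le> \<bar>s - t\<bar>"
proof -
  have "tent L s \<le> tent L t + \<bar>s - t\<bar>" for s t
  proof -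
    obtain k :: int where "tent L t = \<bar>t - 2 * L * of_int k\<bar> \<or> L = 0" using tent_attained[OF assms] .
    then show ?thesis using tent_le[OF assms, of s k] by auto
  qed
  from this[of s t] this[of t s] show ?thesis by (simp add: abs_le_iff abs_minus_commute)
qed

lemma tent_initial:
  assumes "0 \<le> s" "s \<le> L"
  shows "tent L s = s"
proof -
  have L: "0 \<le> L" using assms by simp
  obtain k :: int where k: "tent L s = \<bar>s - 2 * L * of_int k\<bar> \<or> L = 0" using tent_attained[OF L] .
  have "s \<le> \<bar>s - 2 * L * of_int k\<bar>"
  proof (cases "k \<le> 0")
    case True
    then have "L * of_int k \<le> 0" using L by (simp add: mult_nonneg_nonpos)
    then show ?thesis using assms by linarith
  next
    case False
    then have "L * 1 \<le> L * of_int k" using L by (intro mult_left_mono) auto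
    then show ?thesis using assms by linarith
  qed
  moreover have "tent L s \<le> s" using tent_le[OF L, of s 0] assms by simp
  ultimately show ?thesis using k assms by auto
qed

text \<open>For each value c the solutions of \<open>tent L s = c\<close> lie in two translates of
  the lattice 2LZ, so there is a gap to the right of \<open>s0\<close>.\<close>

lemma tent_avoids:
  assumes L: "0 < L" and C: "finite C"
  shows "\<forall>\<^sub>F s in at_right s0. tent L s \<notin> C"
proof -
  have *: "\<forall>\<^sub>F s in at_right s0. \<forall>k::int. s \<noteq> c + 2 * L * of_int k" for c
  proof -
    define f where "f = \<lfloor>(s0 - c) / (2 * L)\<rfloor>"
    \<comment> \<open>The first point of the translated lattice strictly after
      \<open>s0\<close>.\<close>
    define s1 where "s1 = c + 2 * L * of_int (f + 1)"
    have f: "of_int f \<le> (s0 - c) / (2 * L)" "(s0 - c) / (2 * L) < of_int f + 1"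
      unfolding f_def by linarith+
    have s1: "s0 < s1" and f': "c + 2 * L * of_int f \<le> s0"
      using f L by (auto simp: s1_def field_simps)
    have "s \<noteq> c + 2 * L * of_int k" if s: "s0 < s" "s < s1" for s k
    proof
      assume e: "s = c + 2 * L * of_int k"
      have "2 * L * of_int f < 2 * L * of_int k" using e s f' by linarith
      moreover have "2 * L * of_int k < 2 * L * of_int (f + 1)" using e s by (simp add: s1_def)
      ultimately have "(of_int f :: real) < of_int k" "(of_int k :: real) < of_int (f + 1)"
        using L by (simp_all only: mult_less_cancel_left_pos zero_less_mult_iff zero_less_numeral simp_thms)
      then show False unfolding of_int_less_iff by linarith
    qed
    then show ?thesis unfolding eventually_at_right_field using s1 by blast
  qed
  have "\<forall>\<^sub>F s in at_right s0. \<forall>c\<in>C. (\<forall>k::int. s \<noteq> c + 2 * L * of_int k) \<and> (\<forall>k::int. s \<noteq> - c + 2 * L * of_int k)"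
    using C by (intro eventually_ball_finite ballI eventually_conj *)
  then show ?thesis
  proof eventually_elim
    case (elim s)
    obtain k :: int where "tent L s = \<bar>s - 2 * L * of_int k\<bar>"
      using tent_attained[of L s] L by (metis less_irrefl less_imp_le)
    then have "s = tent L s + 2 * L * of_int k \<or> s = - tent L s + 2 * L * of_int k"
      by (auto simp: abs_if split: if_splits)
    then show ?case using elim by blast
  qed
qed

lemma commute_tent: "commute (g, L) v t = g (tent L (v * t))"
  by (simp add: commute_def tent_def Let_def)

section \<open>A single commuting device\<close>

locale device =
  fixes \<phi> :: streets and x y :: point and g :: "real \<Rightarrow> point" and L v :: real
  assumes config: "\<phi> \<in> street_configs" and sp: "shortest_path \<phi> x y (g, L)" and v: "0 < v"
begin

definition pos :: "real \<Rightarrow> point" where "pos t = g (tent L (v * t))"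

lemmas sp' = shortest_pathD[OF sp]

lemma pos_0: "pos 0 = x"
  using tent_initial[of 0 L] sp' by (simp add: pos_def)

lemma pos_in: "pos t \<in> \<Union>\<phi>"
  using sp'(3) tent_bounds[OF sp'(1)] unfolding pos_def by (meson atLeastAtMost_iff image_subset_iff)

lemma not_regular_iff: "pos t \<notin> regular \<phi> \<longleftrightarrow> pos t \<in> irregular (\<Union>\<phi>)"
  using pos_in[of t] unfolding regular_def by blast

lemma pos_dist: "dist (pos s) (pos t) \<le> v * \<bar>s - t\<bar>"
proof -
  have "dist (pos s) (pos t) \<le> 1 * dist (tent L (v * s)) (tent L (v * t))"
    unfolding pos_def using tent_bounds[OF sp'(1)] by (intro lipschitz_onD[OF sp'(2)]) auto
  also have "\<dots> \<le> \<bar>v * s - v * t\<bar>" using tent_lipschitz[OF sp'(1)] by (simp add: dist_real_def)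
  also have "\<dots> = v * \<bar>s - t\<bar>" using v by (simp add: abs_mult flip: right_diff_distrib)
  finally show ?thesis .
qed

lemma pos_continuous: "continuous_on A pos"
proof -
  have "v-lipschitz_on A pos"
    using pos_dist v by (intro lipschitz_onI) (auto simp: dist_real_def)
  then show ?thesis by (rule lipschitz_on_continuous_on)
qed

lemma pos_initial: "0 \<le> t \<Longrightarrow> v * t \<le> L \<Longrightarrow> pos t = g (v * t)"
  using tent_initial[of "v * t" L] v by (simp add: pos_def)

text \<open>The path is compact and meets finitely many irregular points, each at a single arc
  length because a shortest path is injective. If L > 0, the device is at these arc lengths only at
  isolated times; if L = 0, it never leaves the regular point x.\<close>

lemma eventually_regular:
  assumes "x \<in> regular \<phi>"
  shows "\<forall>\<^sub>F t in at_right s. pos t \<in> regular \<phi>"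
proof (cases "L = 0")
  case True
  then have "pos t = x" for t using sp'(4) unfolding pos_def by simp
  then show ?thesis using assms by simp
next
  case False
  then have L: "0 < L" using sp'(1) by simp
  define C where "C = {s\<in>{0..L}. g s \<in> irregular (\<Union>\<phi>)}"
  have "compact (g ` {0..L})"
    by (intro compact_continuous_image lipschitz_on_continuous_on[OF sp'(2)]) auto
  then have "finite (irregular (\<Union>\<phi>) \<inter> g ` {0..L})"
    by (intro finite_irregular config compact_imp_bounded)
  moreover have "g ` C \<subseteq> irregular (\<Union>\<phi>) \<inter> g ` {0..L}" by (auto simp: C_def)
  ultimately have "finite (g ` C)" by (rule rev_finite_subset)
  moreover have "inj_on g C"
    using shortest_path_inj[OF sp] by (rule inj_on_subset) (auto simp: C_def)
  ultimately have "finite C" by (rule finite_imageD)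
  then have "\<forall>\<^sub>F u in at_right (v * s). tent L u \<notin> C" by (rule tent_avoids[OF L])
  then have "\<forall>\<^sub>F t in at_right s. tent L (v * t) \<notin> C"
  proof -
    obtain b where b: "b > v * s" "\<And>u. v * s < u \<Longrightarrow> u < b \<Longrightarrow> tent L u \<notin> C"
      using \<open>\<forall>\<^sub>F u in at_right (v * s). tent L u \<notin> C\<close> unfolding eventually_at_right_field by blast
    show ?thesis unfolding eventually_at_right_field
      using b v by (intro exI[of _ "b / v"]) (auto simp: field_simps)
  qed
  then show ?thesis
  proof eventually_elim
    case (elim t)
    then have "pos t \<notin> irregular (\<Union>\<phi>)"
      using tent_bounds[OF sp'(1)] by (simp add: C_def pos_def)
    then show ?case using pos_in by (simp add: regular_def)
  qed
qed

text \<open>Either the straight view from the device back to its starting point is never obstructed (\<open>stays\<close>), or it is lost for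
  the first time at a moment \<open>s\<close> when the device passes an irregular point (\<open>leaves\<close>). Two devices in early contact
  would have to leave simultaneously, which genericity forbids.\<close>

definition leaves :: "real \<Rightarrow> bool" where
  "leaves s \<longleftrightarrow> 0 < s \<and> (\<exists>p\<in>irregular (\<Union>\<phi>). dist x p = v * s) \<and>
     (\<forall>t\<in>{0..<s}. closed_segment x (pos t) \<subseteq> regular \<phi>) \<and>
     (\<forall>\<^sub>F t in at_right s. \<not> closed_segment x (pos t) \<subseteq> regular \<phi>)"

definition stays :: "real \<Rightarrow> bool" where
  "stays s \<longleftrightarrow> (\<forall>t\<in>{0..s}. pos t \<in> regular \<phi> \<longrightarrow> closed_segment x (pos t) \<subseteq> regular \<phi>) \<and>
     (\<forall>\<^sub>F t in at_right s. closed_segment x (pos t) \<subseteq> regular \<phi>)"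

lemma segment_until:
  assumes "0 \<le> t" "\<And>s. 0 \<le> s \<Longrightarrow> s \<le> t \<Longrightarrow> pos s \<in> regular \<phi>"
  shows "closed_segment x (pos t) \<subseteq> regular \<phi>"
  using path_regular_segment[OF config pos_continuous, of 0 t] assms pos_0 by force

text \<open>Only finitely many irregular points are visited, so the times of such visits form a
  compact set and there is a first one. Before it the device runs straight, and its distance from
  the start is speed times time.\<close>

lemma first_hit:
  assumes "s \<in> {0..T}" "pos s \<notin> regular \<phi>" and x: "x \<in> regular \<phi>"
  obtains s0 where "s0 \<in> {0<..T}" "pos s0 \<in> irregular (\<Union>\<phi>)" "v * s0 \<le> L" "dist x (pos s0) = v * s0"
    "\<And>t. t \<in> {0..<s0} \<Longrightarrow> closed_segment x (pos t) \<subseteq> regular \<phi>"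
proof -
  define H where "H = {t\<in>{0..T}. pos t \<in> irregular (\<Union>\<phi>)}"
  note irr = not_regular_iff
  have "finite (irregular (\<Union>\<phi>) \<inter> pos ` {0..T})"
    by (intro finite_irregular config compact_imp_bounded compact_continuous_image pos_continuous) auto
  then have "closed (irregular (\<Union>\<phi>) \<inter> pos ` {0..T})" by (rule finite_imp_closed)
  then have "closed ({0..T} \<inter> pos -` (irregular (\<Union>\<phi>) \<inter> pos ` {0..T}))"
    by (intro continuous_closed_preimage pos_continuous) auto
  moreover have "{0..T} \<inter> pos -` (irregular (\<Union>\<phi>) \<inter> pos ` {0..T}) = H" by (auto simp: H_def)
  ultimately have "closed H" by simp
  moreover have "bounded H" by (rule bounded_subset[of "{0..T}"]) (auto simp: H_def)
  ultimately have "compact H" by (simp add: compact_eq_bounded_closed)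
  moreover have "H \<noteq> {}" using assms irr by (auto simp: H_def)
  ultimately obtain s0 where s0: "s0 \<in> H" "\<And>t. t \<in> H \<Longrightarrow> s0 \<le> t" using compact_attains_inf by metis
  have reg: "pos t \<in> regular \<phi>" if "0 \<le> t" "t < s0" for t
    using s0(1) s0(2)[of t] that irr[of t] by (auto simp: H_def)
  have seg: "closed_segment x (pos t) \<subseteq> regular \<phi>" if "t \<in> {0..<s0}" for t
    using that by (intro segment_until reg) auto
  have s0': "0 \<le> s0" "s0 \<le> T" "pos s0 \<in> irregular (\<Union>\<phi>)" using s0(1) by (auto simp: H_def)
  have "s0 \<noteq> 0" using s0' x pos_0 by (auto simp: regular_def)
  then have pos0: "0 < s0" using s0' by simp
  \<comment> \<open>After the first turn the device revisits points of its outward trip, so a first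
    visit cannot happen then.\<close>
  have leL: "v * s0 \<le> L"
  proof (rule ccontr)
    assume "\<not> v * s0 \<le> L"
    define c where "c = tent L (v * s0)"
    have c: "0 \<le> c" "c \<le> L" using tent_bounds[OF sp'(1)] by (auto simp: c_def)
    then have "pos (c / v) = pos s0" using pos_initial[of "c / v"] v by (simp add: pos_def c_def)
    moreover have "c / v < s0" using c \<open>\<not> v * s0 \<le> L\<close> v by (simp add: field_simps)
    ultimately show False using reg[of "c / v"] irr[of s0] s0' c v by auto
  qed
  have d: "dist x (pos t) = v * t" if t: "t \<in> {0..<s0}" for t
  proof -
    have vt: "v * t \<le> v * s0" using t v by (intro mult_left_mono) auto
    then have "pos t = g (v * t)" using t leL by (intro pos_initial) auto
    moreover have "dist (g 0) (g (v * t)) = v * t - 0"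
    proof (rule shortest_path_straight[OF sp])
      show "closed_segment (g 0) (g (v * t)) \<subseteq> \<Union>\<phi>"
        using seg[OF t] \<open>pos t = g (v * t)\<close> sp'(4) by (auto simp: regular_def)
      show "0 \<le> v * t" using t v by simp
      show "v * t \<le> L" by (rule order_trans[OF vt leL])
    qed simp
    ultimately show ?thesis using sp'(4) by simp
  qed
  \<comment> \<open>Straightness is known only before \<open>s0\<close>; the Lipschitz bound carries
    the distance over to \<open>s0\<close>.\<close>
  have "dist x (pos s0) = v * s0"
  proof (rule antisym)
    show "dist x (pos s0) \<le> v * s0" using pos_dist[of 0 s0] pos_0 pos0 by simp
    show "v * s0 \<le> dist x (pos s0)"
    proof (rule field_le_epsilon)
      fix e :: real assume e: "0 < e"
      define t where "t = max 0 (s0 - e / (2 * v))"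
      have t: "t \<in> {0..<s0}" using e v pos0 by (auto simp: t_def)
      have "s0 - t \<le> e / (2 * v)" using e v by (auto simp: t_def)
      then have "v * (s0 - t) \<le> e / 2" using v by (simp add: field_simps)
      moreover have "dist (pos t) (pos s0) \<le> v * (s0 - t)" using pos_dist[of t s0] t by simp
      moreover have "dist x (pos t) \<le> dist x (pos s0) + dist (pos t) (pos s0)"
        by (metis dist_commute dist_triangle)
      ultimately show "v * s0 \<le> dist x (pos s0) + e" using d[OF t] by (simp add: algebra_simps)
    qed
  qed
  then show ?thesis using that[of s0] pos0 s0' leL seg by auto
qed

text \<open>Three cases: no irregular point is met; the first one met is the target, where the
  device turns back onto the straight piece; or the device continues beyond it and the view back is
  blocked.\<close>

lemma stays_or_leaves:
  assumes x: "x \<in> regular \<phi>" and T: "0 \<le> T"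
  shows "stays T \<or> (\<exists>s\<in>{0<..T}. leaves s)"
proof (cases "\<forall>s\<in>{0..T}. pos s \<in> regular \<phi>")
  case True
  then have seg: "closed_segment x (pos t) \<subseteq> regular \<phi>" if "t \<in> {0..T}" for t
    using that by (intro segment_until) auto
  have "pos T \<in> regular \<phi>" using True T by simp
  then obtain e where e: "e > 0" "convex (\<Union>\<phi> \<inter> ball (pos T) e)" and "collinear (\<Union>\<phi> \<inter> ball (pos T) e)"
    and sub: "\<Union>\<phi> \<inter> ball (pos T) e \<subseteq> regular \<phi>"
    by (rule regular_ball[OF config])
  have "\<forall>\<^sub>F t in at_right T. closed_segment x (pos t) \<subseteq> regular \<phi>"
    unfolding eventually_at_right_field
  proof (intro exI[of _ "T + e / v"] conjI allI impI)
    show "T + e / v > T" using e v by simp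
    fix t assume t: "T < t" "t < T + e / v"
    have "dist (pos T) (pos t) \<le> v * (t - T)" using pos_dist[of T t] t by simp
    also have "\<dots> < e" using t v by (simp add: field_simps)
    finally have "closed_segment (pos T) (pos t) \<subseteq> \<Union>\<phi> \<inter> ball (pos T) e"
      using pos_in e(1) by (intro closed_segment_subset e) auto
    then have "closed_segment (pos T) (pos t) \<subseteq> regular \<phi>" using sub by (rule order_trans)
    moreover have "closed_segment x (pos T) \<subseteq> regular \<phi>" using seg T by simp
    ultimately show "closed_segment x (pos t) \<subseteq> regular \<phi>"
      using regular_segment_trans[OF config] by blast
  qed
  then show ?thesis using seg by (auto simp: stays_def)
next
  case False
  then obtain s where s: "s \<in> {0..T}" "pos s \<notin> regular \<phi>" by blast
  obtain s0 where s0: "s0 \<in> {0<..T}" "pos s0 \<in> irregular (\<Union>\<phi>)" "v * s0 \<le> L" "dist x (pos s0) = v * s0"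
    "\<And>t. t \<in> {0..<s0} \<Longrightarrow> closed_segment x (pos t) \<subseteq> regular \<phi>"
    using first_hit[OF s x] by blast
  have p: "pos s0 = g (v * s0)" using s0 by (intro pos_initial) auto
  show ?thesis
  proof (cases "v * s0 = L")
    case True
    \<comment> \<open>Every regular position has an arc length less than L and was already passed on
      the outward trip before \<open>s0\<close>.\<close>
    have bounce: "closed_segment x (pos t) \<subseteq> regular \<phi>" if "pos t \<in> regular \<phi>" for t
    proof -
      define c where "c = tent L (v * t)"
      have c: "0 \<le> c" "c \<le> L" using tent_bounds[OF sp'(1)] by (auto simp: c_def)
      have "c \<noteq> L" using that s0(2) p True by (auto simp: pos_def c_def regular_def)
      then have "c / v \<in> {0..<s0}" using c True v by (auto simp: field_simps)
      moreover have "pos (c / v) = pos t" using pos_initial[of "c / v"] v c by (simp add: pos_def c_def)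
      ultimately show ?thesis using s0(5) by metis
    qed
    have "\<forall>\<^sub>F t in at_right T. closed_segment x (pos t) \<subseteq> regular \<phi>"
      using eventually_regular[OF x] by eventually_elim (rule bounce)
    then show ?thesis using bounce by (auto simp: stays_def)
  next
    case False
    \<comment> \<open>If a position after \<open>s0\<close> were visible before the turn, the path
      up to it would be straight, and equality in the triangle inequality would put the irregular
      point \<open>pos s0\<close> on the line of sight.\<close>
    then have lt: "v * s0 < L" using s0 by simp
    have "\<forall>\<^sub>F t in at_right s0. \<not> closed_segment x (pos t) \<subseteq> regular \<phi>"
      unfolding eventually_at_right_field
    proof (intro exI[of _ "L / v"] conjI allI impI notI)
      show "L / v > s0" using lt v by (simp add: field_simps)
      fix t assume t: "s0 < t" "t < L / v" and seg: "closed_segment x (pos t) \<subseteq> regular \<phi>"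
      have vt: "v * t \<le> L" using t v by (simp add: field_simps)
      have gt: "pos t = g (v * t)" using t s0 vt by (intro pos_initial) auto
      have "dist (g 0) (g (v * t)) = v * t - 0"
        using seg gt t s0 vt v sp'(4) by (intro shortest_path_straight[OF sp]) (auto simp: regular_def)
      then have "dist x (pos t) = v * t" using gt sp'(4) by simp
      moreover have "dist (pos s0) (pos t) \<le> v * t - v * s0"
        using pos_dist[of s0 t] t by (simp add: algebra_simps)
      moreover have "dist x (pos t) \<le> dist x (pos s0) + dist (pos s0) (pos t)" by (rule dist_triangle)
      ultimately have "dist x (pos t) = dist x (pos s0) + dist (pos s0) (pos t)" using s0(4) by simp
      then have "pos s0 \<in> closed_segment x (pos t)" by (simp add: between flip: between_mem_segment)
      then show False using seg s0(2) by (auto simp: regular_def)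
    qed
    then have "leaves s0" using s0 by (auto simp: leaves_def)
    then show ?thesis using s0(1) by blast
  qed
qed

end

text \<open>A contact of duration \<rho> begins at \<open>t0\<close>. The condition
  \<open>generic\<close> is dist x1 p / v1 \<noteq> dist x2 q / v2 with the denominators cleared: on
  their first straight runs the devices are never at irregular points at the same moment.\<close>

locale device_pair =
  a: device \<phi> x1 y1 g1 L1 v1 + b: device \<phi> x2 y2 g2 L2 v2
  for \<phi> x1 y1 g1 L1 v1 x2 y2 g2 L2 v2 +
  fixes \<rho> \<epsilon> t0 :: real
  assumes \<rho>: "0 \<le> \<rho>" and \<epsilon>: "0 < \<epsilon>" and t0: "0 \<le> t0" "t0 \<le> \<rho> + \<epsilon>"
    and reg: "x1 \<in> regular \<phi>" "x2 \<in> regular \<phi>"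
    and street: "\<And>t. t0 \<le> t \<Longrightarrow> t \<le> t0 + \<rho> \<Longrightarrow> \<exists>e. is_street \<phi> e \<and> a.pos t \<in> e \<and> b.pos t \<in> e"
    and free1: "\<And>p. p \<in> irregular (\<Union>\<phi>) \<Longrightarrow> dist x1 p \<le> v1 * (\<rho> + \<epsilon>) \<Longrightarrow> v1 * \<epsilon> < dist x1 p \<and> dist x1 p < v1 * \<rho>"
    and free2: "\<And>p. p \<in> irregular (\<Union>\<phi>) \<Longrightarrow> dist x2 p \<le> v2 * (\<rho> + \<epsilon>) \<Longrightarrow> v2 * \<epsilon> < dist x2 p \<and> dist x2 p < v2 * \<rho>"
    and generic: "\<And>p q. p \<in> irregular (\<Union>\<phi>) \<Longrightarrow> q \<in> irregular (\<Union>\<phi>) \<Longrightarrow> dist x1 p * v2 \<noteq> dist x2 q * v1"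
begin

lemma street_segment:
  assumes "t0 \<le> t" "t \<le> t0 + \<rho>" "a.pos t \<in> regular \<phi>" "b.pos t \<in> regular \<phi>"
  shows "closed_segment (a.pos t) (b.pos t) \<subseteq> regular \<phi>"
  using street[OF assms(1,2)] is_street_regular_segment[OF a.config] assms(3,4) by blast

text \<open>No irregular point is within speed times \<epsilon> of either start, so both devices run
  straight until the contact begins. The segments from start to device, across the contact and back
  to the other start compose.\<close>

lemma initial_segments:
  assumes "t0 \<le> \<epsilon>"
  shows "closed_segment x1 x2 \<subseteq> regular \<phi>"
proof -
  have A: "a.pos t \<in> regular \<phi>" if t: "0 \<le> t" "t \<le> \<epsilon>" for t
  proof (rule ccontr)
    assume "a.pos t \<notin> regular \<phi>"
    then have irr: "a.pos t \<in> irregular (\<Union>\<phi>)" by (simp add: a.not_regular_iff)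
    have d: "dist x1 (a.pos t) \<le> v1 * t" using a.pos_dist[of 0 t] t a.pos_0 by simp
    have "v1 * t \<le> v1 * \<epsilon>" "v1 * t \<le> v1 * (\<rho> + \<epsilon>)" using t a.v \<rho> by (auto intro!: mult_left_mono)
    then show False using free1[OF irr] d by linarith
  qed
  have B: "b.pos t \<in> regular \<phi>" if t: "0 \<le> t" "t \<le> \<epsilon>" for t
  proof (rule ccontr)
    assume "b.pos t \<notin> regular \<phi>"
    then have irr: "b.pos t \<in> irregular (\<Union>\<phi>)" by (simp add: b.not_regular_iff)
    have d: "dist x2 (b.pos t) \<le> v2 * t" using b.pos_dist[of 0 t] t b.pos_0 by simp
    have "v2 * t \<le> v2 * \<epsilon>" "v2 * t \<le> v2 * (\<rho> + \<epsilon>)" using t b.v \<rho> by (auto intro!: mult_left_mono)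
    then show False using free2[OF irr] d by linarith
  qed
  have "closed_segment x1 (a.pos t0) \<subseteq> regular \<phi>"
    using t0 assms by (intro a.segment_until A) auto
  moreover have "closed_segment x2 (b.pos t0) \<subseteq> regular \<phi>"
    using t0 assms by (intro b.segment_until B) auto
  moreover have "closed_segment (a.pos t0) (b.pos t0) \<subseteq> regular \<phi>"
    using t0 \<rho> assms A B by (intro street_segment) auto
  ultimately show ?thesis
    by (metis closed_segment_commute regular_segment_trans[OF a.config])
qed

text \<open>The exit point is at distance v1 s, so \<open>free1\<close> forces \<epsilon> < s <
  \<rho>: the device leaves during the contact. Right after s the other device is still in view of
  its start, the contact joins the two positions, and the starts are joined. Composing these
  segments brings the leaving device back into view.\<close>

lemma not_leaves_first:
  assumes t: "t0 \<le> \<epsilon>" and s: "s \<in> {0<..\<rho> + \<epsilon>}" "a.leaves s"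
    and other: "b.stays (\<rho> + \<epsilon>) \<or> (\<exists>s'\<ge>s. b.leaves s')"
  shows False
proof -
  obtain p where p: "p \<in> irregular (\<Union>\<phi>)" "dist x1 p = v1 * s" using s(2) by (auto simp: a.leaves_def)
  have "v1 * s \<le> v1 * (\<rho> + \<epsilon>)" using s a.v by (intro mult_left_mono) auto
  then have "v1 * \<epsilon> < v1 * s" "v1 * s < v1 * \<rho>" using free1[OF p(1)] p(2) by auto
  then have s': "\<epsilon> < s" "s < \<rho>" using a.v by auto
  obtain u where u: "s < u" "\<And>t. s < t \<Longrightarrow> t < u \<Longrightarrow> b.pos t \<in> regular \<phi> \<Longrightarrow> closed_segment x2 (b.pos t) \<subseteq> regular \<phi>"
    using other
  proof (elim disjE exE conjE)
    assume "b.stays (\<rho> + \<epsilon>)"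
    then show ?thesis using s' \<epsilon> by (intro that[of \<rho>]) (auto simp: b.stays_def)
  next
    fix s2 assume s2: "s \<le> s2" "b.leaves s2"
    obtain q where q: "q \<in> irregular (\<Union>\<phi>)" "dist x2 q = v2 * s2" using s2(2) by (auto simp: b.leaves_def)
    \<comment> \<open>Simultaneous leaving is excluded here, so the other device remains in view a
      little longer.\<close>
    have "s \<noteq> s2" using generic[OF p(1) q(1)] p(2) q(2) by auto
    then show ?thesis using s2 s by (intro that[of s2]) (auto simp: b.leaves_def)
  qed
  have "\<forall>\<^sub>F t in at_right s. t \<in> {s<..<min u \<rho>}"
    using u(1) s' by (intro eventually_at_right_real) auto
  moreover have "\<forall>\<^sub>F t in at_right s. \<not> closed_segment x1 (a.pos t) \<subseteq> regular \<phi>"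
    using s(2) by (simp add: a.leaves_def)
  moreover note a.eventually_regular[OF reg(1), of s] b.eventually_regular[OF reg(2), of s]
  ultimately have "\<forall>\<^sub>F t in at_right s. False"
  proof eventually_elim
    case (elim t)
    have "closed_segment x2 (b.pos t) \<subseteq> regular \<phi>" using elim by (intro u) auto
    moreover have "closed_segment (a.pos t) (b.pos t) \<subseteq> regular \<phi>"
      using elim s' t t0 by (intro street_segment) auto
    ultimately have "closed_segment x1 (a.pos t) \<subseteq> regular \<phi>"
      using initial_segments[OF t] by (metis closed_segment_commute regular_segment_trans[OF a.config])
    then show False using elim by simp
  qed
  then show False by (simp add: trivial_limit_at_right_real)
qed

lemma late_contact:
  assumes "\<epsilon> < t0"
  shows "\<forall>\<^sub>F t in at_right (\<rho> + \<epsilon>). closed_segment (a.pos t) (b.pos t) \<subseteq> regular \<phi>"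
proof -
  have "\<forall>\<^sub>F t in at_right (\<rho> + \<epsilon>). t \<in> {\<rho> + \<epsilon><..<t0 + \<rho>}"
    using assms by (intro eventually_at_right_real) auto
  with a.eventually_regular[OF reg(1)] b.eventually_regular[OF reg(2)] show ?thesis
  proof eventually_elim
    case (elim t)
    then show ?case using t0 by (intro street_segment) auto
  qed
qed

end

lemma (in device_pair) swap: "device_pair \<phi> x2 y2 g2 L2 v2 x1 y1 g1 L1 v1 \<rho> \<epsilon> t0"
proof unfold_locales
  show "\<exists>e. is_street \<phi> e \<and> b.pos t \<in> e \<and> a.pos t \<in> e" if "t0 \<le> t" "t \<le> t0 + \<rho>" for t
    using street[OF that] by blast
  show "dist x2 p * v1 \<noteq> dist x1 q * v2" if "p \<in> irregular (\<Union>\<phi>)" "q \<in> irregular (\<Union>\<phi>)" for p q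
    using generic[OF that(2,1)] by simp
qed (use \<rho> \<epsilon> t0 reg free1 free2 in auto)

lemma (in device_pair) contact_segment:
  "\<forall>\<^sub>F t in at_right (\<rho> + \<epsilon>). closed_segment (a.pos t) (b.pos t) \<subseteq> regular \<phi>"
proof (cases "t0 \<le> \<epsilon>")
  case False
  then show ?thesis by (intro late_contact) simp
next
  case True
  interpret s: device_pair \<phi> x2 y2 g2 L2 v2 x1 y1 g1 L1 v1 \<rho> \<epsilon> t0 by (rule swap)
  have "0 \<le> \<rho> + \<epsilon>" using \<rho> \<epsilon> by simp
  then have cases: "a.stays (\<rho> + \<epsilon>) \<or> (\<exists>s\<in>{0<..\<rho> + \<epsilon>}. a.leaves s)"
      "b.stays (\<rho> + \<epsilon>) \<or> (\<exists>s\<in>{0<..\<rho> + \<epsilon>}. b.leaves s)"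
    using a.stays_or_leaves[OF reg(1)] b.stays_or_leaves[OF reg(2)] by blast+
  \<comment> \<open>If some device leaves, the one that leaves first contradicts
    \<open>not_leaves_first\<close>, in one order of the pair or the other.\<close>
  have "a.stays (\<rho> + \<epsilon>) \<and> b.stays (\<rho> + \<epsilon>)"
    using cases not_leaves_first[OF True] s.not_leaves_first[OF True] by (metis linear)
  then have "\<forall>\<^sub>F t in at_right (\<rho> + \<epsilon>). closed_segment x1 (a.pos t) \<subseteq> regular \<phi>"
      "\<forall>\<^sub>F t in at_right (\<rho> + \<epsilon>). closed_segment x2 (b.pos t) \<subseteq> regular \<phi>"
    by (auto simp: a.stays_def b.stays_def)
  then show ?thesis
  proof eventually_elim
    case (elim t)
    then show ?case using initial_segments[OF True]
      by (metis closed_segment_commute regular_segment_trans[OF a.config])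
  qed
qed

section \<open>Clusters of devices and long streets\<close>

lemma mem_Q: "z \<in> Q n x \<longleftrightarrow> \<bar>fst z - fst x\<bar> \<le> n / 2 \<and> \<bar>snd z - snd x\<bar> \<le> n / 2"
proof -
  have "z \<in> Q n x \<longleftrightarrow> fst x - n / 2 \<le> fst z \<and> fst z \<le> fst x + n / 2 \<and>
      snd x - n / 2 \<le> snd z \<and> snd z \<le> snd x + n / 2"
    unfolding Q_def by (cases z; cases x) (auto simp: cbox_Pair_eq)
  then show ?thesis by (simp only:) (safe; linarith)
qed

lemma compact_Q [simp]: "compact (Q n x)" and closed_Q [simp]: "closed (Q n x)"
  and bounded_Q [simp]: "bounded (Q n x)" and borel_Q [measurable, simp]: "Q n x \<in> sets borel"
  by (auto simp: Q_def)

text \<open>One step from W' does not get beyond W. A cluster that never stops in W outside W' is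
  therefore confined to W', which is bounded.\<close>

lemma exit_cluster:
  fixes x0 :: "'a::metric_space"
  assumes K: "\<And>x y. (x, y) \<in> E \<Longrightarrow> dist x y \<le> K"
    and W: "bounded W'" "x0 \<in> W'" "\<And>w z. w \<in> W' \<Longrightarrow> dist w z \<le> K \<Longrightarrow> z \<in> W" "W' \<subseteq> W"
    and unb: "\<not> bounded {y. (x0, y) \<in> E\<^sup>*}"
  obtains y where "(x0, y) \<in> (E \<inter> W \<times> W)\<^sup>*" "y \<in> W" "y \<notin> W'"
proof -
  have "\<exists>y. (x0, y) \<in> (E \<inter> W \<times> W)\<^sup>* \<and> y \<in> W \<and> y \<notin> W'"
  proof (rule ccontr)
    assume neg: "\<not> ?thesis"
    have "y \<in> W' \<and> (x0, y) \<in> (E \<inter> W \<times> W)\<^sup>*" if "(x0, y) \<in> E\<^sup>*" for y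
      using that
    proof (induction rule: rtrancl_induct)
      case (step y z)
      have "z \<in> W" using W(3)[of y z] K step by blast
      then have "(y, z) \<in> E \<inter> W \<times> W" using step W(4) by blast
      then have "(x0, z) \<in> (E \<inter> W \<times> W)\<^sup>*" using step by (meson rtrancl.rtrancl_into_rtrancl)
      then show ?case using neg \<open>z \<in> W\<close> by blast
    qed (use W in auto)
    then have "{y. (x0, y) \<in> E\<^sup>*} \<subseteq> W'" by blast
    then show False using unb W(1) bounded_subset by blast
  qed
  then show ?thesis using that by blast
qed

locale devices =
  fixes \<phi> :: streets and \<gamma> :: "streets \<Rightarrow> point \<Rightarrow> point \<Rightarrow> (real \<Rightarrow> point) \<times> real"
    and \<xi> :: "point set" and w :: "point \<Rightarrow> point \<times> real" and V :: real
  assumes config: "\<phi> \<in> street_configs" and pts: "\<xi> \<subseteq> \<Union>\<phi>"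
    and shortest: "\<And>x. x \<in> \<xi> \<Longrightarrow> shortest_path \<phi> x (fst (w x)) (\<gamma> \<phi> x (fst (w x)))"
    and speed: "\<And>x. x \<in> \<xi> \<Longrightarrow> 0 < snd (w x) \<and> snd (w x) \<le> V"
begin

lemma device:
  assumes "x \<in> \<xi>"
  obtains g L where "device \<phi> x (fst (w x)) g L (snd (w x))"
    "\<And>t. device_pos \<gamma> \<phi> w x t = device.pos g L (snd (w x)) t"
proof -
  obtain g L where gL: "\<gamma> \<phi> x (fst (w x)) = (g, L)" by fastforce
  have "device \<phi> x (fst (w x)) g L (snd (w x))"
    using config shortest[OF assms] speed[OF assms] gL by unfold_locales auto
  moreover have "device_pos \<gamma> \<phi> w x t = device.pos g L (snd (w x)) t" for t
    using device.pos_def[OF calculation] by (simp add: device_pos_def gL commute_tent)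
  ultimately show ?thesis by (rule that)
qed

lemma device_pos_dist:
  assumes "x \<in> \<xi>" "0 \<le> t"
  shows "dist x (device_pos \<gamma> \<phi> w x t) \<le> V * t"
proof -
  obtain g L where d: "device \<phi> x (fst (w x)) g L (snd (w x))"
    "\<And>t. device_pos \<gamma> \<phi> w x t = device.pos g L (snd (w x)) t" using device[OF assms(1)] by blast
  have "dist x (device_pos \<gamma> \<phi> w x t) \<le> snd (w x) * t"
    using device.pos_dist[OF d(1), of 0 t] device.pos_0[OF d(1)] d(2) assms(2) by simp
  also have "\<dots> \<le> V * t" using speed[OF assms(1)] assms(2) by (intro mult_right_mono) auto
  finally show ?thesis .
qed

lemma edge_dist:
  assumes e: "(x, y) \<in> edges \<gamma> \<phi> \<xi> w T \<rho> r" and \<rho>: "0 \<le> \<rho>" "0 \<le> r"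
  shows "dist x y \<le> 2 * V * T + r"
proof -
  obtain t where t: "t \<in> {0..T - \<rho>}" "{t..t + \<rho>} \<subseteq> contact_times \<gamma> \<phi> w r x y" and xy: "x \<in> \<xi>" "y \<in> \<xi>"
    using e by (auto simp: edges_def)
  then have "t \<in> contact_times \<gamma> \<phi> w r x y" using \<rho> by auto
  then have "dist (device_pos \<gamma> \<phi> w x t) (device_pos \<gamma> \<phi> w y t) \<le> r"
    using \<rho> by (auto simp: contact_times_def split: if_splits)
  moreover have "V * t \<le> V * T" using t \<rho> speed[OF xy(1)] by (intro mult_left_mono) auto
  moreover have "dist x (device_pos \<gamma> \<phi> w x t) \<le> V * t" "dist y (device_pos \<gamma> \<phi> w y t) \<le> V * t"
    using device_pos_dist xy t by auto
  moreover have "dist x y \<le> dist x (device_pos \<gamma> \<phi> w x t) +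
      dist (device_pos \<gamma> \<phi> w x t) (device_pos \<gamma> \<phi> w y t) + dist y (device_pos \<gamma> \<phi> w y t)"
    by (metis dist_commute dist_triangle dist_triangle_le add_mono order_refl add.assoc)
  ultimately show ?thesis by linarith
qed

end

text \<open>Exceptional devices are excluded only in the window W, since they are merely rare;
  genericity is an almost sure property and is assumed for all pairs.\<close>

locale slow_devices = devices +
  fixes \<rho> \<epsilon> r :: real and W :: "point set"
  assumes \<rho>: "0 \<le> \<rho>" and \<epsilon>: "0 < \<epsilon>"
    and generic: "\<And>x y p q. x \<in> \<xi> \<Longrightarrow> y \<in> \<xi> \<Longrightarrow> x \<noteq> y \<Longrightarrow> p \<in> irregular (\<Union>\<phi>) \<Longrightarrow> q \<in> irregular (\<Union>\<phi>) \<Longrightarrow>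
        dist x p * snd (w y) \<noteq> dist y q * snd (w x)"
    and free: "\<And>x p. x \<in> \<xi> \<inter> W \<Longrightarrow> p \<in> irregular (\<Union>\<phi>) \<Longrightarrow> dist x p \<le> snd (w x) * (\<rho> + \<epsilon>) \<Longrightarrow>
        snd (w x) * \<epsilon> < dist x p \<and> dist x p < snd (w x) * \<rho>"
begin

lemma in_regular:
  assumes "x \<in> \<xi> \<inter> W"
  shows "x \<in> regular \<phi>"
proof (rule ccontr)
  assume "x \<notin> regular \<phi>"
  then have "x \<in> irregular (\<Union>\<phi>)" using assms pts unfolding regular_def by blast
  \<comment> \<open>With p = x the distance is 0, and \<open>free\<close> would make speed times
    \<epsilon> negative.\<close>
  then show False using free[OF assms, of x] speed[of x] assms \<rho> \<epsilon>
    by (auto simp: mult_less_0_iff)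
qed

lemma edge_segment:
  assumes e: "(x, y) \<in> edges \<gamma> \<phi> \<xi> w (2 * \<rho> + \<epsilon>) \<rho> r \<inter> W \<times> W"
  shows "\<forall>\<^sub>F t in at_right (\<rho> + \<epsilon>).
    closed_segment (device_pos \<gamma> \<phi> w x t) (device_pos \<gamma> \<phi> w y t) \<subseteq> regular \<phi>"
proof -
  obtain t0 where t0: "0 \<le> t0" "t0 \<le> \<rho> + \<epsilon>" and ct: "{t0..t0 + \<rho>} \<subseteq> contact_times \<gamma> \<phi> w r x y"
    and xy: "x \<in> \<xi> \<inter> W" "y \<in> \<xi> \<inter> W" "x \<noteq> y"
    using e by (auto simp: edges_def)
  obtain g1 L1 where d1: "device \<phi> x (fst (w x)) g1 L1 (snd (w x))"
    "\<And>t. device_pos \<gamma> \<phi> w x t = device.pos g1 L1 (snd (w x)) t" using device[of x] xy by blast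
  obtain g2 L2 where d2: "device \<phi> y (fst (w y)) g2 L2 (snd (w y))"
    "\<And>t. device_pos \<gamma> \<phi> w y t = device.pos g2 L2 (snd (w y)) t" using device[of y] xy by blast
  interpret device_pair \<phi> x "fst (w x)" g1 L1 "snd (w x)" y "fst (w y)" g2 L2 "snd (w y)" \<rho> \<epsilon> t0
  proof (intro device_pair.intro d1(1) d2(1) device_pair_axioms.intro)
    fix t assume "t0 \<le> t" "t \<le> t0 + \<rho>"
    then have "t \<in> contact_times \<gamma> \<phi> w r x y" using ct by auto
    then show "\<exists>e. is_street \<phi> e \<and> device.pos g1 L1 (snd (w x)) t \<in> e \<and> device.pos g2 L2 (snd (w y)) t \<in> e"
      by (auto simp: contact_times_def d1(2) d2(2))
  qed (use \<rho> \<epsilon> t0 xy in_regular free generic in auto)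
  show ?thesis using contact_segment by (simp add: d1(2) d2(2))
qed

text \<open>All edges are evaluated right after the same time \<rho> + \<epsilon>, so their segments
  compose along the chain, and a finite chain needs only finitely many right neighbourhoods.\<close>

lemma cluster_segment:
  assumes "(x, y) \<in> (edges \<gamma> \<phi> \<xi> w (2 * \<rho> + \<epsilon>) \<rho> r \<inter> W \<times> W)\<^sup>*" "x \<in> \<xi> \<inter> W"
  shows "\<forall>\<^sub>F t in at_right (\<rho> + \<epsilon>).
    closed_segment (device_pos \<gamma> \<phi> w x t) (device_pos \<gamma> \<phi> w y t) \<subseteq> regular \<phi>"
  using assms(1)
proof (induction rule: rtrancl_induct)
  case base
  obtain g L where d: "device \<phi> x (fst (w x)) g L (snd (w x))"
    "\<And>t. device_pos \<gamma> \<phi> w x t = device.pos g L (snd (w x)) t" using device[of x] assms(2) by blast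
  show ?case using device.eventually_regular[OF d(1) in_regular[OF assms(2)]] by (simp add: d(2))
next
  case (step y z)
  from step.IH edge_segment[OF step.hyps(2)] show ?case
    by eventually_elim (rule regular_segment_trans[OF config])
qed

text \<open>Jumps of at most m / 4 let the cluster stop between Q (11 m) and Q (12 m), and each
  device is at most m / 4 away from its start when the segment is drawn. So the segment runs from Q
  (2 m) to a point outside Q (10 m).\<close>

lemma cluster_long_segment:
  assumes r: "0 \<le> r" and m: "2 * V * (2 * \<rho> + \<epsilon>) + r \<le> m / 4"
    and W: "W = Q (12 * m) c" and x0: "x0 \<in> \<xi> \<inter> Q m c"
    and unb: "\<not> bounded {y. (x0, y) \<in> (edges \<gamma> \<phi> \<xi> w (2 * \<rho> + \<epsilon>) \<rho> r)\<^sup>*}"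
  obtains a b where "closed_segment a b \<subseteq> regular \<phi>" "a \<in> Q (2 * m) c" "b \<notin> Q (10 * m) c"
proof -
  define E where "E = edges \<gamma> \<phi> \<xi> w (2 * \<rho> + \<epsilon>) \<rho> r"
  have V: "0 < V" using speed[of x0] x0 by auto
  then have "0 \<le> V * (2 * \<rho> + \<epsilon>)" using \<rho> \<epsilon> by simp
  then have m0: "0 \<le> m" using m r by linarith
  have comp: "\<bar>fst u - fst v\<bar> \<le> dist u v" "\<bar>snd u - snd v\<bar> \<le> dist u v" for u v :: point
    using dist_fst_le[of u v] dist_snd_le[of u v] by (auto simp: dist_real_def)
  obtain y where y: "(x0, y) \<in> (E \<inter> W \<times> W)\<^sup>*" "y \<in> W" "y \<notin> Q (11 * m) c"
  proof (rule exit_cluster[of E "m / 4" "Q (11 * m) c" x0 W])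
    show "dist x y \<le> m / 4" if "(x, y) \<in> E" for x y
      using edge_dist[of x y "2 * \<rho> + \<epsilon>" \<rho> r] that m r \<rho> by (simp add: E_def)
    show "x0 \<in> Q (11 * m) c" using x0 m0 by (auto simp: mem_Q)
    show "z \<in> W" if "w \<in> Q (11 * m) c" "dist w z \<le> m / 4" for w z
      using that comp[of w z] m0 unfolding W mem_Q by linarith
    show "Q (11 * m) c \<subseteq> W" using m0 by (auto simp: W mem_Q)
    show "\<not> bounded {y. (x0, y) \<in> E\<^sup>*}" using unb by (simp add: E_def)
  qed auto
  have x0W: "x0 \<in> \<xi> \<inter> W" using x0 m0 by (auto simp: W mem_Q)
  have y\<xi>: "y \<in> \<xi>"
    using y(1) x0 by (induction rule: rtrancl_induct) (auto simp: E_def edges_def)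
  have "\<forall>\<^sub>F t in at_right (\<rho> + \<epsilon>). t \<in> {\<rho> + \<epsilon><..<2 * \<rho> + \<epsilon> + (\<rho> + \<epsilon>)}"
    using \<rho> \<epsilon> by (intro eventually_at_right_real) auto
  moreover have "\<forall>\<^sub>F t in at_right (\<rho> + \<epsilon>).
      closed_segment (device_pos \<gamma> \<phi> w x0 t) (device_pos \<gamma> \<phi> w y t) \<subseteq> regular \<phi>"
    using cluster_segment[OF y(1)[unfolded E_def] x0W] .
  ultimately have "\<forall>\<^sub>F t in at_right (\<rho> + \<epsilon>). t \<in> {\<rho> + \<epsilon><..<2 * \<rho> + \<epsilon> + (\<rho> + \<epsilon>)} \<and>
      closed_segment (device_pos \<gamma> \<phi> w x0 t) (device_pos \<gamma> \<phi> w y t) \<subseteq> regular \<phi>"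
    by (rule eventually_conj)
  then obtain t where t: "\<rho> + \<epsilon> < t" "t < 2 * (2 * \<rho> + \<epsilon>)"
      "closed_segment (device_pos \<gamma> \<phi> w x0 t) (device_pos \<gamma> \<phi> w y t) \<subseteq> regular \<phi>"
    using eventually_happens'[OF trivial_limit_at_right_real] \<rho> \<epsilon> by fastforce
  have "V * t \<le> V * (2 * (2 * \<rho> + \<epsilon>))" using V t by (intro mult_left_mono) auto
  also have "\<dots> = 2 * V * (2 * \<rho> + \<epsilon>)" by simp
  finally have Vt: "V * t \<le> m / 4" using m r by linarith
  have a: "dist x0 (device_pos \<gamma> \<phi> w x0 t) \<le> m / 4"
    using device_pos_dist[of x0 t] x0 t \<rho> \<epsilon> Vt by auto
  have b: "dist y (device_pos \<gamma> \<phi> w y t) \<le> m / 4"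
    using device_pos_dist[of y t] y\<xi> t \<rho> \<epsilon> Vt by auto
  show ?thesis
  proof (rule that[OF t(3)])
    have "x0 \<in> Q m c" using x0 by simp
    then show "device_pos \<gamma> \<phi> w x0 t \<in> Q (2 * m) c"
      using comp[of x0 "device_pos \<gamma> \<phi> w x0 t"] a m0 unfolding mem_Q by linarith
    show "device_pos \<gamma> \<phi> w y t \<notin> Q (10 * m) c"
      using y(3) comp[of y "device_pos \<gamma> \<phi> w y t"] b m0 unfolding mem_Q by linarith
  qed
qed

end

section \<open>Rational boxes and separation\<close>

definition rat_boxes :: "(point \<times> point) set" where
  "rat_boxes = (\<rat> \<times> \<rat>) \<times> (\<rat> \<times> \<rat>)"

definition rat_opens :: "point set set" where
  "rat_opens = {\<Union>(a, b)\<in>F. box a b | F. finite F \<and> F \<subseteq> rat_boxes}"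

lemma countable_rat_boxes [simp]: "countable rat_boxes"
  by (auto simp: rat_boxes_def intro!: countable_SIGMA countable_rat)

lemma countable_rat_opens [simp]: "countable rat_opens"
proof -
  have "rat_opens = (\<lambda>F. \<Union>(a, b)\<in>F. box a b) ` {F. finite F \<and> F \<subseteq> rat_boxes}"
    by (auto simp: rat_opens_def)
  then show ?thesis
    by (rule ssubst) (rule countable_image[OF countable_Collect_finite_subset[OF countable_rat_boxes]])
qed

lemma open_rat_opens: "W \<in> rat_opens \<Longrightarrow> open W"
  by (auto simp: rat_opens_def)

lemma rat_box_near:
  fixes x :: point
  assumes "e > 0"
  obtains a b where "(a, b) \<in> rat_boxes" "x \<in> box a b" "cbox a b \<subseteq> ball x e"
proof -
  obtain a b where ab: "\<forall>i\<in>Basis. a \<bullet> i \<in> \<rat> \<and> b \<bullet> i \<in> \<rat>" "x \<in> box a b" "box a b \<subseteq> ball x (e / 2)"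
    using rational_boxes[of "e / 2" x] assms by auto
  have "closure (box a b) = cbox a b" using ab(2) by (intro closure_box) auto
  then have "cbox a b \<subseteq> closure (ball x (e / 2))" using closure_mono[OF ab(3)] by simp
  then have "cbox a b \<subseteq> ball x e" using assms by (auto simp: closure_ball)
  moreover have "(a, b) \<in> rat_boxes"
    using ab(1) by (auto simp: rat_boxes_def Basis_prod_def mem_Times_iff inner_prod_def)
  ultimately show ?thesis using that ab(2) by blast
qed

lemma compact_rat_boxes_cover:
  assumes "compact S" "\<And>x. x \<in> S \<Longrightarrow> \<exists>(a, b)\<in>R. x \<in> box a b"
  obtains F where "finite F" "F \<subseteq> R" "S \<subseteq> (\<Union>(a, b)\<in>F. box a b)"
  using compactE_image[OF assms(1), of R "\<lambda>(a, b). box a b"] assms(2) by (force simp: split_beta)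

text \<open>Countably many open sets suffice to separate compact sets, which turns topological
  separation into a countable condition.\<close>

lemma compact_rat_open_between:
  assumes "compact S" "open V" "S \<subseteq> V"
  obtains W where "W \<in> rat_opens" "S \<subseteq> W" "W \<subseteq> V"
proof -
  define R where "R = {(a, b)\<in>rat_boxes. box a b \<subseteq> V}"
  have "\<exists>(a, b)\<in>R. x \<in> box a b" if x: "x \<in> S" for x
  proof -
    obtain e where e: "e > 0" "ball x e \<subseteq> V" using assms x by (meson openE subsetD)
    obtain a b where ab: "(a, b) \<in> rat_boxes" "x \<in> box a b" "cbox a b \<subseteq> ball x e"
      using rat_box_near[OF e(1)] .
    have "box a b \<subseteq> V" using ab(3) e(2) box_subset_cbox[of a b] by blast
    then have "(a, b) \<in> R" using ab(1) by (simp add: R_def)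
    then show ?thesis using ab(2) by blast
  qed
  then obtain F where F: "finite F" "F \<subseteq> R" "S \<subseteq> (\<Union>(a, b)\<in>F. box a b)"
    using compact_rat_boxes_cover[OF assms(1)] by metis
  show ?thesis
    by (rule that[of "\<Union>(a, b)\<in>F. box a b"]) (use F in \<open>auto simp: rat_opens_def R_def\<close>)
qed

text \<open>A countable, hence measurable, way to say that \<open>A \<inter> K\<close> is not contained in one component of \<open>A \<inter> K'\<close>.\<close>

definition splits :: "point set \<Rightarrow> point set \<Rightarrow> point set \<Rightarrow> bool" where
  "splits A K K' \<longleftrightarrow> (\<exists>W1\<in>rat_opens. \<exists>W2\<in>rat_opens. W1 \<inter> W2 = {} \<and> A \<inter> K' \<subseteq> W1 \<union> W2 \<and>
     \<not> A \<inter> K \<subseteq> W1 \<and> \<not> A \<inter> K \<subseteq> W2)"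

text \<open>A component is connected and lies on one side of every splitting.\<close>

lemma not_splits_component:
  assumes "C \<in> components (A \<inter> K')" "A \<inter> K \<subseteq> C"
  shows "\<not> splits A K K'"
proof
  assume "splits A K K'"
  then obtain W1 W2 where W: "W1 \<in> rat_opens" "W2 \<in> rat_opens" "W1 \<inter> W2 = {}" "A \<inter> K' \<subseteq> W1 \<union> W2"
      "\<not> A \<inter> K \<subseteq> W1" "\<not> A \<inter> K \<subseteq> W2" by (auto simp: splits_def)
  have C: "connected C" "C \<subseteq> A \<inter> K'"
    using assms(1) by (auto intro: in_components_connected dest: in_components_subset)
  have "W1 \<inter> C = {} \<or> W2 \<inter> C = {}"
    using C W by (intro connectedD[OF C(1)]) (auto intro: open_rat_opens)
  then show False using W C assms(2) by blast
qed

text \<open>A segment from Q (2 m) to the outside of Q (10 m) crosses the square of sup norm 3 m.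
  The doubled box Q (2 m) around a centre of sup norm 3 m contains neither end of it.\<close>

definition grid :: "real \<Rightarrow> point set" where
  "grid m = (\<lambda>(i, j). (m * real_of_int i, m * real_of_int j)) ` ({-3..3} \<times> {-3..3})"

text \<open>The corner boxes of the grid squares keep a segment from covering the whole of \<open>A\<close> in a square.\<close>

definition well_connected :: "real \<Rightarrow> point set \<Rightarrow> bool" where
  "well_connected m A \<longleftrightarrow> (\<forall>y\<in>grid m. \<not> splits A (Q m y) (Q (2 * m) y) \<and>
     (\<forall>s\<in>{-1, 1}. \<forall>t\<in>{-1, 1}. A \<inter> Q (m / 4) (y + (s * (3 * m / 8), t * (3 * m / 8))) \<noteq> {}))"

text \<open>A segment through the corner boxes of one diagonal has a direction with coordinates of
  equal sign, and the other diagonal demands opposite signs. So no segment visits all four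
  corners.\<close>

lemma segment_misses_corner:
  assumes m: "0 < m" and sub: "A \<inter> Q m y \<subseteq> closed_segment a b"
    and ne: "\<forall>s\<in>{-1, 1}. \<forall>t\<in>{-1, 1}. A \<inter> Q (m / 4) (y + (s * (3 * m / 8), t * (3 * m / 8))) \<noteq> {}"
  shows False
proof -
  obtain dx dy where d: "b - a = (dx, dy)" by fastforce
  have corner: "\<exists>u\<in>closed_segment a b. u \<in> Q (m / 4) (y + (s * (3 * m / 8), t * (3 * m / 8)))"
    if st: "s \<in> {-1, 1}" "t \<in> {-1, 1}" for s t
  proof -
    obtain u where u: "u \<in> A" "u \<in> Q (m / 4) (y + (s * (3 * m / 8), t * (3 * m / 8)))"
      using ne st by blast
    moreover have "\<bar>s * (3 * m / 8)\<bar> \<le> 3 * m / 8" "\<bar>t * (3 * m / 8)\<bar> \<le> 3 * m / 8" using st m by auto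
    ultimately have "u \<in> Q m y" unfolding mem_Q fst_add snd_add fst_conv snd_conv by linarith
    then show ?thesis using u sub by blast
  qed
  obtain u1 where u1: "u1 \<in> closed_segment a b" "u1 \<in> Q (m / 4) (y + (3 * m / 8, 3 * m / 8))"
    using corner[of 1 1] by auto
  obtain u2 where u2: "u2 \<in> closed_segment a b" "u2 \<in> Q (m / 4) (y + (- (3 * m / 8), - (3 * m / 8)))"
    using corner[of "-1" "-1"] by auto
  obtain u3 where u3: "u3 \<in> closed_segment a b" "u3 \<in> Q (m / 4) (y + (3 * m / 8, - (3 * m / 8)))"
    using corner[of 1 "-1"] by auto
  obtain u4 where u4: "u4 \<in> closed_segment a b" "u4 \<in> Q (m / 4) (y + (- (3 * m / 8), 3 * m / 8))"
    using corner[of "-1" 1] by auto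
  obtain k where k: "u1 - u2 = k *\<^sub>R (b - a)" using segment_direction[OF u2(1) u1(1)] .
  obtain l where l: "u3 - u4 = l *\<^sub>R (b - a)" using segment_direction[OF u4(1) u3(1)] .
  have "fst u1 - fst u2 = k * dx" "snd u1 - snd u2 = k * dy" "fst u3 - fst u4 = l * dx" "snd u3 - snd u4 = l * dy"
    using arg_cong[OF k, of fst] arg_cong[OF k, of snd] arg_cong[OF l, of fst] arg_cong[OF l, of snd] by (simp_all add: d)
  moreover have "fst y + m / 4 \<le> fst u1" "snd y + m / 4 \<le> snd u1"
    using u1(2) unfolding mem_Q fst_add snd_add fst_conv snd_conv by linarith+
  moreover have "fst u2 \<le> fst y - m / 4" "snd u2 \<le> snd y - m / 4"
    using u2(2) unfolding mem_Q fst_add snd_add fst_conv snd_conv by linarith+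
  moreover have "fst y + m / 4 \<le> fst u3" "snd u3 \<le> snd y - m / 4"
    using u3(2) unfolding mem_Q fst_add snd_add fst_conv snd_conv by linarith+
  moreover have "fst u4 \<le> fst y - m / 4" "snd y + m / 4 \<le> snd u4"
    using u4(2) unfolding mem_Q fst_add snd_add fst_conv snd_conv by linarith+
  ultimately have "0 < k * dx" "0 < k * dy" "0 < l * dx" "l * dy < 0"
    using m by linarith+
  then have "0 < (k * dx) * (k * dy)" "(l * dx) * (l * dy) < 0"
    by (simp_all only: mult_pos_pos mult_pos_neg)
  then have "0 < (k * k) * (dx * dy)" "(l * l) * (dx * dy) < 0" by (simp_all add: ac_simps)
  then show False by (metis mult_less_0_iff not_square_less_zero zero_less_mult_iff less_asym)
qed

text \<open>The part S of the segment in a doubled box is compact, and relatively open in the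
  streets because the ends of the segment are outside. So S can be split from the remaining streets
  T, and well-connectedness puts all streets of the inner box on S. But a segment misses one of the
  corner boxes.\<close>

lemma no_long_segment:
  assumes \<phi>: "\<phi> \<in> street_configs" and m: "0 < m" and wc: "well_connected m (\<Union>\<phi>)"
    and seg: "closed_segment a b \<subseteq> regular \<phi>" and a: "a \<in> Q (2 * m) 0" and b: "b \<notin> Q (10 * m) 0"
  shows False
proof -
  define f where "f z = max \<bar>fst z\<bar> \<bar>snd z\<bar>" for z :: point
  have fa: "f a \<le> m" and fb: "5 * m < f b" using a b by (auto simp: f_def mem_Q)
  have "connected (f ` closed_segment a b)"
    by (intro connected_continuous_image) (auto simp: f_def intro!: continuous_intros)
  then have "is_interval (f ` closed_segment a b)" by (simp add: is_interval_connected_1)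
  then have "3 * m \<in> f ` closed_segment a b"
    using fa fb m unfolding is_interval_1
    by (elim ballE[of _ _ "f a"] ballE[of _ _ "f b"]) auto
  then obtain q where q: "q \<in> closed_segment a b" "f q = 3 * m" by auto
  define i j where "i = round (fst q / m)" and "j = round (snd q / m)"
  define y where "y = (m * real_of_int i, m * real_of_int j)"
  have q3: "\<bar>fst q\<bar> \<le> 3 * m" "\<bar>snd q\<bar> \<le> 3 * m" using q(2) by (auto simp: f_def)
  have near: "\<bar>z - m * real_of_int (round (z / m))\<bar> \<le> m / 2" for z
  proof -
    have "\<bar>of_int (round (z / m)) - z / m\<bar> \<le> 1 / 2" by (rule of_int_round_abs_le)
    then have "m * \<bar>of_int (round (z / m)) - z / m\<bar> \<le> m * (1 / 2)" using m by (intro mult_left_mono) auto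
    also have "m * \<bar>of_int (round (z / m)) - z / m\<bar> = \<bar>m * (of_int (round (z / m)) - z / m)\<bar>"
      using m by (simp add: abs_mult)
    also have "m * (of_int (round (z / m)) - z / m) = m * of_int (round (z / m)) - z"
      using m by (simp add: field_simps)
    finally show ?thesis by (simp add: abs_minus_commute)
  qed
  have small: "\<bar>round (z / m)\<bar> \<le> 3" if "\<bar>z\<bar> \<le> 3 * m" for z
  proof -
    have "m * real_of_int (round (z / m)) < m * 4" "m * (-4) < m * real_of_int (round (z / m))"
      using near[of z] that m by linarith+
    then have "real_of_int (round (z / m)) < 4" "-4 < real_of_int (round (z / m))"
      using m by (simp_all only: mult_less_cancel_left_pos)
    then show ?thesis by linarith
  qed
  \<comment> \<open>A coordinate of modulus 3 m is a multiple of m, so rounding does not move it,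
    and the centre y has sup norm 3 m as well.\<close>
  have exact: "m * real_of_int (round (z / m)) = z" if "\<bar>z\<bar> = 3 * m" for z
  proof -
    have "z / m = 3 \<or> z / m = -3" using that m by (auto simp: abs_if field_simps split: if_splits)
    then have "real_of_int (round (z / m)) = z / m" by (metis of_int_numeral of_int_neg_numeral round_of_int)
    then show ?thesis using m by simp
  qed
  have "(i, j) \<in> {-3..3} \<times> {-3..3}" using small[OF q3(1)] small[OF q3(2)] by (auto simp: i_def j_def abs_le_iff)
  then have y: "y \<in> grid m" by (auto simp: grid_def y_def)
  have yb: "\<bar>fst y\<bar> \<le> 3 * m" "\<bar>snd y\<bar> \<le> 3 * m"
  proof -
    have "\<bar>real_of_int i\<bar> \<le> 3" "\<bar>real_of_int j\<bar> \<le> 3"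
      using small[OF q3(1)] small[OF q3(2)] unfolding i_def j_def by linarith+
    then have "m * \<bar>real_of_int i\<bar> \<le> m * 3" "m * \<bar>real_of_int j\<bar> \<le> m * 3"
      using m by (intro mult_left_mono; simp)+
    then show "\<bar>fst y\<bar> \<le> 3 * m" "\<bar>snd y\<bar> \<le> 3 * m" using m by (auto simp: y_def abs_mult)
  qed
  have qy: "q \<in> Q m y" using near by (simp add: mem_Q y_def i_def j_def)
  have ay: "a \<notin> Q (2 * m) y"
  proof -
    have "\<bar>fst q\<bar> = 3 * m \<or> \<bar>snd q\<bar> = 3 * m" using q(2) by (auto simp: f_def max_def split: if_splits)
    then have "\<bar>fst y\<bar> = 3 * m \<or> \<bar>snd y\<bar> = 3 * m" using exact by (auto simp: y_def i_def j_def)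
    then show ?thesis using fa m unfolding mem_Q f_def by (auto simp: abs_if split: if_splits)
  qed
  have bY: "b \<notin> Q (2 * m) y" using fb yb m unfolding mem_Q f_def by (auto simp: abs_if max_def split: if_splits)
  define S where "S = closed_segment a b \<inter> Q (2 * m) y"
  have "\<exists>e>0. \<Union>\<phi> \<inter> ball u e \<subseteq> closed_segment a b" if "u \<in> S" for u
  proof -
    have "u \<in> open_segment a b" using that ay bY by (auto simp: S_def open_segment_def)
    then show ?thesis using regular_segment_open[OF \<phi> seg] by metis
  qed
  then obtain e where e: "\<And>u. u \<in> S \<Longrightarrow> e u > 0 \<and> \<Union>\<phi> \<inter> ball u (e u) \<subseteq> closed_segment a b" by metis
  define T where "T = \<Union>\<phi> \<inter> Q (2 * m) y - (\<Union>u\<in>S. ball u (e u))"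
  have "compact S" unfolding S_def by (intro compact_Int_closed compact_segment closed_Q)
  moreover have "compact T"
    unfolding T_def by (intro compact_diff closed_Int_compact closed_streets[OF \<phi>] compact_Q) auto
  moreover have ST: "S \<inter> T = {}" using e by (force simp: T_def)
  ultimately obtain V1 V2 where V: "open V1" "open V2" "S \<subseteq> V1" "T \<subseteq> V2" "V1 \<inter> V2 = {}"
    using separation_normal_compact[of S T] by (metis compact_imp_closed)
  obtain W1 where W1: "W1 \<in> rat_opens" "S \<subseteq> W1" "W1 \<subseteq> V1"
    using compact_rat_open_between[OF \<open>compact S\<close> V(1,3)] .
  obtain W2 where W2: "W2 \<in> rat_opens" "T \<subseteq> W2" "W2 \<subseteq> V2"
    using compact_rat_open_between[OF \<open>compact T\<close> V(2,4)] .
  have cover: "\<Union>\<phi> \<inter> Q (2 * m) y \<subseteq> S \<union> T" using e by (auto simp: S_def T_def)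
  have "q \<in> S" using q(1) qy m by (auto simp: S_def mem_Q)
  then have "q \<in> \<Union>\<phi> \<inter> Q m y" "q \<notin> W2" using seg W1 W2 V qy q(1) by (auto simp: regular_def)
  moreover have "\<not> splits (\<Union>\<phi>) (Q m y) (Q (2 * m) y)" using wc y by (simp add: well_connected_def)
  \<comment> \<open>The point q belongs to the inner box but not to W2, so W2 is not the side that
    contains the streets of the inner box.\<close>
  ultimately have "\<Union>\<phi> \<inter> Q m y \<subseteq> W1"
    unfolding splits_def using W1 W2 V(5) cover by (meson disjoint_iff dual_order.trans subsetD sup_mono)
  moreover have "Q m y \<subseteq> Q (2 * m) y" using m by (auto simp: mem_Q)
  ultimately have "\<Union>\<phi> \<inter> Q m y \<subseteq> S"
    using cover W1 W2 V by blast
  then have "\<Union>\<phi> \<inter> Q m y \<subseteq> closed_segment a b" by (auto simp: S_def)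
  then show False
    using wc y m unfolding well_connected_def by (intro segment_misses_corner[of m "\<Union>\<phi>" y a b]) auto
qed

section \<open>Measurable events for closed sets\<close>

lemma space_closed_space: "space closed_space = {F. closed F}"
  unfolding closed_space_def by (rule space_measure_of) auto

lemma pred_countable_Bex:
  assumes "countable X" "\<And>i. i \<in> X \<Longrightarrow> Measurable.pred M (\<lambda>x. P x i)"
  shows "Measurable.pred M (\<lambda>x. \<exists>i\<in>X. P x i)"
proof -
  have "(\<Union>i\<in>X. {x\<in>space M. P x i}) \<in> sets M"
    using assms by (intro sets.countable_UN'') (auto simp: pred_def)
  moreover have "(\<Union>i\<in>X. {x\<in>space M. P x i}) = {x\<in>space M. \<exists>i\<in>X. P x i}" by auto
  ultimately show ?thesis by (simp add: pred_def)
qed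

lemma pred_countable_Ball:
  assumes "countable X" "\<And>i. i \<in> X \<Longrightarrow> Measurable.pred M (\<lambda>x. P x i)"
  shows "Measurable.pred M (\<lambda>x. \<forall>i\<in>X. P x i)"
  using pred_intros_logic(2)[OF pred_countable_Bex[OF assms(1) pred_intros_logic(2)[OF assms(2)]]] by simp

lemma hit_measurable [measurable]:
  assumes "compact K"
  shows "Measurable.pred closed_space (\<lambda>A. A \<inter> K \<noteq> {})"
proof -
  have "{F. closed F \<and> F \<inter> K \<noteq> {}} \<in> sets closed_space"
    unfolding closed_space_def using assms by (intro in_measure_of) auto
  moreover have "{F \<in> space closed_space. F \<inter> K \<noteq> {}} = {F. closed F \<and> F \<inter> K \<noteq> {}}"
    by (auto simp: space_closed_space)
  ultimately show ?thesis by (simp add: pred_def)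
qed

lemma miss_measurable [measurable]:
  assumes "compact K"
  shows "Measurable.pred closed_space (\<lambda>A. A \<inter> K = {})"
  using pred_intros_logic(2)[OF hit_measurable[OF assms]] by simp

text \<open>The condition amounts to missing the compact set K - W.\<close>

lemma inside_measurable:
  assumes "compact K" "open W"
  shows "Measurable.pred closed_space (\<lambda>A. A \<inter> K \<subseteq> W)"
proof -
  have "Measurable.pred closed_space (\<lambda>A. A \<inter> (K - W) = {})"
    using assms by (intro miss_measurable compact_diff)
  moreover have "A \<inter> (K - W) = {} \<longleftrightarrow> A \<inter> K \<subseteq> W" for A by auto
  ultimately show ?thesis by simp
qed

lemma splits_measurable:
  assumes "compact K" "compact K'"
  shows "Measurable.pred closed_space (\<lambda>A. splits A K K')"
  unfolding splits_def
  by (intro pred_countable_Ball pred_countable_Bex countable_rat_opens pred_intros_logic inside_measurable assms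
      open_Un open_rat_opens) (auto simp: pred_def)

lemma finite_grid: "finite (grid m)"
  by (simp add: grid_def)

lemma well_connected_measurable: "Measurable.pred closed_space (well_connected m)"
  unfolding well_connected_def
  by (intro pred_countable_Ball pred_intros_logic splits_measurable hit_measurable)
    (auto simp: finite_grid countable_finite)

section \<open>Convexity and length as countable tests\<close>

lemma compact_combination:
  fixes S T :: "'a::real_normed_vector set"
  assumes "compact S" "compact T"
  shows "compact ((\<lambda>(x, y). (1 - t) *\<^sub>R x + t *\<^sub>R y) ` (S \<times> T))"
  using assms
  by (intro compact_continuous_image compact_Times) (auto simp: split_beta intro!: continuous_intros)

text \<open>A point of a segment that lies outside the closed set S has a ball outside S. Small
  rational boxes around the ends and a rational weight near the true one keep all their combinations
  in this ball, so the test detects it.\<close>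

lemma closed_convex_iff:
  fixes S :: "point set"
  assumes S: "closed S"
  shows "convex S \<longleftrightarrow> (\<forall>(a, b)\<in>rat_boxes. \<forall>(c, d)\<in>rat_boxes. \<forall>t\<in>\<rat> \<inter> {0..1}.
     S \<inter> cbox a b \<noteq> {} \<longrightarrow> S \<inter> cbox c d \<noteq> {} \<longrightarrow>
     S \<inter> (\<lambda>(x, y). (1 - t) *\<^sub>R x + t *\<^sub>R y) ` (cbox a b \<times> cbox c d) \<noteq> {})" (is "_ \<longleftrightarrow> ?R")
proof
  assume cv: "convex S"
  have "S \<inter> (\<lambda>(x, y). (1 - t) *\<^sub>R x + t *\<^sub>R y) ` (cbox a b \<times> cbox c d) \<noteq> {}"
    if t: "t \<in> {0..1}" and hit: "S \<inter> cbox a b \<noteq> {}" "S \<inter> cbox c d \<noteq> {}" for a b c d and t :: real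
  proof -
    obtain x y where xy: "x \<in> S" "x \<in> cbox a b" "y \<in> S" "y \<in> cbox c d" using hit by blast
    then have "(1 - t) *\<^sub>R x + t *\<^sub>R y \<in> S" using cv t by (intro convexD) auto
    then show ?thesis using xy by fast
  qed
  then show ?R by blast
next
  assume R: ?R
  show "convex S"
    unfolding convex_contains_segment
  proof (intro ballI subsetI, rule ccontr)
    fix u v z assume uv: "u \<in> S" "v \<in> S" and z: "z \<in> closed_segment u v" "z \<notin> S"
    obtain t0 where t0: "0 \<le> t0" "t0 \<le> 1" "z = (1 - t0) *\<^sub>R u + t0 *\<^sub>R v"
      using z by (auto simp: in_segment)
    obtain e where e: "e > 0" "ball z e \<subseteq> - S" using S z(2) by (metis ComplI open_Compl openE)
    define B where "B = norm u + norm v + 1"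
    have B: "B > 0" by (simp add: B_def add_nonneg_pos)
    obtain t where t: "t \<in> \<rat>" "0 \<le> t" "t \<le> 1" "\<bar>t - t0\<bar> * B < e / 2"
    proof (cases "t0 = 1")
      case True
      then show ?thesis using that[of 1] e by simp
    next
      case False
      then have "t0 < min 1 (t0 + e / (2 * B))" using t0 e B by simp
      then obtain q where q: "q \<in> \<rat>" "t0 < q" "q < min 1 (t0 + e / (2 * B))" using Rats_dense_in_real by blast
      have "\<bar>q - t0\<bar> * B < e / (2 * B) * B" using q B by (intro mult_strict_right_mono) auto
      then show ?thesis using that[of q] q t0 B by simp
    qed
    have e2: "e / 2 > 0" using e by simp
    obtain a b where ab: "(a, b) \<in> rat_boxes" "u \<in> box a b" "cbox a b \<subseteq> ball u (e / 2)"
      by (rule rat_box_near[OF e2])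
    obtain c d where cd: "(c, d) \<in> rat_boxes" "v \<in> box c d" "cbox c d \<subseteq> ball v (e / 2)"
      by (rule rat_box_near[OF e2])
    have "S \<inter> cbox a b \<noteq> {}" "S \<inter> cbox c d \<noteq> {}"
      using uv ab cd box_subset_cbox by blast+
    then have "S \<inter> (\<lambda>(x, y). (1 - t) *\<^sub>R x + t *\<^sub>R y) ` (cbox a b \<times> cbox c d) \<noteq> {}"
      using R[unfolded split_beta, rule_format, of "(a, b)" "(c, d)" t] ab(1) cd(1) t
      by (simp add: split_beta)
    then obtain x y where xy: "x \<in> cbox a b" "y \<in> cbox c d" "(1 - t) *\<^sub>R x + t *\<^sub>R y \<in> S" by auto
    have "(1 - t) *\<^sub>R x + t *\<^sub>R y - z = (1 - t) *\<^sub>R (x - u) + t *\<^sub>R (y - v) + (t - t0) *\<^sub>R (v - u)"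
      unfolding t0(3) by (simp add: algebra_simps)
    then have "dist ((1 - t) *\<^sub>R x + t *\<^sub>R y) z \<le>
        norm ((1 - t) *\<^sub>R (x - u)) + norm (t *\<^sub>R (y - v)) + norm ((t - t0) *\<^sub>R (v - u))"
      unfolding dist_norm by (simp only:) (intro norm_triangle_le add_right_mono norm_triangle_ineq)
    also have "norm ((1 - t) *\<^sub>R (x - u)) \<le> (1 - t) * (e / 2)"
    proof -
      have "norm (x - u) \<le> e / 2" using xy(1) ab(3) by (auto simp: dist_norm norm_minus_commute)
      then show ?thesis using t mult_left_mono[of "norm (x - u)" "e / 2" "1 - t"] by simp
    qed
    also have "norm (t *\<^sub>R (y - v)) \<le> t * (e / 2)"
    proof -
      have "norm (y - v) \<le> e / 2" using xy(2) cd(3) by (auto simp: dist_norm norm_minus_commute)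
      then show ?thesis using t mult_left_mono[of "norm (y - v)" "e / 2" t] by simp
    qed
    also have "norm ((t - t0) *\<^sub>R (v - u)) \<le> \<bar>t - t0\<bar> * B"
      unfolding norm_scaleR B_def using norm_triangle_ineq4[of v u] by (intro mult_left_mono) auto
    finally have "dist ((1 - t) *\<^sub>R x + t *\<^sub>R y) z \<le> (1 - t) * (e / 2) + t * (e / 2) + \<bar>t - t0\<bar> * B"
      by simp
    moreover have "(1 - t) * (e / 2) + t * (e / 2) = e / 2" by (simp add: field_simps)
    ultimately have "dist ((1 - t) *\<^sub>R x + t *\<^sub>R y) z < e" using t(4) by linarith
    then show False using e(2) xy(3) by (auto simp: dist_commute)
  qed
qed

lemma convex_measurable:
  assumes "compact K"
  shows "Measurable.pred closed_space (\<lambda>A. convex (A \<inter> K))"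
proof -
  define P where "P A \<longleftrightarrow> (\<forall>p\<in>rat_boxes. \<forall>q\<in>rat_boxes. \<forall>t\<in>\<rat> \<inter> {0..1}.
     A \<inter> (K \<inter> cbox (fst p) (snd p)) \<noteq> {} \<longrightarrow> A \<inter> (K \<inter> cbox (fst q) (snd q)) \<noteq> {} \<longrightarrow>
     A \<inter> (K \<inter> (\<lambda>(x, y). (1 - t) *\<^sub>R x + t *\<^sub>R y) ` (cbox (fst p) (snd p) \<times> cbox (fst q) (snd q))) \<noteq> {})" for A
  have "Measurable.pred closed_space P"
    unfolding P_def
    by (intro pred_countable_Ball pred_countable_Bex pred_intros_logic hit_measurable compact_Int
        compact_combination assms) (auto intro: countable_subset[OF _ countable_rat])
  moreover have "convex (A \<inter> K) \<longleftrightarrow> P A" if "A \<in> space closed_space" for A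
  proof -
    have "closed (A \<inter> K)" using that assms by (simp add: space_closed_space compact_imp_closed closed_Int)
    then show ?thesis unfolding closed_convex_iff[OF \<open>closed (A \<inter> K)\<close>] P_def by (simp add: split_beta Int_assoc)
  qed
  ultimately show ?thesis by (subst measurable_cong) auto
qed

text \<open>A substitute for the bound \<open>len\<close> \<le> c, equivalent up to a constant
  factor on compact sets: \<open>len\<close> ranges over arbitrary covers, whereas finite covers by
  rational boxes can be tested in countably many steps.\<close>

definition small_cover :: "real \<Rightarrow> point set \<Rightarrow> point set \<Rightarrow> bool" where
  "small_cover c A K \<longleftrightarrow> (\<forall>k::nat. \<exists>F\<in>{F. finite F \<and> F \<subseteq> rat_boxes}.
     ((\<forall>(a, b)\<in>F. dist a b \<le> 1 / (real k + 1)) \<and> (\<Sum>(a, b)\<in>F. dist a b) \<le> c) \<and>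
     A \<inter> K \<subseteq> (\<Union>(a, b)\<in>F. box a b))"

lemma small_cover_measurable:
  assumes "compact K"
  shows "Measurable.pred closed_space (\<lambda>A. small_cover c A K)"
  unfolding small_cover_def
  by (intro pred_intros_countable pred_countable_Ball pred_countable_Bex pred_intros_logic inside_measurable assms
      countable_Collect_finite_subset countable_rat_boxes open_UN) (auto simp: pred_def intro: countable_finite)

lemma small_cover_mono: "small_cover c A K \<Longrightarrow> c \<le> c' \<Longrightarrow> K' \<subseteq> K \<Longrightarrow> A' \<subseteq> A \<Longrightarrow> small_cover c' A' K'"
  unfolding small_cover_def by (fastforce intro: order_trans)

lemma diameter_box_le:
  fixes a b z :: "'a::euclidean_space"
  shows "diameter ((+) z ` box a b) \<le> dist a b"
proof (rule diameter_le)
  fix x y assume "x \<in> (+) z ` box a b" "y \<in> (+) z ` box a b"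
  then have "\<bar>(x - y) \<bullet> i\<bar> \<le> \<bar>(a - b) \<bullet> i\<bar>" if "i \<in> Basis" for i
    using that by (force simp: mem_box inner_diff_left)
  then show "norm (x - y) \<le> dist a b" unfolding dist_norm by (rule norm_le_componentwise)
qed simp

text \<open>Such covers are admissible in \<open>len\<close>. The shift by z lets a cover of a
  recentred box bound the length of the original streets.\<close>

lemma small_cover_len:
  assumes sc: "small_cover c A K" and B: "\<And>p. p \<in> B \<Longrightarrow> p - z \<in> A \<inter> K"
  shows "len B \<le> ennreal c"
  unfolding len_def
proof (rule SUP_least)
  fix \<delta> :: real assume "\<delta> \<in> {0<..}"
  then have \<delta>: "\<delta> > 0" by simp
  obtain k :: nat where k: "inverse (real (Suc k)) < \<delta>" using reals_Archimedean[OF \<delta>] by blast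
  have "\<exists>F\<in>{F. finite F \<and> F \<subseteq> rat_boxes}.
     ((\<forall>(a, b)\<in>F. dist a b \<le> 1 / (real k + 1)) \<and> (\<Sum>(a, b)\<in>F. dist a b) \<le> c) \<and>
     A \<inter> K \<subseteq> (\<Union>(a, b)\<in>F. box a b)"
    using sc unfolding small_cover_def by (rule spec)
  then obtain F where F: "finite F" and d: "\<forall>(a, b)\<in>F. dist a b \<le> 1 / (real k + 1)"
      and c: "(\<Sum>(a, b)\<in>F. dist a b) \<le> c" and cov: "A \<inter> K \<subseteq> (\<Union>(a, b)\<in>F. box a b)"
    by (elim bexE conjE CollectE)
  obtain h where h: "bij_betw h {0..<card F} F" using ex_bij_betw_nat_finite[OF F] by blast
  \<comment> \<open>\<open>len\<close> asks for a sequence of sets, so the finite cover is padded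
    with empty sets.\<close>
  define U where "U i = (if i < card F then (+) z ` box (fst (h i)) (snd (h i)) else {})" for i
  have hF: "h i \<in> F" if "i < card F" for i using h that by (auto simp: bij_betw_def)
  have dU: "diameter (U i) \<le> (if i < card F then dist (fst (h i)) (snd (h i)) else 0)" for i
    using diameter_box_le[of z "fst (h i)" "snd (h i)"] by (simp add: U_def)
  have "B \<subseteq> (\<Union>i. U i)"
  proof
    fix p assume p: "p \<in> B"
    then obtain ab where ab: "ab \<in> F" "p - z \<in> box (fst ab) (snd ab)"
      using subsetD[OF cov B[OF p]] by (auto simp: split_beta)
    then have "ab \<in> h ` {0..<card F}" using h by (simp add: bij_betw_imp_surj_on)
    then obtain i where i: "i < card F" "h i = ab" by auto
    have "z + (p - z) \<in> (+) z ` box (fst (h i)) (snd (h i))" using i ab(2) by blast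
    then have "p \<in> U i" unfolding U_def using i by simp
    then show "p \<in> (\<Union>i. U i)" by blast
  qed
  moreover have "bounded (U i) \<and> diameter (U i) \<le> \<delta>" for i
  proof
    show "bounded (U i)" by (auto simp: U_def intro: bounded_translation)
    have "dist (fst (h i)) (snd (h i)) \<le> 1 / (real k + 1)" if "i < card F"
      using d hF[OF that] by (auto simp: split_beta)
    then show "diameter (U i) \<le> \<delta>"
      using dU[of i] k \<delta> by (auto simp: inverse_eq_divide add.commute split: if_splits)
  qed
  ultimately have "(INF U\<in>{U :: nat \<Rightarrow> point set. B \<subseteq> (\<Union>i. U i) \<and> (\<forall>i. bounded (U i) \<and> diameter (U i) \<le> \<delta>)}.
       \<Sum>i. ennreal (diameter (U i))) \<le> (\<Sum>i. ennreal (diameter (U i)))"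
    by (intro INF_lower) simp
  also have "\<dots> = (\<Sum>i<card F. ennreal (diameter (U i)))"
    by (rule suminf_finite) (auto simp: U_def)
  also have "\<dots> \<le> (\<Sum>i<card F. ennreal (dist (fst (h i)) (snd (h i))))"
    using dU by (intro sum_mono ennreal_leI) (metis lessThan_iff)
  also have "\<dots> = ennreal (\<Sum>i<card F. dist (fst (h i)) (snd (h i)))" by simp
  also have "(\<Sum>i<card F. dist (fst (h i)) (snd (h i))) = (\<Sum>(a, b)\<in>F. dist a b)"
    using sum.reindex_bij_betw[OF h, of "\<lambda>(a, b). dist a b"] by (simp add: split_beta lessThan_atLeast0)
  also have "ennreal \<dots> \<le> ennreal c" using c by (rule ennreal_leI)
  finally show "(INF U\<in>{U :: nat \<Rightarrow> point set. B \<subseteq> (\<Union>i. U i) \<and> (\<forall>i. bounded (U i) \<and> diameter (U i) \<le> \<delta>)}.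
       \<Sum>i. ennreal (diameter (U i))) \<le> ennreal c" .
qed

text \<open>Each side is at most twice the diameter plus 2 e, and the diagonal is at most the sum of
  the two sides; hence the factor 4.\<close>

lemma bounded_in_rat_box:
  fixes S :: "point set"
  assumes S: "bounded S" and e: "e > 0"
  obtains a b where "(a, b) \<in> rat_boxes" "S \<subseteq> box a b" "dist a b \<le> 4 * diameter S + 4 * e"
proof (cases "S = {}")
  case True
  have "(0, 0) \<in> rat_boxes" by (simp add: rat_boxes_def zero_prod_def)
  then show ?thesis using that[of 0 0] True e by simp
next
  case False
  then obtain x where x: "x \<in> S" by blast
  define d where "d = diameter S"
  obtain a1 where a1: "a1 \<in> \<rat>" "fst x - d - e < a1" "a1 < fst x - d"
    using Rats_dense_in_real[of "fst x - d - e" "fst x - d"] e by auto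
  obtain a2 where a2: "a2 \<in> \<rat>" "snd x - d - e < a2" "a2 < snd x - d"
    using Rats_dense_in_real[of "snd x - d - e" "snd x - d"] e by auto
  obtain b1 where b1: "b1 \<in> \<rat>" "fst x + d < b1" "b1 < fst x + d + e"
    using Rats_dense_in_real[of "fst x + d" "fst x + d + e"] e by auto
  obtain b2 where b2: "b2 \<in> \<rat>" "snd x + d < b2" "b2 < snd x + d + e"
    using Rats_dense_in_real[of "snd x + d" "snd x + d + e"] e by auto
  have "S \<subseteq> box (a1, a2) (b1, b2)"
  proof
    fix y assume y: "y \<in> S"
    have "dist x y \<le> d" unfolding d_def using diameter_bounded_bound[OF S x y] .
    then have "\<bar>fst x - fst y\<bar> \<le> d" "\<bar>snd x - snd y\<bar> \<le> d"
      using dist_fst_le[of x y] dist_snd_le[of x y] by (auto simp: dist_real_def)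
    then show "y \<in> box (a1, a2) (b1, b2)"
      using a1 a2 b1 b2 by (auto simp: mem_box Basis_prod_def inner_prod_def)
  qed
  moreover have "dist (a1, a2) (b1, b2) \<le> dist a1 b1 + dist a2 b2"
    unfolding dist_Pair_Pair by (rule sqrt_sum_squares_le_sum) auto
  then have "dist (a1, a2) (b1, b2) \<le> 4 * d + 4 * e"
    using a1 a2 b1 b2 diameter_ge_0[OF S] unfolding dist_real_def d_def[symmetric] by linarith
  ultimately show ?thesis
    using that[of "(a1, a2)" "(b1, b2)"] a1 a2 b1 b2 by (simp add: rat_boxes_def d_def)
qed

text \<open>A good cover is enlarged to rational boxes, and compactness leaves finitely many. Of the
  factor 5, a share of 4 comes from the diameters and 1 from the margins \<open>e\<close>, whose sum
  is at most c / 4 and which also enter with the factor 4.\<close>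

lemma len_small_cover:
  assumes AK: "compact (A \<inter> K)" and len: "len (A \<inter> K) < ennreal c" and c: "c > 0"
  shows "small_cover (5 * c) A K"
  unfolding small_cover_def
proof
  fix k :: nat
  \<comment> \<open>Both terms of 4 diam + 4 e are at most 4 \<delta>, and 8 \<delta> is the mesh
    required at k.\<close>
  define \<delta> where "\<delta> = 1 / (8 * (real k + 1))"
  have \<delta>: "\<delta> > 0" by (simp add: \<delta>_def)
  have "(INF U\<in>{U :: nat \<Rightarrow> point set. A \<inter> K \<subseteq> (\<Union>i. U i) \<and> (\<forall>i. bounded (U i) \<and> diameter (U i) \<le> \<delta>)}.
       \<Sum>i. ennreal (diameter (U i))) \<le> len (A \<inter> K)"
    unfolding len_def using \<delta> by (intro SUP_upper) simp
  then have "(INF U\<in>{U :: nat \<Rightarrow> point set. A \<inter> K \<subseteq> (\<Union>i. U i) \<and> (\<forall>i. bounded (U i) \<and> diameter (U i) \<le> \<delta>)}.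
       \<Sum>i. ennreal (diameter (U i))) < ennreal c" using len by (rule order_le_less_trans)
  then obtain U :: "nat \<Rightarrow> point set" where U: "A \<inter> K \<subseteq> (\<Union>i. U i)" "\<And>i. bounded (U i)" "\<And>i. diameter (U i) \<le> \<delta>"
      "(\<Sum>i. ennreal (diameter (U i))) < ennreal c"
    unfolding INF_less_iff by blast
  define e where "e i = min (c / 4) \<delta> * (1 / 2) ^ Suc i" for i
  have e: "e i > 0" "e i \<le> \<delta>" for i
  proof -
    show "e i > 0" using c \<delta> by (simp add: e_def)
    have "e i \<le> \<delta> * 1"
      unfolding e_def using \<delta> c by (intro mult_mono power_le_one) (auto simp del: power_Suc)
    then show "e i \<le> \<delta>" by simp
  qed
  have "\<forall>i. \<exists>p. p \<in> rat_boxes \<and> U i \<subseteq> box (fst p) (snd p) \<and> dist (fst p) (snd p) \<le> 4 * diameter (U i) + 4 * e i"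
    using bounded_in_rat_box[OF U(2) e(1)] by (metis fst_conv snd_conv)
  then obtain p where p: "\<And>i. p i \<in> rat_boxes" "\<And>i. U i \<subseteq> box (fst (p i)) (snd (p i))"
      "\<And>i. dist (fst (p i)) (snd (p i)) \<le> 4 * diameter (U i) + 4 * e i"
    by metis
  have "A \<inter> K \<subseteq> (\<Union>i\<in>UNIV. box (fst (p i)) (snd (p i)))" using U(1) p(2) by blast
  then obtain I where I: "finite I" "A \<inter> K \<subseteq> (\<Union>i\<in>I. box (fst (p i)) (snd (p i)))"
    using compactE_image[OF AK, of UNIV "\<lambda>i. box (fst (p i)) (snd (p i))"] by auto
  have diam0: "0 \<le> diameter (U i)" for i using U(2) by (rule diameter_ge_0)
  have "(\<Sum>i\<in>I. diameter (U i)) \<le> c"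
  proof -
    have "ennreal (\<Sum>i\<in>I. diameter (U i)) = (\<Sum>i\<in>I. ennreal (diameter (U i)))"
      using diam0 by (intro sum_ennreal[symmetric]) auto
    also have "\<dots> \<le> (\<Sum>i. ennreal (diameter (U i)))" using I(1) by (intro sum_le_suminf) auto
    also have "\<dots> \<le> ennreal c" using U(4) by simp
    finally show ?thesis using c by simp
  qed
  moreover have "(\<Sum>i\<in>I. e i) \<le> c / 4"
  proof -
    have "(\<Sum>i\<in>I. e i) \<le> (\<Sum>i. e i)"
      using I(1) e(1) unfolding e_def
      by (intro sum_le_suminf summable_mult summable_geometric_iff[THEN iffD2]) (auto intro: less_imp_le)
    also have "\<dots> = min (c / 4) \<delta> * (\<Sum>i. (1 / 2) ^ Suc i)"
      unfolding e_def by (rule suminf_mult) simp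
    also have "(\<Sum>i. (1 / 2 :: real) ^ Suc i) = 1" using power_half_series by (simp add: sums_iff)
    finally show ?thesis by simp
  qed
  moreover have "(\<Sum>(a, b)\<in>p ` I. dist a b) \<le> (\<Sum>i\<in>I. 4 * diameter (U i) + 4 * e i)"
  proof -
    have "(\<Sum>(a, b)\<in>p ` I. dist a b) \<le> (\<Sum>i\<in>I. (\<lambda>(a, b). dist a b) (p i))"
      using I(1) sum_image_le[of I "\<lambda>(a, b). dist a b" p] by (auto simp: o_def split_beta)
    also have "\<dots> \<le> (\<Sum>i\<in>I. 4 * diameter (U i) + 4 * e i)"
      using p(3) by (intro sum_mono) (simp add: split_beta)
    finally show ?thesis .
  qed
  moreover have "dist (fst (p i)) (snd (p i)) \<le> 1 / (real k + 1)" for i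
  proof -
    have "4 * diameter (U i) + 4 * e i \<le> 8 * \<delta>" using U(3)[of i] e(2)[of i] by simp
    also have "\<dots> = 1 / (real k + 1)" unfolding \<delta>_def by (simp add: divide_simps)
    finally show ?thesis using p(3)[of i] by linarith
  qed
  ultimately show "\<exists>F\<in>{F. finite F \<and> F \<subseteq> rat_boxes}.
     ((\<forall>(a, b)\<in>F. dist a b \<le> 1 / (real k + 1)) \<and> (\<Sum>(a, b)\<in>F. dist a b) \<le> 5 * c) \<and>
     A \<inter> K \<subseteq> (\<Union>(a, b)\<in>F. box a b)"
    using I p(1)
    by (intro bexI[of _ "p ` I"]) (auto simp: split_beta sum.distrib sum_distrib_left[symmetric])
qed

text \<open>If \<open>dist u p < d\<close> and \<open>s \<le> t < s + d\<close>, then every \<open>x\<close> in the box with \<open>t \<le> dist x p \<le> t + d\<close> lies in the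
  ring around \<open>u\<close>, whence the asymmetric margins.\<close>

definition ring :: "real \<Rightarrow> point \<Rightarrow> real \<Rightarrow> real \<Rightarrow> point set" where
  "ring n c s d = {x\<in>Q n 0. s - d \<le> dist x c \<and> dist x c \<le> s + 3 * d}"

lemma compact_ring [simp]: "compact (ring n c s d)"
proof -
  have "ring n c s d = Q n 0 \<inter> (\<lambda>x. dist x c) -` {s - d..s + 3 * d}" by (auto simp: ring_def)
  also have "compact \<dots>" by (intro compact_Int_closed compact_Q closed_vimage) (auto intro!: continuous_intros)
  finally show ?thesis .
qed

text \<open>The finite rational data replace the irregular points, whose measurability would be
  awkward: each irregular point is close to a centre in \<open>C\<close>, and the rings around the centres carry little length.\<close>

definition certificate :: "real \<Rightarrow> real \<Rightarrow> real \<Rightarrow> real \<Rightarrow> point set \<Rightarrow> bool" where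
  "certificate n P c d A \<longleftrightarrow> (\<exists>C\<in>{C. finite C \<and> C \<subseteq> \<rat> \<times> \<rat>}. \<exists>R\<in>{R. finite R \<and> R \<subseteq> rat_boxes}.
     (\<forall>p\<in>R. convex (A \<inter> cbox (fst p) (snd p))) \<and>
     A \<inter> Q n 0 \<subseteq> (\<Union>u\<in>C. ball u d) \<union> (\<Union>p\<in>R. box (fst p) (snd p)) \<and>
     (\<forall>k\<in>{..nat \<lceil>P / d\<rceil>}. \<forall>u\<in>C. small_cover (c / card C) A (ring n u (k * d) d)))"

lemma certificate_measurable: "Measurable.pred closed_space (certificate n P c d)"
  unfolding certificate_def
  by (intro pred_countable_Ball pred_countable_Bex pred_intros_logic inside_measurable
      convex_measurable small_cover_measurable countable_Collect_finite_subset countable_rat_boxes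
      countable_SIGMA countable_rat open_UN open_Un compact_ring compact_Q compact_cbox)
    (auto intro: countable_finite)

text \<open>Near an interior point of the box the sets A and X agree. If no centre is close to p,
  then a box on which A is convex covers p, and X would be convex near p.\<close>

lemma certificate_irregular:
  assumes C: "A \<inter> Q n 0 \<subseteq> (\<Union>u\<in>C. ball u d) \<union> (\<Union>p\<in>R. box (fst p) (snd p))"
    and R: "\<forall>p\<in>R. convex (A \<inter> cbox (fst p) (snd p))" and A: "A = X \<inter> Q n 0"
    and p: "p \<in> irregular X" "p \<in> interior (Q n 0)"
  shows "\<exists>u\<in>C. dist u p < d"
proof (rule ccontr)
  assume "\<not> ?thesis"
  moreover have "p \<in> A \<inter> Q n 0" using p interior_subset by (auto simp: A irregular_def)
  ultimately have "p \<in> (\<Union>p\<in>R. box (fst p) (snd p))" using subsetD[OF C, of p] by (auto simp: not_less)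
  then obtain q where q: "q \<in> R" "p \<in> box (fst q) (snd q)" by blast
  have "open (box (fst q) (snd q) \<inter> interior (Q n 0))" by (intro open_Int open_box open_interior)
  then obtain e where e: "e > 0" "ball p e \<subseteq> box (fst q) (snd q) \<inter> interior (Q n 0)"
    using q p(2) by (metis IntI openE)
  have "convex (A \<inter> cbox (fst q) (snd q) \<inter> ball p e)"
    by (rule convex_Int[OF bspec[OF R q(1)] convex_ball])
  moreover have "A \<inter> cbox (fst q) (snd q) \<inter> ball p e = X \<inter> ball p e"
    using e(2) interior_subset[of "Q n 0"] box_subset_cbox[of "fst q" "snd q"] unfolding A by blast
  ultimately show False using p(1) e(1) by (auto simp: irregular_def)
qed

text \<open>Each irregular point gets a nearby rational centre, and the remaining compact part of
  the streets is covered by boxes on which it is convex. By \<open>thin\<close> the shells around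
  irregular points carry little length uniformly in the radius, and the rings around the centres lie
  in such shells.\<close>

lemma certificate_exists:
  assumes \<phi>: "\<phi> \<in> street_configs" and P: "0 \<le> P" and c: "0 < c"
    and thin: "\<And>p c. 0 < c \<Longrightarrow> \<exists>z>0. \<forall>s\<in>{0..P + 2}. len (\<Union>\<phi> \<inter> Q n 0 \<inter> {x. \<bar>dist x p - s\<bar> \<le> z}) < ennreal c"
  shows "\<exists>i0. \<forall>i\<ge>i0. certificate n P c (1 / real (Suc i)) (\<Union>\<phi> \<inter> Q n 0)"
proof -
  define N where "N = irregular (\<Union>\<phi>) \<inter> Q n 0"
  define A where "A = \<Union>\<phi> \<inter> Q n 0"
  have N: "finite N" unfolding N_def by (intro finite_irregular \<phi> bounded_Q)
  \<comment> \<open>The factor 5 is lost in \<open>len_small_cover\<close>. The other factor shares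
    c among the centres, with + 1 against division by zero.\<close>
  define c0 where "c0 = c / (5 * (card N + 1))"
  have c0: "0 < c0" using c by (simp add: c0_def)
  have "\<forall>p. \<exists>z>0. \<forall>s\<in>{0..P + 2}. len (A \<inter> {x. \<bar>dist x p - s\<bar> \<le> z}) < ennreal c0"
    using thin[OF c0] by (simp add: A_def)
  then obtain z where z: "\<And>p. z p > 0"
      "\<And>p s. s \<in> {0..P + 2} \<Longrightarrow> len (A \<inter> {x. \<bar>dist x p - s\<bar> \<le> z p}) < ennreal c0"
    by metis
  have len_mono: "len X \<le> len Y" if "X \<subseteq> Y" for X Y
    unfolding len_def using that by (intro SUP_mono' INF_superset_mono) auto
  define z0 where "z0 = Min (insert 1 (z ` N))"
  have z0: "0 < z0" "\<And>p. p \<in> N \<Longrightarrow> z0 \<le> z p" using N z(1) by (auto simp: z0_def)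
  obtain i0 :: nat where i0: "5 / z0 < real i0" using reals_Archimedean2 by blast
  have "certificate n P c (1 / real (Suc i)) A" if i: "i \<ge> i0" for i
  proof -
    define d where "d = 1 / real (Suc i)"
    have d: "0 < d" "d \<le> 1" by (auto simp: d_def)
    have "5 / z0 < real (Suc i)" using i i0 by simp
    \<comment> \<open>A ring extends 3 d beyond its radius and its centre is off by less than d / 2,
      so shells of half-width 5 d contain the rings.\<close>
    then have d5: "5 * d \<le> z0" using z0(1) by (simp add: d_def field_simps)
    have "\<forall>p::point. \<exists>q\<in>\<rat> \<times> \<rat>. dist q p < d / 2"
    proof
      fix p :: point
      have d2: "d / 2 > 0" using d by simp
      obtain a b where ab: "(a, b) \<in> rat_boxes" "p \<in> box a b" "cbox a b \<subseteq> ball p (d / 2)"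
        by (rule rat_box_near[OF d2])
      then have "a \<in> cbox a b" by (metis box_ne_empty(1) box_subset_cbox emptyE empty_iff mem_box(2) order_refl subsetD)
      then show "\<exists>q\<in>\<rat> \<times> \<rat>. dist q p < d / 2" using ab unfolding rat_boxes_def by (intro bexI[of _ a]) (auto simp: dist_commute)
    qed
    then obtain q where q: "\<And>p::point. q p \<in> \<rat> \<times> \<rat>" "\<And>p. dist (q p) p < d / 2" by metis
    define C where "C = q ` N"
    define R where "R = {(a, b)\<in>rat_boxes. convex (A \<inter> cbox a b)}"
    have "compact (A - (\<Union>u\<in>C. ball u d))"
      unfolding A_def by (intro compact_diff closed_Int_compact closed_streets \<phi> compact_Q) auto
    moreover have "\<exists>(a, b)\<in>R. x \<in> box a b" if x: "x \<in> A - (\<Union>u\<in>C. ball u d)" for x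
    proof -
      have "x \<notin> N"
      proof
        assume "x \<in> N"
        then have "x \<in> ball (q x) d" using q(2)[of x] d by simp
        then show False using x \<open>x \<in> N\<close> by (auto simp: C_def)
      qed
      then obtain e where e: "e > 0" "convex (\<Union>\<phi> \<inter> ball x e)" using x by (auto simp: N_def A_def irregular_def)
      obtain a b where ab: "(a, b) \<in> rat_boxes" "x \<in> box a b" "cbox a b \<subseteq> ball x e"
        using rat_box_near[OF e(1)] .
      have "convex ((\<Union>\<phi> \<inter> ball x e) \<inter> Q n 0 \<inter> cbox a b)" by (intro convex_Int e(2)) (auto simp: Q_def)
      moreover have "(\<Union>\<phi> \<inter> ball x e) \<inter> Q n 0 \<inter> cbox a b = A \<inter> cbox a b" using ab(3) by (auto simp: A_def)
      ultimately show ?thesis using ab unfolding R_def by (intro bexI[of _ "(a, b)"]) auto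
    qed
    ultimately obtain F where F: "finite F" "F \<subseteq> R" "A - (\<Union>u\<in>C. ball u d) \<subseteq> (\<Union>(a, b)\<in>F. box a b)"
      by (rule compact_rat_boxes_cover)
    have "small_cover (c / card C) A (ring n u (k * d) d)" if k: "k \<le> nat \<lceil>P / d\<rceil>" and u: "u \<in> C" for k u
    proof -
      obtain p where p: "p \<in> N" "u = q p" using u by (auto simp: C_def)
      have "real k \<le> real (nat \<lceil>P / d\<rceil>)" using k by simp
      also have "\<dots> \<le> P / d + 1" using P d by (simp add: of_nat_nat of_int_ceiling_le_add_one)
      finally have "k * d \<le> (P / d + 1) * d" using d by (intro mult_right_mono) auto
      also have "\<dots> = P + d" using d by (simp add: field_simps)
      finally have s: "k * d \<in> {0..P + 2}" using d by auto
      have "A \<inter> ring n u (k * d) d \<subseteq> A \<inter> {x. \<bar>dist x p - k * d\<bar> \<le> z p}"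
      proof safe
        fix a b assume "(a, b) \<in> ring n u (k * d) d"
        moreover have "\<bar>dist (a, b) p - dist (a, b) u\<bar> \<le> dist u p"
          by (metis abs_dist_diff_le dist_commute)
        ultimately show "\<bar>dist (a, b) p - k * d\<bar> \<le> z p"
          using q(2)[of p] z0(2)[OF p(1)] d5 d unfolding ring_def p(2) by auto
      qed
      then have "len (A \<inter> ring n u (k * d) d) < ennreal c0"
        using z(2)[OF s, of p] len_mono by (meson order_le_less_trans)
      moreover have "compact (A \<inter> ring n u (k * d) d)"
        unfolding A_def Int_assoc by (intro closed_Int_compact closed_streets \<phi> compact_Int compact_Q compact_ring)
      ultimately have "small_cover (5 * c0) A (ring n u (k * d) d)" using c0 by (intro len_small_cover)
      moreover have "5 * c0 \<le> c / card C"
      proof -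
        have "card C \<le> card N" unfolding C_def by (rule card_image_le[OF N])
        moreover have "card C > 0" using u N by (auto simp: C_def card_gt_0_iff)
        ultimately have "c / (real (card N) + 1) \<le> c / card C" using c by (intro divide_left_mono) auto
        moreover have "5 * c0 = c / (real (card N) + 1)" unfolding c0_def by (simp add: divide_simps)
        ultimately show ?thesis by simp
      qed
      ultimately show ?thesis by (rule small_cover_mono) auto
    qed
    moreover have "C \<in> {C. finite C \<and> C \<subseteq> \<rat> \<times> \<rat>}" using N q(1) unfolding C_def by blast
    moreover have "F \<in> {F. finite F \<and> F \<subseteq> rat_boxes}" "\<forall>p\<in>F. convex (A \<inter> cbox (fst p) (snd p))"
      using F(1,2) by (auto simp: R_def)
    moreover have "A \<inter> Q n 0 \<subseteq> (\<Union>u\<in>C. ball u d) \<union> (\<Union>p\<in>F. box (fst p) (snd p))"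
      using F(3) unfolding split_beta by blast
    ultimately have "certificate n P c d A"
      unfolding certificate_def by (intro bexI[of _ C] bexI[of _ F]) auto
    then show ?thesis by (simp add: d_def)
  qed
  then show ?thesis by (auto simp: A_def)
qed

section \<open>Poisson processes\<close>

lemma space_point_space: "space point_space = point_configs"
  unfolding point_space_def by (rule space_measure_of) auto

text \<open>Measurable supersets of arbitrarily small measure intersect in a null set. This serves
  events whose own measurability is not established.\<close>

lemma AE_notI_small:
  assumes "\<And>c. c > 0 \<Longrightarrow> \<exists>A\<in>sets M. S \<inter> space M \<subseteq> A \<and> emeasure M A \<le> ennreal c"
  shows "AE x in M. x \<notin> S"
proof -
  have "\<forall>i::nat. \<exists>A\<in>sets M. S \<inter> space M \<subseteq> A \<and> emeasure M A \<le> ennreal (1 / real (Suc i))"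
    by (intro allI assms) simp
  then obtain A where A: "\<And>i::nat. A i \<in> sets M" "\<And>i. S \<inter> space M \<subseteq> A i"
      "\<And>i. emeasure M (A i) \<le> ennreal (1 / real (Suc i))" by metis
  have "emeasure M (\<Inter>i. A i) \<le> 0"
  proof (rule ennreal_le_epsilon)
    fix e :: real assume "0 < e"
    then obtain i where "inverse (real (Suc i)) < e" using reals_Archimedean by blast
    then have "1 / real (Suc i) \<le> e" by (simp add: inverse_eq_divide)
    have "emeasure M (\<Inter>i. A i) \<le> emeasure M (A i)" using A(1) by (intro emeasure_mono) auto
    also have "\<dots> \<le> ennreal (1 / real (Suc i))" by (rule A)
    also have "\<dots> \<le> 0 + ennreal e" using \<open>1 / real (Suc i) \<le> e\<close> by (simp add: ennreal_leI)
    finally show "emeasure M (\<Inter>i. A i) \<le> 0 + ennreal e" .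
  qed
  then have "(\<Inter>i. A i) \<in> null_sets M" using A(1) by (auto simp: null_sets_def)
  then show ?thesis by (rule AE_I') (use A(2) in blast)
qed

locale poisson =
  fixes m :: "point set \<Rightarrow> ennreal" and P :: "point set measure"
  assumes pp: "poisson_process m P"
begin

sublocale prob_space P using pp by (simp add: poisson_process_def)

definition bb :: "point set \<Rightarrow> bool" where "bb B \<longleftrightarrow> B \<in> sets borel \<and> bounded B"

lemma space_P: "space P = point_configs"
  using pp sets_eq_imp_space_eq[of P point_space] by (simp add: poisson_process_def space_point_space)

lemma finite_points: "\<xi> \<in> space P \<Longrightarrow> bounded B \<Longrightarrow> finite (\<xi> \<inter> B)"
  by (simp add: space_P point_configs_def)

lemma count_measurable [measurable]:
  assumes "bb B"
  shows "(\<lambda>\<xi>. card (\<xi> \<inter> B)) \<in> P \<rightarrow>\<^sub>M count_space UNIV"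
proof (subst measurable_count_space_eq2_countable, safe)
  fix k :: nat
  have "{\<xi>\<in>point_configs. card (\<xi> \<inter> B) = k} \<in> sets point_space"
    unfolding point_space_def using assms by (intro in_measure_of) (auto simp: bb_def)
  then have "{\<xi>\<in>space P. card (\<xi> \<inter> B) = k} \<in> sets P"
    using pp by (simp add: space_P poisson_process_def)
  moreover have "(\<lambda>\<xi>. card (\<xi> \<inter> B)) -` {k} \<inter> space P = {\<xi>\<in>space P. card (\<xi> \<inter> B) = k}" by auto
  ultimately show "(\<lambda>\<xi>. card (\<xi> \<inter> B)) -` {k} \<inter> space P \<in> sets P" by simp
qed auto

lemma hit_sets: "bb B \<Longrightarrow> {\<xi>\<in>space P. \<xi> \<inter> B \<noteq> {}} \<in> sets P"
proof -
  assume B: "bb B"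
  have "{\<xi>\<in>space P. card (\<xi> \<inter> B) \<noteq> 0} \<in> sets P" using count_measurable[OF B] by measurable
  also have "{\<xi>\<in>space P. card (\<xi> \<inter> B) \<noteq> 0} = {\<xi>\<in>space P. \<xi> \<inter> B \<noteq> {}}"
    using B finite_points by (auto simp: bb_def card_eq_0_iff)
  finally show ?thesis .
qed

lemma finite_m: "bb B \<Longrightarrow> m B < \<infinity>"
  using pp by (auto simp: poisson_process_def bb_def)

lemma prob_count: "bb B \<Longrightarrow> prob {\<xi>\<in>space P. card (\<xi> \<inter> B) = k}
    = enn2real (m B) ^ k / fact k * exp (- enn2real (m B))"
  using pp by (auto simp: poisson_process_def bb_def)

lemma prob_hit:
  assumes B: "bb B"
  shows "prob {\<xi>\<in>space P. \<xi> \<inter> B \<noteq> {}} = 1 - exp (- enn2real (m B))"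
proof -
  have "space P - {\<xi>\<in>space P. \<xi> \<inter> B \<noteq> {}} = {\<xi>\<in>space P. card (\<xi> \<inter> B) = 0}"
    using B finite_points by (auto simp: bb_def card_eq_0_iff)
  then have "prob (space P - {\<xi>\<in>space P. \<xi> \<inter> B \<noteq> {}}) = exp (- enn2real (m B))"
    using prob_count[OF B, of 0] by simp
  then show ?thesis using prob_compl[OF hit_sets[OF B]] by simp
qed

lemma null_imp_avoid:
  assumes B: "bb B" "m B = 0"
  shows "AE \<xi> in P. \<xi> \<inter> B = {}"
proof -
  have "prob {\<xi>\<in>space P. \<xi> \<inter> B \<noteq> {}} = 0" using prob_hit[OF B(1)] B(2) by simp
  then have "{\<xi>\<in>space P. \<xi> \<inter> B \<noteq> {}} \<in> null_sets P"
    using hit_sets[OF B(1)] by (simp add: null_sets_def emeasure_eq_measure)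
  then show ?thesis by (rule AE_I') auto
qed

text \<open>The series of k r^k / k! is shifted by one. As m is a bare set function, this identity
  is also the source of its monotonicity and superadditivity below.\<close>

lemma mean_count:
  assumes B: "bb B"
  shows "(\<integral>\<^sup>+\<xi>. of_nat (card (\<xi> \<inter> B)) \<partial>P) = m B"
proof -
  define r where "r = enn2real (m B)"
  have r: "0 \<le> r" "ennreal r = m B" using finite_m[OF B] by (auto simp: r_def)
  define A where "A k = {\<xi>\<in>space P. card (\<xi> \<inter> B) = k}" for k
  have A: "A k \<in> sets P" for k
    unfolding A_def using count_measurable[OF B] by measurable
  have "(\<integral>\<^sup>+\<xi>. of_nat (card (\<xi> \<inter> B)) \<partial>P) = (\<integral>\<^sup>+\<xi>. (\<Sum>k. of_nat k * indicator (A k) \<xi>) \<partial>P)"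
  proof (rule nn_integral_cong)
    fix \<xi> assume "\<xi> \<in> space P"
    then have "(\<Sum>k. of_nat k * indicator (A k) \<xi> :: ennreal) =
        (\<Sum>k\<in>{card (\<xi> \<inter> B)}. of_nat k * indicator (A k) \<xi>)"
      by (intro suminf_finite) (auto simp: A_def)
    also have "\<dots> = of_nat (card (\<xi> \<inter> B))" using \<open>\<xi> \<in> space P\<close> by (simp add: A_def)
    finally show "of_nat (card (\<xi> \<inter> B)) = (\<Sum>k. of_nat k * indicator (A k) \<xi> :: ennreal)" by simp
  qed
  also have "\<dots> = (\<Sum>k. of_nat k * emeasure P (A k))"
    using A by (subst nn_integral_suminf) (auto simp: nn_integral_cmult_indicator)
  also have "\<dots> = (\<Sum>k. ennreal (real k * (r ^ k / fact k * exp (- r))))"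
  proof (rule suminf_cong)
    fix k
    have "emeasure P (A k) = ennreal (r ^ k / fact k * exp (- r))"
      using prob_count[OF B, of k] by (simp add: emeasure_eq_measure A_def r_def)
    then show "of_nat k * emeasure P (A k) = ennreal (real k * (r ^ k / fact k * exp (- r)))"
      using r(1) by (simp only: ennreal_of_nat_eq_real_of_nat) (intro ennreal_mult[symmetric]; simp)
  qed
  also have "\<dots> = ennreal r"
  proof (rule suminf_ennreal_eq)
    have "(\<lambda>k. r * exp (- r) * (r ^ k /\<^sub>R fact k)) sums (r * exp (- r) * exp r)"
      by (intro sums_mult exp_converges)
    moreover have "r * exp (- r) * (r ^ k /\<^sub>R fact k) = real (Suc k) * (r ^ Suc k / fact (Suc k) * exp (- r))" for k
      by (simp add: divide_simps del: of_nat_Suc)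
    moreover have "r * exp (- r) * exp r = r" by (simp add: exp_minus)
    ultimately have "(\<lambda>k. real (Suc k) * (r ^ Suc k / fact (Suc k) * exp (- r))) sums r" by (simp only:)
    then show "(\<lambda>k. real k * (r ^ k / fact k * exp (- r))) sums r"
      by (subst (asm) sums_Suc_iff) simp
  qed (use r in auto)
  finally show ?thesis using r by simp
qed

lemma m_mono:
  assumes "bb A" "bb B" "A \<subseteq> B"
  shows "m A \<le> m B"
  unfolding mean_count[OF assms(1), symmetric] mean_count[OF assms(2), symmetric]
  using assms by (intro nn_integral_mono of_nat_mono card_mono finite_points) (auto simp: bb_def)

lemma m_sum_disjoint:
  assumes I: "finite I" and B: "\<And>i. i \<in> I \<Longrightarrow> bb (B i)" "disjoint_family_on B I"
    and C: "bb C" "\<And>i. i \<in> I \<Longrightarrow> B i \<subseteq> C"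
  shows "(\<Sum>i\<in>I. m (B i)) \<le> m C"
proof -
  have "(\<Sum>i\<in>I. m (B i)) = (\<Sum>i\<in>I. \<integral>\<^sup>+\<xi>. of_nat (card (\<xi> \<inter> B i)) \<partial>P)"
    using mean_count B(1) by simp
  also have "\<dots> = (\<integral>\<^sup>+\<xi>. (\<Sum>i\<in>I. of_nat (card (\<xi> \<inter> B i))) \<partial>P)"
  proof (rule nn_integral_sum[symmetric])
    fix i assume "i \<in> I"
    show "(\<lambda>\<xi>. of_nat (card (\<xi> \<inter> B i)) :: ennreal) \<in> borel_measurable P"
      by (rule measurable_compose[OF count_measurable[OF B(1)[OF \<open>i \<in> I\<close>]]]) simp
  qed
  also have "\<dots> \<le> (\<integral>\<^sup>+\<xi>. of_nat (card (\<xi> \<inter> C)) \<partial>P)"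
  proof (rule nn_integral_mono)
    fix \<xi> assume "\<xi> \<in> space P"
    then have fin: "finite (\<xi> \<inter> C)" "\<And>i. i \<in> I \<Longrightarrow> finite (\<xi> \<inter> B i)"
      using finite_points B(1) C(1) by (auto simp: bb_def)
    have "(\<Sum>i\<in>I. card (\<xi> \<inter> B i)) = card (\<Union>i\<in>I. \<xi> \<inter> B i)"
      using I fin(2) B(2) by (intro card_UN_disjoint[symmetric]) (auto simp: disjoint_family_on_def)
    also have "\<dots> \<le> card (\<xi> \<inter> C)" using fin(1) C(2) by (intro card_mono) auto
    finally show "(\<Sum>i\<in>I. of_nat (card (\<xi> \<inter> B i)) :: ennreal) \<le> of_nat (card (\<xi> \<inter> C))"
      unfolding of_nat_sum[symmetric] by (rule of_nat_mono)
  qed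
  also have "\<dots> = m C" by (rule mean_count[OF C(1)])
  finally show ?thesis .
qed

lemma mean_prod:
  assumes I: "finite I" and B: "\<And>i. i \<in> I \<Longrightarrow> bb (B i)" and dis: "disjoint_family_on B I"
  shows "(\<integral>\<^sup>+\<xi>. (\<Prod>i\<in>I. of_nat (card (\<xi> \<inter> B i))) \<partial>P) = (\<Prod>i\<in>I. m (B i))"
\<comment> \<open>\<open>poisson_process\<close> indexes the counts by the sets themselves, so the
  family has to be injective. Disjoint sets coincide only if they are empty, and then both sides
  vanish.\<close>
proof (cases "\<exists>i\<in>I. B i = {}")
  case True
  then obtain i where i: "i \<in> I" "B i = {}" by blast
  then have "m (B i) = 0" using mean_count[OF B[OF i(1)]] by simp
  then have "(\<Prod>i\<in>I. m (B i)) = 0" using I i(1) by (intro prod_zero bexI[of _ i])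
  moreover have "(\<Prod>i\<in>I. of_nat (card (\<xi> \<inter> B i)) :: ennreal) = 0" for \<xi>
    using I i by (intro prod_zero bexI[of _ i]) auto
  ultimately show ?thesis by (simp only:) simp
next
  case False
  then have inj: "inj_on B I" using dis unfolding inj_on_def disjoint_family_on_def by blast
  have "finite (B ` I) \<and> disjoint (B ` I) \<and> (\<forall>C\<in>B ` I. C \<in> sets borel \<and> bounded C)"
    using I B disjoint_family_on_disjoint_image[OF dis] by (auto simp: bb_def)
  then have ind: "indep_vars (\<lambda>_. count_space UNIV) (\<lambda>C \<xi>. card (\<xi> \<inter> C)) (B ` I)"
    using pp unfolding poisson_process_def by blast
  have "indep_vars (\<lambda>_. borel) (\<lambda>C \<xi>. of_nat (card (\<xi> \<inter> C)) :: ennreal) (B ` I)"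
    by (rule indep_vars_compose2[OF ind]) auto
  then have "(\<integral>\<^sup>+\<xi>. (\<Prod>C\<in>B ` I. of_nat (card (\<xi> \<inter> C))) \<partial>P) = (\<Prod>C\<in>B ` I. \<integral>\<^sup>+\<xi>. of_nat (card (\<xi> \<inter> C)) \<partial>P)"
    using I by (intro indep_vars_nn_integral) auto
  then show ?thesis using mean_count B by (simp add: prod.reindex[OF inj])
qed

text \<open>If shells of mass at least c existed at every width, compactness of the radii would give
  a radius l all of whose shells have mass at least c. Each of them is hit with probability at least
  1 - e^-c, and as B contains finitely many points, the intersection of these events puts a point on
  the level set of l, which is null. The detour through the process replaces continuity of m from
  above.\<close>

lemma thin:
  fixes h :: "point \<Rightarrow> real"
  assumes B: "bb B" and h: "h \<in> borel_measurable borel"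
    and null: "\<And>s. m (B \<inter> {x. h x = s}) = 0" and c: "0 < c"
  shows "\<exists>z>0. \<forall>s\<in>{0..S}. m (B \<inter> {x. \<bar>h x - s\<bar> \<le> z}) < ennreal c"
proof (rule ccontr)
  assume neg: "\<not> ?thesis"
  have bbB: "bb (B \<inter> {x. \<bar>h x - s\<bar> \<le> z})" for s z
  proof -
    have "{x. \<bar>h x - s\<bar> \<le> z} \<in> sets borel" using h by measurable
    then show ?thesis using B by (auto simp: bb_def intro: bounded_subset)
  qed
  have "\<forall>i::nat. \<exists>s\<in>{0..S}. ennreal c \<le> m (B \<inter> {x. \<bar>h x - s\<bar> \<le> 1 / real (Suc i)})"
  proof
    fix i :: nat
    have "1 / real (Suc i) > 0" by simp
    then show "\<exists>s\<in>{0..S}. ennreal c \<le> m (B \<inter> {x. \<bar>h x - s\<bar> \<le> 1 / real (Suc i)})"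
      using neg by (meson not_less)
  qed
  then obtain s where s: "\<And>i::nat. s i \<in> {0..S}"
      "\<And>i. ennreal c \<le> m (B \<inter> {x. \<bar>h x - s i\<bar> \<le> 1 / real (Suc i)})" by metis
  obtain l \<sigma> where l: "strict_mono (\<sigma> :: nat \<Rightarrow> nat)" "(s \<circ> \<sigma>) \<longlonglongrightarrow> l"
    using compact_Icc[of 0 S] s(1) unfolding compact_eq_seq_compact_metric seq_compact_def by metis
  have big: "ennreal c \<le> m (B \<inter> {x. \<bar>h x - l\<bar> \<le> z})" if z: "z > 0" for z
  proof -
    have "\<forall>\<^sub>F i in sequentially. \<bar>s (\<sigma> i) - l\<bar> < z / 2"
      using tendstoD[OF l(2), of "z / 2"] z by (simp add: dist_real_def)
    moreover have "\<forall>\<^sub>F i in sequentially. 1 / real (Suc i) < z / 2"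
      using order_tendstoD(2)[OF LIMSEQ_inverse_real_of_nat, of "z / 2"] z by (simp add: inverse_eq_divide)
    ultimately have "\<forall>\<^sub>F i in sequentially. \<bar>s (\<sigma> i) - l\<bar> < z / 2 \<and> 1 / real (Suc i) < z / 2"
      by (rule eventually_conj)
    then obtain i where i: "\<bar>s (\<sigma> i) - l\<bar> < z / 2" "1 / real (Suc i) < z / 2"
      using eventually_happens'[OF sequentially_bot] by fast
    have "1 / real (Suc (\<sigma> i)) \<le> 1 / real (Suc i)"
      using seq_suble[OF l(1), of i] by (intro divide_left_mono) auto
    then have "B \<inter> {x. \<bar>h x - s (\<sigma> i)\<bar> \<le> 1 / real (Suc (\<sigma> i))} \<subseteq> B \<inter> {x. \<bar>h x - l\<bar> \<le> z}"
    proof safe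
      fix x1 x2 assume "\<bar>h (x1, x2) - s (\<sigma> i)\<bar> \<le> 1 / real (Suc (\<sigma> i))"
      then show "\<bar>h (x1, x2) - l\<bar> \<le> z" using i \<open>1 / real (Suc (\<sigma> i)) \<le> 1 / real (Suc i)\<close> by linarith
    qed
    then show ?thesis using s(2)[of "\<sigma> i"] m_mono[OF bbB bbB] by (meson order_trans)
  qed
  define E where "E i = {\<xi>\<in>space P. \<xi> \<inter> (B \<inter> {x. \<bar>h x - l\<bar> \<le> 1 / real (Suc i)}) \<noteq> {}}" for i
  have E: "range E \<subseteq> sets P" using hit_sets[OF bbB] by (auto simp: E_def)
  have "decseq E"
  proof (rule decseq_SucI)
    fix i
    have "1 / real (Suc (Suc i)) \<le> 1 / real (Suc i)" by (intro divide_left_mono) auto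
    then show "E (Suc i) \<subseteq> E i" unfolding E_def by (auto intro: order_trans)
  qed
  then have "(\<lambda>i. prob (E i)) \<longlonglongrightarrow> prob (\<Inter>i. E i)" by (rule finite_Lim_measure_decseq[OF E])
  moreover have "1 - exp (- c) \<le> prob (E i)" for i
  proof -
    have "c \<le> enn2real (m (B \<inter> {x. \<bar>h x - l\<bar> \<le> 1 / real (Suc i)}))"
      using big[of "1 / real (Suc i)"] finite_m[OF bbB] c
      by (metis enn2real_ennreal enn2real_mono infinity_ennreal_def less_imp_le of_nat_0_less_iff zero_less_Suc zero_less_divide_1_iff)
    then show ?thesis unfolding E_def prob_hit[OF bbB] by simp
  qed
  ultimately have "1 - exp (- c) \<le> prob (\<Inter>i. E i)" by (intro LIMSEQ_le_const) auto
  moreover have "prob (\<Inter>i. E i) \<le> prob {\<xi>\<in>space P. \<xi> \<inter> (B \<inter> {x. h x = l}) \<noteq> {}}"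
  proof (rule finite_measure_mono)
    have "B \<inter> {x. h x = l} = B \<inter> {x. \<bar>h x - l\<bar> \<le> 0}" by auto
    then show "{\<xi>\<in>space P. \<xi> \<inter> (B \<inter> {x. h x = l}) \<noteq> {}} \<in> events" using hit_sets[OF bbB[of l 0]] by simp
    show "(\<Inter>i. E i) \<subseteq> {\<xi>\<in>space P. \<xi> \<inter> (B \<inter> {x. h x = l}) \<noteq> {}}"
    proof
      fix \<xi> assume \<xi>: "\<xi> \<in> (\<Inter>i. E i)"
      then have sp: "\<xi> \<in> space P" by (auto simp: E_def)
      have fin: "finite (\<xi> \<inter> B)" using sp B by (auto simp: bb_def intro: finite_points)
      have ex: "\<exists>x\<in>\<xi> \<inter> B. \<bar>h x - l\<bar> \<le> 1 / real (Suc i)" for i using \<xi> by (fastforce simp: E_def)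
      define d where "d = Min ((\<lambda>x. \<bar>h x - l\<bar>) ` (\<xi> \<inter> B))"
      have ne: "\<xi> \<inter> B \<noteq> {}" using ex by blast
      have "d \<in> (\<lambda>x. \<bar>h x - l\<bar>) ` (\<xi> \<inter> B)" unfolding d_def using fin ne by (intro Min_in) auto
      then obtain x where x: "x \<in> \<xi> \<inter> B" "d = \<bar>h x - l\<bar>" by blast
      have "d \<le> 1 / real (Suc i)" for i
      proof -
        obtain y where y: "y \<in> \<xi> \<inter> B" "\<bar>h y - l\<bar> \<le> 1 / real (Suc i)" using ex by blast
        have "d \<le> \<bar>h y - l\<bar>" unfolding d_def using fin y by (intro Min_le) auto
        then show ?thesis using y by simp
      qed
      then have "d \<le> 0" using LIMSEQ_inverse_real_of_nat
        by (intro LIMSEQ_le_const[of "\<lambda>i. 1 / real (Suc i)"]) (auto simp: inverse_eq_divide)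
      then have "h x = l" using x by simp
      then show "\<xi> \<in> {\<xi>\<in>space P. \<xi> \<inter> (B \<inter> {x. h x = l}) \<noteq> {}}" using x(1) sp by blast
    qed
  qed
  moreover have "bb (B \<inter> {x. h x = l})"
  proof -
    have "B \<inter> {x. h x = l} = B \<inter> {x. \<bar>h x - l\<bar> \<le> 0}" by auto
    then show ?thesis using bbB[of l 0] by simp
  qed
  then have "prob {\<xi>\<in>space P. \<xi> \<inter> (B \<inter> {x. h x = l}) \<noteq> {}} = 0" using prob_hit null by simp
  moreover have "exp (- c) < 1" using c by simp
  ultimately show False by linarith
qed

text \<open>Cut B2 into slabs on which \<open>h2\<close> varies by less than d. A point of a slab
  leaves its partner only a thin shell of B1, and by independence on disjoint sets the expected
  number of such pairs is at most the sum of the products of masses, hence at most c' times the mass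
  of B2.\<close>

lemma generic_pair:
  fixes h1 h2 :: "point \<Rightarrow> real"
  assumes B: "bb B1" "bb B2" "B1 \<inter> B2 = {}" and a: "0 < a"
    and h: "h1 \<in> borel_measurable borel" "h2 \<in> borel_measurable borel"
    and range: "\<And>x. x \<in> B2 \<Longrightarrow> 0 \<le> h2 x \<and> h2 x < S"
    and null: "\<And>s. m (B1 \<inter> {x. h1 x = s}) = 0"
  shows "AE \<xi> in P. \<xi> \<notin> {\<xi>. \<exists>x\<in>\<xi> \<inter> B1. \<exists>y\<in>\<xi> \<inter> B2. h1 x = a * h2 y}"
proof (rule AE_notI_small)
  fix c :: real assume c: "c > 0"
  define M where "M = enn2real (m B2)"
  have M: "0 \<le> M" "m B2 = ennreal M" using finite_m[OF B(2)] by (auto simp: M_def)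
  define c' where "c' = c / (M + 1)"
  have c': "0 < c'" using c M by (simp add: c'_def)
  obtain z where z: "z > 0" "\<And>s. s \<in> {0..a * S} \<Longrightarrow> m (B1 \<inter> {x. \<bar>h1 x - s\<bar> \<le> z}) < ennreal c'"
    using thin[OF B(1) h(1) null c'] by blast
  \<comment> \<open>A variation d of \<open>h2\<close> means a variation a d = z of a times
    \<open>h2\<close>, the half-width of the shells.\<close>
  define d where "d = z / a"
  have d: "d > 0" using z a by (simp add: d_def)
  define K where "K = nat \<lceil>S / d\<rceil>"
  define R where "R k = B2 \<inter> {y. real k * d \<le> h2 y \<and> h2 y < real (Suc k) * d}" for k
  \<comment> \<open>The minimum keeps the radius at most a S, so that the choice of z applies when S
    > 0; for slabs that occur it changes nothing.\<close>
  define T where "T k = B1 \<inter> {x. \<bar>h1 x - min (a * S) (a * (real k * d))\<bar> \<le> z}" for k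
  have RT: "bb (R k)" "bb (T k)" for k
  proof -
    have "{y. real k * d \<le> h2 y \<and> h2 y < real (Suc k) * d} \<in> sets borel" using h by measurable
    moreover have "{x. \<bar>h1 x - min (a * S) (a * (real k * d))\<bar> \<le> z} \<in> sets borel" using h by measurable
    ultimately show "bb (R k)" "bb (T k)"
      using B by (auto simp: bb_def R_def T_def intro: bounded_subset)
  qed
  define A where "A = (\<Union>k<K. {\<xi>\<in>space P. \<xi> \<inter> T k \<noteq> {}} \<inter> {\<xi>\<in>space P. \<xi> \<inter> R k \<noteq> {}})"
  have A: "A \<in> sets P" unfolding A_def by (intro sets.finite_UN sets.Int hit_sets RT) auto
  moreover have "{\<xi>. \<exists>x\<in>\<xi> \<inter> B1. \<exists>y\<in>\<xi> \<inter> B2. h1 x = a * h2 y} \<inter> space P \<subseteq> A"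
  proof safe
    fix \<xi> x1 x2 y1 y2 assume \<xi>: "\<xi> \<in> space P" "(x1, x2) \<in> \<xi>" "(x1, x2) \<in> B1" "(y1, y2) \<in> \<xi>" "(y1, y2) \<in> B2"
      and eq: "h1 (x1, x2) = a * h2 (y1, y2)"
    define x y where "x = (x1, x2)" and "y = (y1, y2)"
    have y: "0 \<le> h2 y" "h2 y < S" using range \<xi> by (auto simp: y_def)
    define k where "k = nat \<lfloor>h2 y / d\<rfloor>"
    have k: "real k = of_int \<lfloor>h2 y / d\<rfloor>" using y d by (simp add: k_def)
    have kd: "real k * d \<le> h2 y" "h2 y < real (Suc k) * d"
    proof -
      have "real k \<le> h2 y / d" "h2 y / d < real k + 1" unfolding k by linarith+
      then show "real k * d \<le> h2 y" "h2 y < real (Suc k) * d" using d by (simp_all add: field_simps)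
    qed
    have "real k * d < S" using kd y by simp
    then have "real k < S / d" using d by (simp add: field_simps)
    then have "k < K" unfolding K_def by linarith
    have kS: "min (a * S) (a * (real k * d)) = a * (real k * d)"
      using \<open>real k * d < S\<close> a by (intro min_absorb2 mult_left_mono) auto
    have "\<bar>h1 x - a * (real k * d)\<bar> \<le> z"
    proof -
      have "h1 x - a * (real k * d) = a * (h2 y - real k * d)" using eq by (simp add: x_def y_def algebra_simps)
      moreover have "0 \<le> a * (h2 y - real k * d)" using a kd by simp
      moreover have "h2 y - real k * d \<le> d" using kd by (simp add: algebra_simps)
      then have "a * (h2 y - real k * d) \<le> a * d" using a by (intro mult_left_mono) auto
      ultimately show ?thesis using a by (simp add: d_def)
    qed
    then have "x \<in> T k" "y \<in> R k" using \<xi> kS kd by (auto simp: T_def R_def x_def y_def)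
    then show "\<xi> \<in> A" using \<open>k < K\<close> \<xi> unfolding A_def x_def y_def by blast
  qed
  moreover have "emeasure P A \<le> ennreal c"
  proof -
    have "emeasure P ({\<xi>\<in>space P. \<xi> \<inter> T k \<noteq> {}} \<inter> {\<xi>\<in>space P. \<xi> \<inter> R k \<noteq> {}}) \<le> m (T k) * m (R k)" for k
    proof -
      define B' where "B' b = (if b then T k else R k)" for b :: bool
      have "emeasure P ({\<xi>\<in>space P. \<xi> \<inter> T k \<noteq> {}} \<inter> {\<xi>\<in>space P. \<xi> \<inter> R k \<noteq> {}}) =
          (\<integral>\<^sup>+\<xi>. indicator ({\<xi>\<in>space P. \<xi> \<inter> T k \<noteq> {}} \<inter> {\<xi>\<in>space P. \<xi> \<inter> R k \<noteq> {}}) \<xi> \<partial>P)"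
        using hit_sets RT by (intro nn_integral_indicator[symmetric]) auto
      also have "\<dots> \<le> (\<integral>\<^sup>+\<xi>. (\<Prod>b\<in>UNIV. of_nat (card (\<xi> \<inter> B' b))) \<partial>P)"
      proof (rule nn_integral_mono)
        fix \<xi> assume \<xi>: "\<xi> \<in> space P"
        have "1 \<le> (of_nat (card (\<xi> \<inter> X)) :: ennreal)" if "bb X" "\<xi> \<inter> X \<noteq> {}" for X
        proof -
          have "0 < card (\<xi> \<inter> X)" using that finite_points[OF \<xi>] by (simp add: bb_def card_gt_0_iff)
          then have "of_nat 1 \<le> (of_nat (card (\<xi> \<inter> X)) :: ennreal)" by (intro of_nat_mono) simp
          then show ?thesis by simp
        qed
        then have "indicator ({\<xi>\<in>space P. \<xi> \<inter> T k \<noteq> {}} \<inter> {\<xi>\<in>space P. \<xi> \<inter> R k \<noteq> {}}) \<xi> \<le>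
            (of_nat (card (\<xi> \<inter> T k)) * of_nat (card (\<xi> \<inter> R k)) :: ennreal)"
          using RT mult_mono[of 1 "of_nat (card (\<xi> \<inter> T k)) :: ennreal" 1 "of_nat (card (\<xi> \<inter> R k))"]
          by (auto simp: indicator_def)
        then show "indicator ({\<xi>\<in>space P. \<xi> \<inter> T k \<noteq> {}} \<inter> {\<xi>\<in>space P. \<xi> \<inter> R k \<noteq> {}}) \<xi> \<le>
            (\<Prod>b\<in>UNIV. of_nat (card (\<xi> \<inter> B' b)) :: ennreal)"
          by (simp add: UNIV_bool B'_def mult.commute)
      qed
      also have "\<dots> = (\<Prod>b\<in>UNIV. m (B' b))"
        using B(3) RT by (intro mean_prod) (auto simp: B'_def disjoint_family_on_def T_def R_def split: if_splits)
      also have "\<dots> = m (T k) * m (R k)" by (simp add: UNIV_bool B'_def mult.commute)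
      finally show ?thesis .
    qed
    moreover have "m (T k) \<le> ennreal c'" if k: "k < K" for k
    proof -
      have "0 < S"
      proof (rule ccontr)
        assume "\<not> 0 < S"
        then have "S / d \<le> 0" using d by (simp add: divide_le_0_iff)
        then have "K = 0" by (simp add: K_def)
        then show False using k by simp
      qed
      then have "min (a * S) (a * (real k * d)) \<in> {0..a * S}" using a d by auto
      then show ?thesis unfolding T_def by (intro less_imp_le z(2))
    qed
    ultimately have le: "emeasure P ({\<xi>\<in>space P. \<xi> \<inter> T k \<noteq> {}} \<inter> {\<xi>\<in>space P. \<xi> \<inter> R k \<noteq> {}}) \<le> ennreal c' * m (R k)"
      if "k < K" for k
      using that by (meson mult_right_mono order_trans zero_le)
    have "emeasure P A \<le> (\<Sum>k<K. emeasure P ({\<xi>\<in>space P. \<xi> \<inter> T k \<noteq> {}} \<inter> {\<xi>\<in>space P. \<xi> \<inter> R k \<noteq> {}}))"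
      unfolding A_def using hit_sets RT by (intro emeasure_subadditive_finite) auto
    also have "\<dots> \<le> (\<Sum>k<K. ennreal c' * m (R k))" by (intro sum_mono le) simp
    also have "\<dots> = ennreal c' * (\<Sum>k<K. m (R k))" by (simp add: sum_distrib_left)
    also have "\<dots> \<le> ennreal c' * m B2"
    proof (intro mult_left_mono m_sum_disjoint RT B)
      show "disjoint_family_on R {..<K}"
        unfolding disjoint_family_on_def
      proof (intro ballI impI, rule ccontr)
        fix k l assume "k \<noteq> l" "R k \<inter> R l \<noteq> {}"
        then obtain y where "real k * d \<le> h2 y" "h2 y < real (Suc k) * d" "real l * d \<le> h2 y" "h2 y < real (Suc l) * d"
          by (auto simp: R_def)
        then have "real k * d < real (Suc l) * d" "real l * d < real (Suc k) * d" by linarith+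
        then have "real k < real (Suc l)" "real l < real (Suc k)" using d by (simp_all only: mult_less_cancel_right_pos)
        then show False using \<open>k \<noteq> l\<close> by simp
      qed
    qed (auto simp: R_def)
    also have "\<dots> = ennreal (c' * M)" using M c' by (simp add: ennreal_mult)
    also have "\<dots> \<le> ennreal c"
    proof (rule ennreal_leI)
      have "c' * M \<le> c' * (M + 1)" using c' by (intro mult_left_mono) auto
      also have "\<dots> = c" using M by (simp add: c'_def)
      finally show "c' * M \<le> c" .
    qed
    finally show ?thesis .
  qed
  ultimately show "\<exists>A\<in>sets P. {\<xi>. \<exists>x\<in>\<xi> \<inter> B1. \<exists>y\<in>\<xi> \<inter> B2. h1 x = a * h2 y} \<inter> space P \<subseteq> A \<and> emeasure P A \<le> ennreal c"
    by blast
qed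

end

section \<open>Device positions and velocities in general position\<close>

lemma len_mono: "A \<subseteq> B \<Longrightarrow> len A \<le> len B"
  unfolding len_def by (intro SUP_mono' INF_superset_mono) auto

lemma len_finite:
  assumes "finite A"
  shows "len A = 0"
proof -
  have "len A \<le> ennreal 0"
    unfolding len_def
  proof (rule SUP_least)
    fix d :: real assume d: "d \<in> {0<..}"
    obtain h where h: "bij_betw h {0..<card A} A" using ex_bij_betw_nat_finite[OF assms] by blast
    define U where "U i = (if i < card A then {h i} else {})" for i
    have A: "A \<subseteq> (\<Union>i. U i)"
    proof
      fix x assume "x \<in> A"
      then have "x \<in> h ` {0..<card A}" using h by (simp add: bij_betw_imp_surj_on)
      then show "x \<in> (\<Union>i. U i)" by (force simp: U_def)
    qed
    have U0: "diameter (U i) = 0" "bounded (U i)" for i by (auto simp: U_def)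
    have "(INF U\<in>{U :: nat \<Rightarrow> point set. A \<subseteq> (\<Union>i. U i) \<and> (\<forall>i. bounded (U i) \<and> diameter (U i) \<le> d)}.
       \<Sum>i. ennreal (diameter (U i))) \<le> (\<Sum>i. ennreal (diameter (U i)))"
      using d A by (intro INF_lower) (auto simp: U0)
    then show "(INF U\<in>{U :: nat \<Rightarrow> point set. A \<subseteq> (\<Union>i. U i) \<and> (\<forall>i. bounded (U i) \<and> diameter (U i) \<le> d)}.
       \<Sum>i. ennreal (diameter (U i))) \<le> ennreal 0" by (simp add: U0)
  qed
  then show ?thesis by simp
qed

text \<open>Of three points on a line one lies strictly between the others and is strictly closer to
  p than one of them. So a segment meets a sphere at most twice.\<close>

lemma finite_segment_sphere:
  fixes a b p :: "'a::euclidean_space"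
  shows "finite (closed_segment a b \<inter> {x. dist x p = s})"
proof (rule ccontr)
  assume "infinite (closed_segment a b \<inter> {x. dist x p = s})" (is "infinite ?S")
  then obtain T where T: "T \<subseteq> ?S" "finite T" "card T = 3" using infinite_arbitrarily_large by metis
  then obtain x y z where xyz: "T = {x, y, z}" "x \<noteq> y" "x \<noteq> z" "y \<noteq> z" by (auto simp: card_3_iff)
  have "collinear T" using T(1) collinear_closed_segment collinear_subset by blast
  then have "collinear {x, y, z}" by (simp add: xyz)
  moreover have False if "u \<in> open_segment v w" "u \<in> T" "v \<in> T" "w \<in> T" for u v w
  proof -
    have "dist p u = s" "dist p v = s" "dist p w = s" using that(2-) T(1) by (auto simp: dist_commute)
    then show False using dist_decreases_open_segment[OF that(1), of p] by simp
  qed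
  ultimately show False
    unfolding collinear_between_cases between_mem_segment
    using xyz by (metis closed_segment_commute insertI1 insertI2 insert_iff open_segment_def DiffI empty_iff)
qed

lemma finite_streets_sphere:
  assumes \<phi>: "\<phi> \<in> street_configs" and B: "bounded B"
  shows "finite (\<Union>\<phi> \<inter> (B \<inter> {x. dist x p = s}))"
proof (rule finite_subset)
  show "\<Union>\<phi> \<inter> (B \<inter> {x. dist x p = s}) \<subseteq> (\<Union>t\<in>{t\<in>\<phi>. t \<inter> B \<noteq> {}}. t \<inter> {x. dist x p = s})" by blast
  have "finite (t \<inter> {x. dist x p = s})" if "t \<in> \<phi>" for t
    using street_configs_segment[OF \<phi> that] finite_segment_sphere by metis
  then show "finite (\<Union>t\<in>{t\<in>\<phi>. t \<inter> B \<noteq> {}}. t \<inter> {x. dist x p = s})"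
    using street_configs_finite[OF \<phi> B] by (intro finite_UN_I) auto
qed

lemma countable_irregular:
  assumes "\<phi> \<in> street_configs"
  shows "countable (irregular (\<Union>\<phi>))"
proof -
  have "irregular (\<Union>\<phi>) \<subseteq> (\<Union>i::nat. irregular (\<Union>\<phi>) \<inter> cball 0 (real i))"
  proof
    fix p assume p: "p \<in> irregular (\<Union>\<phi>)"
    obtain i :: nat where "norm p \<le> real i" using real_arch_simple by blast
    then show "p \<in> (\<Union>i::nat. irregular (\<Union>\<phi>) \<inter> cball 0 (real i))" using p by auto
  qed
  moreover have "countable (\<Union>i::nat. irregular (\<Union>\<phi>) \<inter> cball 0 (real i))"
    by (rule countable_UN) (auto intro!: countable_finite finite_irregular assms)
  ultimately show ?thesis by (rule countable_subset)
qed

lemma countable_config: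
  assumes "\<xi> \<in> point_configs"
  shows "countable \<xi>"
proof -
  have "\<xi> = (\<Union>i::nat. \<xi> \<inter> cball 0 (real i))"
  proof (intro equalityI subsetI)
    fix p assume p: "p \<in> \<xi>"
    obtain i :: nat where "norm p \<le> real i" using real_arch_simple by blast
    then show "p \<in> (\<Union>i::nat. \<xi> \<inter> cball 0 (real i))" using p by auto
  qed auto
  moreover have "countable (\<Union>i::nat. \<xi> \<inter> cball 0 (real i))"
    by (rule countable_UN) (use assms in \<open>auto intro!: countable_finite simp: point_configs_def\<close>)
  ultimately show ?thesis by simp
qed

locale street_poisson = poisson "\<lambda>A. ennreal l * len (\<Union>\<phi> \<inter> A)" P
  for l :: real and \<phi> :: streets and P :: "point set measure" +
  assumes config: "\<phi> \<in> street_configs"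
begin

lemma AE_on_streets: "AE \<xi> in P. \<xi> \<subseteq> \<Union>\<phi>"
proof -
  have "AE \<xi> in P. \<xi> \<inter> (cball 0 (real i) - \<Union>\<phi>) = {}" for i :: nat
  proof (rule null_imp_avoid)
    show "bb (cball 0 (real i) - \<Union>\<phi>)"
      using closed_streets[OF config] by (simp add: bb_def bounded_diff)
    show "ennreal l * len (\<Union>\<phi> \<inter> (cball 0 (real i) - \<Union>\<phi>)) = 0" by (simp add: len_finite Int_Diff)
  qed
  then have "AE \<xi> in P. \<forall>i::nat. \<xi> \<inter> (cball 0 (real i) - \<Union>\<phi>) = {}" by (simp add: AE_all_countable)
  then show ?thesis
  proof eventually_elim
    case (elim \<xi>)
    show ?case
    proof
      fix p assume p: "p \<in> \<xi>"
      obtain i :: nat where "norm p \<le> real i" using real_arch_simple by blast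
      then have "p \<in> cball 0 (real i)" by simp
      then show "p \<in> \<Union>\<phi>" using elim[rule_format, of i] p by blast
    qed
  qed
qed

lemma AE_regular: "AE \<xi> in P. \<xi> \<inter> irregular (\<Union>\<phi>) = {}"
proof -
  have "AE \<xi> in P. \<forall>p\<in>irregular (\<Union>\<phi>). \<xi> \<inter> {p} = {}"
  proof (subst AE_ball_countable[OF countable_irregular[OF config]], intro ballI null_imp_avoid)
    fix p
    show "bb {p}" by (simp add: bb_def)
    show "ennreal l * len (\<Union>\<phi> \<inter> {p}) = 0" by (simp add: len_finite)
  qed
  then show ?thesis by eventually_elim blast
qed

lemma sphere_null: "bounded B \<Longrightarrow> ennreal l * len (\<Union>\<phi> \<inter> (B \<inter> {x. dist x p = s})) = 0"
  using finite_streets_sphere[OF config] by (simp add: len_finite)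

text \<open>A ratio of velocities has at most countably many atoms. Those atoms are excluded as ratios
  of distances by the positions; every other ratio is excluded by the velocities.\<close>

lemma AE_generic:
  assumes A: "countable A" "\<And>a. a \<in> A \<Longrightarrow> 0 < a"
  shows "AE \<xi> in P. \<forall>x\<in>\<xi>. \<forall>y\<in>\<xi>. x \<noteq> y \<longrightarrow> (\<forall>p\<in>irregular (\<Union>\<phi>). \<forall>q\<in>irregular (\<Union>\<phi>). \<forall>a\<in>A. dist x p \<noteq> a * dist y q)"
proof -
  define B where "B p = cbox (fst p) (snd p)" for p :: "point \<times> point"
  have one: "AE \<xi> in P. \<xi> \<notin> {\<xi>. \<exists>x\<in>\<xi> \<inter> B b. \<exists>y\<in>\<xi> \<inter> B b'. dist x p = a * dist y q}"
    if "B b \<inter> B b' = {}" "a \<in> A" for b b' p q a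
  proof -
    have "bounded (B b')" by (simp add: B_def)
    then obtain S where S: "\<And>x. x \<in> B b' \<Longrightarrow> dist q x \<le> S" unfolding bounded_any_center[of _ q] by metis
    show ?thesis
    proof (rule generic_pair[where S = "S + 1"])
      show "bb (B b)" "bb (B b')" by (auto simp: bb_def B_def)
      show "B b \<inter> B b' = {}" "0 < a" using that A by auto
      show "0 \<le> dist x q \<and> dist x q < S + 1" if "x \<in> B b'" for x
        using S[OF that] by (simp add: dist_commute)
      show "ennreal l * len (\<Union>\<phi> \<inter> (B b \<inter> {x. dist x p = s})) = 0" for s
        by (rule sphere_null) (simp add: B_def)
    qed (auto intro!: borel_measurable_continuous_onI continuous_intros)
  qed
  \<comment> \<open>Distinct points have disjoint rational boxes around them, so countably many
    pairs of boxes suffice.\<close>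
  define I where "I = {(b, b')\<in>rat_boxes \<times> rat_boxes. B b \<inter> B b' = {}}"
  have "countable I" unfolding I_def by (rule countable_subset[of _ "rat_boxes \<times> rat_boxes"]) auto
  then have "AE \<xi> in P. \<forall>bb\<in>I. \<forall>p\<in>irregular (\<Union>\<phi>). \<forall>q\<in>irregular (\<Union>\<phi>). \<forall>a\<in>A.
      \<xi> \<notin> {\<xi>. \<exists>x\<in>\<xi> \<inter> B (fst bb). \<exists>y\<in>\<xi> \<inter> B (snd bb). dist x p = a * dist y q}"
    using one by (simp add: AE_ball_countable countable_irregular[OF config] A(1)) (auto simp: I_def)
  then show ?thesis
  proof eventually_elim
    case (elim \<xi>)
    show ?case
    proof (intro ballI impI notI)
      fix x y p q a assume h: "x \<in> \<xi>" "y \<in> \<xi>" "x \<noteq> y" "p \<in> irregular (\<Union>\<phi>)" "q \<in> irregular (\<Union>\<phi>)" "a \<in> A"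
        and eq: "dist x p = a * dist y q"
      have d: "dist x y / 2 > 0" using h by simp
      obtain b c where bc: "(b, c) \<in> rat_boxes" "x \<in> box b c" "cbox b c \<subseteq> ball x (dist x y / 2)"
        by (rule rat_box_near[OF d])
      obtain b' c' where bc': "(b', c') \<in> rat_boxes" "y \<in> box b' c'" "cbox b' c' \<subseteq> ball y (dist x y / 2)"
        by (rule rat_box_near[OF d])
      have "ball x (dist x y / 2) \<inter> ball y (dist x y / 2) = {}" by (rule disjoint_ballI) simp
      then have "((b, c), (b', c')) \<in> I" using bc bc' by (auto simp: I_def B_def)
      moreover have "x \<in> B (b, c)" "y \<in> B (b', c')" using bc(2) bc'(2) box_subset_cbox by (auto simp: B_def)
      ultimately show False using elim h eq by force
    qed
  qed
qed

end

section \<open>Product laws of targets and velocities\<close>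

lemma prob_pair_snd:
  assumes "prob_space N" "prob_space \<mu>" "J \<in> sets \<mu>"
  shows "emeasure (N \<Otimes>\<^sub>M \<mu>) (space N \<times> J) = emeasure \<mu> J"
proof -
  interpret N: prob_space N by fact
  interpret \<mu>: prob_space \<mu> by fact
  show ?thesis using assms(3) by (simp add: \<mu>.emeasure_pair_measure_Times N.emeasure_space_1)
qed

text \<open>Union bound over the functions that choose a witness in each S i. By \<open>dis\<close>
  different indices use different coordinates, so the measure of a cylinder is a product, and the
  sum over all choices of these products is a product of sums.\<close>

lemma PiM_union_bound:
  fixes N :: "'x \<Rightarrow> 'a measure" and S :: "'i \<Rightarrow> ('k \<times> 'x) set"
  assumes prob: "\<And>x. x \<in> \<xi> \<Longrightarrow> prob_space (N x)" and I: "finite I"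
    and S: "\<And>i. i \<in> I \<Longrightarrow> finite (S i)" "\<And>i s. i \<in> I \<Longrightarrow> s \<in> S i \<Longrightarrow> snd s \<in> \<xi> \<and> A i s \<in> sets (N (snd s))"
    and dis: "\<And>i j s t. i \<in> I \<Longrightarrow> j \<in> I \<Longrightarrow> s \<in> S i \<Longrightarrow> t \<in> S j \<Longrightarrow> snd s = snd t \<Longrightarrow> i = j"
  shows "\<exists>X\<in>sets (PiM \<xi> N). {w\<in>space (PiM \<xi> N). \<forall>i\<in>I. \<exists>s\<in>S i. w (snd s) \<in> A i s} \<subseteq> X \<and>
     emeasure (PiM \<xi> N) X \<le> (\<Prod>i\<in>I. \<Sum>s\<in>S i. emeasure (N (snd s)) (A i s))"
proof -
  \<comment> \<open>The cylinder of the choice f. The inverse function recovers from a coordinate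
    the index whose constraint applies to it.\<close>
  define X where "X f = prod_emb \<xi> N ((\<lambda>i. snd (f i)) ` I)
      (Pi\<^sub>E ((\<lambda>i. snd (f i)) ` I) (\<lambda>x. A (the_inv_into I (\<lambda>i. snd (f i)) x) (f (the_inv_into I (\<lambda>i. snd (f i)) x))))" for f
  have f: "inj_on (\<lambda>i. snd (f i)) I" "\<And>i. i \<in> I \<Longrightarrow> f i \<in> S i"
      "\<And>i. i \<in> I \<Longrightarrow> the_inv_into I (\<lambda>i. snd (f i)) (snd (f i)) = i"
      "\<And>i. i \<in> I \<Longrightarrow> snd (f i) \<in> \<xi>" "\<And>i. i \<in> I \<Longrightarrow> A i (f i) \<in> sets (N (snd (f i)))" if "f \<in> Pi\<^sub>E I S" for f
  proof -
    show f: "\<And>i. i \<in> I \<Longrightarrow> f i \<in> S i" using that by auto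
    show "\<And>i. i \<in> I \<Longrightarrow> snd (f i) \<in> \<xi>" "\<And>i. i \<in> I \<Longrightarrow> A i (f i) \<in> sets (N (snd (f i)))"
      using S(2) f by blast+
    show inj: "inj_on (\<lambda>i. snd (f i)) I"
    proof (rule inj_onI)
      fix i j assume "i \<in> I" "j \<in> I" "snd (f i) = snd (f j)"
      then show "i = j" using dis[of i j "f i" "f j"] f by blast
    qed
    show "\<And>i. i \<in> I \<Longrightarrow> the_inv_into I (\<lambda>i. snd (f i)) (snd (f i)) = i"
      by (rule the_inv_into_f_f[OF inj])
  qed
  have fin: "finite (Pi\<^sub>E I S)" using I S by (intro finite_PiE) auto
  have Xs: "X f \<in> sets (PiM \<xi> N)" if "f \<in> Pi\<^sub>E I S" for f
    unfolding X_def using I f[OF that] by (intro sets_PiM_I) auto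
  have Xe: "emeasure (PiM \<xi> N) (X f) = (\<Prod>i\<in>I. emeasure (N (snd (f i))) (A i (f i)))" if "f \<in> Pi\<^sub>E I S" for f
  proof -
    have "emeasure (PiM \<xi> N) (X f) = (\<Prod>x\<in>(\<lambda>i. snd (f i)) ` I. emeasure (N x)
        (A (the_inv_into I (\<lambda>i. snd (f i)) x) (f (the_inv_into I (\<lambda>i. snd (f i)) x))))"
      unfolding X_def using I f[OF that] prob by (intro emeasure_PiM_emb) auto
    also have "\<dots> = (\<Prod>i\<in>I. emeasure (N (snd (f i))) (A i (f i)))"
      using f[OF that] by (simp add: prod.reindex cong: prod.cong)
    finally show ?thesis .
  qed
  have sub: "{w\<in>space (PiM \<xi> N). \<forall>i\<in>I. \<exists>s\<in>S i. w (snd s) \<in> A i s} \<subseteq> (\<Union>f\<in>Pi\<^sub>E I S. X f)"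
  proof
    fix w assume w: "w \<in> {w\<in>space (PiM \<xi> N). \<forall>i\<in>I. \<exists>s\<in>S i. w (snd s) \<in> A i s}"
    then obtain f0 where f0: "\<And>i. i \<in> I \<Longrightarrow> f0 i \<in> S i \<and> w (snd (f0 i)) \<in> A i (f0 i)" by (auto; metis)
    define g where "g = restrict f0 I"
    have g: "g \<in> Pi\<^sub>E I S" using f0 by (auto simp: g_def)
    have "w \<in> X g"
      unfolding X_def prod_emb_def using w f0 f[OF g]
      by (auto simp: space_PiM g_def PiE_iff)
    then show "w \<in> (\<Union>f\<in>Pi\<^sub>E I S. X f)" using g by blast
  qed
  have "emeasure (PiM \<xi> N) (\<Union>f\<in>Pi\<^sub>E I S. X f) \<le> (\<Sum>f\<in>Pi\<^sub>E I S. emeasure (PiM \<xi> N) (X f))"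
    using Xs fin by (intro emeasure_subadditive_finite) auto
  also have "\<dots> = (\<Sum>f\<in>Pi\<^sub>E I S. \<Prod>i\<in>I. emeasure (N (snd (f i))) (A i (f i)))"
    using Xe by simp
  also have "\<dots> = (\<Prod>i\<in>I. \<Sum>s\<in>S i. emeasure (N (snd s)) (A i s))"
    using I S(1) by (intro prod_sum_PiE[symmetric]) auto
  finally show ?thesis using sub Xs fin by (intro bexI[of _ "\<Union>f\<in>Pi\<^sub>E I S. X f"]) auto
qed

text \<open>The velocities of two different devices have the joint law \<mu> \<otimes> \<mu>,
  checked on rectangles, and a is not an atom of the ratio under this law.\<close>

lemma AE_velocity_ratio:
  fixes N :: "'x \<Rightarrow> ('a \<times> real) measure"
  assumes N: "\<And>x. x \<in> \<xi> \<Longrightarrow> \<exists>K. prob_space K \<and> N x = K \<Otimes>\<^sub>M \<mu>" and \<mu>: "prob_space \<mu>" "sets \<mu> = sets borel"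
    and xy: "x \<in> \<xi>" "y \<in> \<xi>" "x \<noteq> y"
    and a: "measure (distr (\<mu> \<Otimes>\<^sub>M \<mu>) borel (\<lambda>(v, v'). v / v')) {a} = 0"
  shows "AE w in PiM \<xi> N. snd (w x) / snd (w y) \<noteq> a"
proof -
  interpret \<mu>: prob_space \<mu> by fact
  interpret pair_prob_space \<mu> \<mu> ..
  have [measurable_cong]: "sets \<mu> = sets borel" by fact
  have prob: "prob_space (N z)" if z: "z \<in> \<xi>" for z
  proof -
    obtain K where K: "prob_space K" "N z = K \<Otimes>\<^sub>M \<mu>" using N[OF z] by blast
    interpret K: prob_space K by fact
    interpret K\<mu>: pair_prob_space K \<mu> ..
    show ?thesis unfolding K(2) by unfold_locales
  qed
  define h where "h w = (snd (w x), snd (w y))" for w :: "'x \<Rightarrow> 'a \<times> real"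
  have comp: "(\<lambda>w. snd (w z)) \<in> PiM \<xi> N \<rightarrow>\<^sub>M \<mu>" if z: "z \<in> \<xi>" for z
  proof -
    obtain K where K: "N z = K \<Otimes>\<^sub>M \<mu>" using N[OF z] by blast
    have "(\<lambda>w. w z) \<in> PiM \<xi> N \<rightarrow>\<^sub>M N z" using z by (rule measurable_component_singleton)
    then show ?thesis unfolding K by (rule measurable_compose) simp
  qed
  have h: "h \<in> PiM \<xi> N \<rightarrow>\<^sub>M \<mu> \<Otimes>\<^sub>M \<mu>"
    unfolding h_def using comp xy by (intro measurable_Pair)
  have law: "\<mu> \<Otimes>\<^sub>M \<mu> = distr (PiM \<xi> N) (\<mu> \<Otimes>\<^sub>M \<mu>) h"
  proof (rule pair_measure_eqI)
    fix A B assume AB: "A \<in> sets \<mu>" "B \<in> sets \<mu>"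
    define X where "X z = space (N z) \<inter> snd -` (if z = x then A else B)" for z
    have Xe: "X z \<in> sets (N z) \<and> emeasure (N z) (X z) = emeasure \<mu> (if z = x then A else B)" if z: "z \<in> \<xi>" for z
    proof -
      obtain K where K: "prob_space K" "N z = K \<Otimes>\<^sub>M \<mu>" using N[OF z] by blast
      define C where "C = (if z = x then A else B)"
      have C: "C \<in> sets \<mu>" using AB by (simp add: C_def)
      have "X z = space K \<times> C"
        unfolding X_def K(2) C_def[symmetric] using sets.sets_into_space[OF C] by (auto simp: space_pair_measure)
      then show ?thesis using prob_pair_snd[OF K(1) \<mu>(1) C] C K(2) by (simp add: C_def)
    qed
    have "h -` (A \<times> B) \<inter> space (PiM \<xi> N) = prod_emb \<xi> N {x, y} (Pi\<^sub>E {x, y} X)"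
      using xy by (auto simp: h_def prod_emb_def X_def space_PiM PiE_iff)
    then have "emeasure (distr (PiM \<xi> N) (\<mu> \<Otimes>\<^sub>M \<mu>) h) (A \<times> B) = emeasure (PiM \<xi> N) (prod_emb \<xi> N {x, y} (Pi\<^sub>E {x, y} X))"
      using h AB by (simp add: emeasure_distr)
    also have "\<dots> = (\<Prod>z\<in>{x, y}. emeasure (N z) (X z))"
      using xy Xe prob by (intro emeasure_PiM_emb) auto
    also have "\<dots> = emeasure \<mu> A * emeasure \<mu> B" using xy Xe by simp
    finally show "emeasure \<mu> A * emeasure \<mu> B = emeasure (distr (PiM \<xi> N) (\<mu> \<Otimes>\<^sub>M \<mu>) h) (A \<times> B)" by simp
  qed (auto intro: \<mu>.sigma_finite_measure_axioms)
  have "AE v in \<mu> \<Otimes>\<^sub>M \<mu>. fst v / snd v \<noteq> a"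
  proof -
    have m: "(\<lambda>(v, v'). v / v') \<in> borel_measurable (\<mu> \<Otimes>\<^sub>M \<mu>)" by measurable
    interpret R: prob_space "distr (\<mu> \<Otimes>\<^sub>M \<mu>) borel (\<lambda>(v, v'). v / v')" by (rule prob_space_distr[OF m])
    have "{a} \<in> null_sets (distr (\<mu> \<Otimes>\<^sub>M \<mu>) borel (\<lambda>(v, v'). v / v'))"
      using a by (simp add: null_sets_def R.emeasure_eq_measure)
    then have "AE u in distr (\<mu> \<Otimes>\<^sub>M \<mu>) borel (\<lambda>(v, v'). v / v'). u \<notin> {a}" by (rule AE_not_in)
    then show ?thesis using AE_distrD[OF m] by (simp add: split_beta)
  qed
  then have "AE v in distr (PiM \<xi> N) (\<mu> \<Otimes>\<^sub>M \<mu>) h. fst v / snd v \<noteq> a" unfolding law[symmetric] .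
  then have "AE w in PiM \<xi> N. fst (h w) / snd (h w) \<noteq> a" by (rule AE_distrD[OF h])
  then show ?thesis by (simp add: h_def)
qed

section \<open>A Peierls argument\<close>

type_synonym site = "int \<times> int"

definition center :: "real \<Rightarrow> site \<Rightarrow> point" where
  "center m z = (m * real_of_int (fst z), m * real_of_int (snd z))"

definition site_of :: "real \<Rightarrow> point \<Rightarrow> site" where
  "site_of m p = (round (fst p / m), round (snd p / m))"

definition site_dist :: "site \<Rightarrow> site \<Rightarrow> int" where
  "site_dist u v = max \<bar>fst u - fst v\<bar> \<bar>snd u - snd v\<bar>"

text \<open>Successive points of an extracted chain are at most 101 m apart, and rounding to sites
  adds at most 1. There are 205^2 = 42025 such sites.\<close>

definition site_nbrs :: "site \<Rightarrow> site set" where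
  "site_nbrs z = {fst z - 102..fst z + 102} \<times> {snd z - 102..snd z + 102}"

fun site_chains :: "nat \<Rightarrow> site \<Rightarrow> site list set" where
  "site_chains 0 z = {[z]}"
| "site_chains (Suc M) z = (\<Union>z'\<in>site_nbrs z. (#) z ` site_chains M z')"

text \<open>Points at least 100 m apart differ by 50 m in some coordinate, and rounding costs 1. As
  49 > 3 * 16, boxes of side 16 m around such sites are disjoint and as far apart as stabilization
  demands.\<close>

definition separated :: "site list \<Rightarrow> bool" where
  "separated zs \<longleftrightarrow> sorted_wrt (\<lambda>u v. 49 \<le> site_dist u v) zs"

definition sep_chains :: "nat \<Rightarrow> site \<Rightarrow> site list set" where
  "sep_chains M z = {zs\<in>site_chains M z. separated zs}"

lemma site_dist_commute: "site_dist u v = site_dist v u"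
  by (simp add: site_dist_def abs_minus_commute)

lemma separated_distinct: "separated zs \<Longrightarrow> distinct zs"
  unfolding separated_def by (induction zs) (auto simp: site_dist_def)

lemma separated_dist:
  assumes "separated zs" "u \<in> set zs" "v \<in> set zs" "u \<noteq> v"
  shows "49 \<le> site_dist u v"
  using assms
proof (induction zs)
  case (Cons z zs)
  then show ?case
    using site_dist_commute[of u v] unfolding separated_def by (metis set_ConsD sorted_wrt.simps(2))
qed simp

lemma length_chains: "zs \<in> site_chains M z \<Longrightarrow> length zs = Suc M"
  by (induction M arbitrary: z zs) auto

lemma chains_count: "finite (site_chains M z) \<and> card (site_chains M z) \<le> 42025 ^ M"
proof (induction M arbitrary: z)
  case (Suc M)
  have f: "finite (site_nbrs z)" "card (site_nbrs z) = 42025" by (auto simp: site_nbrs_def)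
  have "card (site_chains (Suc M) z) \<le> (\<Sum>z'\<in>site_nbrs z. card ((#) z ` site_chains M z'))"
    using f by (simp add: card_UN_le)
  also have "\<dots> \<le> (\<Sum>z'\<in>site_nbrs z. 42025 ^ M)"
    using Suc by (intro sum_mono) (auto intro: order_trans[OF card_image_le])
  finally show ?case using f Suc by auto
qed simp

lemma finite_sep_chains [simp]: "finite (sep_chains M z)"
  using chains_count[of M z] by (simp add: sep_chains_def)

lemma card_sep_chains: "card (sep_chains M z) \<le> 42025 ^ M"
  using chains_count[of M z] card_mono[of "site_chains M z" "sep_chains M z"] by (auto simp: sep_chains_def)

lemma round_near:
  fixes m z :: real
  assumes m: "0 < m"
  shows "\<bar>z - m * real_of_int (round (z / m))\<bar> \<le> m / 2"
proof -
  have "\<bar>of_int (round (z / m)) - z / m\<bar> \<le> 1 / 2" by (rule of_int_round_abs_le)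
  then have "m * \<bar>of_int (round (z / m)) - z / m\<bar> \<le> m * (1 / 2)" using m by (intro mult_left_mono) auto
  also have "m * \<bar>of_int (round (z / m)) - z / m\<bar> = \<bar>m * (of_int (round (z / m)) - z / m)\<bar>"
    using m by (simp add: abs_mult)
  also have "m * (of_int (round (z / m)) - z / m) = m * of_int (round (z / m)) - z"
    using m by (simp add: field_simps)
  finally show ?thesis by (simp add: abs_minus_commute)
qed

lemma in_site_box: "0 < m \<Longrightarrow> p \<in> Q m (center m (site_of m p))"
  using round_near[of m "fst p"] round_near[of m "snd p"] by (simp add: mem_Q center_def site_of_def)

lemma round_diff:
  fixes a b :: real
  shows "\<bar>real_of_int (round a - round b)\<bar> \<le> \<bar>a - b\<bar> + 1" "\<bar>a - b\<bar> - 1 \<le> \<bar>real_of_int (round a - round b)\<bar>"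
  using of_int_round_abs_le[of a] of_int_round_abs_le[of b] by linarith+

lemma site_near:
  assumes m: "0 < m" and d: "dist p q \<le> 101 * m"
  shows "site_of m q \<in> site_nbrs (site_of m p)"
proof -
  have "\<bar>fst p - fst q\<bar> \<le> 101 * m" "\<bar>snd p - snd q\<bar> \<le> 101 * m"
    using dist_fst_le[of p q] dist_snd_le[of p q] d by (auto simp: dist_real_def)
  then have "\<bar>fst p / m - fst q / m\<bar> \<le> 101" "\<bar>snd p / m - snd q / m\<bar> \<le> 101"
    using m by (simp_all add: field_simps flip: diff_divide_distrib)
  then have "\<bar>round (fst p / m) - round (fst q / m)\<bar> \<le> 102" "\<bar>round (snd p / m) - round (snd q / m)\<bar> \<le> 102"
    using round_diff(1)[of "fst p / m" "fst q / m"] round_diff(1)[of "snd p / m" "snd q / m"] by linarith+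
  then show ?thesis by (auto simp: site_nbrs_def site_of_def abs_le_iff)
qed

lemma site_far:
  assumes m: "0 < m" and d: "100 * m \<le> dist p q"
  shows "49 \<le> site_dist (site_of m p) (site_of m q)"
proof -
  have "dist p q \<le> \<bar>fst p - fst q\<bar> + \<bar>snd p - snd q\<bar>"
    using sqrt_sum_squares_le_sum_abs[of "fst p - fst q" "snd p - snd q"]
    by (simp add: dist_prod_def dist_real_def)
  then have "50 * m \<le> \<bar>fst p - fst q\<bar> \<or> 50 * m \<le> \<bar>snd p - snd q\<bar>" using d by linarith
  then have "50 \<le> \<bar>fst p / m - fst q / m\<bar> \<or> 50 \<le> \<bar>snd p / m - snd q / m\<bar>"
    using m by (simp add: field_simps flip: diff_divide_distrib)
  then have "49 \<le> \<bar>round (fst p / m) - round (fst q / m)\<bar> \<or> 49 \<le> \<bar>round (snd p / m) - round (snd q / m)\<bar>"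
    using round_diff(2)[of "fst p / m" "fst q / m"] round_diff(2)[of "snd p / m" "snd q / m"] by linarith
  then show ?thesis by (auto simp: site_dist_def site_of_def)
qed

text \<open>Delete the ball of radius 100 m around y. The cluster leaves it through finitely many
  devices at distance up to 101 m; if all their clusters outside the ball were bounded, so would be
  that of y. Continue with an unbounded one. Since W shrinks, later points avoid the balls around
  all earlier points and not only around the last.\<close>

lemma extract_chain:
  assumes m: "0 < m" and fin: "\<And>B. bounded B \<Longrightarrow> finite (\<xi> \<inter> B)"
    and E: "\<And>x y. (x, y) \<in> E \<Longrightarrow> x \<in> \<xi> \<and> y \<in> \<xi> \<and> dist x y \<le> m"
    and "y \<in> W" "W \<subseteq> \<xi>" "\<not> bounded {u. (y, u) \<in> (E \<inter> W \<times> W)\<^sup>*}"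
  shows "\<exists>ys. map (site_of m) ys \<in> site_chains M (site_of m y) \<and> set ys \<subseteq> W \<and>
     sorted_wrt (\<lambda>u v. 100 * m \<le> dist u v) ys \<and> (\<forall>u\<in>set ys. \<not> bounded {v. (u, v) \<in> E\<^sup>*})"
  using assms(4-6)
proof (induction M arbitrary: y W)
  case 0
  have "{u. (y, u) \<in> (E \<inter> W \<times> W)\<^sup>*} \<subseteq> {u. (y, u) \<in> E\<^sup>*}"
    using rtrancl_mono[of "E \<inter> W \<times> W" E] by blast
  then have "\<not> bounded {u. (y, u) \<in> E\<^sup>*}" using 0 bounded_subset by blast
  then show ?case using 0 by (intro exI[of _ "[y]"]) auto
next
  case (Suc M)
  define W' where "W' = W - ball y (100 * m)"
  define Z where "Z = {z\<in>W'. dist y z \<le> 101 * m}"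
  have "Z \<subseteq> \<xi> \<inter> cball y (101 * m)" using Suc.prems by (auto simp: Z_def W'_def)
  then have Z: "finite Z" using finite_subset[OF _ fin[OF bounded_cball]] by blast
  \<comment> \<open>Either the chain ends in the ball, or it left the ball for the last time through
    an element of Z.\<close>
  have "u \<in> ball y (100 * m) \<union> (\<Union>z\<in>Z. {u. (z, u) \<in> (E \<inter> W' \<times> W')\<^sup>*})" if "(y, u) \<in> (E \<inter> W \<times> W)\<^sup>*" for u
    using that
  proof (induction rule: rtrancl_induct)
    case base
    then show ?case using m by simp
  next
    case (step u v)
    show ?case
    proof (cases "v \<in> ball y (100 * m)")
      case False
      then have v: "v \<in> W'" using step by (auto simp: W'_def)
      show ?thesis
      proof (cases "u \<in> ball y (100 * m)")
        case True
        have "dist y v \<le> dist y u + dist u v" by (rule dist_triangle)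
        moreover have "dist u v \<le> m" using step E by blast
        ultimately have "v \<in> Z" using True v by (simp add: Z_def)
        then show ?thesis by blast
      next
        case False
        then obtain z where z: "z \<in> Z" "(z, u) \<in> (E \<inter> W' \<times> W')\<^sup>*" using step.IH by blast
        have "(u, v) \<in> E \<inter> W' \<times> W'" using step.hyps False v by (auto simp: W'_def)
        then show ?thesis using z by (blast intro: rtrancl.rtrancl_into_rtrancl)
      qed
    qed auto
  qed
  then have sub: "{u. (y, u) \<in> (E \<inter> W \<times> W)\<^sup>*} \<subseteq> ball y (100 * m) \<union> (\<Union>z\<in>Z. {u. (z, u) \<in> (E \<inter> W' \<times> W')\<^sup>*})"
    by blast
  have "\<exists>z\<in>Z. \<not> bounded {u. (z, u) \<in> (E \<inter> W' \<times> W')\<^sup>*}"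
  proof (rule ccontr)
    assume "\<not> ?thesis"
    then have "bounded (ball y (100 * m) \<union> (\<Union>z\<in>Z. {u. (z, u) \<in> (E \<inter> W' \<times> W')\<^sup>*}))"
      using Z by (auto intro: bounded_UN)
    then show False using Suc.prems(3) bounded_subset[OF _ sub] by blast
  qed
  then obtain z where z: "z \<in> Z" "\<not> bounded {u. (z, u) \<in> (E \<inter> W' \<times> W')\<^sup>*}" by blast
  then obtain ys where ys: "map (site_of m) ys \<in> site_chains M (site_of m z)" "set ys \<subseteq> W'"
     "sorted_wrt (\<lambda>u v. 100 * m \<le> dist u v) ys" "\<forall>u\<in>set ys. \<not> bounded {v. (u, v) \<in> E\<^sup>*}"
    using Suc.IH[of z W'] Suc.prems(2) by (force simp: Z_def W'_def)
  have "{u. (y, u) \<in> (E \<inter> W \<times> W)\<^sup>*} \<subseteq> {u. (y, u) \<in> E\<^sup>*}"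
    using rtrancl_mono[of "E \<inter> W \<times> W" E] by blast
  then have "\<not> bounded {u. (y, u) \<in> E\<^sup>*}" using Suc.prems bounded_subset by blast
  moreover have "site_of m z \<in> site_nbrs (site_of m y)" using z(1) m by (intro site_near) (auto simp: Z_def)
  ultimately show ?case
    using ys Suc.prems(1) by (intro exI[of _ "y # ys"]) (auto simp: W'_def subset_iff not_less)
qed

lemma extract_sep_chain:
  assumes m: "0 < m" and fin: "\<And>B. bounded B \<Longrightarrow> finite (\<xi> \<inter> B)"
    and E: "\<And>x y. (x, y) \<in> E \<Longrightarrow> x \<in> \<xi> \<and> y \<in> \<xi> \<and> dist x y \<le> m"
    and x: "x \<in> \<xi>" "\<not> bounded {u. (x, u) \<in> E\<^sup>*}"
  obtains zs where "zs \<in> sep_chains M (site_of m x)"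
    "\<And>z. z \<in> set zs \<Longrightarrow> \<exists>u\<in>\<xi> \<inter> Q m (center m z). \<not> bounded {v. (u, v) \<in> E\<^sup>*}"
proof -
  have EE: "E \<inter> \<xi> \<times> \<xi> = E" using E by auto
  have "\<exists>ys. map (site_of m) ys \<in> site_chains M (site_of m x) \<and> set ys \<subseteq> \<xi> \<and>
     sorted_wrt (\<lambda>u v. 100 * m \<le> dist u v) ys \<and> (\<forall>u\<in>set ys. \<not> bounded {v. (u, v) \<in> E\<^sup>*})"
  proof (rule extract_chain[OF m])
    show "\<And>B. bounded B \<Longrightarrow> finite (\<xi> \<inter> B)" by (rule fin)
    show "\<And>x y. (x, y) \<in> E \<Longrightarrow> x \<in> \<xi> \<and> y \<in> \<xi> \<and> dist x y \<le> m" by (rule E)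
    show "\<not> bounded {u. (x, u) \<in> (E \<inter> \<xi> \<times> \<xi>)\<^sup>*}" using x(2) by (simp add: EE)
  qed (use x in auto)
  then obtain ys where ys: "map (site_of m) ys \<in> site_chains M (site_of m x)" "set ys \<subseteq> \<xi>"
     "sorted_wrt (\<lambda>u v. 100 * m \<le> dist u v) ys" "\<forall>u\<in>set ys. \<not> bounded {v. (u, v) \<in> E\<^sup>*}"
    by blast
  have "separated (map (site_of m) ys)"
    unfolding separated_def sorted_wrt_map using ys(3) by (rule sorted_wrt_mono_rel[rotated]) (rule site_far[OF m])
  then have "map (site_of m) ys \<in> sep_chains M (site_of m x)" using ys by (simp add: sep_chains_def)
  then show ?thesis
    by (rule that) (use ys in_site_box[OF m] in auto)
qed

section \<open>First moment bounds along chains\<close>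

lemma suminf_finite_small_term:
  fixes f :: "nat \<Rightarrow> ennreal"
  assumes "(\<Sum>i. f i) \<noteq> \<top>" "c > 0"
  shows "\<exists>i. f i \<le> ennreal c"
proof (rule ccontr)
  assume neg: "\<not> ?thesis"
  obtain s where s: "(\<Sum>i. f i) = ennreal s" "0 \<le> s" using assms(1) by (cases "\<Sum>i. f i") auto
  obtain N :: nat where N: "s / c < N" using reals_Archimedean2 by blast
  have "ennreal (real N * c) = (\<Sum>i<N. ennreal c)" using assms by (simp add: ennreal_mult ennreal_of_nat_eq_real_of_nat)
  also have "\<dots> \<le> (\<Sum>i<N. f i)" using neg by (intro sum_mono) (auto simp: not_le intro: less_imp_le)
  also have "\<dots> \<le> (\<Sum>i. f i)" by (intro sum_le_suminf) auto
  finally have "real N * c \<le> s" unfolding s using s(2) by simp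
  then show False using N assms(2) by (simp add: field_simps)
qed

lemma prod_mono_ennreal:
  fixes f g :: "'a \<Rightarrow> ennreal"
  assumes "\<And>i. i \<in> I \<Longrightarrow> f i \<le> g i"
  shows "prod f I \<le> prod g I"
  using assms by (induction I rule: infinite_finite_induct) (auto intro!: mult_mono)

lemma center_far:
  assumes m: "0 < m" and d: "49 \<le> site_dist u v"
  shows "49 * m \<le> \<bar>fst (center m u) - fst (center m v)\<bar> \<or> 49 * m \<le> \<bar>snd (center m u) - snd (center m v)\<bar>"
proof -
  have *: "\<bar>m * real_of_int a - m * real_of_int b\<bar> = m * \<bar>real_of_int (a - b)\<bar>" for a b
    using m by (simp add: abs_mult flip: right_diff_distrib)
  have "49 \<le> \<bar>fst u - fst v\<bar> \<or> 49 \<le> \<bar>snd u - snd v\<bar>" using d by (auto simp: site_dist_def max_def split: if_splits)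
  then have "49 \<le> \<bar>real_of_int (fst u - fst v)\<bar> \<or> 49 \<le> \<bar>real_of_int (snd u - snd v)\<bar>" by linarith
  then show ?thesis
    using m mult_left_mono[of 49 "\<bar>real_of_int (fst u - fst v)\<bar>" m] mult_left_mono[of 49 "\<bar>real_of_int (snd u - snd v)\<bar>" m]
    unfolding center_def fst_conv snd_conv * by auto
qed

lemma site_boxes_disjoint:
  assumes "0 < m" "49 \<le> site_dist u v"
  shows "Q (16 * m) (center m u) \<inter> Q (16 * m) (center m v) = {}"
proof (rule ccontr)
  assume "\<not> ?thesis"
  then obtain p where "p \<in> Q (16 * m) (center m u)" "p \<in> Q (16 * m) (center m v)" by blast
  then show False using center_far[OF assms] assms(1) unfolding mem_Q by linarith
qed

context street_poisson
begin

text \<open>Expanding the product leaves products of counts in disjoint sets, to which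
  \<open>mean_prod\<close> applies; afterwards the sum is folded back.\<close>

lemma mean_weighted_prod:
  fixes a :: "site \<Rightarrow> nat \<Rightarrow> ennreal"
  assumes I: "finite I" and B: "\<And>z k. z \<in> I \<Longrightarrow> k < K z \<Longrightarrow> bb (B z k)"
    and dis: "\<And>u v j k. u \<in> I \<Longrightarrow> v \<in> I \<Longrightarrow> u \<noteq> v \<Longrightarrow> j < K u \<Longrightarrow> k < K v \<Longrightarrow> B u j \<inter> B v k = {}"
  shows "(\<integral>\<^sup>+\<xi>. (\<Prod>z\<in>I. \<Sum>k<K z. a z k * of_nat (card (\<xi> \<inter> B z k))) \<partial>P) =
    (\<Prod>z\<in>I. \<Sum>k<K z. a z k * (ennreal l * len (\<Union>\<phi> \<inter> B z k)))"
proof -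
  let ?F = "Pi\<^sub>E I (\<lambda>z. {..<K z})"
  have f: "bb (B z (f z))" if "f \<in> ?F" "z \<in> I" for f z using that B by (auto simp: PiE_iff)
  have meas: "(\<lambda>\<xi>. of_nat (card (\<xi> \<inter> B z (f z))) :: ennreal) \<in> borel_measurable P" if "f \<in> ?F" "z \<in> I" for f z
    by (rule measurable_compose[OF count_measurable[OF f[OF that]]]) simp
  have "(\<integral>\<^sup>+\<xi>. (\<Prod>z\<in>I. \<Sum>k<K z. a z k * of_nat (card (\<xi> \<inter> B z k))) \<partial>P) =
      (\<integral>\<^sup>+\<xi>. (\<Sum>f\<in>?F. (\<Prod>z\<in>I. a z (f z)) * (\<Prod>z\<in>I. of_nat (card (\<xi> \<inter> B z (f z))))) \<partial>P)"
    using I by (subst prod_sum_PiE) (auto simp: prod.distrib)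
  also have "\<dots> = (\<Sum>f\<in>?F. \<integral>\<^sup>+\<xi>. (\<Prod>z\<in>I. a z (f z)) * (\<Prod>z\<in>I. of_nat (card (\<xi> \<inter> B z (f z)))) \<partial>P)"
    using meas by (intro nn_integral_sum borel_measurable_times_ennreal borel_measurable_prod_ennreal) auto
  also have "\<dots> = (\<Sum>f\<in>?F. (\<Prod>z\<in>I. a z (f z)) * (\<integral>\<^sup>+\<xi>. (\<Prod>z\<in>I. of_nat (card (\<xi> \<inter> B z (f z)))) \<partial>P))"
    using meas by (intro sum.cong refl nn_integral_cmult borel_measurable_prod_ennreal) auto
  also have "\<dots> = (\<Sum>f\<in>?F. (\<Prod>z\<in>I. a z (f z)) * (\<Prod>z\<in>I. ennreal l * len (\<Union>\<phi> \<inter> B z (f z))))"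
  proof (intro sum.cong refl arg_cong2[where f = "(*)"] mean_prod I f)
    fix f assume "f \<in> ?F"
    then show "disjoint_family_on (\<lambda>z. B z (f z)) I" using dis by (auto simp: disjoint_family_on_def PiE_iff)
  qed auto
  also have "\<dots> = (\<Prod>z\<in>I. \<Sum>k<K z. a z k * (ennreal l * len (\<Union>\<phi> \<inter> B z k)))"
    using I by (subst prod_sum_PiE) (auto simp: prod.distrib)
  finally show ?thesis .
qed

text \<open>A first moment argument in two stages. Given the positions, \<open>H\<close> bounds the
  probability that each good site of a chain contains an exceptional device. The mean of
  \<open>H\<close> over the positions is at most the product in \<open>sum\<close>, where sites that
  are not good count 1. Percolation yields chains of every length, so it is enough that the bound is
  small for one length.\<close>

lemma no_percolation:
  fixes \<kappa> :: "point \<Rightarrow> point measure" and \<mu> :: "real measure" and good :: "site \<Rightarrow> bool"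
    and K :: "site \<Rightarrow> nat" and B :: "site \<Rightarrow> nat \<Rightarrow> point set" and J :: "site \<Rightarrow> nat \<Rightarrow> real set"
    and E :: "point set \<Rightarrow> (point \<Rightarrow> point \<times> real) \<Rightarrow> (point \<times> point) set"
  assumes m: "0 < m" and \<kappa>: "\<And>x. x \<in> \<Union>\<phi> \<Longrightarrow> prob_space (\<kappa> x)"
    and \<mu>: "prob_space \<mu>" "sets \<mu> = sets borel"
    and B: "\<And>z k. good z \<Longrightarrow> k < K z \<Longrightarrow> bb (B z k) \<and> B z k \<subseteq> Q (16 * m) (center m z) \<and> J z k \<in> sets borel"
    and \<eta>: "\<And>z. good z \<Longrightarrow> (\<Sum>k<K z. emeasure \<mu> (J z k) * (ennreal l * len (\<Union>\<phi> \<inter> B z k))) \<le> ennreal \<eta>"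
    and sum: "\<And>z0. (\<Sum>M. \<Sum>zs\<in>sep_chains M z0. \<Prod>z\<in>set zs. if good z then ennreal \<eta> else 1) \<noteq> \<top>"
    and imp: "AE \<xi> in P. AE w in PiM \<xi> (\<lambda>x. \<kappa> x \<Otimes>\<^sub>M \<mu>). E \<xi> w \<subseteq> \<xi> \<times> \<xi> \<and> (\<forall>(x, y)\<in>E \<xi> w. dist x y \<le> m) \<and>
      (\<forall>z. good z \<longrightarrow> (\<forall>k<K z. \<forall>x\<in>\<xi> \<inter> B z k. snd (w x) \<notin> J z k) \<longrightarrow>
        (\<forall>x\<in>\<xi> \<inter> Q m (center m z). bounded {y. (x, y) \<in> (E \<xi> w)\<^sup>*}))"
  shows "AE \<xi> in P. AE w in PiM \<xi> (\<lambda>x. \<kappa> x \<Otimes>\<^sub>M \<mu>). \<not> percolates \<xi> (E \<xi> w)"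
proof -
  interpret \<mu>: prob_space \<mu> by (rule \<mu>)
  define G where "G zs = {z\<in>set zs. good z}" for zs
  define H where "H zs \<xi> = (\<Prod>z\<in>G zs. \<Sum>k<K z. emeasure \<mu> (J z k) * of_nat (card (\<xi> \<inter> B z k)))" for zs and \<xi> :: "point set"
  have dis: "B u j \<inter> B v k = {}" if "separated zs" "u \<in> G zs" "v \<in> G zs" "u \<noteq> v" "j < K u" "k < K v" for zs u v j k
  proof -
    have "49 \<le> site_dist u v" using that separated_dist by (auto simp: G_def)
    then have "Q (16 * m) (center m u) \<inter> Q (16 * m) (center m v) = {}" by (rule site_boxes_disjoint[OF m])
    then show ?thesis using B[of u j] B[of v k] that by (auto simp: G_def)
  qed
  have Hm: "H zs \<in> borel_measurable P" for zs
    unfolding H_def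
  proof (intro borel_measurable_prod_ennreal borel_measurable_sum borel_measurable_times_ennreal)
    fix z k assume "z \<in> G zs" "k \<in> {..<K z}"
    then have "bb (B z k)" using B by (auto simp: G_def)
    then show "(\<lambda>\<xi>. of_nat (card (\<xi> \<inter> B z k)) :: ennreal) \<in> borel_measurable P"
      by (rule measurable_compose[OF count_measurable]) simp
  qed auto
  \<comment> \<open>A finite mean makes the sum over all chains finite for almost every set of
    positions, for each of the countably many initial sites.\<close>
  have "AE \<xi> in P. (\<Sum>M. \<Sum>zs\<in>sep_chains M z0. H zs \<xi>) \<noteq> \<infinity>" for z0
  proof (rule nn_integral_noteq_infinite)
    show "(\<lambda>\<xi>. \<Sum>M. \<Sum>zs\<in>sep_chains M z0. H zs \<xi>) \<in> borel_measurable P" using Hm by measurable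
    have "(\<integral>\<^sup>+\<xi>. (\<Sum>M. \<Sum>zs\<in>sep_chains M z0. H zs \<xi>) \<partial>P) = (\<Sum>M. \<Sum>zs\<in>sep_chains M z0. \<integral>\<^sup>+\<xi>. H zs \<xi> \<partial>P)"
      using Hm by (simp add: nn_integral_suminf nn_integral_sum)
    also have "\<dots> \<le> (\<Sum>M. \<Sum>zs\<in>sep_chains M z0. \<Prod>z\<in>set zs. if good z then ennreal \<eta> else 1)"
    proof (intro suminf_le sum_mono)
      fix M zs assume zs: "zs \<in> sep_chains M z0"
      have fin: "finite (G zs)" by (simp add: G_def)
      have "(\<integral>\<^sup>+\<xi>. H zs \<xi> \<partial>P) = (\<Prod>z\<in>G zs. \<Sum>k<K z. emeasure \<mu> (J z k) * (ennreal l * len (\<Union>\<phi> \<inter> B z k)))"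
        unfolding H_def using zs B by (intro mean_weighted_prod fin dis) (auto simp: G_def sep_chains_def)
      also have "\<dots> \<le> (\<Prod>z\<in>G zs. ennreal \<eta>)" using \<eta> by (intro prod_mono_ennreal) (auto simp: G_def)
      also have "\<dots> = (\<Prod>z\<in>set zs. if good z then ennreal \<eta> else 1)"
        unfolding G_def by (rule prod.inter_filter) simp
      finally show "(\<integral>\<^sup>+\<xi>. H zs \<xi> \<partial>P) \<le> (\<Prod>z\<in>set zs. if good z then ennreal \<eta> else 1)" .
    qed auto
    finally show "(\<integral>\<^sup>+\<xi>. (\<Sum>M. \<Sum>zs\<in>sep_chains M z0. H zs \<xi>) \<partial>P) \<noteq> \<infinity>"
      using sum[of z0] by (auto simp: top_unique)
  qed
  then have "AE \<xi> in P. \<forall>z0. (\<Sum>M. \<Sum>zs\<in>sep_chains M z0. H zs \<xi>) \<noteq> \<infinity>" by (simp add: AE_all_countable)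
  then show ?thesis using imp AE_on_streets AE_space
  proof eventually_elim
    case (elim \<xi>)
    define N where "N x = \<kappa> x \<Otimes>\<^sub>M \<mu>" for x
    have N: "prob_space (N x)" if x: "x \<in> \<xi>" for x
    proof -
      interpret k: prob_space "\<kappa> x" using \<kappa> elim(3) x by blast
      interpret pair_prob_space "\<kappa> x" \<mu> ..
      show ?thesis unfolding N_def by unfold_locales
    qed
    have fin: "finite (\<xi> \<inter> C)" if "bounded C" for C using finite_points elim(4) that by blast
    define Bad where "Bad z w \<longleftrightarrow> (\<exists>k<K z. \<exists>x\<in>\<xi> \<inter> B z k. snd (w x) \<in> J z k)" for z and w :: "point \<Rightarrow> point \<times> real"
    have bound: "\<exists>X\<in>sets (PiM \<xi> N). {w\<in>space (PiM \<xi> N). \<forall>z\<in>G zs. Bad z w} \<subseteq> X \<and> emeasure (PiM \<xi> N) X \<le> H zs \<xi>"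
      if zs: "separated zs" for zs
    proof -
      define S where "S z = (SIGMA k:{..<K z}. \<xi> \<inter> B z k)" for z
      define A where "A z s = space (\<kappa> (snd s)) \<times> J z (fst s)" for z and s :: "nat \<times> point"
      have S: "finite (S z)" if "z \<in> G zs" for z
        unfolding S_def using that B fin by (intro finite_SigmaI) (auto simp: G_def bb_def)
      have A: "snd s \<in> \<xi> \<and> A z s \<in> sets (N (snd s))" if "z \<in> G zs" "s \<in> S z" for z s
      proof -
        have s: "good z" "fst s < K z" "snd s \<in> \<xi>" using that by (auto simp: S_def G_def)
        then have "J z (fst s) \<in> sets \<mu>" using B \<mu>(2) by simp
        then show ?thesis unfolding A_def N_def using s(3) pair_measureI[OF sets.top] by blast
      qed
      have "\<exists>X\<in>sets (PiM \<xi> N). {w\<in>space (PiM \<xi> N). \<forall>z\<in>G zs. \<exists>s\<in>S z. w (snd s) \<in> A z s} \<subseteq> X \<and>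
          emeasure (PiM \<xi> N) X \<le> (\<Prod>z\<in>G zs. \<Sum>s\<in>S z. emeasure (N (snd s)) (A z s))"
      proof (rule PiM_union_bound[OF N _ S A])
        show "finite (G zs)" by (simp add: G_def)
        show "u = v" if "u \<in> G zs" "v \<in> G zs" "s \<in> S u" "t \<in> S v" "snd s = snd t" for u v s t
        proof (rule ccontr)
          assume "u \<noteq> v"
          then have "B u (fst s) \<inter> B v (fst t) = {}" using that by (intro dis[OF zs]) (auto simp: S_def)
          then show False using that by (auto simp: S_def)
        qed
      qed auto
      moreover have "{w\<in>space (PiM \<xi> N). \<forall>z\<in>G zs. Bad z w} \<subseteq> {w\<in>space (PiM \<xi> N). \<forall>z\<in>G zs. \<exists>s\<in>S z. w (snd s) \<in> A z s}"
      proof safe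
        fix w z assume w: "w \<in> space (PiM \<xi> N)" "z \<in> G zs" "\<forall>z\<in>G zs. Bad z w"
        then obtain k x where kx: "k < K z" "x \<in> \<xi> \<inter> B z k" "snd (w x) \<in> J z k" by (auto simp: Bad_def)
        have "w x \<in> space (N x)" using w kx by (auto simp: space_PiM)
        then have "fst (w x) \<in> space (\<kappa> x)" by (auto simp: N_def space_pair_measure)
        then have "w (snd (k, x)) \<in> A z (k, x)" "(k, x) \<in> S z" using kx by (auto simp: A_def S_def mem_Times_iff)
        then show "\<exists>s\<in>S z. w (snd s) \<in> A z s" by blast
      qed
      moreover have "(\<Sum>s\<in>S z. emeasure (N (snd s)) (A z s)) = (\<Sum>k<K z. emeasure \<mu> (J z k) * of_nat (card (\<xi> \<inter> B z k)))"
        if z: "z \<in> G zs" for z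
      proof -
        have "(\<Sum>s\<in>S z. emeasure (N (snd s)) (A z s)) = (\<Sum>(k, x)\<in>S z. emeasure \<mu> (J z k))"
        proof (rule sum.cong, simp, clarify)
          fix k x assume "(k, x) \<in> S z"
          then have "x \<in> \<xi>" and "J z k \<in> sets \<mu>" using z B \<mu>(2) by (auto simp: S_def G_def)
          moreover have "x \<in> \<Union>\<phi>" using \<open>x \<in> \<xi>\<close> elim(3) by blast
          ultimately show "emeasure (N (snd (k, x))) (A z (k, x)) = emeasure \<mu> (J z k)"
            using prob_pair_snd[OF \<kappa>[of x] \<mu>(1), of "J z k"] by (simp add: A_def N_def)
        qed
        also have "\<dots> = (\<Sum>k<K z. \<Sum>x\<in>\<xi> \<inter> B z k. emeasure \<mu> (J z k))"
          unfolding S_def using z B fin by (intro sum.Sigma[symmetric]) (auto simp: G_def bb_def)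
        also have "\<dots> = (\<Sum>k<K z. emeasure \<mu> (J z k) * of_nat (card (\<xi> \<inter> B z k)))" by (simp add: mult.commute)
        finally show ?thesis .
      qed
      ultimately show ?thesis unfolding H_def by (simp cong: prod.cong) (meson order_trans)
    qed
    have "AE w in PiM \<xi> N. w \<notin> {w. \<forall>M. \<exists>zs\<in>sep_chains M z0. \<forall>z\<in>G zs. Bad z w}" for z0
    proof (rule AE_notI_small)
      fix c :: real assume c: "c > 0"
      \<comment> \<open>A convergent series has a term below c, and the chains of this one length
        already cover the event.\<close>
      obtain M where M: "(\<Sum>zs\<in>sep_chains M z0. H zs \<xi>) \<le> ennreal c"
        using suminf_finite_small_term[OF spec[OF elim(1), of z0, unfolded infinity_ennreal_def] c] by blast
      define X where "X zs = (SOME X. X \<in> sets (PiM \<xi> N) \<and>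
          {w\<in>space (PiM \<xi> N). \<forall>z\<in>G zs. Bad z w} \<subseteq> X \<and> emeasure (PiM \<xi> N) X \<le> H zs \<xi>)" for zs
      have X: "X zs \<in> sets (PiM \<xi> N) \<and> {w\<in>space (PiM \<xi> N). \<forall>z\<in>G zs. Bad z w} \<subseteq> X zs \<and>
          emeasure (PiM \<xi> N) (X zs) \<le> H zs \<xi>" if "separated zs" for zs
        unfolding X_def by (rule someI_ex) (rule bound[OF that, unfolded Bex_def])
      have sep: "separated zs" if "zs \<in> sep_chains M z0" for zs using that by (simp add: sep_chains_def)
      show "\<exists>A\<in>sets (PiM \<xi> N). {w. \<forall>M. \<exists>zs\<in>sep_chains M z0. \<forall>z\<in>G zs. Bad z w} \<inter> space (PiM \<xi> N) \<subseteq> A \<and>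
          emeasure (PiM \<xi> N) A \<le> ennreal c"
      proof (intro bexI[of _ "\<Union>zs\<in>sep_chains M z0. X zs"] conjI)
        show "{w. \<forall>M. \<exists>zs\<in>sep_chains M z0. \<forall>z\<in>G zs. Bad z w} \<inter> space (PiM \<xi> N) \<subseteq> (\<Union>zs\<in>sep_chains M z0. X zs)"
        proof safe
          fix w assume w: "\<forall>M. \<exists>zs\<in>sep_chains M z0. \<forall>z\<in>G zs. Bad z w" "w \<in> space (PiM \<xi> N)"
          then obtain zs where zs: "zs \<in> sep_chains M z0" "\<forall>z\<in>G zs. Bad z w" by blast
          then have "w \<in> X zs" using X[OF sep[OF zs(1)]] w(2) by blast
          then show "w \<in> (\<Union>zs\<in>sep_chains M z0. X zs)" using zs(1) by blast
        qed
        have "emeasure (PiM \<xi> N) (\<Union>zs\<in>sep_chains M z0. X zs) \<le> (\<Sum>zs\<in>sep_chains M z0. emeasure (PiM \<xi> N) (X zs))"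
          using X sep by (intro emeasure_subadditive_finite) auto
        also have "\<dots> \<le> (\<Sum>zs\<in>sep_chains M z0. H zs \<xi>)" using X sep by (intro sum_mono) auto
        also note M
        finally show "emeasure (PiM \<xi> N) (\<Union>zs\<in>sep_chains M z0. X zs) \<le> ennreal c" .
        show "(\<Union>zs\<in>sep_chains M z0. X zs) \<in> sets (PiM \<xi> N)" using X sep by (intro sets.finite_UN) auto
      qed
    qed
    then have "AE w in PiM \<xi> N. \<forall>z0. w \<notin> {w. \<forall>M. \<exists>zs\<in>sep_chains M z0. \<forall>z\<in>G zs. Bad z w}"
      by (simp only: AE_all_countable) simp
    then have "AE w in PiM \<xi> N. \<not> percolates \<xi> (E \<xi> w)"
      using elim(2) unfolding N_def[symmetric]
    proof eventually_elim
      case (elim w)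
      show ?case
      proof
        assume "percolates \<xi> (E \<xi> w)"
        then obtain x where x: "x \<in> \<xi>" "\<not> bounded {y. (x, y) \<in> (E \<xi> w)\<^sup>*}" by (auto simp: percolates_def)
        have E: "u \<in> \<xi> \<and> v \<in> \<xi> \<and> dist u v \<le> m" if "(u, v) \<in> E \<xi> w" for u v using elim(2) that by blast
        have "\<exists>zs\<in>sep_chains M (site_of m x). \<forall>z\<in>G zs. Bad z w" for M
        proof -
          obtain zs where zs: "zs \<in> sep_chains M (site_of m x)"
            "\<And>z. z \<in> set zs \<Longrightarrow> \<exists>u\<in>\<xi> \<inter> Q m (center m z). \<not> bounded {v. (u, v) \<in> (E \<xi> w)\<^sup>*}"
            using extract_sep_chain[OF m fin E x] by blast
          have "Bad z w" if "z \<in> G zs" for z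
            using zs(2)[of z] that elim(2) unfolding G_def Bad_def by blast
          then show ?thesis using zs(1) by blast
        qed
        then show False using elim(1) by blast
      qed
    qed
    then show ?case unfolding N_def .
  qed
qed

end

section \<open>Stationarity and stabilization\<close>

lemma Union_translate: "\<Union>(translate z \<phi>) = (\<lambda>p. p + z) ` \<Union>\<phi>"
  by (auto simp: translate_def)

lemma translate_translate: "translate z (translate z' \<phi>) = translate (z' + z) \<phi>"
  by (simp add: translate_def image_image add.assoc)

lemma translate_0 [simp]: "translate 0 \<phi> = \<phi>"
  by (simp add: translate_def)

lemma translate_inverse: "translate z (translate (- z) \<phi>) = \<phi>"
  by (simp add: translate_translate)

lemma translate_segment: "(\<lambda>p. p + z) ` closed_segment a b = closed_segment (a + z) (b + z)"
  using closed_segment_translation[of z a b] by (simp add: add.commute[of _ z])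

lemma translate_configs_aux:
  assumes "\<phi> \<in> street_configs"
  shows "translate z \<phi> \<in> street_configs"
  unfolding street_configs_def
proof (safe)
  fix s assume "s \<in> translate z \<phi>"
  then obtain t where t: "t \<in> \<phi>" "s = (\<lambda>p. p + z) ` t" by (auto simp: translate_def)
  then obtain a b where ab: "a \<noteq> b" "t = closed_segment a b" using street_configs_segment[OF assms] by metis
  then show "\<exists>a b. a \<noteq> b \<and> s = closed_segment a b"
    using t by (intro exI[of _ "a + z"] exI[of _ "b + z"]) (simp add: translate_segment)
next
  fix B :: "point set" assume B: "bounded B"
  have "bounded ((\<lambda>p. p - z) ` B)" by (rule bounded_translation_minus[OF B])
  then have fin: "finite {s\<in>\<phi>. s \<inter> (\<lambda>p. p - z) ` B \<noteq> {}}" by (rule street_configs_finite[OF assms])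
  have "{s\<in>translate z \<phi>. s \<inter> B \<noteq> {}} \<subseteq> (\<lambda>s. (\<lambda>p. p + z) ` s) ` {s\<in>\<phi>. s \<inter> (\<lambda>p. p - z) ` B \<noteq> {}}"
  proof
    fix s assume "s \<in> {s\<in>translate z \<phi>. s \<inter> B \<noteq> {}}"
    then obtain t q where t: "t \<in> \<phi>" "s = (\<lambda>p. p + z) ` t" "q \<in> s" "q \<in> B" unfolding translate_def by blast
    then obtain p where "p \<in> t" "q = p + z" by blast
    with t have t: "t \<in> \<phi>" "s = (\<lambda>p. p + z) ` t" "p \<in> t" "p + z \<in> B" by simp_all
    have "p = (p + z) - z" by simp
    then have "p \<in> t \<inter> (\<lambda>p. p - z) ` B" using t by blast
    then show "s \<in> (\<lambda>s. (\<lambda>p. p + z) ` s) ` {s\<in>\<phi>. s \<inter> (\<lambda>p. p - z) ` B \<noteq> {}}" using t by blast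
  qed
  then show "finite {s\<in>translate z \<phi>. s \<inter> B \<noteq> {}}" using fin finite_surj by blast
qed

lemma translate_configs [simp]: "translate z \<phi> \<in> street_configs \<longleftrightarrow> \<phi> \<in> street_configs"
  using translate_configs_aux[of \<phi> z] translate_configs_aux[of "translate z \<phi>" "- z"]
    translate_inverse[of "- z" \<phi>] by auto

lemma space_street_space: "space street_space = street_configs"
  unfolding street_space_def by (rule space_measure_of) auto

text \<open>A translation moves the pairs of end points by (z, z), so preimages of generators are
  generators.\<close>

lemma translate_measurable [measurable]: "translate z \<in> street_space \<rightarrow>\<^sub>M street_space"
proof -
  let ?G = "{{\<phi> \<in> street_configs. card {s \<in> \<phi>. \<exists>(a, b)\<in>E. s = closed_segment a b} = k} |E k.
      E \<in> sets borel \<and> bounded E}"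
  have "translate z \<in> street_space \<rightarrow>\<^sub>M sigma street_configs ?G"
  proof (rule measurable_measure_of)
  show "?G \<subseteq> Pow street_configs" by auto
  show "translate z \<in> space street_space \<rightarrow> street_configs" by (auto simp: space_street_space)
  fix A assume "A \<in> ?G"
  then obtain E k where E: "E \<in> sets borel" "bounded E"
    and A: "A = {\<phi> \<in> street_configs. card {s \<in> \<phi>. \<exists>(a, b)\<in>E. s = closed_segment a b} = k}" by auto
  define E' where "E' = (\<lambda>p. p - (z, z)) ` E"
  have E'_alt: "E' = (\<lambda>p. p + (z, z)) -` E"
  proof (intro equalityI subsetI)
    fix p assume "p \<in> (\<lambda>p. p + (z, z)) -` E"
    then show "p \<in> E'" unfolding E'_def by (intro image_eqI[of _ _ "p + (z, z)"]) simp_all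
  next
    fix p assume "p \<in> E'"
    then obtain q where "q \<in> E" "p = q - (z, z)" unfolding E'_def by blast
    then have "p + (z, z) = q" by simp
    with \<open>q \<in> E\<close> show "p \<in> (\<lambda>p. p + (z, z)) -` E" by simp
  qed
  have "(\<lambda>p::point \<times> point. p + (z, z)) \<in> borel \<rightarrow>\<^sub>M borel"
    by (intro borel_measurable_continuous_onI continuous_intros)
  from measurable_sets[OF this E(1)] have "E' \<in> sets borel" by (simp add: E'_alt)
  moreover have "bounded E'" unfolding E'_def by (rule bounded_translation_minus[OF E(2)])
  moreover have "card {s \<in> translate z \<phi>. \<exists>(a, b)\<in>E. s = closed_segment a b} = card {s \<in> \<phi>. \<exists>(a, b)\<in>E'. s = closed_segment a b}"
    for \<phi>
  proof -
    have "inj (\<lambda>p::point. p + z)" by (simp add: inj_on_def)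
    then have inj: "inj (\<lambda>s. (\<lambda>p. p + z) ` s)" by (intro injI) (simp add: inj_image_eq_iff)
    have "{s \<in> translate z \<phi>. \<exists>(a, b)\<in>E. s = closed_segment a b} =
        (\<lambda>s. (\<lambda>p. p + z) ` s) ` {s \<in> \<phi>. \<exists>(a, b)\<in>E'. s = closed_segment a b}"
    proof (intro equalityI subsetI)
      fix s assume "s \<in> {s \<in> translate z \<phi>. \<exists>(a, b)\<in>E. s = closed_segment a b}"
      then obtain t a b where t: "t \<in> \<phi>" "s = (\<lambda>p. p + z) ` t" "(a, b) \<in> E" "s = closed_segment a b"
        by (auto simp: translate_def)
      have "(\<lambda>p. p + z) ` t = (\<lambda>p. p + z) ` closed_segment (a - z) (b - z)"
        using t by (simp add: translate_segment)
      then have "t = closed_segment (a - z) (b - z)" by (rule injD[OF inj])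
      moreover have "(a - z, b - z) \<in> E'" using t by (simp add: E'_alt)
      ultimately show "s \<in> (\<lambda>s. (\<lambda>p. p + z) ` s) ` {s \<in> \<phi>. \<exists>(a, b)\<in>E'. s = closed_segment a b}"
        using t by auto
    next
      fix s assume "s \<in> (\<lambda>s. (\<lambda>p. p + z) ` s) ` {s \<in> \<phi>. \<exists>(a, b)\<in>E'. s = closed_segment a b}"
      then obtain a b where t: "closed_segment a b \<in> \<phi>" "(a, b) \<in> E'" "s = (\<lambda>p. p + z) ` closed_segment a b" by auto
      then have "(a + z, b + z) \<in> E" by (simp add: E'_alt)
      then show "s \<in> {s \<in> translate z \<phi>. \<exists>(a, b)\<in>E. s = closed_segment a b}"
        using t translate_segment[of z a b] unfolding translate_def by blast
    qed
    then show ?thesis using card_image[OF inj_on_subset[OF inj]] by simp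
  qed
  ultimately have "translate z -` A \<inter> street_configs = {\<phi> \<in> street_configs. card {s \<in> \<phi>. \<exists>(a, b)\<in>E'. s = closed_segment a b} = k}"
      "E' \<in> sets borel \<and> bounded E'"
    unfolding A by auto
  then have "translate z -` A \<inter> street_configs \<in> sets street_space"
    unfolding street_space_def by (intro in_measure_of) auto
  then show "translate z -` A \<inter> space street_space \<in> sets street_space" by (simp add: space_street_space)
  qed
  then show ?thesis by (subst (2) street_space_def)
qed

lemma translate_Q: "(\<lambda>p. p - c) ` (X \<inter> Q n c) = (\<lambda>p. p - c) ` X \<inter> Q n 0"
proof -
  have "p - c \<in> Q n 0 \<longleftrightarrow> p \<in> Q n c" for p by (simp add: mem_Q)
  then show ?thesis by auto
qed

section \<open>Stabilization radii at rational points\<close>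

definition rat_points :: "real \<Rightarrow> point \<Rightarrow> point set" where
  "rat_points n x = Q n x \<inter> (\<rat> \<times> \<rat>)"

lemma countable_rat_points [simp]: "countable (rat_points n x)"
  unfolding rat_points_def by (rule countable_subset[of _ "\<rat> \<times> \<rat>"]) (auto intro: countable_SIGMA countable_rat)

lemma small_radii_alt: "small_radii R \<phi> n x c \<longleftrightarrow> (SUP y\<in>rat_points n x. ereal (R \<phi> y)) < ereal c"
  by (simp add: small_radii_def rat_points_def)

lemma small_radii_cover:
  assumes I: "finite I" "I \<noteq> {}" and cov: "rat_points n x \<subseteq> (\<Union>i\<in>I. rat_points (n' i) (x' i))"
    and small: "\<And>i. i \<in> I \<Longrightarrow> small_radii R \<phi> (n' i) (x' i) c"
  shows "small_radii R \<phi> n x c"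
proof -
  define s where "s i = (SUP y\<in>rat_points (n' i) (x' i). ereal (R \<phi> y))" for i
  have "(SUP y\<in>rat_points n x. ereal (R \<phi> y)) \<le> Max (s ` I)"
  proof (rule SUP_least)
    fix y assume "y \<in> rat_points n x"
    then obtain i where i: "i \<in> I" "y \<in> rat_points (n' i) (x' i)" using cov by blast
    then have "ereal (R \<phi> y) \<le> s i" unfolding s_def by (intro SUP_upper)
    also have "\<dots> \<le> Max (s ` I)" using I i by (intro Max_ge) auto
    finally show "ereal (R \<phi> y) \<le> Max (s ` I)" .
  qed
  also have "\<dots> < ereal c"
    using I small by (subst Max_less_iff) (auto simp: s_def small_radii_alt)
  finally show ?thesis by (simp add: small_radii_alt)
qed

locale street_law = prob_space M
  for M :: "streets measure" and R :: "streets \<Rightarrow> point \<Rightarrow> real" +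
  assumes sets_M: "sets M = sets street_space"
    and stationary: "\<And>z. distr M street_space (translate z) = M"
    and stabilizing: "stabilizing M R" and connected: "asymp_ess_connected M R"
begin

lemma space_M: "space M = street_configs"
  using sets_eq_imp_space_eq[OF sets_M] by (simp add: space_street_space)

lemma R_measurable [measurable]: "(\<lambda>\<phi>. R \<phi> x) \<in> borel_measurable M"
  using stabilizing unfolding stabilizing_def by blast

lemma translate_M [measurable]: "translate z \<in> M \<rightarrow>\<^sub>M M"
  using translate_measurable[of z] by (simp cong: measurable_cong_sets add: sets_M)

lemma AE_translate:
  assumes "AE \<phi> in M. P \<phi>"
  shows "AE \<phi> in M. P (translate z \<phi>)"
proof -
  have "AE \<phi> in distr M street_space (translate z). P \<phi>" using assms unfolding stationary .
  then show ?thesis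
    by (rule AE_distrD[rotated]) (simp cong: measurable_cong_sets add: sets_M translate_measurable)
qed

lemma prob_translate:
  assumes "A \<in> sets M"
  shows "prob {\<phi>\<in>space M. translate z \<phi> \<in> A} = prob A"
proof -
  have t: "translate z \<in> M \<rightarrow>\<^sub>M street_space"
    using translate_measurable[of z] by (simp cong: measurable_cong_sets add: sets_M)
  have "prob A = measure (distr M street_space (translate z)) A" by (simp add: stationary)
  also have "\<dots> = prob (translate z -` A \<inter> space M)" using assms by (intro measure_distr t) (simp add: sets_M)
  also have "translate z -` A \<inter> space M = {\<phi>\<in>space M. translate z \<phi> \<in> A}" by auto
  finally show ?thesis by simp
qed

text \<open>The pair of \<phi> and \<open>R \<phi>\<close> lies on the graph of R, and by joint
  stationarity the shifted pair has the same law. Lying on the graph is tested at countably many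
  points, which makes it measurable.\<close>

lemma R_covariant: "AE \<phi> in M. \<forall>x\<in>\<rat> \<times> \<rat>. R (translate z \<phi>) x = R \<phi> (x - z)"
proof -
  define N where "N = street_space \<Otimes>\<^sub>M PiM (UNIV :: point set) (\<lambda>_. borel :: real measure)"
  have fields: "(\<lambda>\<phi>. \<phi>) \<in> M \<rightarrow>\<^sub>M street_space" "translate z \<in> M \<rightarrow>\<^sub>M street_space"
    using translate_measurable[of z] by (simp_all cong: measurable_cong_sets add: sets_M)
  have R1: "(\<lambda>\<phi>. R \<phi>) \<in> M \<rightarrow>\<^sub>M PiM UNIV (\<lambda>_. borel)" "(\<lambda>\<phi> x. R \<phi> (x - z)) \<in> M \<rightarrow>\<^sub>M PiM UNIV (\<lambda>_. borel)"
    by (intro measurable_PiM_single'; auto)+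
  have g: "(\<lambda>\<phi>. (\<phi>, R \<phi>)) \<in> M \<rightarrow>\<^sub>M N" and f: "(\<lambda>\<phi>. (translate z \<phi>, \<lambda>x. R \<phi> (x - z))) \<in> M \<rightarrow>\<^sub>M N"
    unfolding N_def using fields R1 by (intro measurable_Pair; simp)+
  define C where "C p \<longleftrightarrow> (\<forall>x\<in>\<rat> \<times> \<rat>. snd p x = R (fst p) x)" for p :: "streets \<times> (point \<Rightarrow> real)"
  have "Measurable.pred N C"
    unfolding C_def
  proof (rule pred_countable_Ball)
    show "countable (\<rat> \<times> \<rat> :: point set)" by (intro countable_SIGMA countable_rat)
    fix x :: point
    have "(\<lambda>\<phi>. R \<phi> x) \<in> street_space \<rightarrow>\<^sub>M borel" using R_measurable[of x] by (simp cong: measurable_cong_sets add: sets_M)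
    then have "(\<lambda>p. R (fst p) x) \<in> N \<rightarrow>\<^sub>M borel" unfolding N_def by measurable
    moreover have "(\<lambda>p. snd p x) \<in> N \<rightarrow>\<^sub>M borel" unfolding N_def by measurable
    ultimately show "Measurable.pred N (\<lambda>p. snd p x = R (fst p) x)" by measurable
  qed
  then have C: "{p\<in>space N. C p} \<in> sets N" by (simp add: pred_def)
  have "distr M N (\<lambda>\<phi>. (translate z \<phi>, \<lambda>x. R \<phi> (x - z))) = distr M N (\<lambda>\<phi>. (\<phi>, R \<phi>))"
    using stabilizing unfolding stabilizing_def N_def by blast
  moreover have "AE p in distr M N (\<lambda>\<phi>. (\<phi>, R \<phi>)). C p"
    using C by (subst AE_distr_iff[OF g]) (auto simp: C_def)
  ultimately have "AE p in distr M N (\<lambda>\<phi>. (translate z \<phi>, \<lambda>x. R \<phi> (x - z))). C p" by (simp only:)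
  then have "AE \<phi> in M. C (translate z \<phi>, \<lambda>x. R \<phi> (x - z))" by (rule AE_distrD[OF f])
  then show ?thesis by eventually_elim (auto simp: C_def)
qed

text \<open>A rational shift permutes the rational points, so the two suprema run over corresponding
  values.\<close>

lemma small_radii_translate:
  assumes z: "z \<in> \<rat> \<times> \<rat>"
  shows "AE \<phi> in M. \<forall>n x c. small_radii R (translate z \<phi>) n x c \<longleftrightarrow> small_radii R \<phi> n (x - z) c"
  using R_covariant[of z]
proof eventually_elim
  case (elim \<phi>)
  show ?case
  proof (intro allI)
    fix n x c
    have "rat_points n x = (\<lambda>y. y + z) ` rat_points n (x - z)"
    proof (intro equalityI subsetI)
      fix y assume y: "y \<in> rat_points n x"
      then have "y - z \<in> rat_points n (x - z)"
        using z by (auto simp: rat_points_def mem_Q mem_Times_iff algebra_simps)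
      then show "y \<in> (\<lambda>y. y + z) ` rat_points n (x - z)" by (intro image_eqI[of _ _ "y - z"]) auto
    next
      fix y assume "y \<in> (\<lambda>y. y + z) ` rat_points n (x - z)"
      then show "y \<in> rat_points n x"
        using z by (auto simp: rat_points_def mem_Q mem_Times_iff algebra_simps)
    qed
    then have "(SUP y\<in>rat_points n x. ereal (R (translate z \<phi>) y)) =
        (SUP y\<in>rat_points n (x - z). ereal (R (translate z \<phi>) (y + z)))" by (simp add: image_image)
    also have "\<dots> = (SUP y\<in>rat_points n (x - z). ereal (R \<phi> y))"
    proof (intro SUP_cong refl)
      fix y assume "y \<in> rat_points n (x - z)"
      then have "y + z \<in> \<rat> \<times> \<rat>" using z by (auto simp: rat_points_def mem_Times_iff)
      then show "ereal (R (translate z \<phi>) (y + z)) = ereal (R \<phi> y)" using bspec[OF elim] by simp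
    qed
    finally show "small_radii R (translate z \<phi>) n x c \<longleftrightarrow> small_radii R \<phi> n (x - z) c"
      by (simp add: small_radii_alt)
  qed
qed

lemma small_radii_measurable [measurable]: "Measurable.pred M (\<lambda>\<phi>. small_radii R \<phi> n x c)"
  unfolding small_radii_alt by measurable

lemma small_radii_sets: "{\<phi>\<in>space M. small_radii R \<phi> n x c} \<in> sets M"
  using small_radii_measurable by (simp add: pred_def)

lemma prob_small_radii:
  assumes "x \<in> \<rat> \<times> \<rat>"
  shows "prob {\<phi>\<in>space M. \<not> small_radii R \<phi> n x c} = prob {\<phi>\<in>space M. \<not> small_radii R \<phi> n 0 c}"
proof -
  have A: "{\<phi>\<in>space M. \<not> small_radii R \<phi> n y c} \<in> sets M" for y by measurable
  have "- x \<in> \<rat> \<times> \<rat>" using assms by (cases x) auto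
  have "prob {\<phi>\<in>space M. \<not> small_radii R \<phi> n 0 c} = prob {\<phi>\<in>space M. translate (- x) \<phi> \<in> {\<phi>\<in>space M. \<not> small_radii R \<phi> n 0 c}}"
    by (rule prob_translate[symmetric, OF A])
  also have "\<dots> = prob {\<phi>\<in>space M. \<not> small_radii R \<phi> n x c}"
  proof (rule finite_measure_eq_AE)
    show "AE \<phi> in M. \<phi> \<in> {\<phi>\<in>space M. translate (- x) \<phi> \<in> {\<phi>\<in>space M. \<not> small_radii R \<phi> n 0 c}} \<longleftrightarrow>
        \<phi> \<in> {\<phi>\<in>space M. \<not> small_radii R \<phi> n x c}"
      using small_radii_translate[OF \<open>- x \<in> \<rat> \<times> \<rat>\<close>]
    proof eventually_elim
      case (elim \<phi>)
      from spec[OF spec[OF spec[OF elim, of n], of 0], of c] show ?case by (simp add: space_M)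
    qed
    show "{\<phi>\<in>space M. translate (- x) \<phi> \<in> {\<phi>\<in>space M. \<not> small_radii R \<phi> n 0 c}} \<in> events"
      using measurable_sets[OF translate_M A] by (simp add: vimage_def Int_def conj_commute)
  qed (rule A)
  finally show ?thesis by simp
qed

definition fail :: "nat \<Rightarrow> real" where
  "fail j = prob {\<phi>\<in>space M. \<not> small_radii R \<phi> j 0 j}"

lemma fail_tendsto: "fail \<longlonglongrightarrow> 0"
proof -
  have "fail = (\<lambda>j. 1 - prob {\<phi>\<in>space M. small_radii R \<phi> j 0 j})"
    unfolding fail_def using prob_neg[OF small_radii_sets] by simp
  moreover have "(\<lambda>j::nat. prob {\<phi>\<in>space M. small_radii R \<phi> j 0 j}) \<longlonglongrightarrow> 1"
    using stabilizing unfolding stabilizing_def by blast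
  then have "(\<lambda>j::nat. 1 - prob {\<phi>\<in>space M. small_radii R \<phi> j 0 j}) \<longlonglongrightarrow> 1 - 1"
    by (intro tendsto_diff tendsto_const)
  ultimately show ?thesis by simp
qed

text \<open>Stabilization provides the bound j on boxes of side j, whereas essential connectedness
  with n = 2 j demands the bound j on boxes of side 4 j. The large box is covered by 5 x 5 small
  ones.\<close>

lemma fail_large_box:
  assumes j: "0 < j" and x: "x \<in> \<rat> \<times> \<rat>"
  shows "prob {\<phi>\<in>space M. \<not> small_radii R \<phi> (4 * real j) x j} \<le> 25 * fail j"
proof -
  define I where "I = {-2..2::int} \<times> {-2..2::int}"
  define c where "c i = (real j * real_of_int (fst i), real j * real_of_int (snd i))" for i
  have I: "finite I" "I \<noteq> {}" "card I = 25" by (auto simp: I_def)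
  have c: "c i \<in> \<rat> \<times> \<rat>" for i by (simp add: c_def)
  have cov: "rat_points (4 * real j) 0 \<subseteq> (\<Union>i\<in>I. rat_points (real j) (c i))"
  proof
    fix p assume p: "p \<in> rat_points (4 * real j) 0"
    define i where "i = site_of (real j) p"
    have "p \<in> Q (real j) (c i)" using in_site_box[of "real j" p] j by (simp add: i_def c_def center_def)
    moreover have "i \<in> I"
    proof -
      have "\<bar>fst p\<bar> \<le> 2 * real j" "\<bar>snd p\<bar> \<le> 2 * real j" using p by (auto simp: rat_points_def mem_Q)
      then have "\<bar>fst p / real j - 0\<bar> \<le> 2" "\<bar>snd p / real j - 0\<bar> \<le> 2" using j by (auto simp: field_simps)
      then have "\<bar>round (fst p / real j)\<bar> \<le> 2" "\<bar>round (snd p / real j)\<bar> \<le> 2"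
        using of_int_round_abs_le[of "fst p / real j"] of_int_round_abs_le[of "snd p / real j"] by linarith+
      then show ?thesis by (auto simp: I_def i_def site_of_def abs_le_iff)
    qed
    ultimately show "p \<in> (\<Union>i\<in>I. rat_points (real j) (c i))" using p by (auto simp: rat_points_def)
  qed
  have meas: "{\<phi>\<in>space M. \<not> small_radii R \<phi> n y c} \<in> sets M" for n y c by measurable
  have "prob {\<phi>\<in>space M. \<not> small_radii R \<phi> (4 * real j) x j} = prob {\<phi>\<in>space M. \<not> small_radii R \<phi> (4 * real j) 0 j}"
    by (rule prob_small_radii[OF x])
  also have "\<dots> \<le> prob (\<Union>i\<in>I. {\<phi>\<in>space M. \<not> small_radii R \<phi> (real j) (c i) j})"
  proof (rule finite_measure_mono)
    show "{\<phi>\<in>space M. \<not> small_radii R \<phi> (4 * real j) 0 j} \<subseteq> (\<Union>i\<in>I. {\<phi>\<in>space M. \<not> small_radii R \<phi> (real j) (c i) j})"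
      using small_radii_cover[OF I(1,2) cov] by blast
    show "(\<Union>i\<in>I. {\<phi>\<in>space M. \<not> small_radii R \<phi> (real j) (c i) j}) \<in> events"
      using I(1) meas by (intro sets.finite_UN) auto
  qed
  also have "\<dots> \<le> (\<Sum>i\<in>I. prob {\<phi>\<in>space M. \<not> small_radii R \<phi> (real j) (c i) j})"
    using I(1) meas by (intro finite_measure_subadditive_finite) auto
  also have "\<dots> = (\<Sum>i\<in>I. fail j)" unfolding fail_def using prob_small_radii[OF c] by simp
  also have "\<dots> = 25 * fail j" using I by simp
  finally show ?thesis .
qed

text \<open>The conclusion of \<open>asymp_ess_connected\<close> at an arbitrary centre, with
  positive length weakened to non-emptiness.\<close>

definition linked :: "real \<Rightarrow> point \<Rightarrow> streets \<Rightarrow> bool" where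
  "linked n x \<phi> \<longleftrightarrow> \<Union>\<phi> \<inter> Q n x \<noteq> {} \<and> (\<exists>C\<in>components (\<Union>\<phi> \<inter> Q (2 * n) x). \<Union>\<phi> \<inter> Q n x \<subseteq> C)"

lemma components_translate:
  fixes S :: "'a::real_normed_vector set"
  assumes "C \<in> components S"
  shows "(\<lambda>p. p + z) ` C \<in> components ((\<lambda>p. p + z) ` S)"
proof -
  have "homeomorphism S ((\<lambda>p. p + z) ` S) (\<lambda>p. p + z) (\<lambda>p. p - z)"
    by (auto simp: homeomorphism_def image_image intro!: continuous_intros)
  moreover obtain x where x: "x \<in> S" "C = connected_component_set S x" using assms by (auto simp: components_def)
  have "(\<lambda>p. p + z) ` connected_component_set S x = connected_component_set ((\<lambda>p. p + z) ` S) (x + z)"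
  proof (rule connected_component_unique[symmetric])
    show "x + z \<in> (\<lambda>p. p + z) ` connected_component_set S x" using x(1) by simp
    show "(\<lambda>p. p + z) ` connected_component_set S x \<subseteq> (\<lambda>p. p + z) ` S"
      using connected_component_subset by blast
    show "connected ((\<lambda>p. p + z) ` connected_component_set S x)"
      by (intro connected_continuous_image continuous_intros) simp
    fix c' assume c': "x + z \<in> c'" "c' \<subseteq> (\<lambda>p. p + z) ` S" "connected c'"
    have "connected ((\<lambda>p. p - z) ` c')" by (intro connected_continuous_image continuous_intros c')
    moreover have "(\<lambda>p. p - z) ` c' \<subseteq> S" using c'(2) by force
    moreover have "x \<in> (\<lambda>p. p - z) ` c'" using c'(1) by force
    ultimately have "(\<lambda>p. p - z) ` c' \<subseteq> connected_component_set S x" by (rule connected_component_maximal[rotated 1])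
    then show "c' \<subseteq> (\<lambda>p. p + z) ` connected_component_set S x" by force
  qed
  then show ?thesis using x by (auto simp: components_def)
qed

text \<open>Stationarity moves the statement at the origin to other centres. Integer centres are
  rational, and they leave only countably many exceptional null sets.\<close>

lemma eventually_linked:
  "\<forall>\<^sub>F j in sequentially. AE \<phi> in M. \<forall>x\<in>range (\<lambda>(a, b). (real_of_int a, real_of_int b)).
     small_radii R \<phi> (4 * real j) x j \<longrightarrow> linked (2 * real j) x \<phi>"
proof -
  have len: "0 < len A \<longrightarrow> A \<noteq> {}" for A using len_finite[of "{}"] by auto
  obtain n0 :: nat where n0: "\<forall>n\<ge>n0. AE \<phi> in M. small_radii R \<phi> (2 * n) 0 (n / 2) \<longrightarrow>
        len (\<Union>\<phi> \<inter> Q n 0) > 0 \<and> (\<exists>C\<in>components (\<Union>\<phi> \<inter> Q (2 * n) 0). \<Union>\<phi> \<inter> Q n 0 \<subseteq> C)"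
    using connected unfolding asymp_ess_connected_def eventually_sequentially by blast
  have n0: "AE \<phi> in M. small_radii R \<phi> (2 * real n) 0 (real n / 2) \<longrightarrow> linked (real n) 0 \<phi>" if "n \<ge> n0" for n
    using n0[rule_format, OF that] by eventually_elim (use len in \<open>auto simp: linked_def\<close>)
  have "AE \<phi> in M. \<forall>x\<in>range (\<lambda>(a, b). (real_of_int a, real_of_int b)).
     small_radii R \<phi> (4 * real j) x j \<longrightarrow> linked (2 * real j) x \<phi>" if j: "j \<ge> n0" for j
  proof (subst AE_ball_countable, simp, safe)
    fix a b
    define x where "x = (real_of_int a, real_of_int b)"
    have x: "- x \<in> \<rat> \<times> \<rat>" by (simp add: x_def)
    have "AE \<phi> in M. small_radii R \<phi> (2 * real (2 * j)) 0 (real (2 * j) / 2) \<longrightarrow> linked (real (2 * j)) 0 \<phi>"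
      using j by (intro n0) simp
    then have "AE \<phi> in M. small_radii R (translate (- x) \<phi>) (2 * real (2 * j)) 0 (real (2 * j) / 2) \<longrightarrow>
        linked (real (2 * j)) 0 (translate (- x) \<phi>)" by (rule AE_translate)
    then show "AE \<phi> in M. small_radii R \<phi> (4 * real j) (real_of_int a, real_of_int b) j \<longrightarrow>
        linked (2 * real j) (real_of_int a, real_of_int b) \<phi>"
      using small_radii_translate[OF x] unfolding x_def[symmetric]
    proof eventually_elim
      case (elim \<phi>)
      show ?case
      proof
        assume "small_radii R \<phi> (4 * real j) x j"
        then have l: "linked (real (2 * j)) 0 (translate (- x) \<phi>)" using elim by simp
        define X where "X = \<Union>(translate (- x) \<phi>)"
        have X: "(\<lambda>p. p + x) ` (X \<inter> Q n 0) = \<Union>\<phi> \<inter> Q n x" for n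
          using translate_Q[of x "\<Union>\<phi>" n] by (simp add: X_def Union_translate flip: translate_Q) (simp add: image_image)
        obtain C where C: "C \<in> components (X \<inter> Q (2 * (2 * real j)) 0)" "X \<inter> Q (2 * real j) 0 \<subseteq> C"
          using l by (auto simp: linked_def X_def)
        have "(\<lambda>p. p + x) ` C \<in> components (\<Union>\<phi> \<inter> Q (2 * (2 * real j)) x)"
          using components_translate[OF C(1), of x] by (simp add: X)
        moreover have "\<Union>\<phi> \<inter> Q (2 * real j) x \<subseteq> (\<lambda>p. p + x) ` C" using C(2) unfolding X[symmetric] by (rule image_mono)
        moreover have "\<Union>\<phi> \<inter> Q (2 * real j) x \<noteq> {}"
          using l unfolding X[symmetric] by (simp add: linked_def X_def)
        ultimately show "linked (2 * real j) x \<phi>" by (auto simp: linked_def)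
      qed
    qed
  qed
  then show ?thesis unfolding eventually_sequentially by blast
qed

end

section \<open>Recentred boxes and independent sites\<close>

lemma shift_measurable: "(\<lambda>A. (\<lambda>p. p - c) ` A) \<in> closed_space \<rightarrow>\<^sub>M closed_space"
proof -
  let ?G = "{{F. closed F \<and> F \<inter> K \<noteq> {}} | K. compact (K :: point set)}"
  have "(\<lambda>A. (\<lambda>p. p - c) ` A) \<in> closed_space \<rightarrow>\<^sub>M sigma {F. closed F} ?G"
  proof (rule measurable_measure_of)
    show "(\<lambda>A. (\<lambda>p. p - c) ` A) \<in> space closed_space \<rightarrow> {F. closed F}"
      by (auto simp: space_closed_space closed_translation_subtract)
    fix Y assume "Y \<in> ?G"
    then obtain K where K: "compact K" "Y = {F. closed F \<and> F \<inter> K \<noteq> {}}" by blast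
    have "compact ((+) c ` K)" using K(1) by (rule compact_translation)
    then have "Measurable.pred closed_space (\<lambda>A. A \<inter> (+) c ` K \<noteq> {})" by (rule hit_measurable)
    moreover have "(\<lambda>p. p - c) ` A \<inter> K \<noteq> {} \<longleftrightarrow> A \<inter> (+) c ` K \<noteq> {}" for A by force
    ultimately show "(\<lambda>A. (\<lambda>p. p - c) ` A) -` Y \<inter> space closed_space \<in> sets closed_space"
      by (simp add: pred_def K(2) vimage_def Int_def space_closed_space closed_translation_subtract conj_commute cong: conj_cong)
  qed auto
  then show ?thesis by (subst (2) closed_space_def)
qed

text \<open>A point outside the closed set K has a rational closed box around it that misses K, so
  countably many miss conditions suffice.\<close>

lemma subset_measurable:
  fixes K :: "point set"
  assumes "closed K"
  shows "Measurable.pred closed_space (\<lambda>A. A \<subseteq> K)"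
proof -
  define B where "B = {p\<in>rat_boxes. cbox (fst p) (snd p) \<inter> K = {}}"
  have "Measurable.pred closed_space (\<lambda>A. \<forall>p\<in>B. A \<inter> cbox (fst p) (snd p) = {})"
    by (intro pred_countable_Ball miss_measurable countable_subset[OF _ countable_rat_boxes]) (auto simp: B_def)
  moreover have "(\<forall>p\<in>B. A \<inter> cbox (fst p) (snd p) = {}) \<longleftrightarrow> A \<subseteq> K" for A
  proof
    assume R: "\<forall>p\<in>B. A \<inter> cbox (fst p) (snd p) = {}"
    show "A \<subseteq> K"
    proof (rule ccontr)
      assume "\<not> A \<subseteq> K"
      then obtain x where x: "x \<in> A" "x \<in> - K" by blast
      have "open (- K)" using assms by auto
      then obtain e where e: "e > 0" "ball x e \<subseteq> - K" using x(2) by (meson openE)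
      obtain a b where ab: "(a, b) \<in> rat_boxes" "x \<in> box a b" "cbox a b \<subseteq> ball x e" using rat_box_near[OF e(1)] .
      then have "(a, b) \<in> B" using e(2) by (auto simp: B_def)
      then show False using R x(1) ab(2) box_subset_cbox[of a b] by fastforce
    qed
  qed (auto simp: B_def)
  ultimately show ?thesis by simp
qed

context street_law
begin

text \<open>As \<open>fail\<close> tends to 0, almost surely small radii occur on arbitrarily large
  boxes. Any two points lie in such a box and hence in one component. Connectedness makes shortest
  paths exist between all points of the streets.\<close>

lemma AE_connected: "AE \<phi> in M. connected (\<Union>\<phi>)"
proof -
  have small: "AE \<phi> in M. \<phi> \<notin> {\<phi>. \<forall>j\<ge>J. \<not> small_radii R \<phi> (4 * real j) 0 j}" for J :: nat
  proof (rule AE_notI_small)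
    fix c :: real assume c: "c > 0"
    have "\<forall>\<^sub>F j in sequentially. fail j < c / 25" using order_tendstoD(2)[OF fail_tendsto, of "c / 25"] c by simp
    then have "\<forall>\<^sub>F j in sequentially. fail j < c / 25 \<and> max 1 J \<le> j"
      by (intro eventually_conj eventually_ge_at_top)
    then obtain j where j: "fail j < c / 25" "max 1 J \<le> j" using eventually_happens'[OF sequentially_bot] by blast
    define A where "A = {\<phi>\<in>space M. \<not> small_radii R \<phi> (4 * real j) 0 j}"
    have A: "A \<in> sets M" unfolding A_def by measurable
    have "prob A \<le> 25 * fail j" unfolding A_def using j by (intro fail_large_box) (auto simp: zero_prod_def)
    also have "\<dots> \<le> c" using j by simp
    finally have "emeasure M A \<le> ennreal c" by (simp add: emeasure_eq_measure ennreal_leI)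
    then show "\<exists>A\<in>events. {\<phi>. \<forall>j\<ge>J. \<not> small_radii R \<phi> (4 * real j) 0 j} \<inter> space M \<subseteq> A \<and> emeasure M A \<le> ennreal c"
      using A j(2) by (intro bexI[of _ A]) (auto simp: A_def)
  qed
  obtain j0 where j0: "\<And>j. j \<ge> j0 \<Longrightarrow> AE \<phi> in M. \<forall>x\<in>range (\<lambda>(a, b). (real_of_int a, real_of_int b)).
     small_radii R \<phi> (4 * real j) x j \<longrightarrow> linked (2 * real j) x \<phi>"
    using eventually_linked unfolding eventually_sequentially by blast
  have "AE \<phi> in M. \<forall>J. \<phi> \<notin> {\<phi>. \<forall>j\<ge>J. \<not> small_radii R \<phi> (4 * real j) 0 j}"
    using small by (simp only: AE_all_countable) simp
  moreover have "AE \<phi> in M. \<forall>j\<in>{j0..}. \<forall>x\<in>range (\<lambda>(a, b). (real_of_int a, real_of_int b)).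
     small_radii R \<phi> (4 * real j) x j \<longrightarrow> linked (2 * real j) x \<phi>"
    using j0 by (subst AE_ball_countable) auto
  ultimately show ?thesis
  proof eventually_elim
    case (elim \<phi>)
    show ?case
      unfolding connected_iff_connected_component
    proof (intro ballI)
      fix x y assume xy: "x \<in> \<Union>\<phi>" "y \<in> \<Union>\<phi>"
      obtain N :: nat where N: "max (max \<bar>fst x\<bar> \<bar>snd x\<bar>) (max \<bar>fst y\<bar> \<bar>snd y\<bar>) \<le> real N" using real_arch_simple by blast
      obtain j where j: "j \<ge> max j0 N" "small_radii R \<phi> (4 * real j) 0 j" using elim(1) by blast
      have "(0 :: point) = (\<lambda>(a, b). (real_of_int a, real_of_int b)) (0, 0)" by (simp add: zero_prod_def)
      then have "0 \<in> range (\<lambda>(a, b). (real_of_int a, real_of_int b))" by blast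
      moreover have "j \<in> {j0..}" using j by simp
      ultimately have "linked (2 * real j) 0 \<phi>" using elim(2) j(2) by blast
      then obtain C where C: "C \<in> components (\<Union>\<phi> \<inter> Q (2 * (2 * real j)) 0)" "\<Union>\<phi> \<inter> Q (2 * real j) 0 \<subseteq> C"
        by (auto simp: linked_def)
      have "real N \<le> real j" using j by simp
      then have "x \<in> Q (2 * real j) 0" "y \<in> Q (2 * real j) 0" using N by (auto simp: mem_Q)
      then have "x \<in> C" "y \<in> C" using xy C(2) by auto
      moreover have "connected C" "C \<subseteq> \<Union>\<phi>" using C(1) in_components_connected in_components_subset by blast+
      ultimately show "connected_component (\<Union>\<phi>) x y" by (auto simp: connected_component_def)
    qed
  qed
qed

text \<open>The sites have spacing m = 8 k, and 128 k = 16 m. The factor 8 turns the sides and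
  offsets of all boxes in \<open>well_connected\<close> into integer multiples of k.\<close>

definition good :: "(point set \<Rightarrow> bool) \<Rightarrow> nat \<Rightarrow> streets \<Rightarrow> site \<Rightarrow> bool" where
  "good G k \<phi> z \<longleftrightarrow> G ((\<lambda>p. p - center (8 * real k) z) ` (\<Union>\<phi> \<inter> Q (128 * real k) (center (8 * real k) z))) \<and>
     small_radii R \<phi> (128 * real k) (center (8 * real k) z) (128 * real k)"

context
  fixes G :: "point set \<Rightarrow> bool" and k :: nat
  assumes G: "Measurable.pred closed_space G" "\<And>A. G A \<Longrightarrow> A \<noteq> {}" and k: "0 < k"
begin

text \<open>Stabilization applies one function f to restrictions that are not recentred, whereas G
  refers to recentred ones. So f has to find the site in I by itself: the boxes are disjoint, and a
  non-empty restriction fits into only one of them.\<close>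

lemma good_family:
  assumes I: "finite I" "\<And>u v. u \<in> I \<Longrightarrow> v \<in> I \<Longrightarrow> u \<noteq> v \<Longrightarrow> 49 \<le> site_dist u v"
  obtains X :: "point \<Rightarrow> streets \<Rightarrow> real" where "indep_vars (\<lambda>_. borel) X (center (8 * real k) ` I)"
    "\<And>z \<phi>. z \<in> I \<Longrightarrow> X (center (8 * real k) z) \<phi> = (if good G k \<phi> z then 1 else 0)"
proof -
  define m where "m = 8 * real k"
  define n where "n = 128 * k"
  have m: "0 < m" using k by (simp add: m_def)
  have nm: "real n = 16 * m" by (simp add: n_def m_def)
  define f where "f A = (if \<exists>z\<in>I. A \<subseteq> Q n (center m z) \<and> G ((\<lambda>p. p - center m z) ` A) then 1 else 0 :: real)" for A
  define X where "X = (\<lambda>x \<phi>. f (\<Union>\<phi> \<inter> Q n x) * (if small_radii R \<phi> n x n then 1 else 0))"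
  have "f \<in> borel_measurable closed_space"
  proof -
    have "Measurable.pred closed_space (\<lambda>A. \<exists>z\<in>I. A \<subseteq> Q n (center m z) \<and> G ((\<lambda>p. p - center m z) ` A))"
      using I(1) by (intro pred_countable_Bex pred_intros_logic subset_measurable
          measurable_compose[OF shift_measurable G(1)] countable_finite) auto
    then show ?thesis unfolding f_def by measurable
  qed
  moreover have "\<forall>x\<in>center m ` I. \<forall>y\<in>center m ` I - {x}. dist x y > 3 * real n"
  proof (intro ballI)
    fix x y assume "x \<in> center m ` I" "y \<in> center m ` I - {x}"
    then obtain u v where uv: "u \<in> I" "v \<in> I" "center m v \<noteq> center m u" "x = center m u" "y = center m v" by blast
    then have "49 * m \<le> \<bar>fst (center m u) - fst (center m v)\<bar> \<or> 49 * m \<le> \<bar>snd (center m u) - snd (center m v)\<bar>"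
      by (intro center_far[OF m] I(2)) auto
    moreover have "\<bar>fst (center m u) - fst (center m v)\<bar> \<le> dist (center m u) (center m v)"
      "\<bar>snd (center m u) - snd (center m v)\<bar> \<le> dist (center m u) (center m v)"
      using dist_fst_le[of "center m u" "center m v"] dist_snd_le[of "center m u" "center m v"] by (auto simp: dist_real_def)
    ultimately show "3 * real n < dist x y" using m unfolding nm uv(4,5) by linarith
  qed
  moreover have "\<forall>A. 0 \<le> f A" "\<exists>c. \<forall>A. f A \<le> c" by (auto simp: f_def intro!: exI[of _ 1])
  moreover have "real n \<ge> 1" "finite (center m ` I)" using k I(1) by (auto simp: n_def)
  moreover note stabilizing[unfolded stabilizing_def, THEN conjunct2, THEN conjunct2, THEN conjunct2,
      THEN spec[of _ n], THEN spec[of _ f], THEN spec[of _ "center m ` I"]]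
  ultimately have "indep_vars (\<lambda>_. borel) X (center m ` I)"
    unfolding X_def by simp
  moreover have "X (center m z) \<phi> = (if good G k \<phi> z then 1 else 0)" if z: "z \<in> I" for z \<phi>
  proof -
    define A where "A = \<Union>\<phi> \<inter> Q n (center m z)"
    have "(\<exists>u\<in>I. A \<subseteq> Q n (center m u) \<and> G ((\<lambda>p. p - center m u) ` A)) \<longleftrightarrow> G ((\<lambda>p. p - center m z) ` A)"
    proof
      assume "\<exists>u\<in>I. A \<subseteq> Q n (center m u) \<and> G ((\<lambda>p. p - center m u) ` A)"
      then obtain u where u: "u \<in> I" "A \<subseteq> Q n (center m u)" "G ((\<lambda>p. p - center m u) ` A)" by blast
      then have "A \<noteq> {}" using G(2) by blast
      then have "Q n (center m u) \<inter> Q n (center m z) \<noteq> {}" using u(2) by (auto simp: A_def)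
      then have "u = z" using site_boxes_disjoint[OF m I(2)[OF u(1) z]] unfolding nm by blast
      then show "G ((\<lambda>p. p - center m z) ` A)" using u(3) by simp
    qed (use z in \<open>auto simp: A_def\<close>)
    moreover have "128 * real k = real n" "8 * real k = m" by (simp_all add: n_def m_def)
    ultimately show ?thesis unfolding X_def f_def good_def A_def by simp
  qed
  ultimately show ?thesis using that unfolding m_def by blast
qed

text \<open>Independence of a family with one member already contains the measurability of that
  member.\<close>

lemma good_sets: "{\<phi>\<in>space M. good G k \<phi> z} \<in> sets M"
proof -
  obtain X :: "point \<Rightarrow> streets \<Rightarrow> real" where X: "indep_vars (\<lambda>_. borel) X (center (8 * real k) ` {z})"
    "\<And>\<phi>. X (center (8 * real k) z) \<phi> = (if good G k \<phi> z then 1 else 0)"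
    using good_family[of "{z}"] by (metis empty_iff finite.emptyI finite.insertI insertE insertI1)
  have "X (center (8 * real k) z) \<in> borel_measurable M" using X(1) by (auto simp: indep_vars_def)
  then have "{\<phi>\<in>space M. X (center (8 * real k) z) \<phi> = 1} \<in> sets M" by measurable
  moreover have "(if b then 1 else 0 :: real) = 1 \<longleftrightarrow> b" for b by simp
  ultimately show ?thesis unfolding X(2) by simp
qed

lemma prob_good: "prob {\<phi>\<in>space M. good G k \<phi> z} = prob {\<phi>\<in>space M. good G k \<phi> 0}"
proof -
  define c where "c = center (8 * real k) z"
  have c: "- c \<in> \<rat> \<times> \<rat>" by (simp add: c_def center_def)
  have "prob {\<phi>\<in>space M. good G k \<phi> 0} = prob {\<phi>\<in>space M. translate (- c) \<phi> \<in> {\<phi>\<in>space M. good G k \<phi> 0}}"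
    by (rule prob_translate[symmetric, OF good_sets])
  also have "\<dots> = prob {\<phi>\<in>space M. good G k \<phi> z}"
  proof (rule finite_measure_eq_AE)
    show "AE \<phi> in M. \<phi> \<in> {\<phi>\<in>space M. translate (- c) \<phi> \<in> {\<phi>\<in>space M. good G k \<phi> 0}} \<longleftrightarrow>
        \<phi> \<in> {\<phi>\<in>space M. good G k \<phi> z}"
      using small_radii_translate[OF c]
    proof eventually_elim
      case (elim \<phi>)
      have "center (8 * real k) 0 = 0" by (simp add: center_def zero_prod_def)
      moreover have "\<Union>(translate (- c) \<phi>) \<inter> Q (128 * real k) 0 = (\<lambda>p. p - c) ` (\<Union>\<phi> \<inter> Q (128 * real k) c)"
        by (simp add: translate_Q Union_translate)
      moreover have "small_radii R (translate (- c) \<phi>) (128 * real k) 0 (128 * real k) \<longleftrightarrow>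
          small_radii R \<phi> (128 * real k) c (128 * real k)"
        using spec[OF spec[OF spec[OF elim, of "128 * real k"], of 0], of "128 * real k"] by simp
      ultimately have "good G k (translate (- c) \<phi>) 0 \<longleftrightarrow> good G k \<phi> z"
        by (simp add: good_def c_def)
      then show ?case by (simp add: space_M)
    qed
    show "{\<phi>\<in>space M. translate (- c) \<phi> \<in> {\<phi>\<in>space M. good G k \<phi> 0}} \<in> events"
      using measurable_sets[OF translate_M good_sets] by (simp add: vimage_def Int_def conj_commute)
  qed (rule good_sets)
  finally show ?thesis by simp
qed

text \<open>By independence the mean factorises, and each factor is at most \<eta> plus the
  probability of not being good.\<close>

lemma mean_chain:
  assumes \<eta>: "0 \<le> \<eta>" and p: "prob {\<phi>\<in>space M. \<not> good G k \<phi> 0} \<le> p" and zs: "separated zs"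
  shows "(\<integral>\<^sup>+\<phi>. (\<Prod>z\<in>set zs. if good G k \<phi> z then ennreal \<eta> else 1) \<partial>M) \<le> ennreal (p + \<eta>) ^ length zs"
proof -
  define c where "c = center (8 * real k)"
  obtain X :: "point \<Rightarrow> streets \<Rightarrow> real" where X: "indep_vars (\<lambda>_. borel) X (c ` set zs)"
    "\<And>z \<phi>. z \<in> set zs \<Longrightarrow> X (c z) \<phi> = (if good G k \<phi> z then 1 else 0)"
    unfolding c_def using good_family[of "set zs"] separated_dist[OF zs] by auto
  have inj: "inj_on c (set zs)"
    using k by (intro inj_onI) (auto simp: c_def center_def prod_eq_iff)
  define h where "h t = (if t = 1 then ennreal \<eta> else 1)" for t :: real
  have h: "h \<in> borel_measurable borel" unfolding h_def by measurable
  have "(\<integral>\<^sup>+\<phi>. (\<Prod>z\<in>set zs. if good G k \<phi> z then ennreal \<eta> else 1) \<partial>M) = (\<integral>\<^sup>+\<phi>. (\<Prod>x\<in>c ` set zs. h (X x \<phi>)) \<partial>M)"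
    using X(2) by (intro nn_integral_cong) (auto simp: prod.reindex[OF inj] h_def intro!: prod.cong)
  also have "\<dots> = (\<Prod>x\<in>c ` set zs. \<integral>\<^sup>+\<phi>. h (X x \<phi>) \<partial>M)"
    using indep_vars_compose2[OF X(1), of "\<lambda>_. h" "\<lambda>_. borel"] h by (intro indep_vars_nn_integral) auto
  also have "\<dots> = (\<Prod>z\<in>set zs. \<integral>\<^sup>+\<phi>. h (X (c z) \<phi>) \<partial>M)" by (simp add: prod.reindex[OF inj])
  also have "\<dots> \<le> (\<Prod>z\<in>set zs. ennreal (p + \<eta>))"
  proof (rule prod_mono_ennreal)
    fix z assume z: "z \<in> set zs"
    have ng: "{\<phi>\<in>space M. \<not> good G k \<phi> z} \<in> sets M"
      using sets.Diff[OF sets.top good_sets[of z]] by (simp add: set_diff_eq cong: conj_cong)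
    have "(\<integral>\<^sup>+\<phi>. h (X (c z) \<phi>) \<partial>M) \<le> (\<integral>\<^sup>+\<phi>. ennreal \<eta> + indicator {\<phi>\<in>space M. \<not> good G k \<phi> z} \<phi> \<partial>M)"
      using X(2)[OF z] by (intro nn_integral_mono) (auto simp: h_def indicator_def)
    also have "\<dots> = ennreal \<eta> + emeasure M {\<phi>\<in>space M. \<not> good G k \<phi> z}"
      using ng by (simp add: nn_integral_add emeasure_space_1)
    also have "emeasure M {\<phi>\<in>space M. \<not> good G k \<phi> z} = ennreal (prob {\<phi>\<in>space M. \<not> good G k \<phi> 0})"
      using prob_good[of z] prob_neg[OF good_sets] by (simp add: emeasure_eq_measure)
    also have "ennreal \<eta> + \<dots> \<le> ennreal \<eta> + ennreal p" using p by (intro add_left_mono ennreal_leI)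
    also have "\<dots> = ennreal (p + \<eta>)"
      using \<eta> p by (subst ennreal_plus[symmetric]) (auto simp: add.commute intro: order_trans[OF measure_nonneg])
    finally show "(\<integral>\<^sup>+\<phi>. h (X (c z) \<phi>) \<partial>M) \<le> ennreal (p + \<eta>)" .
  qed
  also have "\<dots> = ennreal (p + \<eta>) ^ length zs"
    using separated_distinct[OF zs] by (simp add: distinct_card)
  finally show ?thesis .
qed

text \<open>There are at most 42025^N chains with N + 1 sites, and each has mean at most (p +
  \<eta>)^(N + 1): a convergent geometric series.\<close>

lemma AE_summable:
  assumes \<eta>: "0 \<le> \<eta>" and p: "prob {\<phi>\<in>space M. \<not> good G k \<phi> 0} \<le> p" and small: "42025 * (p + \<eta>) < 1"
  shows "AE \<phi> in M. \<forall>z0. (\<Sum>N. \<Sum>zs\<in>sep_chains N z0. \<Prod>z\<in>set zs. if good G k \<phi> z then ennreal \<eta> else 1) \<noteq> \<top>"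
proof -
  have p0: "0 \<le> p" using p measure_nonneg order_trans by blast
  define g where "g zs \<phi> = (\<Prod>z\<in>set zs. if good G k \<phi> z then ennreal \<eta> else 1)" for zs \<phi>
  have g: "g zs \<in> borel_measurable M" for zs
    unfolding g_def using good_sets by (intro borel_measurable_prod_ennreal measurable_If) (auto simp: pred_def)
  have "AE \<phi> in M. (\<Sum>N. \<Sum>zs\<in>sep_chains N z0. g zs \<phi>) \<noteq> \<infinity>" for z0
  proof (rule nn_integral_noteq_infinite)
    show "(\<lambda>\<phi>. \<Sum>N. \<Sum>zs\<in>sep_chains N z0. g zs \<phi>) \<in> borel_measurable M" using g by measurable
    have "(\<integral>\<^sup>+\<phi>. (\<Sum>N. \<Sum>zs\<in>sep_chains N z0. g zs \<phi>) \<partial>M) = (\<Sum>N. \<Sum>zs\<in>sep_chains N z0. \<integral>\<^sup>+\<phi>. g zs \<phi> \<partial>M)"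
      using g by (simp add: nn_integral_suminf nn_integral_sum)
    also have "\<dots> \<le> (\<Sum>N. ennreal ((42025 * (p + \<eta>)) ^ N * (p + \<eta>)))"
    proof (intro suminf_le)
      fix N
      have "(\<Sum>zs\<in>sep_chains N z0. \<integral>\<^sup>+\<phi>. g zs \<phi> \<partial>M) \<le> (\<Sum>zs\<in>sep_chains N z0. ennreal (p + \<eta>) ^ Suc N)"
      proof (rule sum_mono)
        fix zs assume "zs \<in> sep_chains N z0"
        then have "length zs = Suc N" "separated zs" by (auto simp: sep_chains_def length_chains)
        then show "(\<integral>\<^sup>+\<phi>. g zs \<phi> \<partial>M) \<le> ennreal (p + \<eta>) ^ Suc N"
          using mean_chain[OF \<eta> p, of zs] by (simp add: g_def)
      qed
      also have "\<dots> = of_nat (card (sep_chains N z0)) * ennreal (p + \<eta>) ^ Suc N" by simp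
      also have "\<dots> \<le> of_nat (42025 ^ N) * ennreal (p + \<eta>) ^ Suc N"
        by (intro mult_right_mono of_nat_mono card_sep_chains) simp
      also have "\<dots> = ennreal (real (42025 ^ N) * (p + \<eta>) ^ Suc N)"
        using p0 \<eta> by (simp add: ennreal_mult ennreal_power ennreal_of_nat_eq_real_of_nat del: of_nat_power power_Suc ennreal_plus)
      also have "real (42025 ^ N) * (p + \<eta>) ^ Suc N = (42025 * (p + \<eta>)) ^ N * (p + \<eta>)"
        unfolding power_mult_distrib by (simp only: power_Suc of_nat_power of_nat_numeral mult.assoc mult.commute[of "p + \<eta>"])
      finally show "(\<Sum>zs\<in>sep_chains N z0. \<integral>\<^sup>+\<phi>. g zs \<phi> \<partial>M) \<le> ennreal ((42025 * (p + \<eta>)) ^ N * (p + \<eta>))" .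
    qed auto
    also have "\<dots> = ennreal (\<Sum>N. (42025 * (p + \<eta>)) ^ N * (p + \<eta>))"
      using small p0 \<eta> by (intro suminf_ennreal2 summable_mult2 summable_geometric) auto
    finally show "(\<integral>\<^sup>+\<phi>. (\<Sum>N. \<Sum>zs\<in>sep_chains N z0. g zs \<phi>) \<partial>M) \<noteq> \<infinity>" by (auto simp: top_unique)
  qed
  then show ?thesis by (simp only: AE_all_countable g_def) simp
qed

end

text \<open>With m = 8 k, the second condition links Q m y inside Q (2 m) y (\<open>linked\<close>
  with j = 4 k), and the last one finds streets in the corner boxes (j = k). Everything is phrased
  by radii because \<open>fail\<close> controls their probabilities.\<close>

definition typical :: "nat \<Rightarrow> streets \<Rightarrow> bool" where
  "typical k \<phi> \<longleftrightarrow> small_radii R \<phi> (128 * real k) 0 (128 * real k) \<and>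
     (\<forall>y\<in>grid (8 * real k). small_radii R \<phi> (16 * real k) y (4 * real k) \<and>
       (\<forall>s\<in>{-1, 1}. \<forall>t\<in>{-1, 1}. small_radii R \<phi> (4 * real k) (y + (s * (3 * real k), t * (3 * real k))) k))"

lemma grid_int:
  assumes "y \<in> grid (8 * real k)"
  shows "y \<in> range (\<lambda>(a, b). (real_of_int a, real_of_int b))"
    "s \<in> {-1, 1} \<Longrightarrow> t \<in> {-1, 1} \<Longrightarrow>
      y + (s * (3 * real k), t * (3 * real k)) \<in> range (\<lambda>(a, b). (real_of_int a, real_of_int b))"
proof -
  obtain i j where y: "y = (8 * real k * real_of_int i, 8 * real k * real_of_int j)" using assms by (auto simp: grid_def)
  have "y = (\<lambda>(a, b). (real_of_int a, real_of_int b)) (8 * int k * i, 8 * int k * j)" by (simp add: y)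
  then show "y \<in> range (\<lambda>(a, b). (real_of_int a, real_of_int b))" by blast
  assume st: "s \<in> {-1, 1}" "t \<in> {-1, 1}"
  define s' t' :: int where "s' = (if s = 1 then 1 else -1)" and "t' = (if t = 1 then 1 else -1)"
  have "y + (s * (3 * real k), t * (3 * real k)) =
      (\<lambda>(a, b). (real_of_int a, real_of_int b)) (8 * int k * i + s' * (3 * int k), 8 * int k * j + t' * (3 * int k))"
    using st by (auto simp: y s'_def t'_def)
  then show "y + (s * (3 * real k), t * (3 * real k)) \<in> range (\<lambda>(a, b). (real_of_int a, real_of_int b))" by blast
qed

lemma card_grid: "card (grid m) \<le> 49"
proof -
  have "card (grid m) \<le> card ({-3..3::int} \<times> {-3..3::int})" unfolding grid_def by (rule card_image_le) simp
  then show ?thesis by simp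
qed

lemma typical_sets: "{\<phi>\<in>space M. typical k \<phi>} \<in> sets M"
proof -
  have "Measurable.pred M (typical k)"
    unfolding typical_def
    by (intro pred_intros_logic pred_countable_Ball small_radii_measurable) (auto simp: countable_finite finite_grid)
  then show ?thesis by (simp add: pred_def)
qed

text \<open>Union bound with 1225 = 49 * 25 and 4900 = 49 * 4 * 25, for 49 grid points, four corners
  and the factor 25 of \<open>fail_large_box\<close>.\<close>

lemma prob_not_typical:
  assumes k: "0 < k"
  shows "prob {\<phi>\<in>space M. \<not> typical k \<phi>} \<le> fail (128 * k) + 1225 * fail (4 * k) + 4900 * fail k"
proof -
  define m where "m = 8 * real k"
  define A where "A n x c = {\<phi>\<in>space M. \<not> small_radii R \<phi> n x c}" for n x c
  have A: "A n x c \<in> sets M" for n x c unfolding A_def by measurable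
  define I where "I = grid m \<times> ({-1, 1::real} \<times> {-1, 1::real})"
  define pt where "pt i = fst i + (fst (snd i) * (3 * real k), snd (snd i) * (3 * real k))" for i :: "point \<times> real \<times> real"
  have fin: "finite (grid m)" "finite I" using finite_grid by (auto simp: I_def)
  have cI: "card I \<le> 196" using card_grid[of m] by (simp add: I_def card_cartesian_product)
  have rat: "y \<in> \<rat> \<times> \<rat>" if "y \<in> range (\<lambda>(a, b). (real_of_int a, real_of_int b))" for y :: point
    using that by auto
  have "{\<phi>\<in>space M. \<not> typical k \<phi>} \<subseteq> A (128 * real k) 0 (128 * real k) \<union>
      ((\<Union>y\<in>grid m. A (16 * real k) y (4 * real k)) \<union> (\<Union>i\<in>I. A (4 * real k) (pt i) (real k)))"
    unfolding typical_def A_def I_def pt_def m_def by force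
  then have "prob {\<phi>\<in>space M. \<not> typical k \<phi>} \<le> prob (A (128 * real k) 0 (128 * real k) \<union>
      ((\<Union>y\<in>grid m. A (16 * real k) y (4 * real k)) \<union> (\<Union>i\<in>I. A (4 * real k) (pt i) (real k))))"
    using A fin by (intro finite_measure_mono sets.Un sets.finite_UN) auto
  also have "\<dots> \<le> prob (A (128 * real k) 0 (128 * real k)) +
      prob ((\<Union>y\<in>grid m. A (16 * real k) y (4 * real k)) \<union> (\<Union>i\<in>I. A (4 * real k) (pt i) (real k)))"
    using A fin by (intro measure_subadditive sets.Un sets.finite_UN) auto
  also have "prob ((\<Union>y\<in>grid m. A (16 * real k) y (4 * real k)) \<union> (\<Union>i\<in>I. A (4 * real k) (pt i) (real k))) \<le>
      prob (\<Union>y\<in>grid m. A (16 * real k) y (4 * real k)) + prob (\<Union>i\<in>I. A (4 * real k) (pt i) (real k))"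
    using A fin by (intro measure_subadditive sets.finite_UN) auto
  also have "prob (\<Union>y\<in>grid m. A (16 * real k) y (4 * real k)) \<le> (\<Sum>y\<in>grid m. prob (A (16 * real k) y (4 * real k)))"
    using A fin by (intro finite_measure_subadditive_finite) auto
  also have "\<dots> \<le> (\<Sum>y\<in>grid m. 25 * fail (4 * k))"
  proof (rule sum_mono)
    fix y assume "y \<in> grid m"
    then have "y \<in> \<rat> \<times> \<rat>" using grid_int(1) rat unfolding m_def by blast
    then show "prob (A (16 * real k) y (4 * real k)) \<le> 25 * fail (4 * k)"
      using fail_large_box[of "4 * k" y] k by (simp add: A_def)
  qed
  also have "\<dots> \<le> 1225 * fail (4 * k)"
  proof -
    have "real (card (grid m)) * (25 * fail (4 * k)) \<le> 49 * (25 * fail (4 * k))"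
      using card_grid[of m] by (intro mult_right_mono) (auto simp: fail_def)
    then show ?thesis by simp
  qed
  also have "prob (\<Union>i\<in>I. A (4 * real k) (pt i) (real k)) \<le> (\<Sum>i\<in>I. prob (A (4 * real k) (pt i) (real k)))"
    by (intro finite_measure_subadditive_finite fin image_subsetI A)
  also have "\<dots> \<le> (\<Sum>i\<in>I. 25 * fail k)"
  proof (rule sum_mono)
    fix i assume "i \<in> I"
    then have "pt i \<in> \<rat> \<times> \<rat>" using grid_int(2)[of "fst i" k "fst (snd i)" "snd (snd i)"] rat
      unfolding m_def I_def pt_def by auto
    then show "prob (A (4 * real k) (pt i) (real k)) \<le> 25 * fail k"
      using fail_large_box[of k "pt i"] k by (simp add: A_def)
  qed
  also have "\<dots> \<le> 4900 * fail k"
  proof -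
    have "real (card I) * (25 * fail k) \<le> 196 * (25 * fail k)"
      using cI by (intro mult_right_mono) (auto simp: fail_def)
    then show ?thesis by simp
  qed
  finally show ?thesis by (simp add: A_def fail_def)
qed

lemma eventually_typical:
  assumes p: "0 < p"
  shows "\<forall>\<^sub>F k in sequentially. prob {\<phi>\<in>space M. \<not> typical k \<phi>} < p"
proof -
  have sub: "(\<lambda>k. fail (c * k)) \<longlonglongrightarrow> 0" if "0 < c" for c
    using LIMSEQ_subseq_LIMSEQ[OF fail_tendsto, of "\<lambda>k. c * k"] that by (simp add: o_def strict_mono_def)
  have "(\<lambda>k. fail (128 * k) + 1225 * fail (4 * k) + 4900 * fail k) \<longlonglongrightarrow> 0 + 1225 * 0 + 4900 * 0"
    by (intro tendsto_add tendsto_mult tendsto_const sub fail_tendsto) auto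
  then have "\<forall>\<^sub>F k in sequentially. fail (128 * k) + 1225 * fail (4 * k) + 4900 * fail k < p"
    using order_tendstoD(2) p by fastforce
  with eventually_gt_at_top[of 0] show ?thesis
  proof eventually_elim
    case (elim k)
    show ?case using prob_not_typical[OF elim(1)] elim(2) by (rule order_le_less_trans)
  qed
qed

text \<open>Grid centres have coordinates up to 24 k, so every box of the tests lies in Q (128 k) 0,
  and the restriction of the streets is invisible to the tests.\<close>

lemma eventually_well_connected:
  "\<forall>\<^sub>F k in sequentially. AE \<phi> in M. typical k \<phi> \<longrightarrow> well_connected (8 * real k) (\<Union>\<phi> \<inter> Q (128 * real k) 0)"
proof -
  obtain j0 where j0: "\<And>j. j \<ge> j0 \<Longrightarrow> AE \<phi> in M. \<forall>x\<in>range (\<lambda>(a, b). (real_of_int a, real_of_int b)).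
     small_radii R \<phi> (4 * real j) x j \<longrightarrow> linked (2 * real j) x \<phi>"
    using eventually_linked unfolding eventually_sequentially by blast
  have "AE \<phi> in M. typical k \<phi> \<longrightarrow> well_connected (8 * real k) (\<Union>\<phi> \<inter> Q (128 * real k) 0)" if k: "k \<ge> j0" for k
  proof -
    have "4 * k \<ge> j0" using k by simp
    from j0[OF k] j0[OF this] show ?thesis
    proof eventually_elim
      case (elim \<phi>)
      show ?case
      proof
        assume typical: "typical k \<phi>"
        define m where "m = 8 * real k"
        define A where "A = \<Union>\<phi> \<inter> Q (128 * real k) 0"
        show "well_connected (8 * real k) (\<Union>\<phi> \<inter> Q (128 * real k) 0)"
          unfolding well_connected_def m_def[symmetric] A_def[symmetric]
        proof (intro ballI conjI)
          fix y assume y: "y \<in> grid m"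
          then have yi: "y \<in> range (\<lambda>(a, b). (real_of_int a, real_of_int b))"
            unfolding m_def by (rule grid_int(1))
          have yb: "\<bar>fst y\<bar> \<le> 24 * real k" "\<bar>snd y\<bar> \<le> 24 * real k"
          proof -
            obtain i j where ij: "y = (m * real_of_int i, m * real_of_int j)" "i \<in> {-3..3}" "j \<in> {-3..3}"
              using y unfolding grid_def by (elim imageE SigmaE) (simp only: case_prod_conv)
            have "\<bar>real_of_int i\<bar> \<le> 3" "\<bar>real_of_int j\<bar> \<le> 3" using ij by auto
            then have "m * \<bar>real_of_int i\<bar> \<le> m * 3" "m * \<bar>real_of_int j\<bar> \<le> m * 3"
              by (intro mult_left_mono; simp add: m_def)+
            then show "\<bar>fst y\<bar> \<le> 24 * real k" "\<bar>snd y\<bar> \<le> 24 * real k" by (auto simp: ij(1) abs_mult m_def)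
          qed
          have "small_radii R \<phi> (4 * real (4 * k)) y (real (4 * k))"
            using typical y by (simp add: typical_def m_def)
          then have "linked (2 * real (4 * k)) y \<phi>" using elim(2) yi by blast
          then obtain C where C: "C \<in> components (\<Union>\<phi> \<inter> Q (2 * m) y)" "\<Union>\<phi> \<inter> Q m y \<subseteq> C"
            by (auto simp: linked_def m_def)
          have "Q (2 * m) y \<subseteq> Q (128 * real k) 0"
          proof
            fix p assume "p \<in> Q (2 * m) y"
            then show "p \<in> Q (128 * real k) 0" using yb unfolding mem_Q m_def fst_zero snd_zero by linarith
          qed
          then have "A \<inter> Q (2 * m) y = \<Union>\<phi> \<inter> Q (2 * m) y" by (auto simp: A_def)
          then have "C \<in> components (A \<inter> Q (2 * m) y)" "A \<inter> Q m y \<subseteq> C" using C by (auto simp: A_def)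
          then show "\<not> splits A (Q m y) (Q (2 * m) y)" by (rule not_splits_component)
          fix s t :: real assume st: "s \<in> {-1, 1}" "t \<in> {-1, 1}"
          define y' where "y' = y + (s * (3 * real k), t * (3 * real k))"
          have y'i: "y' \<in> range (\<lambda>(a, b). (real_of_int a, real_of_int b))"
            unfolding y'_def using grid_int(2)[OF y[unfolded m_def] st] .
          have "small_radii R \<phi> (4 * real k) y' k" using typical y st unfolding typical_def m_def y'_def by blast
          then have "linked (2 * real k) y' \<phi>" using elim(1) y'i by blast
          moreover have "Q (2 * real k) y' \<subseteq> Q (128 * real k) 0"
          proof
            fix p assume "p \<in> Q (2 * real k) y'"
            moreover have "\<bar>s * (3 * real k)\<bar> \<le> 3 * real k" "\<bar>t * (3 * real k)\<bar> \<le> 3 * real k" using st by auto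
            ultimately show "p \<in> Q (128 * real k) 0"
              using yb unfolding mem_Q y'_def fst_zero snd_zero fst_add snd_add fst_conv snd_conv by linarith
          qed
          ultimately have "A \<inter> Q (2 * real k) y' \<noteq> {}" by (auto simp: linked_def A_def)
          moreover have "m / 4 = 2 * real k" "3 * m / 8 = 3 * real k" by (auto simp: m_def)
          ultimately show "A \<inter> Q (m / 4) (y + (s * (3 * m / 8), t * (3 * m / 8))) \<noteq> {}"
            by (simp add: y'_def)
        qed
      qed
    qed
  qed
  then show ?thesis unfolding eventually_sequentially by blast
qed

text \<open>The events increase in j and exhaust the typical configurations up to a null set, so
  continuity from below provides j.\<close>

lemma good_exists:
  fixes G :: "nat \<Rightarrow> point set \<Rightarrow> bool"
  assumes G: "\<And>j. Measurable.pred closed_space (G j)" "\<And>j A. G j A \<Longrightarrow> A \<noteq> {}" "\<And>j A. G j A \<Longrightarrow> G (Suc j) A"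
    and k: "0 < k" and p: "prob {\<phi>\<in>space M. \<not> typical k \<phi>} < p"
    and cover: "AE \<phi> in M. typical k \<phi> \<longrightarrow> (\<exists>j. G j (\<Union>\<phi> \<inter> Q (128 * real k) 0))"
  shows "\<exists>j. prob {\<phi>\<in>space M. \<not> good (G j) k \<phi> 0} < p"
proof -
  define A where "A j = {\<phi>\<in>space M. good (G j) k \<phi> 0}" for j
  have A: "A j \<in> sets M" for j unfolding A_def by (rule good_sets[OF G(1,2) k])
  have "incseq A" by (rule incseq_SucI) (auto simp: A_def good_def G(3))
  then have "(\<lambda>j. prob (A j)) \<longlonglongrightarrow> prob (\<Union>j. A j)" using A by (intro finite_Lim_measure_incseq) auto
  moreover have "1 - p < prob (\<Union>j. A j)"
  proof -
    have "prob {\<phi>\<in>space M. typical k \<phi>} \<le> prob (\<Union>j. A j)"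
    proof (rule finite_measure_mono_AE)
      show "AE \<phi> in M. \<phi> \<in> {\<phi>\<in>space M. typical k \<phi>} \<longrightarrow> \<phi> \<in> (\<Union>j. A j)"
        using cover
      proof eventually_elim
        case (elim \<phi>)
        have "center (8 * real k) 0 = 0" by (simp add: center_def zero_prod_def)
        then show ?case using elim by (auto simp: A_def good_def typical_def)
      qed
    qed (use A in auto)
    moreover have "1 - p < prob {\<phi>\<in>space M. typical k \<phi>}"
      using p prob_neg[OF typical_sets[of k]] by simp
    ultimately show ?thesis by simp
  qed
  ultimately have "\<forall>\<^sub>F j in sequentially. 1 - p < prob (A j)" by (rule order_tendstoD(1))
  then obtain j where "1 - p < prob (A j)" using eventually_happens'[OF sequentially_bot] by blast
  then have "prob {\<phi>\<in>space M. \<not> good (G j) k \<phi> 0} < p" using prob_neg[OF A[of j, unfolded A_def]] by (simp add: A_def)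
  then show ?thesis by blast
qed

end

section \<open>Exceptional positions and velocities in a good box\<close>

lemma small_cover_Un:
  assumes "small_cover a A K" "small_cover b A L"
  shows "small_cover (a + b) A (K \<union> L)"
  unfolding small_cover_def
proof
  fix k :: nat
  obtain F where F: "finite F" "F \<subseteq> rat_boxes" "\<forall>(a, b)\<in>F. dist a b \<le> 1 / (real k + 1)" "(\<Sum>(a, b)\<in>F. dist a b) \<le> a"
    "A \<inter> K \<subseteq> (\<Union>(a, b)\<in>F. box a b)"
    using assms(1) unfolding small_cover_def by (elim allE[of _ k] bexE conjE CollectE) (rule that)
  obtain H where H: "finite H" "H \<subseteq> rat_boxes" "\<forall>(a, b)\<in>H. dist a b \<le> 1 / (real k + 1)" "(\<Sum>(a, b)\<in>H. dist a b) \<le> b"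
    "A \<inter> L \<subseteq> (\<Union>(a, b)\<in>H. box a b)"
    using assms(2) unfolding small_cover_def by (elim allE[of _ k] bexE conjE CollectE) (rule that)
  have "(\<Sum>(a, b)\<in>F \<union> H. dist a b) \<le> (\<Sum>(a, b)\<in>F. dist a b) + (\<Sum>(a, b)\<in>H. dist a b)"
    using F(1) H(1) by (subst sum.union_inter[symmetric]) (auto intro!: sum_nonneg)
  then have s: "(\<Sum>(a, b)\<in>F \<union> H. dist a b) \<le> a + b" using F(4) H(4) by linarith
  have c: "A \<inter> (K \<union> L) \<subseteq> (\<Union>(a, b)\<in>F \<union> H. box a b)" using F(5) H(5) by blast
  have d: "\<forall>(a, b)\<in>F \<union> H. dist a b \<le> 1 / (real k + 1)" using F(3) H(3) by blast
  show "\<exists>F\<in>{F. finite F \<and> F \<subseteq> rat_boxes}. ((\<forall>(a, b)\<in>F. dist a b \<le> 1 / (real k + 1)) \<and> (\<Sum>(a, b)\<in>F. dist a b) \<le> a + b) \<and>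
     A \<inter> (K \<union> L) \<subseteq> (\<Union>(a, b)\<in>F. box a b)"
    using F(1,2) H(1,2) by (intro bexI[of _ "F \<union> H"] conjI s c d) simp
qed

lemma small_cover_UN:
  assumes "finite C" "\<And>u. u \<in> C \<Longrightarrow> small_cover c A (K u)"
  shows "small_cover (real (card C) * c) A (\<Union>u\<in>C. K u)"
  using assms
proof (induction C)
  case empty
  show ?case unfolding small_cover_def by (intro allI bexI[of _ "{}"]) auto
next
  case (insert u C)
  have "small_cover (c + real (card C) * c) A (K u \<union> (\<Union>u\<in>C. K u))"
    by (intro small_cover_Un insert.IH insert.prems) auto
  then show ?case using insert.hyps by (simp add: algebra_simps)
qed

lemma irregular_translate:
  fixes X :: "'a::real_normed_vector set"
  shows "irregular ((\<lambda>p. p - z) ` X) = (\<lambda>p. p - z) ` irregular X"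
proof -
  have "(\<lambda>p. p - z) ` X \<inter> ball (p - z) e = (\<lambda>p. p - z) ` (X \<inter> ball p e)" for p e
    by (auto simp: dist_norm image_iff algebra_simps)
  then have "convex ((\<lambda>p. p - z) ` X \<inter> ball (p - z) e) \<longleftrightarrow> convex (X \<inter> ball p e)" for p e
    by (simp add: convex_translation_subtract_eq)
  then show ?thesis unfolding irregular_def by blast
qed

lemma zero_in_grid: "0 \<in> grid m"
  by (auto simp: grid_def zero_prod_def image_iff intro!: bexI[of _ "(0, 0)"])

lemma well_connected_nonempty: "well_connected m A \<Longrightarrow> A \<noteq> {}"
  unfolding well_connected_def using zero_in_grid[of m] by blast

text \<open>Grid centres have coordinates up to 3 m and the doubled boxes have half-side m, so all
  tests take place inside Q (16 m) 0.\<close>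

lemma well_connected_Int:
  assumes m: "0 < m" and wc: "well_connected m (A \<inter> Q (16 * m) 0)"
  shows "well_connected m A"
proof -
  have sub: "Q (2 * m) y \<subseteq> Q (16 * m) 0" if y: "y \<in> grid m" for y
  proof
    fix p assume p: "p \<in> Q (2 * m) y"
    obtain i j where ij: "y = (m * real_of_int i, m * real_of_int j)" "i \<in> {-3..3}" "j \<in> {-3..3}"
      using y unfolding grid_def by (elim imageE SigmaE) (simp only: case_prod_conv)
    have "\<bar>real_of_int i\<bar> \<le> 3" "\<bar>real_of_int j\<bar> \<le> 3" using ij by auto
    then have "m * \<bar>real_of_int i\<bar> \<le> m * 3" "m * \<bar>real_of_int j\<bar> \<le> m * 3"
      using m by (intro mult_left_mono; simp)+
    then have "\<bar>fst y\<bar> \<le> 3 * m" "\<bar>snd y\<bar> \<le> 3 * m" using m by (auto simp: ij(1) abs_mult)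
    then show "p \<in> Q (16 * m) 0" using p m unfolding mem_Q fst_zero snd_zero by linarith
  qed
  then have "A \<inter> Q (16 * m) 0 \<inter> Q (2 * m) y = A \<inter> Q (2 * m) y" "A \<inter> Q (16 * m) 0 \<inter> Q m y = A \<inter> Q m y"
      if "y \<in> grid m" for y
  proof -
    have "Q m y \<subseteq> Q (2 * m) y" using m by (auto simp: mem_Q)
    with sub[OF that] show "A \<inter> Q (16 * m) 0 \<inter> Q (2 * m) y = A \<inter> Q (2 * m) y" "A \<inter> Q (16 * m) 0 \<inter> Q m y = A \<inter> Q m y"
      by blast+
  qed
  then have "splits (A \<inter> Q (16 * m) 0) (Q m y) (Q (2 * m) y) \<longleftrightarrow> splits A (Q m y) (Q (2 * m) y)" if "y \<in> grid m" for y
    using that by (simp add: splits_def)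
  with wc show ?thesis unfolding well_connected_def by blast
qed

lemma no_long_segment_near:
  assumes \<phi>: "\<phi> \<in> street_configs" and m: "0 < m"
    and wc: "well_connected m ((\<lambda>p. p - c) ` (\<Union>\<phi> \<inter> Q (16 * m) c))"
    and seg: "closed_segment a b \<subseteq> regular \<phi>" and a: "a \<in> Q (2 * m) c" and b: "b \<notin> Q (10 * m) c"
  shows False
proof (rule no_long_segment[of "translate (- c) \<phi>" m "a - c" "b - c"])
  have U: "\<Union>(translate (- c) \<phi>) = (\<lambda>p. p - c) ` \<Union>\<phi>" by (simp add: Union_translate)
  show "well_connected m (\<Union>(translate (- c) \<phi>))"
    using wc unfolding translate_Q U[symmetric] by (rule well_connected_Int[OF m])
  have "closed_segment (a - c) (b - c) = (\<lambda>p. p - c) ` closed_segment a b"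
    using translate_segment[of "- c" a b] by simp
  also have "\<dots> \<subseteq> (\<lambda>p. p - c) ` (\<Union>\<phi> - irregular (\<Union>\<phi>))" using seg by (auto simp: regular_def)
  also have "\<dots> = regular (translate (- c) \<phi>)"
    unfolding regular_def U irregular_translate by (intro image_set_diff) (auto simp: inj_on_def)
  finally show "closed_segment (a - c) (b - c) \<subseteq> regular (translate (- c) \<phi>)" .
qed (use \<phi> m a b in \<open>auto simp: mem_Q\<close>)

lemma nat_floor_bounds:
  fixes d s :: real
  assumes "0 < d" "0 \<le> s"
  obtains k :: nat where "real k * d \<le> s" "s < real (Suc k) * d"
proof
  have "0 \<le> s / d" using assms by simp
  then have "real (nat \<lfloor>s / d\<rfloor>) \<le> s / d" "s / d < real (Suc (nat \<lfloor>s / d\<rfloor>))" by linarith+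
  then show "real (nat \<lfloor>s / d\<rfloor>) * d \<le> s" "s < real (Suc (nat \<lfloor>s / d\<rfloor>)) * d"
    using assms(1) by (simp_all only: pos_le_divide_eq pos_divide_less_eq)
qed

text \<open>Class 0 catches devices of any speed near a centre. Class k + 1 catches those whose
  value v\<rho> is in the k-th interval of length d and which lie in a ring of radius k d. These
  speed classes are disjoint, so their probabilities sum to at most 1; with class 0 this gives the
  factor 2. For a device in no class, the centre close to p shows that the distance to p exceeds 2 d
  and is either less than v\<rho> or greater than v(\<rho> + \<epsilon>).\<close>

lemma certificate_site:
  assumes cert: "certificate n P c d ((\<lambda>p. p - z) ` (\<Union>\<phi> \<inter> Q n z))" and d: "0 < d" and c: "0 \<le> c"
    and \<mu>: "prob_space \<mu>" "sets \<mu> = sets borel" and \<rho>: "0 \<le> \<rho>" and l: "0 \<le> l"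
  shows "\<exists>K (B :: nat \<Rightarrow> point set) J. (\<forall>k<K. B k \<in> sets borel \<and> B k \<subseteq> Q n z \<and> J k \<in> sets borel) \<and>
    (\<Sum>k<K. emeasure \<mu> (J k) * (ennreal l * len (\<Union>\<phi> \<inter> B k))) \<le> ennreal (2 * l * c) \<and>
    (\<forall>x v p \<epsilon>. x \<in> Q n z \<longrightarrow> (\<forall>k<K. x \<in> B k \<longrightarrow> v \<notin> J k) \<longrightarrow> p \<in> irregular (\<Union>\<phi>) \<longrightarrow> p \<in> interior (Q n z) \<longrightarrow>
      0 < v \<longrightarrow> v * \<rho> \<le> P \<longrightarrow> v * \<epsilon> \<le> d \<longrightarrow> dist x p \<le> v * (\<rho> + \<epsilon>) \<longrightarrow>
      v * \<epsilon> < dist x p \<and> dist x p < v * \<rho>)"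
proof -
  interpret \<mu>: prob_space \<mu> by fact
  define X where "X = (\<lambda>p. p - z) ` \<Union>\<phi>"
  define A where "A = X \<inter> Q n 0"
  have A: "(\<lambda>p. p - z) ` (\<Union>\<phi> \<inter> Q n z) = A" by (simp add: A_def X_def translate_Q)
  obtain C R where C: "finite C" and R: "\<forall>p\<in>R. convex (A \<inter> cbox (fst p) (snd p))"
    and cov: "A \<inter> Q n 0 \<subseteq> (\<Union>u\<in>C. ball u d) \<union> (\<Union>p\<in>R. box (fst p) (snd p))"
    and sc: "\<forall>k\<in>{..nat \<lceil>P / d\<rceil>}. \<forall>u\<in>C. small_cover (c / card C) A (ring n u (k * d) d)"
    using cert unfolding certificate_def A by (elim bexE conjE CollectE) (rule that)
  define K where "K = nat \<lceil>P / d\<rceil>"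
  define S where "S k = (\<Union>u\<in>C. ring n u (real k * d) d)" for k
  \<comment> \<open>By truncated subtraction \<open>B 0\<close> equals \<open>B 1\<close>: the rings
    of radius 0 serve once for all speeds and once for the lowest speed class.\<close>
  define B where "B k = {x. x - z \<in> S (k - 1)}" for k
  define J where "J k = (if k = 0 then UNIV else {v. real (k - 1) * d \<le> v * \<rho> \<and> v * \<rho> < real k * d})" for k
  have S: "small_cover c A (S k)" if "k \<le> K" for k
  proof -
    have "small_cover (real (card C) * (c / card C)) A (S k)"
      unfolding S_def using sc that by (intro small_cover_UN C) (auto simp: K_def)
    then show ?thesis by (rule small_cover_mono) (use c in auto)
  qed
  have B: "B k \<in> sets borel \<and> B k \<subseteq> Q n z" for k
  proof -
    have "closed (S (k - 1))" unfolding S_def using C by (intro closed_UN compact_imp_closed) auto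
    then have "closed ((\<lambda>x. x - z) -` S (k - 1))" by (intro continuous_closed_vimage) (auto intro!: continuous_intros)
    moreover have "B k \<subseteq> Q n z"
    proof
      fix x assume "x \<in> B k"
      then have "x - z \<in> Q n 0" by (auto simp: B_def S_def ring_def)
      then show "x \<in> Q n z" by (simp add: mem_Q)
    qed
    ultimately show ?thesis by (simp add: B_def vimage_def)
  qed
  have J: "J k \<in> sets borel" for k
  proof -
    have "{v. a \<le> v * \<rho> \<and> v * \<rho> < b} \<in> sets borel" for a b by measurable
    then show ?thesis by (simp add: J_def)
  qed
  have lB: "len (\<Union>\<phi> \<inter> B k) \<le> ennreal c" if "k \<le> Suc K" for k
  proof (rule small_cover_len[OF S[of "k - 1"]])
    fix p assume p: "p \<in> \<Union>\<phi> \<inter> B k"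
    then have "p - z \<in> S (k - 1)" by (auto simp: B_def)
    moreover from this have "p - z \<in> Q n 0" by (auto simp: S_def ring_def)
    ultimately show "p - z \<in> A \<inter> S (k - 1)" using p unfolding A_def X_def by blast
  qed (use that in auto)
  have disj: "disjoint_family_on (\<lambda>k. J (Suc k)) {..K}"
    unfolding disjoint_family_on_def
  proof (intro ballI impI)
    fix i k :: nat assume "i \<noteq> k"
    have False if i: "real i * d \<le> s" "s < real (Suc i) * d" and k: "real k * d \<le> s" "s < real (Suc k) * d" for s
    proof -
      have "real i * d < real (Suc k) * d" "real k * d < real (Suc i) * d" using i k by linarith+
      then have "i < Suc k" "k < Suc i" using d by (simp_all only: mult_less_cancel_right_pos of_nat_less_iff)
      then show False using \<open>i \<noteq> k\<close> by simp
    qed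
    then show "J (Suc i) \<inter> J (Suc k) = {}" by (auto simp: J_def)
  qed
  have "(\<Sum>k<Suc (Suc K). emeasure \<mu> (J k) * (ennreal l * len (\<Union>\<phi> \<inter> B k))) \<le>
      (\<Sum>k<Suc (Suc K). emeasure \<mu> (J k) * (ennreal l * ennreal c))"
    by (intro sum_mono mult_left_mono lB) auto
  also have "\<dots> = (emeasure \<mu> (J 0) + (\<Sum>k\<le>K. emeasure \<mu> (J (Suc k)))) * (ennreal l * ennreal c)"
    unfolding sum_distrib_right[symmetric] by (subst sum.lessThan_Suc_shift) (simp add: lessThan_Suc_atMost)
  also have "(\<Sum>k\<le>K. emeasure \<mu> (J (Suc k))) = emeasure \<mu> (\<Union>k\<le>K. J (Suc k))"
    by (rule sum_emeasure[OF _ disj]) (use J \<mu>(2) in auto)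
  also have "(emeasure \<mu> (J 0) + emeasure \<mu> (\<Union>k\<le>K. J (Suc k))) * (ennreal l * ennreal c) \<le> (1 + 1) * (ennreal l * ennreal c)"
    by (intro mult_right_mono add_mono \<mu>.emeasure_le_1) auto
  also have "\<dots> = ennreal (2 * l * c)"
    using l c by (simp add: ennreal_mult mult.assoc)
  finally have sum: "(\<Sum>k<Suc (Suc K). emeasure \<mu> (J k) * (ennreal l * len (\<Union>\<phi> \<inter> B k))) \<le> ennreal (2 * l * c)" .
  have free: "v * \<epsilon> < dist x p \<and> dist x p < v * \<rho>"
    if x: "x \<in> Q n z" and av: "\<forall>k<Suc (Suc K). x \<in> B k \<longrightarrow> v \<notin> J k" and p: "p \<in> irregular (\<Union>\<phi>)" "p \<in> interior (Q n z)"
      and v: "0 < v" "v * \<rho> \<le> P" "v * \<epsilon> \<le> d" "dist x p \<le> v * (\<rho> + \<epsilon>)" for x v p \<epsilon>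
  proof -
    have "p - z \<in> irregular X" using p(1) unfolding X_def irregular_translate by blast
    moreover have "p - z \<in> interior (Q n 0)"
      using p(2) by (simp add: Q_def mem_box Basis_prod_def inner_prod_def algebra_simps)
    ultimately obtain u where u: "u \<in> C" "dist u (p - z) < d"
      using certificate_irregular[OF cov R A_def] by blast
    have near: "\<bar>dist (x - z) u - dist x p\<bar> < d"
    proof -
      have "dist (x - z) (p - z) = dist x p" by (simp add: dist_norm)
      then show ?thesis using u(2) dist_triangle[of "x - z" u "p - z"] dist_triangle[of "x - z" "p - z" u]
        by (simp add: dist_commute abs_less_iff)
    qed
    have xQ: "x - z \<in> Q n 0" using x by (simp add: mem_Q)
    have "0 \<le> v * \<rho>" using v \<rho> by simp
    then obtain k :: nat where k: "real k * d \<le> v * \<rho>" "v * \<rho> < real (Suc k) * d"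
      using nat_floor_bounds[OF d] by blast
    have "real k \<le> P / d" using k(1) v(2) d by (simp add: pos_le_divide_eq)
    then have kK: "k \<le> K" unfolding K_def by linarith
    have "x \<notin> B 0" using av by (auto simp: J_def)
    then have "x - z \<notin> ring n u 0 d" using u(1) by (auto simp: B_def S_def)
    then have far: "3 * d < dist (x - z) u" using xQ d zero_le_dist[of "x - z" u] by (auto simp: ring_def not_le)
    have "v \<in> J (Suc k)" using k by (simp add: J_def)
    then have "x \<notin> B (Suc k)" using av kK by auto
    then have "x - z \<notin> ring n u (real k * d) d" using u(1) by (auto simp: B_def S_def)
    then have "dist (x - z) u < real k * d - d \<or> real k * d + 3 * d < dist (x - z) u" using xQ by (auto simp: ring_def not_le)
    moreover have "real (Suc k) * d = real k * d + d" "v * (\<rho> + \<epsilon>) = v * \<rho> + v * \<epsilon>" by (simp_all add: algebra_simps)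
    ultimately show ?thesis using far near k v d by linarith
  qed
  show ?thesis
    by (intro exI[of _ "Suc (Suc K)"] exI[of _ B] exI[of _ J] conjI allI impI sum B[THEN conjunct1] B[THEN conjunct2] J)
      (blast dest: free)+
qed

lemma distr_pair_snd:
  assumes "prob_space N" "prob_space \<mu>"
  shows "distr (N \<Otimes>\<^sub>M \<mu>) \<mu> snd = \<mu>"
proof (rule measure_eqI)
  fix A assume A: "A \<in> sets (distr (N \<Otimes>\<^sub>M \<mu>) \<mu> snd)"
  then have "emeasure (distr (N \<Otimes>\<^sub>M \<mu>) \<mu> snd) A = emeasure (N \<Otimes>\<^sub>M \<mu>) (space N \<times> A)"
    by (auto simp: emeasure_distr space_pair_measure dest: sets.sets_into_space intro!: arg_cong2[where f=emeasure])
  then show "emeasure (distr (N \<Otimes>\<^sub>M \<mu>) \<mu> snd) A = emeasure \<mu> A"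
    using prob_pair_snd[OF assms, of A] A by simp
qed simp

section \<open>Absence of percolation on fixed streets\<close>

context street_poisson
begin

context
  fixes \<gamma> :: "streets \<Rightarrow> point \<Rightarrow> point \<Rightarrow> (real \<Rightarrow> point) \<times> real" and \<kappa> :: "point \<Rightarrow> point measure"
    and \<mu> :: "real measure" and V :: real
  assumes \<gamma>: "selects_shortest_paths \<gamma>" and con: "connected (\<Union>\<phi>)"
    and \<kappa>: "\<And>x. x \<in> \<Union>\<phi> \<Longrightarrow> prob_space (\<kappa> x)" "\<And>x. x \<in> \<Union>\<phi> \<Longrightarrow> AE y in \<kappa> x. y \<in> \<Union>\<phi>"
    and \<mu>: "prob_space \<mu>" "sets \<mu> = sets borel" "AE v in \<mu>. 0 < v \<and> v \<le> V"
begin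

text \<open>Connectedness supplies a shortest path from each device to its target, so
  \<open>\<gamma>\<close> returns one. Devices start at positive distance from irregular points,
  which allows the passage between ratios and products.\<close>

lemma AE_devices:
  "AE \<xi> in P. AE w in PiM \<xi> (\<lambda>x. \<kappa> x \<Otimes>\<^sub>M \<mu>). devices \<phi> \<gamma> \<xi> w V \<and>
     (\<forall>x\<in>\<xi>. \<forall>y\<in>\<xi>. x \<noteq> y \<longrightarrow> (\<forall>p\<in>irregular (\<Union>\<phi>). \<forall>q\<in>irregular (\<Union>\<phi>). dist x p * snd (w y) \<noteq> dist y q * snd (w x)))"
proof -
  interpret \<mu>: prob_space \<mu> by fact
  interpret pair_prob_space \<mu> \<mu> ..
  define N where "N = distr (\<mu> \<Otimes>\<^sub>M \<mu>) borel (\<lambda>(v, v'). v / v')"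
  have "(\<lambda>(v, v'). v / v') \<in> borel_measurable (\<mu> \<Otimes>\<^sub>M \<mu>)"
    unfolding measurable_cong_sets[OF sets_pair_measure_cong[OF \<mu>(2,2)] refl] by measurable
  then interpret N: prob_space N unfolding N_def by (rule prob_space_distr)
  define A where "A = {a. 0 < a \<and> measure N {a} \<noteq> 0}"
  have A: "countable A" by (rule countable_subset[OF _ N.countable_support]) (auto simp: A_def)
  have "AE \<xi> in P. \<forall>x\<in>\<xi>. \<forall>y\<in>\<xi>. x \<noteq> y \<longrightarrow> (\<forall>p\<in>irregular (\<Union>\<phi>). \<forall>q\<in>irregular (\<Union>\<phi>). \<forall>a\<in>A. dist x p \<noteq> a * dist y q)"
    using A by (rule AE_generic) (simp add: A_def)
  with AE_on_streets AE_regular AE_space show ?thesis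
  proof eventually_elim
    case (elim \<xi>)
    have cnt: "countable \<xi>" using elim(3) by (intro countable_config) (simp add: space_P)
    have pr: "prob_space (\<kappa> x \<Otimes>\<^sub>M \<mu>)" if "x \<in> \<xi>" for x
      using \<kappa>(1)[OF subsetD[OF elim(1) that]] \<mu>(1) by (rule prob_space_pair)
    have comp: "AE w in PiM \<xi> (\<lambda>x. \<kappa> x \<Otimes>\<^sub>M \<mu>). fst (w x) \<in> \<Union>\<phi> \<and> 0 < snd (w x) \<and> snd (w x) \<le> V" if x: "x \<in> \<xi>" for x
    proof (rule AE_PiM_component[of \<xi> "\<lambda>x. \<kappa> x \<Otimes>\<^sub>M \<mu>" x "\<lambda>u. fst u \<in> \<Union>\<phi> \<and> 0 < snd u \<and> snd u \<le> V", OF pr x])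
      have xU: "x \<in> \<Union>\<phi>" using x elim(1) by blast
      have "AE u in \<kappa> x \<Otimes>\<^sub>M \<mu>. fst u \<in> \<Union>\<phi>"
        by (rule AE_distrD[OF measurable_fst]) (unfold \<mu>.distr_pair_fst, rule \<kappa>(2)[OF xU])
      moreover have "AE u in \<kappa> x \<Otimes>\<^sub>M \<mu>. 0 < snd u \<and> snd u \<le> V"
        by (rule AE_distrD[OF measurable_snd]) (unfold distr_pair_snd[OF \<kappa>(1)[OF xU] \<mu>(1)], rule \<mu>(3))
      ultimately show "AE u in \<kappa> x \<Otimes>\<^sub>M \<mu>. fst u \<in> \<Union>\<phi> \<and> 0 < snd u \<and> snd u \<le> V" by eventually_elim blast
    qed
    have ratio: "AE w in PiM \<xi> (\<lambda>x. \<kappa> x \<Otimes>\<^sub>M \<mu>). x \<noteq> y \<longrightarrow> snd (w x) / snd (w y) \<noteq> dist x p / dist y q"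
      if x: "x \<in> \<xi>" and y: "y \<in> \<xi>" and p: "p \<in> irregular (\<Union>\<phi>)" and q: "q \<in> irregular (\<Union>\<phi>)" for x y p q
    proof (cases "x = y")
      case False
      have pos: "0 < dist x p" "0 < dist y q" using elim(2) x y p q by auto
      have "dist x p = dist x p / dist y q * dist y q" using pos by simp
      then have "dist x p / dist y q \<notin> A" using elim(4) x y p q False by blast
      then have "measure N {dist x p / dist y q} = 0" using pos by (simp add: A_def)
      then have "AE w in PiM \<xi> (\<lambda>x. \<kappa> x \<Otimes>\<^sub>M \<mu>). snd (w x) / snd (w y) \<noteq> dist x p / dist y q"
        unfolding N_def using \<kappa>(1) elim(1) by (intro AE_velocity_ratio[OF _ \<mu>(1,2) x y False]) blast
      then show ?thesis by eventually_elim simp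
    qed simp
    have "AE w in PiM \<xi> (\<lambda>x. \<kappa> x \<Otimes>\<^sub>M \<mu>). \<forall>x\<in>\<xi>. fst (w x) \<in> \<Union>\<phi> \<and> 0 < snd (w x) \<and> snd (w x) \<le> V"
      using comp cnt by (simp add: AE_ball_countable)
    moreover have "AE w in PiM \<xi> (\<lambda>x. \<kappa> x \<Otimes>\<^sub>M \<mu>). \<forall>x\<in>\<xi>. \<forall>y\<in>\<xi>. \<forall>p\<in>irregular (\<Union>\<phi>). \<forall>q\<in>irregular (\<Union>\<phi>).
        x \<noteq> y \<longrightarrow> snd (w x) / snd (w y) \<noteq> dist x p / dist y q"
      using ratio cnt countable_irregular[OF config] by (simp add: AE_ball_countable)
    ultimately show ?case
    proof eventually_elim
      fix w assume w: "\<forall>x\<in>\<xi>. fst (w x) \<in> \<Union>\<phi> \<and> 0 < snd (w x) \<and> snd (w x) \<le> V"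
        and gen: "\<forall>x\<in>\<xi>. \<forall>y\<in>\<xi>. \<forall>p\<in>irregular (\<Union>\<phi>). \<forall>q\<in>irregular (\<Union>\<phi>).
          x \<noteq> y \<longrightarrow> snd (w x) / snd (w y) \<noteq> dist x p / dist y q"
      have "devices \<phi> \<gamma> \<xi> w V"
      proof
        fix x assume x: "x \<in> \<xi>"
        then have U: "x \<in> \<Union>\<phi>" "fst (w x) \<in> \<Union>\<phi>" using elim(1) w by auto
        then obtain L where "lip_reach (\<Union>\<phi>) L x (fst (w x))" using connected_lip_reach[OF config con] by blast
        then have "\<exists>p. shortest_path \<phi> x (fst (w x)) p" by (rule shortest_path_exists[OF closed_streets[OF config]])
        then show "shortest_path \<phi> x (fst (w x)) (\<gamma> \<phi> x (fst (w x)))"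
          using \<gamma> config U unfolding selects_shortest_paths_def by blast
        show "0 < snd (w x) \<and> snd (w x) \<le> V" using w x by blast
      qed (use config elim(1) in auto)
      moreover have "dist x p * snd (w y) \<noteq> dist y q * snd (w x)"
        if xy: "x \<in> \<xi>" "y \<in> \<xi>" "x \<noteq> y" "p \<in> irregular (\<Union>\<phi>)" "q \<in> irregular (\<Union>\<phi>)" for x y p q
      proof -
        have "0 < dist y q" "0 < snd (w y)" using elim(2) w xy by auto
        moreover have "snd (w x) / snd (w y) \<noteq> dist x p / dist y q" using gen xy by blast
        ultimately show ?thesis by (simp add: field_simps)
      qed
      ultimately show "devices \<phi> \<gamma> \<xi> w V \<and> (\<forall>x\<in>\<xi>. \<forall>y\<in>\<xi>. x \<noteq> y \<longrightarrow>
          (\<forall>p\<in>irregular (\<Union>\<phi>). \<forall>q\<in>irregular (\<Union>\<phi>). dist x p * snd (w y) \<noteq> dist y q * snd (w x)))" by blast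
    qed
  qed
qed

text \<open>Every device counts as exceptional whatever its velocity; a box without devices has no
  cluster to be bounded.\<close>

lemma no_percolation_sparse:
  assumes m: "0 < m" and T: "0 \<le> \<rho>" "0 \<le> r" "2 * V * T + r \<le> m" and L: "0 \<le> L" "l * L \<le> \<eta>" "0 \<le> l"
    and good: "\<And>z. good z \<Longrightarrow> len (\<Union>\<phi> \<inter> Q (16 * m) (center m z)) \<le> ennreal L"
    and sum: "\<And>z0. (\<Sum>M. \<Sum>zs\<in>sep_chains M z0. \<Prod>z\<in>set zs. if good z then ennreal \<eta> else 1) \<noteq> \<top>"
  shows "AE \<xi> in P. AE w in PiM \<xi> (\<lambda>x. \<kappa> x \<Otimes>\<^sub>M \<mu>). \<not> percolates \<xi> (edges \<gamma> \<phi> \<xi> w T \<rho> r)"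
proof (rule no_percolation[OF m \<kappa>(1) \<mu>(1,2), where good = good and K = "\<lambda>_. 1" and \<eta> = \<eta> and J = "\<lambda>_ _. UNIV"
      and B = "\<lambda>z _. Q (16 * m) (center m z)" and E = "\<lambda>\<xi> w. edges \<gamma> \<phi> \<xi> w T \<rho> r"])
  interpret \<mu>: prob_space \<mu> by fact
  fix z assume z: "good z"
  have "emeasure \<mu> UNIV = 1" using \<mu>.emeasure_space_1 sets_eq_imp_space_eq[OF \<mu>(2)] by simp
  then have "(\<Sum>k<1::nat. emeasure \<mu> UNIV * (ennreal l * len (\<Union>\<phi> \<inter> Q (16 * m) (center m z)))) =
      ennreal l * len (\<Union>\<phi> \<inter> Q (16 * m) (center m z))" by simp
  also have "\<dots> \<le> ennreal l * ennreal L" by (intro mult_left_mono good z) simp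
  also have "\<dots> \<le> ennreal \<eta>" using L by (simp add: ennreal_mult[symmetric] ennreal_leI)
  finally show "(\<Sum>k<1::nat. emeasure \<mu> UNIV * (ennreal l * len (\<Union>\<phi> \<inter> Q (16 * m) (center m z)))) \<le> ennreal \<eta>" .
next
  show "AE \<xi> in P. AE w in PiM \<xi> (\<lambda>x. \<kappa> x \<Otimes>\<^sub>M \<mu>). edges \<gamma> \<phi> \<xi> w T \<rho> r \<subseteq> \<xi> \<times> \<xi> \<and>
      (\<forall>(x, y)\<in>edges \<gamma> \<phi> \<xi> w T \<rho> r. dist x y \<le> m) \<and>
      (\<forall>z. good z \<longrightarrow> (\<forall>k<1::nat. \<forall>x\<in>\<xi> \<inter> Q (16 * m) (center m z). snd (w x) \<notin> UNIV) \<longrightarrow>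
        (\<forall>x\<in>\<xi> \<inter> Q m (center m z). bounded {y. (x, y) \<in> (edges \<gamma> \<phi> \<xi> w T \<rho> r)\<^sup>*}))"
    using AE_devices
  proof eventually_elim
    case (elim \<xi>)
    then show ?case
    proof eventually_elim
      case (elim w)
      interpret devices \<phi> \<gamma> \<xi> w V using elim by blast
      have "edges \<gamma> \<phi> \<xi> w T \<rho> r \<subseteq> \<xi> \<times> \<xi>" by (auto simp: edges_def)
      moreover have "\<forall>(x, y)\<in>edges \<gamma> \<phi> \<xi> w T \<rho> r. dist x y \<le> m" using edge_dist[OF _ T(1,2)] T(3) by force
      moreover have "Q m c \<subseteq> Q (16 * m) c" for c using m by (auto simp: mem_Q)
      ultimately show ?case by blast
    qed
  qed
qed (use sum m in \<open>auto simp: bb_def\<close>)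

text \<open>S bounds the distance travelled in time \<rho> and \<delta> that in time \<epsilon>. The
  scale d of the certificate may differ from site to site as long as \<delta> is a lower
  bound.\<close>

lemma no_percolation_slow:
  assumes m: "0 < m" "2 * (2 * S + 1) + r \<le> m / 4" and \<rho>: "0 \<le> \<rho>" "0 < \<epsilon>" "0 \<le> r" and V: "V * \<rho> \<le> S" "V * \<epsilon> \<le> \<delta>" "\<delta> \<le> 1"
    and l: "0 \<le> l" "0 \<le> c" "2 * l * c \<le> \<eta>" and S: "0 \<le> S"
    and good: "\<And>z. good z \<Longrightarrow> well_connected m ((\<lambda>p. p - center m z) ` (\<Union>\<phi> \<inter> Q (16 * m) (center m z))) \<and>
      (\<exists>d\<ge>\<delta>. 0 < d \<and> certificate (16 * m) S c d ((\<lambda>p. p - center m z) ` (\<Union>\<phi> \<inter> Q (16 * m) (center m z))))"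
    and sum: "\<And>z0. (\<Sum>M. \<Sum>zs\<in>sep_chains M z0. \<Prod>z\<in>set zs. if good z then ennreal \<eta> else 1) \<noteq> \<top>"
  shows "AE \<xi> in P. AE w in PiM \<xi> (\<lambda>x. \<kappa> x \<Otimes>\<^sub>M \<mu>). \<not> percolates \<xi> (edges \<gamma> \<phi> \<xi> w (2 * \<rho> + \<epsilon>) \<rho> r)"
proof -
  define site where "site K B J z \<longleftrightarrow> (\<forall>k<K. B k \<in> sets borel \<and> B k \<subseteq> Q (16 * m) (center m z) \<and> J k \<in> sets borel) \<and>
    (\<Sum>k<K. emeasure \<mu> (J k) * (ennreal l * len (\<Union>\<phi> \<inter> B k))) \<le> ennreal \<eta> \<and>
    (\<forall>x v p. x \<in> Q (16 * m) (center m z) \<longrightarrow> (\<forall>k<K. x \<in> B k \<longrightarrow> v \<notin> J k) \<longrightarrow> p \<in> irregular (\<Union>\<phi>) \<longrightarrow>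
      p \<in> interior (Q (16 * m) (center m z)) \<longrightarrow> 0 < v \<longrightarrow> v \<le> V \<longrightarrow> dist x p \<le> v * (\<rho> + \<epsilon>) \<longrightarrow>
      v * \<epsilon> < dist x p \<and> dist x p < v * \<rho>)" for K :: nat and B :: "nat \<Rightarrow> point set" and J :: "nat \<Rightarrow> real set" and z
  have "\<exists>K B J. good z \<longrightarrow> site K B J z" for z
  proof (cases "good z")
    case True
    then obtain d where d: "\<delta> \<le> d" "0 < d" "certificate (16 * m) S c d ((\<lambda>p. p - center m z) ` (\<Union>\<phi> \<inter> Q (16 * m) (center m z)))"
      using good by blast
    obtain K and B :: "nat \<Rightarrow> point set" and J where K: "\<forall>k<K. B k \<in> sets borel \<and> B k \<subseteq> Q (16 * m) (center m z) \<and> J k \<in> sets borel"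
      "(\<Sum>k<K. emeasure \<mu> (J k) * (ennreal l * len (\<Union>\<phi> \<inter> B k))) \<le> ennreal (2 * l * c)"
      "\<forall>x v p \<epsilon>. x \<in> Q (16 * m) (center m z) \<longrightarrow> (\<forall>k<K. x \<in> B k \<longrightarrow> v \<notin> J k) \<longrightarrow> p \<in> irregular (\<Union>\<phi>) \<longrightarrow>
        p \<in> interior (Q (16 * m) (center m z)) \<longrightarrow>
        0 < v \<longrightarrow> v * \<rho> \<le> S \<longrightarrow> v * \<epsilon> \<le> d \<longrightarrow> dist x p \<le> v * (\<rho> + \<epsilon>) \<longrightarrow> v * \<epsilon> < dist x p \<and> dist x p < v * \<rho>"
      using certificate_site[OF d(3,2) l(2) \<mu>(1,2) \<rho>(1) l(1)] by (elim exE conjE) (rule that)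
    have "v * \<rho> \<le> S" "v * \<epsilon> \<le> d" if "v \<le> V" for v
      using mult_right_mono[OF that \<rho>(1)] mult_right_mono[OF that, of \<epsilon>] \<rho>(2) V d(1) by linarith+
    then have "site K B J z"
      unfolding site_def using K(1,3) order_trans[OF K(2) ennreal_leI[OF l(3)]] by blast
    then show ?thesis by blast
  qed blast
  then obtain K B J where site: "\<And>z. good z \<Longrightarrow> site (K z) (B z) (J z) z" by metis
  show ?thesis
  proof (rule no_percolation[OF m(1) \<kappa>(1) \<mu>(1,2), where good = good and K = K and \<eta> = \<eta> and J = J
        and B = B and E = "\<lambda>\<xi> w. edges \<gamma> \<phi> \<xi> w (2 * \<rho> + \<epsilon>) \<rho> r"])
    fix z k assume "good z" "k < K z"
    then have "B z k \<in> sets borel \<and> B z k \<subseteq> Q (16 * m) (center m z) \<and> J z k \<in> sets borel"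
      using site unfolding site_def by blast
    then show "bb (B z k) \<and> B z k \<subseteq> Q (16 * m) (center m z) \<and> J z k \<in> sets borel"
      using bounded_subset[OF compact_imp_bounded[OF compact_Q]] unfolding bb_def by blast
  next
    fix z assume "good z"
    then show "(\<Sum>k<K z. emeasure \<mu> (J z k) * (ennreal l * len (\<Union>\<phi> \<inter> B z k))) \<le> ennreal \<eta>"
      using site unfolding site_def by blast
  next
    show "AE \<xi> in P. AE w in PiM \<xi> (\<lambda>x. \<kappa> x \<Otimes>\<^sub>M \<mu>). edges \<gamma> \<phi> \<xi> w (2 * \<rho> + \<epsilon>) \<rho> r \<subseteq> \<xi> \<times> \<xi> \<and>
        (\<forall>(x, y)\<in>edges \<gamma> \<phi> \<xi> w (2 * \<rho> + \<epsilon>) \<rho> r. dist x y \<le> m) \<and>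
        (\<forall>z. good z \<longrightarrow> (\<forall>k<K z. \<forall>x\<in>\<xi> \<inter> B z k. snd (w x) \<notin> J z k) \<longrightarrow>
          (\<forall>x\<in>\<xi> \<inter> Q m (center m z). bounded {y. (x, y) \<in> (edges \<gamma> \<phi> \<xi> w (2 * \<rho> + \<epsilon>) \<rho> r)\<^sup>*}))"
      using AE_devices
    proof eventually_elim
      case (elim \<xi>)
      then show ?case
      proof eventually_elim
        case (elim w)
        interpret devices \<phi> \<gamma> \<xi> w V using elim by blast
        have jump: "2 * V * (2 * \<rho> + \<epsilon>) + r \<le> m / 4"
        proof -
          have "2 * V * (2 * \<rho> + \<epsilon>) = 2 * (2 * (V * \<rho>) + V * \<epsilon>)" by (simp add: algebra_simps)
          also have "\<dots> \<le> 2 * (2 * S + 1)" using V by (intro mult_left_mono add_mono order_trans[OF V(2,3)]) auto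
          finally show ?thesis using m(2) by linarith
        qed
        have "edges \<gamma> \<phi> \<xi> w (2 * \<rho> + \<epsilon>) \<rho> r \<subseteq> \<xi> \<times> \<xi>" by (auto simp: edges_def)
        moreover have "dist x y \<le> m" if "(x, y) \<in> edges \<gamma> \<phi> \<xi> w (2 * \<rho> + \<epsilon>) \<rho> r" for x y
          using edge_dist[OF that \<rho>(1,3)] jump m(1) by linarith
        moreover have "bounded {y. (x0, y) \<in> (edges \<gamma> \<phi> \<xi> w (2 * \<rho> + \<epsilon>) \<rho> r)\<^sup>*}"
          if z: "good z" and av: "\<forall>k<K z. \<forall>x\<in>\<xi> \<inter> B z k. snd (w x) \<notin> J z k" and x0: "x0 \<in> \<xi> \<inter> Q m (center m z)" for z x0
        proof (rule ccontr)
          assume unb: "\<not> ?thesis"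
          define c0 where "c0 = center m z"
          interpret slow_devices \<phi> \<gamma> \<xi> w V \<rho> \<epsilon> r "Q (12 * m) c0"
          proof
            show "0 \<le> \<rho>" "0 < \<epsilon>" by fact+
            show "dist x p * snd (w y) \<noteq> dist y q * snd (w x)"
              if "x \<in> \<xi>" "y \<in> \<xi>" "x \<noteq> y" "p \<in> irregular (\<Union>\<phi>)" "q \<in> irregular (\<Union>\<phi>)" for x y p q
              using elim that by blast
            fix x p assume x: "x \<in> \<xi> \<inter> Q (12 * m) c0" and p: "p \<in> irregular (\<Union>\<phi>)" and xp: "dist x p \<le> snd (w x) * (\<rho> + \<epsilon>)"
            have v: "0 < snd (w x)" "snd (w x) \<le> V" using speed x by blast+
            have "snd (w x) * (\<rho> + \<epsilon>) \<le> V * (\<rho> + \<epsilon>)" using v \<rho> by (intro mult_right_mono) auto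
            also have "\<dots> = V * \<rho> + V * \<epsilon>" by (simp add: algebra_simps)
            finally have "dist x p \<le> S + 1" using xp V by linarith
            then have near: "\<bar>fst x - fst p\<bar> \<le> S + 1" "\<bar>snd x - snd p\<bar> \<le> S + 1"
              using dist_fst_le[of x p] dist_snd_le[of x p] by (simp_all add: dist_real_def)
            have x12: "\<bar>fst x - fst c0\<bar> \<le> 6 * m" "\<bar>snd x - snd c0\<bar> \<le> 6 * m" using x by (auto simp: mem_Q)
            have "p \<in> box (c0 - (8 * m, 8 * m)) (c0 + (8 * m, 8 * m))"
            proof -
              \<comment> \<open>A device in Q (12 m) is concerned only with irregular points up to S
                + 1 away. They lie in the interior of Q (16 m), where the certificate
                applies.\<close>
              have "S + 1 < 2 * m" using m S \<rho>(3) by (simp add: field_simps)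
              then have "\<bar>fst p - fst c0\<bar> < 8 * m" "\<bar>snd p - snd c0\<bar> < 8 * m" using near x12 by linarith+
              then show ?thesis by (simp add: mem_box Basis_prod_def inner_prod_def abs_less_iff algebra_simps)
            qed
            then have pi: "p \<in> interior (Q (16 * m) c0)" by (simp add: Q_def)
            have xQ: "x \<in> Q (16 * m) c0" using x12 m(1) unfolding mem_Q by linarith
            have avx: "\<forall>k<K z. x \<in> B z k \<longrightarrow> snd (w x) \<notin> J z k" using av x by blast
            show "snd (w x) * \<epsilon> < dist x p \<and> dist x p < snd (w x) * \<rho>"
              using site[OF z, unfolded site_def, THEN conjunct2, THEN conjunct2, THEN spec[of _ x], THEN spec[of _ "snd (w x)"],
                THEN spec[of _ p]] xQ avx p pi v xp unfolding c0_def by blast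
          qed
          obtain a b where "closed_segment a b \<subseteq> regular \<phi>" "a \<in> Q (2 * m) c0" "b \<notin> Q (10 * m) c0"
            using cluster_long_segment[OF \<open>0 \<le> r\<close> jump refl x0[folded c0_def] unb] .
          moreover have "well_connected m ((\<lambda>p. p - c0) ` (\<Union>\<phi> \<inter> Q (16 * m) c0))" using good[OF z] unfolding c0_def by blast
          ultimately show False by (intro no_long_segment_near[OF config m(1)])
        qed
        ultimately show ?case by blast
      qed
    qed
  qed (rule sum | assumption)+
qed

end

end

section \<open>From the estimates to the critical parameters\<close>

lemma edges_mono:
  assumes "T - \<rho> \<le> T' - \<rho>'" "\<rho>' \<le> \<rho>"
  shows "edges \<gamma> \<phi> \<xi> w T \<rho> r \<subseteq> edges \<gamma> \<phi> \<xi> w T' \<rho>' r"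
proof -
  have "\<exists>t\<in>{0..T' - \<rho>'}. {t..t + \<rho>'} \<subseteq> C" if C: "\<exists>t\<in>{0..T - \<rho>}. {t..t + \<rho>} \<subseteq> C" for C
  proof -
    obtain t where t: "t \<in> {0..T - \<rho>}" "{t..t + \<rho>} \<subseteq> C" using C by blast
    have "{t..t + \<rho>'} \<subseteq> {t..t + \<rho>}" using assms(2) by auto
    then show ?thesis using t assms(1) by (intro bexI[of _ t]) auto
  qed
  then show ?thesis unfolding edges_def by blast
qed

lemma percolates_mono:
  assumes "percolates \<xi> E" "E \<subseteq> F"
  shows "percolates \<xi> F"
proof -
  obtain x where x: "x \<in> \<xi>" "\<not> bounded {y. (x, y) \<in> E\<^sup>*}" using assms(1) by (auto simp: percolates_def)
  have "{y. (x, y) \<in> E\<^sup>*} \<subseteq> {y. (x, y) \<in> F\<^sup>*}" using rtrancl_mono[OF assms(2)] by blast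
  then have "\<not> bounded {y. (x, y) \<in> F\<^sup>*}" using x(2) bounded_subset by blast
  then show ?thesis using x(1) unfolding percolates_def by blast
qed

text \<open>Shorter contacts and a later last starting time only add edges. It serves to enlarge T,
  and to replace the contact duration by 0.\<close>

lemma percolates_pos_prob_mono:
  assumes "percolates_pos_prob M \<kappa> \<gamma> D T l \<mu> \<rho> r" "T - \<rho> \<le> T' - \<rho>'" "\<rho>' \<le> \<rho>"
  shows "percolates_pos_prob M \<kappa> \<gamma> D T' l \<mu> \<rho>' r"
proof -
  show ?thesis
    using assms(1) unfolding percolates_pos_prob_def
    by (elim contrapos_nn eventually_mono) (erule percolates_mono, rule edges_mono[OF assms(2,3)])
qed

lemma velocity_bound:
  assumes "velocity_distribution \<mu>"
  obtains V where "0 < V" "AE v in \<mu>. 0 < v \<and> v \<le> V"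
proof -
  interpret prob_space \<mu> using assms by (simp add: velocity_distribution_def)
  have "v_max \<mu> < \<infinity>" "0 < v_min \<mu>" using assms by (auto simp: velocity_distribution_def)
  then obtain V V' where V: "emeasure \<mu> {0..V} = 1" and V': "emeasure \<mu> {V'..} = 1" "0 < V'"
    unfolding v_max_def v_min_def Inf_less_iff less_Sup_iff by auto
  have "AE v in \<mu>. v \<in> {0..V}" "AE v in \<mu>. v \<in> {V'..}"
    using V V'(1) by (intro AE_prob_1; simp add: emeasure_eq_measure)+
  \<comment> \<open>The maximum with 1 makes the positivity of the bound evident.\<close>
  then have "AE v in \<mu>. 0 < v \<and> v \<le> max V 1" by eventually_elim (use V'(2) in auto)
  then show ?thesis by (rule that[rotated]) simp
qed

lemma scale_velocity_bound:
  assumes \<mu>: "velocity_distribution \<mu>" and a: "0 < a" and V: "AE v in \<mu>. 0 < v \<and> v \<le> V"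
  shows "prob_space (scale_velocity a \<mu>)" "sets (scale_velocity a \<mu>) = sets borel"
    "AE v in scale_velocity a \<mu>. 0 < v \<and> v \<le> a * V"
proof -
  interpret prob_space \<mu> using \<mu> by (simp add: velocity_distribution_def)
  have [measurable_cong]: "sets \<mu> = sets borel" using \<mu> by (simp add: velocity_distribution_def)
  have m: "(\<lambda>v. a * v) \<in> borel_measurable \<mu>" by measurable
  show "prob_space (scale_velocity a \<mu>)" unfolding scale_velocity_def by (rule prob_space_distr[OF m])
  show "sets (scale_velocity a \<mu>) = sets borel" by (simp add: scale_velocity_def)
  have "AE v in \<mu>. 0 < a * v \<and> a * v \<le> a * V" using V by eventually_elim (use a in auto)
  then show "AE v in scale_velocity a \<mu>. 0 < v \<and> v \<le> a * V"
    unfolding scale_velocity_def by (subst AE_distr_iff[OF m]) auto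
qed

locale device_system = street_law M R for M R +
  fixes \<kappa> :: "streets \<Rightarrow> point \<Rightarrow> point measure"
    and \<gamma> :: "streets \<Rightarrow> point \<Rightarrow> point \<Rightarrow> (real \<Rightarrow> point) \<times> real"
    and D :: "real \<Rightarrow> streets \<Rightarrow> point set measure"
  assumes kernel: "waypoint_kernel \<kappa>" and \<gamma>: "selects_shortest_paths \<gamma>" and cox: "cox_process M D"
begin

lemma kernel_prob:
  assumes "\<phi> \<in> street_configs" "x \<in> \<Union>\<phi>"
  shows "prob_space (\<kappa> \<phi> x)" "AE y in \<kappa> \<phi> x. y \<in> \<Union>\<phi>"
proof -
  have "\<kappa> \<phi> \<in> restrict_space borel (\<Union>\<phi>) \<rightarrow>\<^sub>M prob_algebra borel"
    using kernel assms(1) unfolding waypoint_kernel_def by blast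
  then have "\<kappa> \<phi> x \<in> space (prob_algebra borel)"
    by (rule measurable_space) (use assms(2) in \<open>simp add: space_restrict_space\<close>)
  then show "prob_space (\<kappa> \<phi> x)" by (simp add: space_prob_algebra)
  show "AE y in \<kappa> \<phi> x. y \<in> \<Union>\<phi>" using kernel assms unfolding waypoint_kernel_def by blast
qed

lemma AE_street_poisson:
  assumes "0 \<le> l"
  shows "AE \<phi> in M. street_poisson l \<phi> (D l \<phi>)"
proof -
  have "AE \<phi> in M. poisson_process (\<lambda>A. ennreal l * len (\<Union>\<phi> \<inter> A)) (D l \<phi>)"
    using cox assms unfolding cox_process_def by blast
  with AE_space show ?thesis
    by eventually_elim (simp add: space_M street_poisson_def street_poisson_axioms_def poisson_def)
qed

text \<open>A statement about \<open>len\<close> alone, read off from the Poisson process with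
  \<lambda> = 1: spheres meet the streets in finitely many points, and \<open>sp.thin\<close> passes
  to thin shells.\<close>

lemma AE_thin:
  "AE \<phi> in M. \<forall>n p c S. 0 < c \<longrightarrow> (\<exists>z>0. \<forall>s\<in>{0..S}. len (\<Union>\<phi> \<inter> Q n 0 \<inter> {x. \<bar>dist x p - s\<bar> \<le> z}) < ennreal c)"
  using AE_street_poisson[OF zero_le_one]
proof eventually_elim
  case (elim \<phi>)
  interpret sp: street_poisson 1 \<phi> "D 1 \<phi>" by fact
  show ?case
  proof (intro allI impI)
    fix n c S :: real and p :: point assume c: "0 < c"
    have "sp.bb (Q n 0)" by (auto simp: sp.bb_def)
    moreover have "(\<lambda>x. dist x p) \<in> borel_measurable borel" by measurable
    ultimately have "\<exists>z>0. \<forall>s\<in>{0..S}. ennreal 1 * len (\<Union>\<phi> \<inter> (Q n 0 \<inter> {x. \<bar>dist x p - s\<bar> \<le> z})) < ennreal c"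
      by (rule sp.thin[OF _ _ sp.sphere_null c]) (simp add: compact_imp_bounded)
    then show "\<exists>z>0. \<forall>s\<in>{0..S}. len (\<Union>\<phi> \<inter> Q n 0 \<inter> {x. \<bar>dist x p - s\<bar> \<le> z}) < ennreal c"
      by (simp add: Int_assoc)
  qed
qed

text \<open>Finite length in bounded boxes is implied by the Poisson process with \<lambda> =
  1.\<close>

lemma AE_small_cover: "AE \<phi> in M. \<forall>n. \<exists>i::nat. small_cover (real i) (\<Union>\<phi> \<inter> Q n 0) (Q n 0)"
  using AE_street_poisson[OF zero_le_one]
proof eventually_elim
  case (elim \<phi>)
  interpret sp: street_poisson 1 \<phi> "D 1 \<phi>" by fact
  show ?case
  proof
    fix n :: real
    have "sp.bb (Q n 0)" by (auto simp: sp.bb_def)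
    then have "len (\<Union>\<phi> \<inter> Q n 0) < \<infinity>" using sp.finite_m[of "Q n 0"] by simp
    then obtain i :: nat where "len (\<Union>\<phi> \<inter> Q n 0) < of_nat i" using ennreal_Ex_less_of_nat by auto
    then have i: "len (\<Union>\<phi> \<inter> Q n 0) < ennreal (real i)" by (simp add: ennreal_of_nat_eq_real_of_nat)
    then have "0 < real i" by (cases i) auto
    moreover have "compact (\<Union>\<phi> \<inter> Q n 0)" using closed_streets[OF sp.config] by (rule closed_Int_compact) simp
    ultimately have "small_cover (5 * real i) (\<Union>\<phi> \<inter> Q n 0) (Q n 0)"
      using i by (intro len_small_cover) (simp_all add: Int_assoc)
    then have "small_cover (real (5 * i)) (\<Union>\<phi> \<inter> Q n 0) (Q n 0)" by simp
    then show "\<exists>i::nat. small_cover (real i) (\<Union>\<phi> \<inter> Q n 0) (Q n 0)" by blast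
  qed
qed

text \<open>The search over all i up to j makes the predicates increase in j, as
  \<open>good_exists\<close> requires.\<close>

definition tame :: "nat \<Rightarrow> (nat \<Rightarrow> point set \<Rightarrow> bool) \<Rightarrow> nat \<Rightarrow> point set \<Rightarrow> bool" where
  "tame k H j A \<longleftrightarrow> well_connected (8 * real k) A \<and> (\<exists>i\<in>{..j}. H i A)"

text \<open>Any $\eta$ with $2 \cdot 205^2 \, \eta < 1$ would do: a site of a chain has $205^2$ possible successors.\<close>

lemma tame_sites:
  fixes H :: "nat \<Rightarrow> nat \<Rightarrow> point set \<Rightarrow> bool"
  assumes H: "\<And>k i. Measurable.pred closed_space (H k i)"
    and cover: "\<And>k. AE \<phi> in M. \<exists>i. H k i (\<Union>\<phi> \<inter> Q (128 * real k) 0)"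
    and \<eta>: "\<eta> = 1 / 200000"
  obtains k j where "0 < k" "b \<le> real k"
    "AE \<phi> in M. \<forall>z0. (\<Sum>N. \<Sum>zs\<in>sep_chains N z0. \<Prod>z\<in>set zs. if good (tame k (H k) j) k \<phi> z then ennreal \<eta> else 1) \<noteq> \<top>"
proof -
  have "\<forall>\<^sub>F k in sequentially. b \<le> real k"
    using filterlim_real_sequentially unfolding filterlim_at_top by blast
  then have "\<forall>\<^sub>F k in sequentially. (0 < k \<and> b \<le> real k) \<and> prob {\<phi>\<in>space M. \<not> typical k \<phi>} < \<eta> \<and>
      (AE \<phi> in M. typical k \<phi> \<longrightarrow> well_connected (8 * real k) (\<Union>\<phi> \<inter> Q (128 * real k) 0))"
    using eventually_well_connected \<eta> by (intro eventually_conj eventually_gt_at_top eventually_typical) auto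
  then obtain k where k: "0 < k" "b \<le> real k" "prob {\<phi>\<in>space M. \<not> typical k \<phi>} < \<eta>"
      "AE \<phi> in M. typical k \<phi> \<longrightarrow> well_connected (8 * real k) (\<Union>\<phi> \<inter> Q (128 * real k) 0)"
    using eventually_happens'[OF sequentially_bot] by blast
  have G: "Measurable.pred closed_space (tame k (H k) j)" for j
    unfolding tame_def by (intro pred_intros_logic well_connected_measurable pred_countable_Bex H) auto
  have ne: "A \<noteq> {}" if "tame k (H k) j A" for j A
    using that well_connected_nonempty by (auto simp: tame_def)
  have "\<exists>j. prob {\<phi>\<in>space M. \<not> good (tame k (H k) j) k \<phi> 0} < \<eta>"
  proof (rule good_exists[where G = "tame k (H k)", OF G _ _ k(1,3)])
    fix j A assume "tame k (H k) j A"
    then show "A \<noteq> {}" by (rule ne)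
  next
    fix j A assume "tame k (H k) j A"
    then show "tame k (H k) (Suc j) A" by (auto simp: tame_def le_Suc_eq)
  next
    show "AE \<phi> in M. typical k \<phi> \<longrightarrow> (\<exists>j. tame k (H k) j (\<Union>\<phi> \<inter> Q (128 * real k) 0))"
      using k(4) cover[of k] by eventually_elim (auto simp: tame_def)
  qed
  then obtain j where j: "prob {\<phi>\<in>space M. \<not> good (tame k (H k) j) k \<phi> 0} \<le> \<eta>" by (auto dest: less_imp_le)
  have "AE \<phi> in M. \<forall>z0. (\<Sum>N. \<Sum>zs\<in>sep_chains N z0. \<Prod>z\<in>set zs. if good (tame k (H k) j) k \<phi> z then ennreal \<eta> else 1) \<noteq> \<top>"
    by (rule AE_summable[OF G _ k(1) _ j]) (use ne \<eta> in auto)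
  then show ?thesis using k that by blast
qed

text \<open>The order of quantifiers matters: \<delta> depends on S, l and r but not on V, \<rho>,
  \<epsilon> or \<mu>. So the product V\<epsilon> can be made small through \<epsilon> for the
  critical time and through V for the critical velocity.\<close>

lemma no_percolation_short_time:
  assumes S: "0 \<le> S" and l: "0 \<le> l" and r: "0 \<le> r"
  shows "\<exists>\<delta>>0. \<forall>V \<rho> \<epsilon> \<mu>. 0 \<le> \<rho> \<and> 0 < \<epsilon> \<and> V * \<rho> \<le> S \<and> V * \<epsilon> \<le> \<delta> \<and> prob_space \<mu> \<and> sets \<mu> = sets borel \<and>
      (AE v in \<mu>. 0 < v \<and> v \<le> V) \<longrightarrow> \<not> percolates_pos_prob M \<kappa> \<gamma> D (2 * \<rho> + \<epsilon>) l \<mu> \<rho> r"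
proof -
  define \<eta> :: real where "\<eta> = 1 / 200000"
  \<comment> \<open>Chosen for 2 l c \<le> \<eta>; the + 1 covers l = 0.\<close>
  define c where "c = \<eta> / (2 * (l + 1))"
  have c: "0 < c" "2 * l * c \<le> \<eta>" using l by (auto simp: c_def \<eta>_def field_simps)
  define H where "H k i = certificate (128 * real k) S c (1 / real (Suc i))" for k i :: nat
  have "AE \<phi> in M. \<exists>i. H k i (\<Union>\<phi> \<inter> Q (128 * real k) 0)" for k
    using AE_space AE_thin
  proof eventually_elim
    case (elim \<phi>)
    have "\<exists>i0. \<forall>i\<ge>i0. certificate (128 * real k) S c (1 / real (Suc i)) (\<Union>\<phi> \<inter> Q (128 * real k) 0)"
      using elim by (intro certificate_exists S c(1)) (auto simp: space_M)
    then show ?case unfolding H_def by blast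
  qed
  then obtain k j where k: "0 < k" "2 * (2 * S + 1) + r \<le> real k"
    and sum: "AE \<phi> in M. \<forall>z0. (\<Sum>N. \<Sum>zs\<in>sep_chains N z0. \<Prod>z\<in>set zs.
      if good (tame k (H k) j) k \<phi> z then ennreal \<eta> else 1) \<noteq> \<top>"
    using tame_sites[of H \<eta> "2 * (2 * S + 1) + r"] certificate_measurable \<eta>_def unfolding H_def by blast
  define m where "m = 8 * real k"
  have m: "0 < m" "2 * (2 * S + 1) + r \<le> m / 4" "16 * m = 128 * real k" using k by (auto simp: m_def)
  show ?thesis
  \<comment> \<open>The finest scale among the certificates that \<open>tame\<close> admits.\<close>
  proof (intro exI[of _ "1 / real (Suc j)"] conjI allI impI; (elim conjE)?)
    fix V \<rho> \<epsilon> :: real and \<mu> :: "real measure"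
    assume \<rho>: "0 \<le> \<rho>" "0 < \<epsilon>" "V * \<rho> \<le> S" "V * \<epsilon> \<le> 1 / real (Suc j)"
      and \<mu>: "prob_space \<mu>" "sets \<mu> = sets borel" "AE v in \<mu>. 0 < v \<and> v \<le> V"
    have "AE \<phi> in M. AE \<xi> in D l \<phi>. AE w in PiM \<xi> (\<lambda>x. \<kappa> \<phi> x \<Otimes>\<^sub>M \<mu>).
        \<not> percolates \<xi> (edges \<gamma> \<phi> \<xi> w (2 * \<rho> + \<epsilon>) \<rho> r)"
      using AE_street_poisson[OF l] AE_connected sum
    proof eventually_elim
      case (elim \<phi>)
      interpret sp: street_poisson l \<phi> "D l \<phi>" by (rule elim(1))
      show ?case
      proof (rule sp.no_percolation_slow[OF \<gamma> elim(2) kernel_prob[OF sp.config] \<mu> m(1,2) \<rho>(1,2) r \<rho>(3,4) _ l less_imp_le[OF c(1)] c(2) S,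
            where good = "good (tame k (H k) j) k \<phi>"])
        fix z assume "good (tame k (H k) j) k \<phi> z"
        then have tame: "tame k (H k) j ((\<lambda>p. p - center m z) ` (\<Union>\<phi> \<inter> Q (16 * m) (center m z)))"
          unfolding good_def m(3) unfolding m_def by blast
        then obtain i where i: "i \<le> j" "H k i ((\<lambda>p. p - center m z) ` (\<Union>\<phi> \<inter> Q (16 * m) (center m z)))"
          by (auto simp: tame_def)
        have "1 / real (Suc j) \<le> 1 / real (Suc i)" using i(1) by (simp add: field_simps)
        then show "well_connected m ((\<lambda>p. p - center m z) ` (\<Union>\<phi> \<inter> Q (16 * m) (center m z))) \<and>
          (\<exists>d\<ge>1 / real (Suc j). 0 < d \<and> certificate (16 * m) S c d ((\<lambda>p. p - center m z) ` (\<Union>\<phi> \<inter> Q (16 * m) (center m z))))"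
          using tame i(2) unfolding tame_def m_def[symmetric] H_def m(3)[symmetric]
          by (intro conjI exI[of _ "1 / real (Suc i)"]) auto
      qed (use elim(3) in auto)
    qed
    then show "\<not> percolates_pos_prob M \<kappa> \<gamma> D (2 * \<rho> + \<epsilon>) l \<mu> \<rho> r" by (simp add: percolates_pos_prob_def)
  qed simp
qed

text \<open>The scale k and the bound j on the length in a good box are chosen before \<lambda>, so
  a small \<lambda> pushes the expected number of devices in such a box below \<eta>.\<close>

lemma no_percolation_few_devices:
  assumes \<rho>: "0 \<le> \<rho>" "0 \<le> r" and \<mu>: "prob_space \<mu>" "sets \<mu> = sets borel" "AE v in \<mu>. 0 < v \<and> v \<le> V"
  obtains l0 where "0 < l0" "\<And>l. 0 \<le> l \<Longrightarrow> l \<le> l0 \<Longrightarrow> \<not> percolates_pos_prob M \<kappa> \<gamma> D T l \<mu> \<rho> r"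
proof -
  define \<eta> :: real where "\<eta> = 1 / 200000"
  define H where "H k i A = small_cover (real i) A (Q (128 * real k) 0)" for k i :: nat and A
  have "AE \<phi> in M. \<exists>i. H k i (\<Union>\<phi> \<inter> Q (128 * real k) 0)" for k
    using AE_small_cover by eventually_elim (simp add: H_def)
  moreover have "Measurable.pred closed_space (H k i)" for k i
    unfolding H_def by (rule small_cover_measurable) simp
  ultimately obtain k j where k: "0 < k" "2 * V * T + r \<le> real k"
    and sum: "AE \<phi> in M. \<forall>z0. (\<Sum>N. \<Sum>zs\<in>sep_chains N z0. \<Prod>z\<in>set zs.
      if good (tame k (H k) j) k \<phi> z then ennreal \<eta> else 1) \<noteq> \<top>"
    using tame_sites[of H \<eta> "2 * V * T + r"] \<eta>_def by blast
  define m where "m = 8 * real k"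
  have m: "0 < m" "2 * V * T + r \<le> m" "16 * m = 128 * real k" using k by (auto simp: m_def)
  show ?thesis
  proof (rule that[of "\<eta> / real (Suc j)"])
    fix l assume l: "0 \<le> l" "l \<le> \<eta> / real (Suc j)"
    have "l * real j \<le> \<eta> / real (Suc j) * real j" using l(2) by (rule mult_right_mono) simp
    also have "\<dots> \<le> \<eta>" by (simp add: \<eta>_def field_simps)
    finally have lj: "l * real j \<le> \<eta>" .
    have "AE \<phi> in M. AE \<xi> in D l \<phi>. AE w in PiM \<xi> (\<lambda>x. \<kappa> \<phi> x \<Otimes>\<^sub>M \<mu>). \<not> percolates \<xi> (edges \<gamma> \<phi> \<xi> w T \<rho> r)"
      using AE_street_poisson[OF l(1)] AE_connected sum
    proof eventually_elim
      case (elim \<phi>)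
      interpret sp: street_poisson l \<phi> "D l \<phi>" by (rule elim(1))
      show ?case
      proof (rule sp.no_percolation_sparse[OF \<gamma> elim(2) kernel_prob[OF sp.config] \<mu> m(1) \<rho> m(2) _ lj l(1),
            where good = "good (tame k (H k) j) k \<phi>"])
        fix z assume "good (tame k (H k) j) k \<phi> z"
        then have "tame k (H k) j ((\<lambda>p. p - center m z) ` (\<Union>\<phi> \<inter> Q (16 * m) (center m z)))"
          unfolding good_def m(3) unfolding m_def by blast
        then obtain i where i: "i \<le> j" "small_cover (real i) ((\<lambda>p. p - center m z) ` (\<Union>\<phi> \<inter> Q (16 * m) (center m z))) (Q (16 * m) 0)"
          by (auto simp: tame_def H_def m(3))
        have "p - center m z \<in> (\<lambda>p. p - center m z) ` (\<Union>\<phi> \<inter> Q (16 * m) (center m z)) \<inter> Q (16 * m) 0"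
          if "p \<in> \<Union>\<phi> \<inter> Q (16 * m) (center m z)" for p
          using that translate_Q[of "center m z" "\<Union>\<phi>" "16 * m"] by blast
        then have "len (\<Union>\<phi> \<inter> Q (16 * m) (center m z)) \<le> ennreal (real i)" by (rule small_cover_len[OF i(2)])
        also have "\<dots> \<le> ennreal (real j)" using i(1) by (simp add: ennreal_leI)
        finally show "len (\<Union>\<phi> \<inter> Q (16 * m) (center m z)) \<le> ennreal (real j)" .
      qed (use elim(3) in auto)
    qed
    then show "\<not> percolates_pos_prob M \<kappa> \<gamma> D T l \<mu> \<rho> r" by (simp add: percolates_pos_prob_def)
  qed (simp add: \<eta>_def)
qed

end

theorem theorem2p2:
  fixes M :: "streets measure"
    and \<kappa> :: "streets \<Rightarrow> point \<Rightarrow> point measure"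
    and \<gamma> :: "streets \<Rightarrow> point \<Rightarrow> point \<Rightarrow> (real \<Rightarrow> point) \<times> real"
    and D :: "real \<Rightarrow> streets \<Rightarrow> point set measure"
    and r \<rho> :: real
  assumes "street_system M"
    and "waypoint_kernel \<kappa>"
    and "selects_shortest_paths \<gamma>"
    and "cox_process M D"
    and "0 \<le> r" and "0 \<le> \<rho>"
  shows "(\<forall>l\<ge>0. \<forall>\<mu>. velocity_distribution \<mu> \<longrightarrow> T_crit M \<kappa> \<gamma> D l \<mu> \<rho> r > ereal (2 * \<rho>)) \<and>
    (\<forall>T\<ge>0. \<forall>\<mu>. velocity_distribution \<mu> \<longrightarrow> lambda_crit M \<kappa> \<gamma> D T \<mu> \<rho> r > 0) \<and>
    (\<forall>T\<ge>0. \<forall>l\<ge>0. \<forall>\<mu>. velocity_distribution \<mu> \<longrightarrow> v_crit M \<kappa> \<gamma> D T l \<mu> \<rho> r > 0)"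
proof -
  obtain R where R: "stabilizing M R" "asymp_ess_connected M R"
    using assms(1) unfolding street_system_def by blast
  interpret device_system M R \<kappa> \<gamma> D
    using assms(1-4) R
    by (intro device_system.intro street_law.intro street_law_axioms.intro device_system_axioms.intro)
      (auto simp only: street_system_def)
  note r = assms(5) and \<rho> = assms(6)
  have T: "T_crit M \<kappa> \<gamma> D l \<mu> \<rho> r > ereal (2 * \<rho>)" if l: "0 \<le> l" and \<mu>: "velocity_distribution \<mu>" for l \<mu>
  proof -
    obtain V where V: "0 < V" "AE v in \<mu>. 0 < v \<and> v \<le> V" using \<mu> by (rule velocity_bound)
    have \<mu>': "prob_space \<mu>" "sets \<mu> = sets borel" using \<mu> by (auto simp: velocity_distribution_def)
    obtain \<delta> where \<delta>: "0 < \<delta>" "\<forall>V' \<rho>' \<epsilon> \<mu>. 0 \<le> \<rho>' \<and> 0 < \<epsilon> \<and> V' * \<rho>' \<le> V * \<rho> \<and> V' * \<epsilon> \<le> \<delta> \<and> prob_space \<mu> \<and>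
        sets \<mu> = sets borel \<and> (AE v in \<mu>. 0 < v \<and> v \<le> V') \<longrightarrow> \<not> percolates_pos_prob M \<kappa> \<gamma> D (2 * \<rho>' + \<epsilon>) l \<mu> \<rho>' r"
      using no_percolation_short_time[OF mult_nonneg_nonneg[OF less_imp_le[OF V(1)] \<rho>] l r] by blast
    define \<epsilon> where "\<epsilon> = \<delta> / V"
    have \<epsilon>: "0 < \<epsilon>" "V * \<epsilon> \<le> \<delta>" using \<delta>(1) V(1) by (simp_all add: \<epsilon>_def)
    have no: "\<not> percolates_pos_prob M \<kappa> \<gamma> D (2 * \<rho> + \<epsilon>) l \<mu> \<rho> r"
      using \<delta>(2) \<rho> \<epsilon> \<mu>' V(2) by blast
    have "ereal (2 * \<rho> + \<epsilon>) \<le> T_crit M \<kappa> \<gamma> D l \<mu> \<rho> r"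
      unfolding T_crit_def
    proof (intro Inf_greatest, elim imageE CollectE conjE)
      fix t T assume "t = ereal T" "percolates_pos_prob M \<kappa> \<gamma> D T l \<mu> \<rho> r"
      then show "ereal (2 * \<rho> + \<epsilon>) \<le> t"
        using no percolates_pos_prob_mono[of M \<kappa> \<gamma> D T l \<mu> \<rho> r "2 * \<rho> + \<epsilon>" \<rho>] by force
    qed
    moreover have "ereal (2 * \<rho>) < ereal (2 * \<rho> + \<epsilon>)" using \<epsilon>(1) by simp
    ultimately show ?thesis by (rule less_le_trans[rotated])
  qed
  have L: "lambda_crit M \<kappa> \<gamma> D T \<mu> \<rho> r > 0" if \<mu>: "velocity_distribution \<mu>" for T \<mu>
  proof -
    obtain V where V: "0 < V" "AE v in \<mu>. 0 < v \<and> v \<le> V" using \<mu> by (rule velocity_bound)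
    have \<mu>': "prob_space \<mu>" "sets \<mu> = sets borel" using \<mu> by (auto simp: velocity_distribution_def)
    obtain l0 where l0: "0 < l0" "\<And>l. 0 \<le> l \<Longrightarrow> l \<le> l0 \<Longrightarrow> \<not> percolates_pos_prob M \<kappa> \<gamma> D T l \<mu> \<rho> r"
      using no_percolation_few_devices[OF \<rho> r \<mu>' V(2)] by blast
    have "ereal l0 \<le> lambda_crit M \<kappa> \<gamma> D T \<mu> \<rho> r"
      unfolding lambda_crit_def using l0(2) by (intro Inf_greatest) force
    then show ?thesis using l0(1) by (simp add: less_le_trans[of 0 "ereal l0"])
  qed
  have v: "v_crit M \<kappa> \<gamma> D T l \<mu> \<rho> r > 0" if T: "0 \<le> T" and l: "0 \<le> l" and \<mu>: "velocity_distribution \<mu>" for T l \<mu>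
  proof -
    obtain V where V: "0 < V" "AE v in \<mu>. 0 < v \<and> v \<le> V" using \<mu> by (rule velocity_bound)
    \<comment> \<open>Here S = 0, since only the contact duration 0 is inserted for \<rho>'.\<close>
    obtain \<delta> where \<delta>: "0 < \<delta>" "\<forall>V' \<rho>' \<epsilon> \<mu>. 0 \<le> \<rho>' \<and> 0 < \<epsilon> \<and> V' * \<rho>' \<le> 0 \<and> V' * \<epsilon> \<le> \<delta> \<and> prob_space \<mu> \<and>
        sets \<mu> = sets borel \<and> (AE v in \<mu>. 0 < v \<and> v \<le> V') \<longrightarrow> \<not> percolates_pos_prob M \<kappa> \<gamma> D (2 * \<rho>' + \<epsilon>) l \<mu> \<rho>' r"
      using no_percolation_short_time[OF order_refl l r] by blast
    \<comment> \<open>For a < a0 the distance a V (T + 1) is less than \<delta>. The horizon T + 1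
      instead of T keeps the slack positive even for T = 0.\<close>
    define a0 where "a0 = \<delta> / (V * (T + 1))"
    have a0: "0 < a0" using \<delta>(1) V(1) T by (simp add: a0_def)
    have large: "a0 \<le> a" if a: "0 < a" and perc: "percolates_pos_prob M \<kappa> \<gamma> D T l (scale_velocity a \<mu>) \<rho> r" for a
    proof (rule ccontr)
      assume "\<not> a0 \<le> a"
      moreover have "0 < V * (T + 1)" using V(1) T by simp
      ultimately have "a * (V * (T + 1)) \<le> \<delta>"
        by (simp only: a0_def not_le pos_less_divide_eq less_imp_le)
      then have "a * V * (T + 1) \<le> \<delta>" by (simp add: mult.assoc)
      then have "\<not> percolates_pos_prob M \<kappa> \<gamma> D (2 * 0 + (T + 1)) l (scale_velocity a \<mu>) 0 r"
        using T scale_velocity_bound[OF \<mu> a V(2)]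
        by (intro \<delta>(2)[THEN spec[of _ "a * V"], THEN spec[of _ 0], THEN spec[of _ "T + 1"], THEN spec, THEN mp] conjI) simp_all
      moreover have "percolates_pos_prob M \<kappa> \<gamma> D (2 * 0 + (T + 1)) l (scale_velocity a \<mu>) 0 r"
        using perc by (rule percolates_pos_prob_mono) (use \<rho> in auto)
      ultimately show False by blast
    qed
    have vm: "0 < v_max \<mu>" using \<mu> by (auto simp: velocity_distribution_def)
    have "ereal a0 * v_max \<mu> \<le> v_crit M \<kappa> \<gamma> D T l \<mu> \<rho> r"
      unfolding v_crit_def
      using large vm by (intro Inf_greatest) (auto intro!: ereal_mult_right_mono)
    moreover have "0 < ereal a0 * v_max \<mu>" using a0 vm by (simp add: ereal_zero_less_0_iff)
    ultimately show ?thesis by (rule less_le_trans[rotated])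
  qed
  show ?thesis using T L v by blast
qed

end
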